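(* Let $\kappa>0$, $\gamma\in(0,1)$, and fix $s>5/2-\gamma$. Assume that $\Theta_0\in H^s(\mathbb{T}^3)$ and $S\in L^\infty(0,\infty;H^{s-\gamma}(\mathbb{T}^3))$ have zero mean on $\mathbb{T}^3$ and are such that $$\operatorname{supp}(\hat\Theta_0)\subset\mathcal{P}_q\quad\text{and}\quad\operatorname{supp}(\hat S(t,\cdot))\subset\mathcal{P}_q$$ for some fixed $q\in\mathbb{Q}\setminus\{0\}$ and all $t\ge0$, where $\mathcal{P}_q=\{k\in\mathbb{Z}^3:k_2=qk_1\}$. Then there exist $T>0$ and a unique solution $$\Theta\in L^\infty(0,T;H^s(\mathbb{T}^3))\cap L^2(0,T;H^{s+\gamma}(\mathbb{T}^3))$$ of the Cauchy problem $$\partial_t\Theta+U\cdot\nabla\Theta=S-\kappa(-\Delta)^\gamma\Theta,\qquad \nabla\cdot U=0,\quad U=M[\Theta],\qquad \Theta(0,\cdot)=\Theta_0,$$ such that $\operatorname{supp}(\hat\Theta(t,\cdot))\subset\mathcal{P}_q$ for all $t\in[0,T)$.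
   Context: Setting (fractionally diffusive magneto-geostrophic equation). $\mathbb{T}^3=(\mathbb{R}/2\pi\mathbb{Z})^3$, and $\hat f(k)$, $k=(k_1,k_2,k_3)\in\mathbb{Z}^3$, denote Fourier coefficients. $\Omega,\beta,\eta,\kappa>0$ are fixed parameters. The velocity $U=M[\Theta]=(M_1\Theta,M_2\Theta,M_3\Theta)$ is given by Fourier multipliers: $\widehat{M_j\Theta}(k)=\hat M_j(k)\hat\Theta(k)$ where, for $k_3\neq0$, $$\hat M_1(k)=\frac{2\Omega k_2k_3|k|^2-(\beta^2/\eta)k_1k_2^2k_3}{4\Omega^2k_3^2|k|^2+(\beta^2/\eta)^2k_2^4},\quad \hat M_2(k)=\frac{-2\Omega k_1k_3|k|^2-(\beta^2/\eta)k_2^3k_3}{4\Omega^2k_3^2|k|^2+(\beta^2/\eta)^2k_2^4},\quad \hat M_3(k)=\frac{(\beta^2/\eta)k_2^2(k_1^2+k_2^2)}{4\Omega^2k_3^2|k|^2+(\beta^2/\eta)^2k_2^4},$$ and $\hat M_j(k)=0$ when $k_3=0$ (so $U$ has zero vertical mean). Then $\nabla\cdot U=0$ automatically. A solution on $(0,T)$ with initial data $\Theta_0$ is a function $\Theta\in L^\infty(0,T;H^s)\cap L^2(0,T;H^{s+\gamma})$ such that for all smooth $\varphi$ on $\mathbb{T}^3$ and all $t\in(0,T)$, $$\int_{\mathbb{T}^3}(\Theta(t,\cdot)-\Theta_0)\varphi\,dx+\kappa\int_0^t\!\!\int_{\mathbb{T}^3}\Theta(-\Delta)^\gamma\varphi\,dx\,d\tau-\int_0^t\!\!\int_{\mathbb{T}^3}\Theta\,U\cdot\nabla\varphi\,dx\,d\tau=\int_0^t\!\!\int_{\mathbb{T}^3}S\varphi\,dx\,d\tau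 .$$ *)

theory Defs
  imports "HOL-Analysis.Analysis"
begin

section \<open>Functions on the torus and Fourier coefficients\<close>

text \<open>Functions on \<open>(\<real> / 2\<pi>\<int>)\<^sup>3\<close> are functions on \<open>\<real>\<^sup>3\<close> that are \<open>2\<pi>\<close>-periodic in each
  coordinate, and integrals over the torus are integrals over the fundamental cell.\<close>

definition periodic3 :: "(real^3 \<Rightarrow> 'a) \<Rightarrow> bool" where
  "periodic3 f \<longleftrightarrow> (\<forall>x i. f (x + axis i (2 * pi)) = f x)"

definition torus :: "(real^3) measure" where
  "torus = lebesgue_on (cbox 0 (\<chi> i. 2 * pi))"

definition L2_torus :: "(real^3 \<Rightarrow> real) set" where
  "L2_torus = {f. periodic3 f \<and> f \<in> borel_measurable torus \<and> integrable torus (\<lambda>x. (f x)\<^sup>2)}"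

definition freq :: "int^3 \<Rightarrow> real^3" where
  "freq k = (\<chi> i. of_int (k $ i))"

definition fourier :: "(real^3 \<Rightarrow> real) \<Rightarrow> int^3 \<Rightarrow> complex" where
  "fourier f k = (LINT x|torus. of_real (f x) * cis (- (freq k \<bullet> x))) / of_real ((2 * pi) ^ 3)"

definition fourier_supp :: "(real^3 \<Rightarrow> real) \<Rightarrow> (int^3) set" where
  "fourier_supp f = {k. fourier f k \<noteq> 0}"

definition zero_mean :: "(real^3 \<Rightarrow> real) \<Rightarrow> bool" where
  "zero_mean f \<longleftrightarrow> (LINT x|torus. f x) = 0"

text \<open>The function in \<open>L\<^sup>2\<close> whose Fourier coefficients are \<open>m k * fourier f k\<close>.  It is unique
  up to null sets when it exists, and it is only used under integrals; when there is no such function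
  the value is unspecified.\<close>

definition fourier_multiplier :: "(int^3 \<Rightarrow> real) \<Rightarrow> (real^3 \<Rightarrow> real) \<Rightarrow> real^3 \<Rightarrow> real" where
  "fourier_multiplier m f =
     (SOME g. g \<in> L2_torus \<and> (\<forall>k. fourier g k = of_real (m k) * fourier f k))"

definition frac_laplacian :: "real \<Rightarrow> (real^3 \<Rightarrow> real) \<Rightarrow> real^3 \<Rightarrow> real" where
  "frac_laplacian \<gamma> = fourier_multiplier (\<lambda>k. norm (freq k) powr (2 * \<gamma>))"


section \<open>Sobolev and Bochner spaces\<close>

text \<open>For \<open>r \<ge> 0\<close> this is the usual space \<open>H\<^sup>r\<close>.  For negative \<open>r\<close> it would omit the
  distributions that are not functions.\<close>

definition sobolev :: "real \<Rightarrow> (real^3 \<Rightarrow> real) set" where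
  "sobolev r = {f \<in> L2_torus.
     (\<lambda>k. (1 + (norm (freq k))\<^sup>2) powr r * (cmod (fourier f k))\<^sup>2) summable_on UNIV}"

definition sobolev_norm :: "real \<Rightarrow> (real^3 \<Rightarrow> real) \<Rightarrow> real" where
  "sobolev_norm r f =
     sqrt (\<Sum>\<^sub>\<infinity>k. (1 + (norm (freq k))\<^sup>2) powr r * (cmod (fourier f k))\<^sup>2)"

text \<open>Strong (Bochner) measurability of a map \<open>I \<rightarrow> H\<^sup>r\<close>: almost everywhere it is the \<open>H\<^sup>r\<close> limit of
  simple functions.  The values of the map only have to lie in \<open>H\<^sup>r\<close> almost everywhere on \<open>I\<close>.\<close>

definition bochner_measurable :: "real \<Rightarrow> real set \<Rightarrow> (real \<Rightarrow> real^3 \<Rightarrow> real) \<Rightarrow> bool" where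
  "bochner_measurable r I u \<longleftrightarrow>
     (AE t in lebesgue_on I. u t \<in> sobolev r) \<and>
     (\<exists>F :: nat \<Rightarrow> real \<Rightarrow> real^3 \<Rightarrow> real.
        (\<forall>n. simple_function (lebesgue_on I) (F n) \<and> F n ` I \<subseteq> sobolev r) \<and>
        (AE t in lebesgue_on I. (\<lambda>n. sobolev_norm r (\<lambda>x. F n t x - u t x)) \<longlonglongrightarrow> 0))"

definition Linf_sobolev :: "real set \<Rightarrow> real \<Rightarrow> (real \<Rightarrow> real^3 \<Rightarrow> real) set" where
  "Linf_sobolev I r = {u. bochner_measurable r I u \<and>
     (\<exists>C. AE t in lebesgue_on I. sobolev_norm r (u t) \<le> C)}"

definition L2_sobolev :: "real set \<Rightarrow> real \<Rightarrow> (real \<Rightarrow> real^3 \<Rightarrow> real) set" where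
  "L2_sobolev I r = {u. bochner_measurable r I u \<and>
     integrable (lebesgue_on I) (\<lambda>t. (sobolev_norm r (u t))\<^sup>2)}"


section \<open>Smooth test functions\<close>

definition partial_deriv :: "3 \<Rightarrow> (real^3 \<Rightarrow> real) \<Rightarrow> real^3 \<Rightarrow> real" where
  "partial_deriv i f x = frechet_derivative f (at x) (axis i 1)"

definition grad :: "(real^3 \<Rightarrow> real) \<Rightarrow> real^3 \<Rightarrow> real^3" where
  "grad f x = (\<chi> i. partial_deriv i f x)"

primrec C_diff :: "nat \<Rightarrow> (real^3 \<Rightarrow> real) \<Rightarrow> bool" where
  "C_diff 0 f \<longleftrightarrow> continuous_on UNIV f"
| "C_diff (Suc n) f \<longleftrightarrow> (\<forall>x. f differentiable (at x)) \<and> (\<forall>i. C_diff n (partial_deriv i f))"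

definition smooth_torus :: "(real^3 \<Rightarrow> real) set" where
  "smooth_torus = {\<phi>. periodic3 \<phi> \<and> (\<forall>n. C_diff n \<phi>)}"


section \<open>The magneto-geostrophic equation\<close>

definition mg_symbol :: "real \<Rightarrow> real \<Rightarrow> real \<Rightarrow> int^3 \<Rightarrow> real^3" where
  "mg_symbol \<Omega> \<beta> \<eta> k =
     (let k1 = freq k $ 1; k2 = freq k $ 2; k3 = freq k $ 3;
          b = \<beta>\<^sup>2 / \<eta>; K = (norm (freq k))\<^sup>2;
          D = 4 * \<Omega>\<^sup>2 * k3\<^sup>2 * K + b\<^sup>2 * k2 ^ 4
      in if k3 = 0 then 0
         else vector [(2 * \<Omega> * k2 * k3 * K - b * k1 * k2\<^sup>2 * k3) / D,
                      (- 2 * \<Omega> * k1 * k3 * K - b * k2 ^ 3 * k3) / D,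
                      b * k2\<^sup>2 * (k1\<^sup>2 + k2\<^sup>2) / D])"

text \<open>Every velocity given by this symbol is divergence free.\<close>

lemma mg_symbol_divergence_free: "freq k \<bullet> mg_symbol \<Omega> \<beta> \<eta> k = 0"
proof -
  have *: "a * ((w * b * c * K - B * a * b\<^sup>2 * c) / D) + b * ((- w * a * c * K - B * b ^ 3 * c) / D)
        + c * (B * b\<^sup>2 * (a\<^sup>2 + b\<^sup>2) / D) = 0" for a b c w B K D :: real
  proof -
    have "a * (w * b * c * K - B * a * b\<^sup>2 * c) + b * (- w * a * c * K - B * b ^ 3 * c)
        + c * (B * b\<^sup>2 * (a\<^sup>2 + b\<^sup>2)) = 0"
      by algebra
    then show ?thesis
      by (simp flip: add_divide_distrib)
  qed
  show ?thesis
    using *[of "freq k $ 1" "2 * \<Omega>" "freq k $ 2" "freq k $ 3" "(norm (freq k))\<^sup>2" "\<beta>\<^sup>2 / \<eta>"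
        "4 * \<Omega>\<^sup>2 * (freq k $ 3)\<^sup>2 * (norm (freq k))\<^sup>2 + (\<beta>\<^sup>2 / \<eta>)\<^sup>2 * freq k $ 2 ^ 4"]
    by (simp add: mg_symbol_def Let_def inner_vec_def sum_3)
qed

definition mg_velocity ::
    "real \<Rightarrow> real \<Rightarrow> real \<Rightarrow> (real^3 \<Rightarrow> real) \<Rightarrow> real^3 \<Rightarrow> real^3" where
  "mg_velocity \<Omega> \<beta> \<eta> \<theta> x = (\<chi> j. fourier_multiplier (\<lambda>k. mg_symbol \<Omega> \<beta> \<eta> k $ j) \<theta> x)"

text \<open>The weak formulation is imposed at every time, so \<open>\<Theta> t\<close> has to be an \<open>L\<^sup>2\<close> function for
  every \<open>t\<close>.  Membership in \<open>L\<^sup>\<infinity>(0,T;H\<^sup>s)\<close> provides this only for almost every \<open>t\<close>.\<close>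

definition mg_solution ::
    "real \<Rightarrow> real \<Rightarrow> real \<Rightarrow> real \<Rightarrow> real \<Rightarrow> real \<Rightarrow> (real \<Rightarrow> real^3 \<Rightarrow> real) \<Rightarrow>
     (real^3 \<Rightarrow> real) \<Rightarrow> real \<Rightarrow> (real \<Rightarrow> real^3 \<Rightarrow> real) \<Rightarrow> bool" where
  "mg_solution \<Omega> \<beta> \<eta> \<kappa> \<gamma> s S \<Theta>0 T \<Theta> \<longleftrightarrow>
     \<Theta> \<in> Linf_sobolev {0<..<T} s \<and> \<Theta> \<in> L2_sobolev {0<..<T} (s + \<gamma>) \<and>
     (\<forall>t\<in>{0..<T}. \<Theta> t \<in> L2_torus) \<and>
     (AE x in torus. \<Theta> 0 x = \<Theta>0 x) \<and>
     (\<forall>\<phi>\<in>smooth_torus. \<forall>t\<in>{0<..<T}.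
        (LINT x|torus. (\<Theta> t x - \<Theta>0 x) * \<phi> x)
        + \<kappa> * (LINT \<tau>|lebesgue_on {0..t}. LINT x|torus. \<Theta> \<tau> x * frac_laplacian \<gamma> \<phi> x)
        - (LINT \<tau>|lebesgue_on {0..t}. LINT x|torus.
             \<Theta> \<tau> x * (mg_velocity \<Omega> \<beta> \<eta> (\<Theta> \<tau>) x \<bullet> grad \<phi> x))
        = (LINT \<tau>|lebesgue_on {0..t}. LINT x|torus. S \<tau> x * \<phi> x))"

definition freq_plane :: "rat \<Rightarrow> (int^3) set" where
  "freq_plane q = {k. of_int (k $ 2) = q * of_int (k $ 1)}"

end

theory Submission
  imports Defs "HOL-Complex_Analysis.Great_Picard"
begin

text \<open>On the plane \<open>k\<^sub>2 = q k\<^sub>1\<close> the symbol is bounded, although it is unbounded on \<open>\<int>\<^sup>3\<close>.  Sums of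
  frequencies stay in the plane, so for data supported there the equation is an active scalar equation
  whose velocity is no rougher than \<open>\<Theta>\<close>; the symbol is also real, even and divergence free.

  In Fourier coefficients the equation becomes an infinite system of integral equations, which is
  truncated to finitely many modes.  Testing with \<open>\<langle>k\<rangle>\<^sup>2\<^sup>s\<close>, the divergence-free structure turns
  \<open>\<langle>k\<rangle>\<^sup>s\<close> into a commutator, so that the nonlinear term is bounded by \<open>A \<parallel>\<Theta>\<parallel>\<^sub>s\<^sup>2\<close>, where \<open>A\<close> is the sum of
  \<open>\<langle>k\<rangle> \<bar>\<Theta>(k)\<bar>\<close> over the Fourier coefficients.  Since \<open>s + \<gamma> > 5/2\<close>, Cauchy-Schwarz bounds \<open>A\<close> by a
  multiple of \<open>\<parallel>\<Theta>\<parallel>\<^sub>s\<^sub>+\<^sub>\<gamma>\<close>, which the dissipation absorbs.  This gives a bound on a time interval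
  independent of the truncation.  The coefficients are then uniformly Lipschitz in time, and a
  diagonal subsequence converges mode by mode to a solution.

  Uniqueness is an \<open>L\<^sup>2\<close> estimate for the difference with the Gronwall factor \<open>A\<close>, which is
  integrable in time.  The weak formulation is equivalent to the system for the coefficients because
  trigonometric test functions are admissible and the exponentials are complete in \<open>L\<^sup>2\<close>.\<close>

subsection \<open>Sobolev weights and lattice sums\<close>

text \<open>On all of the lattice the symbol behaves like an operator of order one: for fixed
  nonzero k_3 and k_2 of size |k_1|^(1/2) the two terms of the denominator balance while the third
  numerator is one power larger. The relation k_2 = q k_1 with q nonzero stays away from this curve,
  since k_2^4 is then comparable to k_1^4. A bounded symbol still leaves one derivative in the
  nonlinearity, which dissipation of order \<gamma> below 1/2 does not recover. Hence the
  cancellation in the transport term is used; it rests on reality of the function, so all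
  truncations are symmetric under k -> -k. The number 5/2 is 1 + 3/2: one derivative on \<Theta>,
  and half the dimension to sum its coefficients. As \<gamma> < 1, also s > 3/2, so the H^s bound
  alone makes the convolution series converge absolutely. The spaces control almost every time,
  whereas the weak formulation speaks of every time; null sets of times are therefore carried along,
  and the continuity of each coefficient, forced by the weak formulation, extends bounds to all
  times.\<close>

lemma freq_nth [simp]: "freq k $ i = of_int (k $ i)"
  by (simp add: freq_def)

lemma freq_add: "freq (k + l) = freq k + freq l"
  by (simp add: vec_eq_iff)

lemma freq_diff: "freq (k - l) = freq k - freq l"
  by (simp add: vec_eq_iff)

lemma freq_uminus [simp]: "freq (- k) = - freq k"
  by (simp add: vec_eq_iff)

lemma freq_0 [simp]: "freq 0 = 0"
  by (simp add: vec_eq_iff)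

text \<open>The index counts powers of 1 + |k|^2, so \<open>wt r\<close> is the weight in the square
  of the H^r norm, and a single derivative corresponds to \<open>wt (1/2)\<close>.\<close>

definition wt :: "real \<Rightarrow> int^3 \<Rightarrow> real" where
  "wt r k = (1 + (norm (freq k))\<^sup>2) powr r"

lemma wt_base_pos: "0 < 1 + (norm (freq k))\<^sup>2"
  by (simp add: add_pos_nonneg)

lemma wt_pos [simp]: "0 < wt r k"
  unfolding wt_def using wt_base_pos[of k] by simp

lemma wt_nonneg [simp]: "0 \<le> wt r k"
  by (simp add: less_imp_le)

lemma wt_neq_0 [simp]: "wt r k \<noteq> 0"
  using wt_pos[of r k] by linarith

lemma wt_0 [simp]: "wt 0 k = 1"
  unfolding wt_def using wt_base_pos[of k] by simp

lemma wt_add: "wt (a + b) k = wt a k * wt b k"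
  by (simp add: wt_def powr_add)

lemma wt_mono: "a \<le> b \<Longrightarrow> wt a k \<le> wt b k"
  unfolding wt_def by (rule powr_mono) simp_all

lemma wt_ge_1: "0 \<le> r \<Longrightarrow> 1 \<le> wt r k"
  using wt_mono[of 0 r k] by simp

lemma wt_uminus [simp]: "wt r (- k) = wt r k"
  by (simp add: wt_def)

lemma wt_minus: "wt (- r) k = inverse (wt r k)"
  by (simp add: wt_def powr_minus)

lemma wt_power2: "(wt r k)\<^sup>2 = wt (2 * r) k"
  using wt_add[of r r k] by (simp add: power2_eq_square)

lemma wt_half_power2 [simp]: "(wt (r / 2) k)\<^sup>2 = wt r k"
  by (simp add: wt_power2)

lemma wt_1: "wt 1 k = 1 + (norm (freq k))\<^sup>2"
  unfolding wt_def using wt_base_pos[of k] by simp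

lemma norm_freq_le_wt: "norm (freq k) \<le> wt (1/2) k"
proof -
  have "norm (freq k) = sqrt ((norm (freq k))\<^sup>2)" by simp
  also have "\<dots> \<le> sqrt (1 + (norm (freq k))\<^sup>2)" by (intro real_sqrt_le_mono) simp
  also have "\<dots> = wt (1/2) k"
    unfolding wt_def using wt_base_pos[of k] by (simp add: powr_half_sqrt)
  finally show ?thesis .
qed

text \<open>Comparison with the powers n^(-2p), where 2p > 1; the integers are covered by two copies
  of the natural numbers.\<close>

lemma summable_on_int_powr:
  assumes "1 / 2 < (p::real)"
  shows "(\<lambda>n::int. (1 + (of_int n)\<^sup>2) powr (- p)) summable_on UNIV"
proof -
  let ?f = "\<lambda>x::real. (1 + x\<^sup>2) powr (- p)"
  have s1: "summable (\<lambda>n::nat. ?f (real n))"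
  proof (rule summable_comparison_test')
    show "summable (\<lambda>n. real n powr (- 2 * p))"
      using assms by (simp add: summable_real_powr_iff)
    show "norm (?f (real n)) \<le> real n powr (- 2 * p)" if "n \<ge> 1" for n
    proof -
      have n: "real n > 0" using that by simp
      have "real n powr (- 2 * p) = ((real n)\<^sup>2) powr (- p)"
        using n by (simp add: powr_powr flip: powr_numeral)
      also have "\<dots> \<ge> ?f (real n)"
        using n assms by (intro powr_mono2') auto
      finally show ?thesis by simp
    qed
  qed
  have s2: "(\<lambda>n::nat. ?f (real n)) summable_on UNIV"
    using s1 by (intro summable_nonneg_imp_summable_on) auto
  have "(\<lambda>n. ?f (of_int n)) summable_on range int"
    by (subst summable_on_reindex) (use s2 in \<open>auto simp: o_def\<close>)
  moreover have "(\<lambda>n. ?f (of_int n)) summable_on range (\<lambda>n. - int n)"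
    by (subst summable_on_reindex) (use s2 in \<open>auto simp: o_def inj_on_def\<close>)
  ultimately have "(\<lambda>n. ?f (of_int n)) summable_on (range int \<union> range (\<lambda>n. - int n))"
    by (rule summable_on_union)
  moreover have "range int \<union> range (\<lambda>n. - int n) = UNIV"
    by (metis (no_types, lifting) UNIV_eq_I UnI1 UnI2 int_cases2 rangeI)
  ultimately show ?thesis by simp
qed

lemma bij_vec3: "bij (\<lambda>(a, b, c). vector [a, b, c] :: 'a::zero ^ 3)"
proof (rule bijI)
  show "inj (\<lambda>(a, b, c). vector [a, b, c] :: 'a::zero ^ 3)"
    by (auto simp: inj_on_def vec_eq_iff forall_3)
  show "surj (\<lambda>(a, b, c). vector [a, b, c] :: 'a::zero ^ 3)"
  proof (rule surjI)
    fix x :: "'a ^ 3"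
    show "(\<lambda>(a, b, c). vector [a, b, c]) ((\<lambda>x. (x$1, x$2, x$3)) x) = x"
      by (simp add: vec_eq_iff forall_3)
  qed
qed

lemma summable_on_prod_nonneg:
  fixes g :: "'a \<Rightarrow> real" and h :: "'b \<Rightarrow> real"
  assumes "g summable_on UNIV" "h summable_on UNIV" "\<And>a. 0 \<le> g a" "\<And>b. 0 \<le> h b"
  shows "(\<lambda>(a, b). g a * h b) summable_on UNIV"
proof -
  have "(\<lambda>x. norm (case x of (a, b) \<Rightarrow> g a * h b)) summable_on (UNIV \<times> UNIV)"
    unfolding Infinite_Sum.abs_summable_on_Sigma_iff
    using assms by (auto simp: abs_mult infsum_cmult_right' infsum_nonneg
        intro!: summable_on_cmult_right summable_on_cmult_left)
  then show ?thesis using assms by (simp add: split_def)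
qed

lemma norm_freq_sq: "(norm (freq k))\<^sup>2 = (of_int (k$1))\<^sup>2 + (of_int (k$2))\<^sup>2 + (of_int (k$3))\<^sup>2"
  by (simp only: power2_norm_eq_inner) (simp add: inner_vec_def sum_3 power2_eq_square)

text \<open>The weight dominates the product of the one-dimensional weights with exponent \<open>p / 3\<close>.\<close>
lemma summable_wt:
  assumes "3 / 2 < p"
  shows "wt (- p) summable_on UNIV"
proof -
  define g where "g n = (1 + (of_int n)\<^sup>2) powr (- (p / 3))" for n :: int
  have g: "g summable_on UNIV"
    unfolding g_def using assms by (intro summable_on_int_powr) auto
  have gp: "0 \<le> g n" for n by (simp add: g_def)
  have "(\<lambda>(b, c). g b * g c) summable_on UNIV"
    by (rule summable_on_prod_nonneg) (use g gp in auto)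
  then have 2: "(\<lambda>(a, y). g a * (case y of (b, c) \<Rightarrow> g b * g c)) summable_on UNIV"
    using g gp by (intro summable_on_prod_nonneg) auto
  have 3: "(\<lambda>k::int^3. g (k$1) * (g (k$2) * g (k$3))) summable_on UNIV"
    by (subst summable_on_reindex_bij_betw[OF bij_vec3, symmetric])
       (use 2 in \<open>simp add: split_def o_def\<close>)
  show ?thesis
  proof (rule summable_on_comparison_test[OF 3])
    fix k :: "int^3"
    let ?x = "1 + (norm (freq k))\<^sup>2"
    have le: "?x powr (- (p / 3)) \<le> g (k $ i)" for i
    proof -
      have "(1 + (of_int (k $ i))\<^sup>2) \<le> ?x"
        using power_mono[OF component_le_norm_cart[of "freq k" i], of 2] by simp
      then show ?thesis unfolding g_def using assms
        by (intro powr_mono2') (auto simp: add_pos_nonneg)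
    qed
    have "wt (- p) k = ?x powr (- (p / 3)) * (?x powr (- (p / 3)) * ?x powr (- (p / 3)))"
      unfolding wt_def by (simp flip: powr_add)
    also have "\<dots> \<le> g (k$1) * (g (k$2) * g (k$3))"
      by (intro mult_mono le mult_nonneg_nonneg gp) auto
    finally show "wt (- p) k \<le> g (k$1) * (g (k$2) * g (k$3))" .
  qed auto
qed

section \<open>Exhaustion of the lattice by symmetric cubes\<close>

definition cube :: "nat \<Rightarrow> (int^3) set" where
  "cube n = {k. \<forall>i. \<bar>k $ i\<bar> \<le> int n}"

lemma finite_cube [simp]: "finite (cube n)"
proof -
  have "cube n \<subseteq> (\<lambda>(a, b, c). vector [a, b, c]) ` ({- int n..int n} \<times> {- int n..int n} \<times> {- int n..int n})"
  proof
    fix k assume "k \<in> cube n"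
    then have "k = (\<lambda>(a, b, c). vector [a, b, c]) (k$1, k$2, k$3)"
        "(k$1, k$2, k$3) \<in> {- int n..int n} \<times> {- int n..int n} \<times> {- int n..int n}"
      by (auto simp: cube_def vec_eq_iff forall_3 abs_le_iff)
    then show "k \<in> (\<lambda>(a, b, c). vector [a, b, c]) ` ({- int n..int n} \<times> {- int n..int n} \<times> {- int n..int n})"
      by (rule image_eqI)
  qed
  then show ?thesis by (rule finite_subset) auto
qed

lemma cube_uminus [simp]: "- k \<in> cube n \<longleftrightarrow> k \<in> cube n"
  by (simp add: cube_def)

lemma cube_mono:
  assumes "m \<le> n"
  shows "cube m \<subseteq> cube n"
proof
  fix k assume k: "k \<in> cube m"
  have "\<bar>k $ i\<bar> \<le> int n" for i
  proof -
    have "\<bar>k $ i\<bar> \<le> int m" using k by (simp add: cube_def)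
    then show ?thesis using assms by linarith
  qed
  then show "k \<in> cube n" by (simp add: cube_def)
qed

lemma finite_subset_cube:
  assumes "finite F"
  shows "\<exists>n. F \<subseteq> cube n"
  using assms
proof induction
  case (insert k F)
  then obtain n where n: "F \<subseteq> cube n" by auto
  define m where "m = nat (Max (range (\<lambda>i. \<bar>k $ i\<bar>)))"
  have "\<bar>k $ i\<bar> \<le> int m" for i
  proof -
    have "\<bar>k $ i\<bar> \<le> Max (range (\<lambda>i. \<bar>k $ i\<bar>))" by (intro Max_ge) auto
    then show ?thesis unfolding m_def using abs_ge_zero[of "k $ i"] by linarith
  qed
  then have "k \<in> cube m" by (simp add: cube_def)
  then have "insert k F \<subseteq> cube (max m n)" using n cube_mono[of m "max m n"] cube_mono[of n "max m n"] by auto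
  then show ?case ..
qed auto

lemma eventually_cube: "\<forall>\<^sub>F n in sequentially. k \<in> cube n"
proof -
  obtain n where "{k} \<subseteq> cube n" using finite_subset_cube[of "{k}"] by auto
  then show ?thesis using cube_mono unfolding eventually_sequentially by blast
qed

text \<open>Every finite set lies in some cube. Unordered sums thereby become limits of sequences,
  the form that measurability of limits and dominated convergence require.\<close>

lemma filterlim_cube: "filterlim cube (finite_subsets_at_top UNIV) sequentially"
  unfolding filterlim_finite_subsets_at_top
proof safe
  fix X :: "(int^3) set" assume "finite X"
  then obtain n where "X \<subseteq> cube n" using finite_subset_cube by blast
  then show "\<forall>\<^sub>F m in sequentially. finite (cube m) \<and> X \<subseteq> cube m \<and> cube m \<subseteq> UNIV"
    using cube_mono unfolding eventually_sequentially by (intro exI[of _ n]) auto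
qed

lemma has_sum_cube:
  assumes "(f has_sum s) UNIV"
  shows "(\<lambda>n. sum f (cube n)) \<longlonglongrightarrow> s"
  using filterlim_compose[OF assms[unfolded has_sum_def] filterlim_cube] .

lemma infsum_cube:
  assumes "f summable_on UNIV"
  shows "(\<lambda>n. sum f (cube n)) \<longlonglongrightarrow> infsum f UNIV"
  using has_sum_cube[OF has_sum_infsum[OF assms]] .

lemma infsum_tail_cube:
  fixes f :: "int^3 \<Rightarrow> real"
  assumes "f summable_on UNIV"
  shows "(\<lambda>n. infsum f (- cube n)) \<longlonglongrightarrow> 0"
proof -
  have "infsum f (- cube n) = infsum f UNIV - sum f (cube n)" for n
  proof -
    have "infsum f (cube n \<union> - cube n) = infsum f (cube n) + infsum f (- cube n)"
      by (rule infsum_Un_disjoint) (auto intro: summable_on_subset_banach[OF assms])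
    then show ?thesis by simp
  qed
  then show ?thesis using tendsto_diff[OF tendsto_const infsum_cube[OF assms], of "infsum f UNIV"] by simp
qed

text \<open>Dominated convergence along the cubes, with \<open>infsum b UNIV * w x\<close> as
  majorant of all partial sums. The product form of the bound serves both series in space, where
  \<open>w\<close> is constant or the modulus of a function, and series in time, where
  \<open>w\<close> is 1.\<close>

lemma
  fixes f :: "int^3 \<Rightarrow> 'a \<Rightarrow> complex"
  assumes meas: "\<And>k. f k \<in> borel_measurable M"
    and bound: "\<And>k x. x \<in> space M \<Longrightarrow> norm (f k x) \<le> b k * w x" and b: "b summable_on UNIV" "\<And>k. 0 \<le> b k"
    and w: "integrable M w" "\<And>x. 0 \<le> w x"
  shows integrable_infsum: "integrable M (\<lambda>x. \<Sum>\<^sub>\<infinity>k. f k x)"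
    and integral_infsum: "(LINT x|M. (\<Sum>\<^sub>\<infinity>k. f k x)) = (\<Sum>\<^sub>\<infinity>k. LINT x|M. f k x)"
    and summable_integral: "(\<lambda>k. norm (LINT x|M. f k x)) summable_on UNIV"
    and measurable_infsum: "(\<lambda>x. \<Sum>\<^sub>\<infinity>k. f k x) \<in> borel_measurable M"
proof -
  have s: "(\<lambda>k. f k x) summable_on UNIV" if "x \<in> space M" for x
    by (rule abs_summable_summable, rule summable_on_comparison_test[OF summable_on_cmult_left[OF b(1), of "w x"]])
       (use bound[OF that] in auto)
  have lim: "(\<lambda>n. \<Sum>k\<in>cube n. f k x) \<longlonglongrightarrow> (\<Sum>\<^sub>\<infinity>k. f k x)" if "x \<in> space M" for x
    by (rule infsum_cube[OF s[OF that]])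
  show m: "(\<lambda>x. \<Sum>\<^sub>\<infinity>k. f k x) \<in> borel_measurable M"
    by (rule borel_measurable_LIMSEQ_metric[OF _ lim]) (auto intro!: borel_measurable_sum meas)
  have B: "norm (\<Sum>k\<in>cube n. f k x) \<le> infsum b UNIV * w x" if "x \<in> space M" for n x
  proof -
    have "norm (\<Sum>k\<in>cube n. f k x) \<le> (\<Sum>k\<in>cube n. b k * w x)"
      by (rule sum_norm_le) (use bound that in auto)
    also have "\<dots> = (\<Sum>k\<in>cube n. b k) * w x" by (simp add: sum_distrib_right)
    also have "\<dots> \<le> infsum b UNIV * w x"
      by (intro mult_right_mono finite_sum_le_infsum b w) (auto simp: b)
    finally show ?thesis .
  qed
  have i: "integrable M (f k)" for k
    by (rule Bochner_Integration.integrable_bound[of M "\<lambda>x. b k * w x"])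
       (use bound meas w b in \<open>auto intro!: AE_I2 simp: abs_mult\<close>)
  have ii: "integrable M (\<lambda>x. \<Sum>\<^sub>\<infinity>k. f k x) \<and> (\<lambda>n. LINT x|M. (\<Sum>k\<in>cube n. f k x)) \<longlonglongrightarrow> (LINT x|M. (\<Sum>\<^sub>\<infinity>k. f k x))"
    by (intro conjI integrable_dominated_convergence[where w="\<lambda>x. infsum b UNIV * w x" and s="\<lambda>n x. \<Sum>k\<in>cube n. f k x"]
        integral_dominated_convergence[where w="\<lambda>x. infsum b UNIV * w x"])
       (use m meas lim B w in \<open>auto intro!: borel_measurable_sum AE_I2\<close>)
  then show "integrable M (\<lambda>x. \<Sum>\<^sub>\<infinity>k. f k x)" by simp
  have "norm (LINT x|M. f k x) \<le> b k * (LINT x|M. w x)" for k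
  proof -
    have "norm (LINT x|M. f k x) \<le> (LINT x|M. norm (f k x))" by (rule integral_norm_bound)
    also have "\<dots> \<le> (LINT x|M. b k * w x)"
      by (rule integral_mono) (use i bound w in auto)
    finally show ?thesis by simp
  qed
  then show si: "(\<lambda>k. norm (LINT x|M. f k x)) summable_on UNIV"
    by (intro summable_on_comparison_test[OF summable_on_cmult_left[OF b(1), of "LINT x|M. w x"]]) simp_all
  have "(\<lambda>n. \<Sum>k\<in>cube n. LINT x|M. f k x) \<longlonglongrightarrow> (LINT x|M. (\<Sum>\<^sub>\<infinity>k. f k x))"
    using ii i by (simp add: Bochner_Integration.integral_sum)
  then show "(LINT x|M. (\<Sum>\<^sub>\<infinity>k. f k x)) = (\<Sum>\<^sub>\<infinity>k. LINT x|M. f k x)"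
    using infsum_cube[OF abs_summable_summable[OF si]] LIMSEQ_unique by blast
qed

subsection \<open>Exponentials on the torus\<close>

abbreviation cell :: "(real^3) set" where
  "cell \<equiv> cbox 0 (\<chi> i. 2 * pi)"

lemma space_torus [simp]: "space torus = cell"
  by (simp add: torus_def)

lemma finite_measure_torus: "finite_measure torus"
  unfolding torus_def by (rule finite_measure_lebesgue_on) auto

interpretation torus: finite_measure torus
  by (rule finite_measure_torus)

lemma measure_torus: "measure torus cell = (2 * pi) ^ 3"
proof -
  have ne: "cell \<noteq> {}" by (simp add: interval_ne_empty_cart)
  have "measure torus cell = measure lebesgue cell"
    by (simp add: torus_def measure_restrict_space)
  also have "\<dots> = (\<Prod>i\<in>(UNIV::3 set). 2 * pi)"
    using content_cbox_cart[OF ne] by simp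
  finally show ?thesis by simp
qed

lemma continuous_imp_measurable_torus:
  fixes f :: "real^3 \<Rightarrow> 'b::euclidean_space"
  assumes "continuous_on UNIV f"
  shows "f \<in> borel_measurable torus"
  unfolding torus_def
  using continuous_imp_measurable_on_sets_lebesgue[of cell f] continuous_on_subset[OF assms] by auto

lemma continuous_imp_integrable_torus:
  fixes f :: "real^3 \<Rightarrow> 'b::euclidean_space"
  assumes "continuous_on UNIV f"
  shows "integrable torus f"
  unfolding torus_def using continuous_imp_integrable continuous_on_subset[OF assms] by blast

text \<open>A shift by at most one period pushes a single slab through one face of the cell, and
  periodicity brings this slab back at the opposite face.\<close>

lemma integral_torus_translate:
  fixes f :: "real^3 \<Rightarrow> complex"
  assumes f: "continuous_on UNIV f" and p: "periodic3 f" and h: "0 \<le> h" "h \<le> 2 * pi"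
  shows "(LINT x|torus. f (x + axis i h)) = (LINT x|torus. f x)"
proof -
  define c :: "real^3" where "c = (\<chi> i. 2 * pi)"
  define v where "v = axis i h"
  define w :: "real^3" where "w = axis i (2 * pi)"
  have int: "f integrable_on cbox a b" for a b
    by (rule integrable_continuous) (use f continuous_on_subset in blast)
  have ax: "axis i 1 \<in> (Basis :: (real^3) set)" by (auto simp: Basis_vec_def)
  have ii: "x \<bullet> axis i 1 = x $ i" for x :: "real^3" by (simp add: inner_axis)
  have c1: "continuous_on UNIV (\<lambda>x. f (x + v))"
    by (intro continuous_on_compose2[OF f] continuous_intros) auto
  have "(LINT x|torus. f (x + v)) = integral (cbox 0 c) (\<lambda>x. f (x + v))"
    using continuous_imp_integrable_torus[OF c1] unfolding torus_def c_def
    by (simp add: lebesgue_integral_eq_integral)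
  also have "\<dots> = integral (cbox v (c + v)) f"
    using integral_shift_cbox[of v v "c + v" f] by simp
  \<comment> \<open>The shifted cell is cut at the face where coordinate \<open>i\<close> equals 2
    pi. The part beyond it is moved back by the period \<open>w\<close>; the two pieces are then
    those of the original cell cut at height \<open>h\<close>.\<close>
  also have "\<dots> = integral (cbox v (c + v) \<inter> {x. x \<bullet> axis i 1 \<le> 2 * pi}) f
                 + integral (cbox v (c + v) \<inter> {x. x \<bullet> axis i 1 \<ge> 2 * pi}) f"
    by (rule integral_split[OF int ax])
  also have "cbox v (c + v) \<inter> {x. x \<bullet> axis i 1 \<le> 2 * pi} = cbox v c"
    unfolding ii using h exhaust_3[of i] by (auto simp: mem_box_cart c_def v_def axis_def forall_3)
  also have "cbox v (c + v) \<inter> {x. x \<bullet> axis i 1 \<ge> 2 * pi} = cbox w (c + v)"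
    unfolding ii using h exhaust_3[of i] by (auto simp: mem_box_cart c_def v_def w_def axis_def forall_3)
  also have "integral (cbox w (c + v)) f = integral (cbox 0 (c + v - w)) (\<lambda>x. f (x + w))"
    using integral_shift_cbox[of w w "c + v" f] by simp
  also have "(\<lambda>x. f (x + w)) = f"
    using p by (simp add: periodic3_def w_def)
  also have "integral (cbox v c) f + integral (cbox 0 (c + v - w)) f
     = integral (cbox 0 c \<inter> {x. x \<bullet> axis i 1 \<le> h}) f + integral (cbox 0 c \<inter> {x. x \<bullet> axis i 1 \<ge> h}) f"
  proof -
    have "cbox 0 c \<inter> {x. x \<bullet> axis i 1 \<le> h} = cbox 0 (c + v - w)"
      unfolding ii using h exhaust_3[of i] by (auto simp: mem_box_cart c_def v_def w_def axis_def forall_3)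
    moreover have "cbox 0 c \<inter> {x. x \<bullet> axis i 1 \<ge> h} = cbox v c"
      unfolding ii using h exhaust_3[of i] by (auto simp: mem_box_cart c_def v_def w_def axis_def forall_3)
    ultimately show ?thesis by simp
  qed
  also have "\<dots> = integral (cbox 0 c) f"
    by (rule integral_split[OF int ax, symmetric])
  also have "\<dots> = (LINT x|torus. f x)"
    using continuous_imp_integrable_torus[OF f] unfolding torus_def c_def
    by (simp add: lebesgue_integral_eq_integral)
  finally show ?thesis by (simp add: v_def)
qed

definition ek :: "int^3 \<Rightarrow> real^3 \<Rightarrow> complex" where
  "ek k x = cis (freq k \<bullet> x)"

lemma ek_0 [simp]: "ek 0 x = 1"
  by (simp add: ek_def)

lemma norm_ek [simp]: "norm (ek k x) = 1"
  by (simp add: ek_def)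

lemma ek_mult: "ek k x * ek l x = ek (k + l) x"
  by (simp add: ek_def cis_mult freq_add inner_add_left)

lemma cnj_ek: "cnj (ek k x) = ek (- k) x"
  by (simp add: ek_def cis_cnj)

lemma ek_add: "ek k (x + y) = ek k x * ek k y"
  by (simp add: ek_def cis_mult inner_add_right)

lemma ek_axis: "ek k (axis i h) = cis (of_int (k $ i) * h)"
  by (simp add: ek_def inner_axis)

lemma continuous_ek [continuous_intros]: "continuous_on S (ek k)"
  unfolding ek_def cis_conv_exp by (intro continuous_intros)

lemma measurable_ek [measurable]: "ek k \<in> borel_measurable torus"
  by (intro continuous_imp_measurable_torus continuous_intros)

lemma periodic3_ek: "periodic3 (ek k)"
  unfolding periodic3_def
proof (intro allI)
  fix x i
  have "cis (of_int (k $ i) * (2 * pi)) = 1"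
    using cis_multiple_2pi[of "of_int (k $ i)"] by (simp add: mult.commute)
  then show "ek k (x + axis i (2 * pi)) = ek k x"
    by (simp add: ek_add ek_axis)
qed

lemma fourier_eq_ek: "fourier f k = (LINT x|torus. of_real (f x) * ek (- k) x) / of_real ((2 * pi) ^ 3)"
  by (simp add: fourier_def ek_def)

text \<open>For a nonzero component \<open>k $ i\<close>, translation by pi / |k_i| along that axis
  changes the sign of the exponential, so its integral equals its own negative.\<close>

lemma integral_ek: "(LINT x|torus. ek k x) = (if k = 0 then of_real ((2 * pi) ^ 3) else 0)"
proof (cases "k = 0")
  case True
  then have "(LINT x|torus. ek k x) = (LINT x|torus. 1)"
    by (intro Bochner_Integration.integral_cong) auto
  then show ?thesis using True by (simp add: measure_torus scaleR_conv_of_real)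
next
  case False
  then obtain i where i: "k $ i \<noteq> 0" by (auto simp: vec_eq_iff)
  define h where "h = pi / \<bar>of_int (k $ i)\<bar>"
  have h: "0 \<le> h" "h \<le> 2 * pi"
  proof -
    have "1 \<le> \<bar>real_of_int (k $ i)\<bar>" using i by linarith
    then show "0 \<le> h" "h \<le> 2 * pi" by (auto simp: h_def divide_simps intro: order_trans[of _ "2 * pi * 1"])
  qed
  have "ek k (axis i h) = -1"
  proof (cases "k $ i > 0")
    case True
    then have "of_int (k $ i) * h = pi" by (simp add: h_def)
    then show ?thesis by (simp add: ek_axis)
  next
    case False
    then have "of_int (k $ i) * h = - pi" using i by (simp add: h_def)
    then show ?thesis by (metis cis_cnj cis_pi complex_cnj_minus complex_cnj_one ek_axis)
  qed
  then have "(LINT x|torus. ek k (x + axis i h)) = - (LINT x|torus. ek k x)"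
    by (simp add: ek_add)
  moreover have "(LINT x|torus. ek k (x + axis i h)) = (LINT x|torus. ek k x)"
    by (rule integral_torus_translate[OF _ periodic3_ek h]) (intro continuous_intros)
  ultimately have "(LINT x|torus. ek k x) = 0" by simp
  then show ?thesis using False by simp
qed

subsection \<open>Completeness of the trigonometric system\<close>

text \<open>The complex span of the exponentials. As an inductive predicate it lets the vanishing of
  all Fourier coefficients pass by induction to every trigonometric polynomial.\<close>

inductive trig_poly :: "(real^3 \<Rightarrow> complex) \<Rightarrow> bool" where
  base: "trig_poly (ek k)"
| add: "trig_poly f \<Longrightarrow> trig_poly g \<Longrightarrow> trig_poly (\<lambda>x. f x + g x)"
| scale: "trig_poly f \<Longrightarrow> trig_poly (\<lambda>x. c * f x)"

lemma trig_poly_const: "trig_poly (\<lambda>x. c)"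
  using trig_poly.scale[OF trig_poly.base[of 0], of c] by (simp add: ek_def)

lemma trig_poly_mult_ek: "trig_poly g \<Longrightarrow> trig_poly (\<lambda>x. ek k x * g x)"
proof (induction rule: trig_poly.induct)
  case (base l)
  then show ?case by (simp add: ek_mult trig_poly.base)
next
  case (add f g)
  from trig_poly.add[OF add.IH] show ?case by (simp add: distrib_left)
next
  case (scale f c)
  from trig_poly.scale[OF scale.IH, of c] show ?case by (simp add: mult.left_commute)
qed

lemma trig_poly_mult:
  assumes "trig_poly f" "trig_poly g"
  shows "trig_poly (\<lambda>x. f x * g x)"
  using assms(1)
proof (induction rule: trig_poly.induct)
  case (base l)
  then show ?case using assms(2) by (rule trig_poly_mult_ek)
next
  case (add f1 f2)
  from trig_poly.add[OF add.IH] show ?case by (simp add: distrib_right)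
next
  case (scale f c)
  from trig_poly.scale[OF scale.IH, of c] show ?case by (simp add: mult.assoc)
qed

text \<open>Closure under products makes polynomials in a real trigonometric polynomial admissible.
  Approximations on the real line are thus transported to the torus.\<close>

lemma trig_poly_compose:
  assumes "real_polynomial_function Q" "trig_poly (\<lambda>x. of_real (h x))"
  shows "trig_poly (\<lambda>x. of_real (Q (h x)))"
  using assms(1)
proof (induction rule: real_polynomial_function.induct)
  case (linear f)
  have "f y = f 1 * y" for y
    using linear_cmul[OF bounded_linear.linear[OF linear], of y 1] by (simp add: mult.commute)
  then show ?case using trig_poly.scale[OF assms(2), of "of_real (f 1)"] by (metis (no_types, lifting) ext of_real_mult)
next
  case (const c)
  then show ?case by (rule trig_poly_const)
next
  case (add f g)
  from trig_poly.add[OF add.IH] show ?case by simp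
next
  case (mult f g)
  from trig_poly_mult[OF mult.IH] show ?case by simp
qed

lemma trig_poly_cos: "trig_poly (\<lambda>x. of_real (cos (x $ i - c) - d))"
proof -
  have "of_real (cos (x $ i - c) - d)
    = cis (- c) / 2 * ek (axis i 1) x + (cis c / 2 * ek (axis i (-1)) x + - of_real d)" for x
  proof -
    have "freq (axis i 1) \<bullet> x = x $ i" "freq (axis i (-1)) \<bullet> x = - x $ i"
      using inner_axis[of x i 1] inner_axis[of x i "-1"]
      by (simp_all add: inner_commute freq_def axis_def if_distrib cong: if_cong)
    moreover have "complex_of_real (cos (x $ i - c)) = (cis (x $ i - c) + cis (c - x $ i)) / 2"
      by (simp add: complex_eq_iff cos_diff sin_diff)
    ultimately show ?thesis
      by (simp add: ek_def add_divide_distrib cis_mult add.commute)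
  qed
  then show ?thesis
    by (simp only:) (intro trig_poly.add trig_poly.scale trig_poly.base trig_poly_const)
qed

lemma integral_trig_poly_0:
  assumes f: "integrable torus f" and 0: "\<And>k. fourier f k = 0" and "trig_poly g"
  shows "integrable torus (\<lambda>x. of_real (f x) * g x) \<and> (LINT x|torus. of_real (f x) * g x) = 0"
  using assms(3)
proof (induction rule: trig_poly.induct)
  case (base k)
  have "integrable torus (\<lambda>x. of_real (f x) * ek k x)"
    by (rule Bochner_Integration.integrable_bound[OF f]) (use f in \<open>auto simp: norm_mult\<close>)
  then show ?case using 0[of "- k"] by (simp add: fourier_eq_ek)
next
  case (add g h)
  then show ?case by (simp add: distrib_left)
next
  case (scale g c)
  then show ?case by (simp add: mult.left_commute)
qed

text \<open>The interval [-2,2] contains every value of a cosine minus a number in [-1,1]. The slope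
  \<open>n\<close> of the ramp and the accuracy \<open>1 / Suc n\<close> are tied to one index, so
  that a single limit yields the step function.\<close>

lemma poly_step_approx:
  "\<exists>Q. real_polynomial_function Q \<and> (\<forall>y\<in>{-2..2::real}. \<bar>min 1 (max 0 (real n * y)) - Q y\<bar> < 1 / Suc n)"
proof -
  have "continuous_on {-2..2::real} (\<lambda>y. min 1 (max 0 (real n * y)))"
    by (intro continuous_intros)
  from Stone_Weierstrass_real_polynomial_function[OF _ this, of "1 / Suc n"]
  show ?thesis by (metis compact_Icc of_nat_0_less_iff zero_less_Suc zero_less_divide_1_iff)
qed

text \<open>The ramps vanish at 0, so the limit is the indicator of the open half line; this is why
  open boxes appear below.\<close>

lemma step_tendsto:
  fixes y :: real
  shows "(\<lambda>n. min 1 (max 0 (real n * y))) \<longlonglongrightarrow> (if y > 0 then 1 else 0)"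
proof (cases "y > 0")
  case True
  obtain N :: nat where N: "1 / y < real N" using reals_Archimedean2 by blast
  have "\<forall>\<^sub>F n in sequentially. min 1 (max 0 (real n * y)) = 1"
    unfolding eventually_sequentially
  proof (intro exI[of _ N] allI impI)
    fix n assume "N \<le> n"
    then have "1 / y \<le> real n" using N by linarith
    then have "1 \<le> real n * y" using True by (simp add: divide_simps)
    then show "min 1 (max 0 (real n * y)) = 1" by simp
  qed
  then show ?thesis using True by (simp add: tendsto_eventually)
next
  case False
  then have "real n * y \<le> 0" for n by (simp add: mult_nonneg_nonpos)
  then have "min 1 (max 0 (real n * y)) = 0" for n by (simp add: max_absorb1)
  then show ?thesis using False by simp
qed

text \<open>Composing polynomial approximations of a step function with \<open>cos (x\<^sub>i - c\<^sub>i) - d\<^sub>i\<close> gives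
  trigonometric polynomials that converge boundedly to the indicator of a box.\<close>
lemma integral_cos_box_0:
  assumes f: "integrable torus f" and 0: "\<And>k. fourier f k = 0" and d: "\<And>i. \<bar>d i\<bar> \<le> 1"
  shows "(LINT x|torus. f x * (if \<forall>i. cos (x $ i - c i) > d i then 1 else 0)) = 0"
proof -
  obtain Q where Q: "\<And>n. real_polynomial_function (Q n)"
    and Qn: "\<And>n y. y \<in> {-2..2::real} \<Longrightarrow> \<bar>min 1 (max 0 (real n * y)) - Q n y\<bar> < 1 / Suc n"
    using poly_step_approx by metis
  define h where "h i x = cos (x $ i - c i) - d i" for i :: 3 and x :: "real^3"
  have h2: "h i x \<in> {-2..2}" for i x
    using d[of i] cos_ge_minus_one[of "x $ i - c i"] cos_le_one[of "x $ i - c i"]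
    unfolding h_def atLeastAtMost_iff by linarith
  \<comment> \<open>The ramp lies in [0,1] and the error is at most 1. Three such factors give the
    majorant \<open>8 * \<bar>f x\<bar>\<close> below.\<close>
  have Q2: "\<bar>Q n (h i x)\<bar> \<le> 2" for n i x
  proof -
    have "1 / real (Suc n) \<le> 1" by simp
    moreover have "0 \<le> min 1 (max 0 (real n * h i x))" "min 1 (max 0 (real n * h i x)) \<le> 1" by auto
    ultimately show ?thesis using Qn[OF h2[of i x], of n] by linarith
  qed
  have Qlim: "(\<lambda>n. Q n (h i x)) \<longlonglongrightarrow> (if h i x > 0 then 1 else 0)" for i x
  proof -
    have "(\<lambda>n. min 1 (max 0 (real n * h i x)) - Q n (h i x)) \<longlonglongrightarrow> 0"
    proof (rule Lim_null_comparison[OF _ LIMSEQ_inverse_real_of_nat])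
      show "\<forall>\<^sub>F n in sequentially. norm (min 1 (max 0 (real n * h i x)) - Q n (h i x)) \<le> inverse (real (Suc n))"
        by (intro always_eventually allI less_imp_le) (use Qn[OF h2] in \<open>simp add: inverse_eq_divide\<close>)
    qed
    from tendsto_diff[OF step_tendsto[of "h i x"] this] show ?thesis by simp
  qed
  have contQ: "continuous_on UNIV (\<lambda>x. Q n (h i x))" for n i
    unfolding h_def
    by (rule continuous_on_compose2[OF continuous_at_imp_continuous_on[OF ballI[OF continuous_real_polymonial_function[OF Q]]]]) (intro continuous_intros, auto)
  have tp: "trig_poly (\<lambda>x. of_real (Q n (h 1 x)) * (of_real (Q n (h 2 x)) * of_real (Q n (h 3 x))))" for n
    unfolding h_def by (intro trig_poly_mult trig_poly_compose[OF Q] trig_poly_cos)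
  have z: "(LINT x|torus. f x * (Q n (h 1 x) * (Q n (h 2 x) * Q n (h 3 x)))) = 0" for n
  proof -
    have "(LINT x|torus. complex_of_real (f x * (Q n (h 1 x) * (Q n (h 2 x) * Q n (h 3 x))))) = 0"
      using integral_trig_poly_0[OF f 0 tp[of n]] by simp
    then show ?thesis by (simp only: integral_complex_of_real of_real_eq_0_iff)
  qed
  have "(\<lambda>n. LINT x|torus. f x * (Q n (h 1 x) * (Q n (h 2 x) * Q n (h 3 x)))) \<longlonglongrightarrow>
     (LINT x|torus. f x * ((if h 1 x > 0 then 1 else 0) * ((if h 2 x > 0 then 1 else 0) * (if h 3 x > 0 then 1 else 0))))"
  proof (rule integral_dominated_convergence[where w="\<lambda>x. 8 * \<bar>f x\<bar>"])
    show "integrable torus (\<lambda>x. 8 * \<bar>f x\<bar>)" using f by simp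
    show "AE x in torus. (\<lambda>n. f x * (Q n (h 1 x) * (Q n (h 2 x) * Q n (h 3 x)))) \<longlonglongrightarrow>
        f x * ((if h 1 x > 0 then 1 else 0) * ((if h 2 x > 0 then 1 else 0) * (if h 3 x > 0 then 1 else 0)))"
      by (intro AE_I2 tendsto_mult tendsto_const Qlim)
    show "AE x in torus. norm (f x * (Q n (h 1 x) * (Q n (h 2 x) * Q n (h 3 x)))) \<le> 8 * \<bar>f x\<bar>" for n
    proof (rule AE_I2)
      fix x
      have "\<bar>Q n (h 1 x)\<bar> * (\<bar>Q n (h 2 x)\<bar> * \<bar>Q n (h 3 x)\<bar>) \<le> 2 * (2 * 2)"
        by (intro mult_mono Q2) auto
      from mult_left_mono[OF this, of "\<bar>f x\<bar>"]
      show "norm (f x * (Q n (h 1 x) * (Q n (h 2 x) * Q n (h 3 x)))) \<le> 8 * \<bar>f x\<bar>"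
        by (simp add: abs_mult mult.commute)
    qed
    have hm: "h i \<in> borel_measurable torus" for i
      unfolding h_def by (intro continuous_imp_measurable_torus continuous_intros)
    show "(\<lambda>x. f x * ((if h 1 x > 0 then 1 else 0) * ((if h 2 x > 0 then 1 else 0) * (if h 3 x > 0 then 1 else 0))))
        \<in> borel_measurable torus"
      using hm f by measurable
    show "(\<lambda>x. f x * (Q n (h 1 x) * (Q n (h 2 x) * Q n (h 3 x)))) \<in> borel_measurable torus" for n
      by (intro borel_measurable_times borel_measurable_integrable[OF f] continuous_imp_measurable_torus contQ)
  qed
  moreover have "(if h 1 x > 0 then 1 else 0) * ((if h 2 x > 0 then 1 else 0) * (if h 3 x > 0 then 1 else 0))
     = (if \<forall>i. cos (x $ i - c i) > d i then 1 else (0::real))" for x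
    by (auto simp: h_def forall_3)
  ultimately show ?thesis using LIMSEQ_unique[OF _ tendsto_const] by (simp add: z)
qed

text \<open>The condition compares the distance \<open>y\<close> from the midpoint with half the
  length \<open>e\<close> of the interval. If \<open>y\<close> exceeds pi, it is reflected to 2 pi -
  y, which is still at least \<open>e\<close> because the interval lies in one period.\<close>

lemma cos_gt_iff:
  assumes ab: "0 \<le> a" "a < b" "b \<le> 2 * pi" and x: "0 \<le> x" "x \<le> 2 * pi"
  shows "cos ((b - a) / 2) < cos (x - (a + b) / 2) \<longleftrightarrow> a < x \<and> x < b"
proof -
  define y where "y = \<bar>x - (a + b) / 2\<bar>"
  define e where "e = (b - a) / 2"
  have e: "0 < e" "e \<le> pi" using ab by (auto simp: e_def)
  have y: "0 \<le> y" "y \<le> 2 * pi - e" using ab x by (auto simp: y_def e_def abs_if field_simps)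
  have 1: "cos (x - (a + b) / 2) = cos y" by (simp add: y_def)
  have 2: "(a < x \<and> x < b) \<longleftrightarrow> y < e" by (auto simp: y_def e_def abs_if field_simps)
  have 3: "cos e < cos y \<longleftrightarrow> y < e"
  proof (cases "y \<le> pi")
    case True
    then show ?thesis using cos_mono_less_eq[of e y] e y by auto
  next
    case False
    have "cos y = cos (2 * pi - y)" by (simp add: cos_diff)
    also have "\<dots> \<le> cos e"
      using cos_monotone_0_pi_le[of e "2 * pi - y"] e y False by auto
    finally show ?thesis using False e by auto
  qed
  show ?thesis unfolding 1 2 using 3 by (simp add: e_def)
qed

text \<open>Completeness for integrable functions: integrals over boxes vanish, hence over Borel
  sets by a Dynkin class argument, hence over the sets where \<open>f\<close> is positive or
  negative.\<close>

theorem fourier_eq_0_imp_AE_0: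
  assumes f: "integrable torus f" and 0: "\<And>k. fourier f k = 0"
  shows "AE x in torus. f x = 0"
proof -
  have fm [measurable]: "f \<in> borel_measurable torus" using f by auto
  have sub: "A \<inter> cell \<in> sets torus" if "A \<in> sets lebesgue" for A
    using that by (auto simp: torus_def sets_restrict_space)
  have i1: "integrable torus (\<lambda>x. f x * indicator A x)" if "A \<inter> cell \<in> sets torus" for A
  proof -
    have "(\<lambda>x. f x * indicator (A \<inter> cell) x) \<in> borel_measurable torus" using that by measurable
    then have "(\<lambda>x. f x * indicator A x) \<in> borel_measurable torus"
      by (rule measurable_cong[THEN iffD1, rotated]) (auto simp: indicator_def)
    then show ?thesis
      by (rule Bochner_Integration.integrable_bound[OF f]) (auto simp: indicator_def)
  qed
  \<comment> \<open>The boundary of the cell is a null set. Discarding it allows the box to be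
    intersected with the cell without distinguishing strict from weak inequalities.\<close>
  have negl: "AE x in torus. x \<in> box 0 (\<chi> i. 2 * pi)"
  proof -
    have "cell - box 0 (\<chi> i. 2 * pi) \<in> null_sets lebesgue"
      using negligible_iff_null_sets negligible_frontier_interval by blast
    then have "AE x in lebesgue. x \<in> cell \<longrightarrow> x \<in> box 0 (\<chi> i. 2 * pi)"
      by (rule AE_I') auto
    then show ?thesis unfolding torus_def by (subst AE_restrict_space_iff) auto
  qed
  have boxes: "(LINT x|torus. f x * indicator (box a b) x) = 0" for a b :: "real^3"
  proof (cases "\<forall>i. max 0 (a $ i) < min (2 * pi) (b $ i)")
    case True
    define a' where "a' i = max 0 (a $ i)" for i
    define b' where "b' i = min (2 * pi) (b $ i)" for i
    have ab: "0 \<le> a' i" "a' i < b' i" "b' i \<le> 2 * pi" for i using True by (auto simp: a'_def b'_def)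
    have "(LINT x|torus. f x * indicator (box a b) x)
      = (LINT x|torus. f x * (if \<forall>i. cos (x $ i - (a' i + b' i) / 2) > cos ((b' i - a' i) / 2) then 1 else 0))"
    proof (rule integral_cong_AE)
      show "AE x in torus. f x * indicator (box a b) x
          = f x * (if \<forall>i. cos (x $ i - (a' i + b' i) / 2) > cos ((b' i - a' i) / 2) then 1 else 0)"
        using negl
      proof eventually_elim
        case (elim x)
        then have "x \<in> box a b \<longleftrightarrow> (\<forall>i. a' i < x $ i \<and> x $ i < b' i)"
          by (auto simp: mem_box_cart a'_def b'_def)
        moreover have "cos ((b' i - a' i) / 2) < cos (x $ i - (a' i + b' i) / 2) \<longleftrightarrow> a' i < x $ i \<and> x $ i < b' i" for i
          by (rule cos_gt_iff[OF ab]) (use elim in \<open>auto simp: mem_box_cart less_imp_le\<close>)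
        ultimately show ?case by (auto simp: indicator_def)
      qed
      show "(\<lambda>x. f x * indicator (box a b) x) \<in> borel_measurable torus"
        by (intro borel_measurable_integrable i1 sub) auto
      have "(\<lambda>x. cos (x $ i - (a' i + b' i) / 2)) \<in> borel_measurable torus" for i
        by (intro continuous_imp_measurable_torus continuous_intros)
      then show "(\<lambda>x. f x * (if \<forall>i. cos (x $ i - (a' i + b' i) / 2) > cos ((b' i - a' i) / 2) then 1 else 0))
         \<in> borel_measurable torus" by measurable
    qed
    also have "\<dots> = 0" by (rule integral_cos_box_0[OF f 0]) simp
    finally show ?thesis .
  next
    case False
    have "AE x in torus. f x * indicator (box a b) x = 0"
      using negl
    proof eventually_elim
      case (elim x)
      have "x \<notin> box a b"
      proof
        assume "x \<in> box a b"
        then have "\<forall>i. max 0 (a $ i) < min (2 * pi) (b $ i)"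
          using elim by (auto simp: mem_box_cart intro: less_trans)
        then show False using False by simp
      qed
      then show ?case by simp
    qed
    then show ?thesis by (rule integral_eq_zero_AE)
  qed
  \<comment> \<open>Open boxes are stable under intersection and generate the Borel sets.
    Complements use the zero frequency, which says that the integral over the whole torus
    vanishes.\<close>
  have borel: "(LINT x|torus. f x * indicator A x) = 0" if "A \<in> sets borel" for A
  proof -
    have leb: "B \<in> sets lebesgue" if "B \<in> sigma_sets UNIV (range (\<lambda>(a, b). box a b))" for B :: "(real^3) set"
    proof -
      have "B \<in> sets borel" using that borel_eq_box by (metis sets_measure_of top_greatest Pow_UNIV)
      then show ?thesis by auto
    qed
    have univ: "(LINT x|torus. f x) = 0"
    proof -
      have "(LINT x|torus. complex_of_real (f x)) = 0" using 0[of 0] by (simp add: fourier_eq_ek)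
      then show ?thesis by (simp only: integral_complex_of_real of_real_eq_0_iff)
    qed
    have "A \<in> sigma_sets UNIV (range (\<lambda>(a, b). box a b))"
      using that borel_eq_box by (metis sets_measure_of top_greatest Pow_UNIV)
    then have "Int_stable (range (\<lambda>(a, b). box a b :: (real^3) set))" "range (\<lambda>(a, b). box a b) \<subseteq> Pow (UNIV :: (real^3) set)"
      "A \<in> sigma_sets UNIV (range (\<lambda>(a, b). box a b))"
      by (auto simp: Int_stable_def box_Int_box)
    then show ?thesis
    proof (induction rule: sigma_sets_induct_disjoint)
      case (basic A)
      then show ?case using boxes by auto
    next
      case empty
      then show ?case by simp
    next
      case (compl A)
      have "(LINT x|torus. f x * indicator (UNIV - A) x) = (LINT x|torus. f x - f x * indicator A x)"
        by (intro Bochner_Integration.integral_cong) (auto simp: indicator_def)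
      also have "\<dots> = 0"
        using compl f i1[OF sub[OF leb[OF compl(1)]]] univ by simp
      finally show ?case .
    next
      case (union A)
      have s: "(\<lambda>i. f x * indicator (A i) x) sums (f x * indicator (\<Union> (range A)) x)" for x
        using sums_mult[OF indicator_sums[of A x], of "f x"] union(1) by (auto simp: disjoint_family_on_def)
      have lu: "A i \<in> sets lebesgue" for i using leb union(2) by auto
      have lm: "\<Union> (range A) \<in> sets lebesgue" using leb union(2) by (intro sets.countable_UN) auto
      have "(\<lambda>n. LINT x|torus. (\<Sum>i<n. f x * indicator (A i) x)) \<longlonglongrightarrow> (LINT x|torus. f x * indicator (\<Union> (range A)) x)"
      proof (rule integral_dominated_convergence[where w="\<lambda>x. \<bar>f x\<bar>"])
        show "AE x in torus. (\<lambda>n. \<Sum>i<n. f x * indicator (A i) x) \<longlonglongrightarrow> f x * indicator (\<Union> (range A)) x"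
          using s by (auto simp: sums_def)
        show "AE x in torus. norm (\<Sum>i<n. f x * indicator (A i) x) \<le> \<bar>f x\<bar>" for n
        proof (rule AE_I2)
          fix x
          have "(\<Sum>i<n. indicator (A i) x) = (indicator (\<Union>i<n. A i) x :: real)"
            using union(1) by (intro indicator_UN_disjoint[symmetric]) (auto simp: disjoint_family_on_def)
          then have "(\<Sum>i<n. f x * indicator (A i) x) = f x * indicator (\<Union>i<n. A i) x"
            by (simp only: sum_distrib_left[symmetric])
          then show "norm (\<Sum>i<n. f x * indicator (A i) x) \<le> \<bar>f x\<bar>"
            by (simp only:) (simp add: abs_mult indicator_def)
        qed
        show "(\<lambda>x. f x * indicator (\<Union> (range A)) x) \<in> borel_measurable torus"
          using i1[OF sub[OF lm]] by auto
        show "(\<lambda>x. \<Sum>i<n. f x * indicator (A i) x) \<in> borel_measurable torus" for n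
          using i1[OF sub[OF lu]] by (intro borel_measurable_sum) auto
      qed (use f in auto)
      moreover have "(LINT x|torus. (\<Sum>i<n. f x * indicator (A i) x)) = 0" for n
        using i1[OF sub[OF lu]] union(3) by (subst Bochner_Integration.integral_sum) auto
      ultimately show ?case using LIMSEQ_unique[OF _ tendsto_const] by simp
    qed
  qed
  \<comment> \<open>The sign \<open>\<sigma>\<close> treats the positive and the negative part of
    \<open>f\<close> at once.\<close>
  have pos: "AE x in torus. \<sigma> * f x \<le> 0" if "\<bar>\<sigma>\<bar> = 1" for \<sigma>
  proof -
    let ?A = "{x \<in> cell. \<sigma> * f x > 0}"
    have "?A \<in> sets torus"
    proof -
      have "{x \<in> space torus. \<sigma> * f x > 0} \<in> sets torus" by measurable
      then show ?thesis by simp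
    qed
    then have "?A \<in> sets lebesgue" using sets_restrict_space_iff[of cell lebesgue ?A] by (simp add: torus_def)
    \<comment> \<open>The level set is only Lebesgue measurable. It agrees with an F-sigma set,
      which is Borel, up to a null set.\<close>
    then obtain C N where C: "fsigma C" and N: "N \<in> null_sets lebesgue" and CN: "C \<union> N = ?A"
      by (rule lebesgue_set_almost_fsigma)
    have Cb: "C \<in> sets borel" using C by (auto simp: fsigma.simps)
    have nN: "AE x in torus. x \<notin> N"
      unfolding torus_def using AE_not_in[OF N] by (subst AE_restrict_space_iff) auto
    have "(LINT x|torus. max 0 (\<sigma> * f x)) = (LINT x|torus. \<sigma> * (f x * indicator C x))"
    proof (rule integral_cong_AE)
      show "AE x in torus. max 0 (\<sigma> * f x) = \<sigma> * (f x * indicator C x)"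
        using nN AE_space
      proof eventually_elim
        case (elim x)
        then have "x \<in> C \<longleftrightarrow> \<sigma> * f x > 0" using CN by auto
        then show ?case by (auto simp: indicator_def max_def)
      qed
      have "(\<lambda>x. f x * indicator C x) \<in> borel_measurable torus"
        using Cb by (intro borel_measurable_integrable i1 sub) auto
      then show "(\<lambda>x. \<sigma> * (f x * indicator C x)) \<in> borel_measurable torus" by measurable
    qed measurable
    also have "\<dots> = 0" using borel[OF Cb] by simp
    finally have "(LINT x|torus. max 0 (\<sigma> * f x)) = 0" .
    moreover have "integrable torus (\<lambda>x. max 0 (\<sigma> * f x))"
      using f by auto
    ultimately have "AE x in torus. max 0 (\<sigma> * f x) = 0"
      by (subst integral_nonneg_eq_0_iff_AE[symmetric]) auto
    then show ?thesis by eventually_elim (auto simp: max_def split: if_splits)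
  qed
  have "AE x in torus. 1 * f x \<le> 0" "AE x in torus. (-1) * f x \<le> 0" by (rule pos, simp)+
  then show ?thesis by eventually_elim auto
qed

subsection \<open>Fourier series\<close>

abbreviation vol :: complex where "vol \<equiv> of_real ((2 * pi) ^ 3)"

definition hermitian :: "(int^3 \<Rightarrow> complex) \<Rightarrow> bool" where
  "hermitian c \<longleftrightarrow> (\<forall>k. c (- k) = cnj (c k))"

text \<open>The real part makes the value real for arbitrary coefficients. For summable hermitian
  coefficients the series is real already, and the real part changes nothing.\<close>

definition fser :: "(int^3 \<Rightarrow> complex) \<Rightarrow> real^3 \<Rightarrow> real" where
  "fser c x = Re (\<Sum>\<^sub>\<infinity>k. c k * ek k x)"

lemma L2_torusD:
  assumes "f \<in> L2_torus"
  shows "f \<in> borel_measurable torus" "integrable torus (\<lambda>x. (f x)\<^sup>2)" "integrable torus f" "periodic3 f"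
proof -
  show 1: "f \<in> borel_measurable torus" "integrable torus (\<lambda>x. (f x)\<^sup>2)" "periodic3 f"
    using assms by (auto simp: L2_torus_def)
  show "integrable torus f"
  proof (rule Bochner_Integration.integrable_bound[of _ "\<lambda>x. 1 + (f x)\<^sup>2"])
    show "AE x in torus. norm (f x) \<le> norm (1 + (f x)\<^sup>2)"
    proof (rule AE_I2)
      fix x
      have "0 \<le> (\<bar>f x\<bar> - 1)\<^sup>2" by simp
      then show "norm (f x) \<le> norm (1 + (f x)\<^sup>2)" using zero_le_power2[of "f x"] by (simp add: power2_eq_square algebra_simps)
    qed
  qed (use 1 in auto)
qed

lemma L2_torus_mult:
  assumes "f \<in> L2_torus" "g \<in> L2_torus"
  shows "integrable torus (\<lambda>x. f x * g x)"
proof (rule Bochner_Integration.integrable_bound[of _ "\<lambda>x. (f x)\<^sup>2 + (g x)\<^sup>2"])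
  show "integrable torus (\<lambda>x. (f x)\<^sup>2 + (g x)\<^sup>2)"
    using L2_torusD[OF assms(1)] L2_torusD[OF assms(2)] by auto
  show "(\<lambda>x. f x * g x) \<in> borel_measurable torus"
    using L2_torusD[OF assms(1)] L2_torusD[OF assms(2)] by auto
  show "AE x in torus. norm (f x * g x) \<le> norm ((f x)\<^sup>2 + (g x)\<^sup>2)"
  proof (rule AE_I2)
    fix x
    have "2 * \<bar>f x\<bar> * \<bar>g x\<bar> \<le> (f x)\<^sup>2 + (g x)\<^sup>2"
      using sum_squares_bound[of "\<bar>f x\<bar>" "\<bar>g x\<bar>"] by simp
    moreover have "0 \<le> \<bar>f x\<bar> * \<bar>g x\<bar>" by simp
    ultimately have "\<bar>f x\<bar> * \<bar>g x\<bar> \<le> (f x)\<^sup>2 + (g x)\<^sup>2" by linarith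
    then show "norm (f x * g x) \<le> norm ((f x)\<^sup>2 + (g x)\<^sup>2)" by (simp add: abs_mult)
  qed
qed

lemma L2_torusI_bounded:
  assumes "periodic3 f" "f \<in> borel_measurable torus" "\<And>x. \<bar>f x\<bar> \<le> B"
  shows "f \<in> L2_torus"
proof -
  have "(f x)\<^sup>2 \<le> B\<^sup>2" for x
    using power_mono[OF assms(3)[of x], of 2] by simp
  then have "integrable torus (\<lambda>x. (f x)\<^sup>2)"
    using assms(2) by (intro torus.integrable_const_bound[where B="B\<^sup>2"]) auto
  then show ?thesis using assms by (simp add: L2_torus_def)
qed

lemma integrable_mult_ek:
  assumes "integrable torus f"
  shows "integrable torus (\<lambda>x. complex_of_real (f x) * ek k x)"
  by (rule Bochner_Integration.integrable_bound[OF assms]) (use assms in \<open>auto simp: norm_mult\<close>)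

lemma integral_mult_ek: "(LINT x|torus. of_real (f x) * ek k x) = vol * fourier f (- k)"
  by (simp add: fourier_eq_ek)

lemma fourier_diff:
  assumes "integrable torus f" "integrable torus g"
  shows "fourier (\<lambda>x. f x - g x) k = fourier f k - fourier g k"
  unfolding fourier_eq_ek using integrable_mult_ek[OF assms(1), of "- k"] integrable_mult_ek[OF assms(2), of "- k"]
  by (simp add: left_diff_distrib diff_divide_distrib)

lemma fourier_uminus_index: "fourier f (- k) = cnj (fourier f k)"
proof -
  have "cnj (fourier f k) = (LINT x|torus. cnj (of_real (f x) * ek (- k) x)) / vol"
    unfolding fourier_eq_ek complex_cnj_divide complex_cnj_complex_of_real
    using Bochner_Integration.integral_cnj[of torus "\<lambda>x. of_real (f x) * ek (- k) x"] by argo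
  then show ?thesis by (simp add: fourier_eq_ek cnj_ek)
qed

lemma hermitian_fourier: "hermitian (fourier f)"
  by (simp add: hermitian_def fourier_uminus_index)

lemma fourier_cong_AE:
  assumes "f \<in> borel_measurable torus" "g \<in> borel_measurable torus" "AE x in torus. f x = g x"
  shows "fourier f k = fourier g k"
proof -
  have "(LINT x|torus. of_real (f x) * ek (- k) x) = (LINT x|torus. of_real (g x) * ek (- k) x)"
    by (rule integral_cong_AE) (use assms in \<open>auto elim: eventually_mono\<close>)
  then show ?thesis by (simp add: fourier_eq_ek)
qed

lemma norm_fourier_le:
  assumes "integrable torus f"
  shows "norm (fourier f k) \<le> (LINT x|torus. \<bar>f x\<bar>) / (2 * pi) ^ 3"
proof -
  have "norm (LINT x|torus. of_real (f x) * ek (- k) x) \<le> (LINT x|torus. norm (of_real (f x) * ek (- k) x))"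
    by (rule integral_norm_bound)
  also have "\<dots> = (LINT x|torus. \<bar>f x\<bar>)" by (simp add: norm_mult)
  finally show ?thesis
    unfolding fourier_eq_ek by (simp add: norm_divide norm_power divide_right_mono)
qed

lemma fourier_eq_imp_AE_eq:
  assumes "integrable torus f" "integrable torus g" "\<And>k. fourier f k = fourier g k"
  shows "AE x in torus. f x = g x"
proof -
  have "AE x in torus. f x - g x = 0"
    by (rule fourier_eq_0_imp_AE_0) (use assms in \<open>auto simp: fourier_diff\<close>)
  then show ?thesis by simp
qed

lemma summable_mult_ek:
  assumes "(\<lambda>k. norm (c k)) summable_on UNIV"
  shows "(\<lambda>k. c k * ek k x) summable_on UNIV"
  by (rule abs_summable_summable) (use assms in \<open>simp add: norm_mult\<close>)

text \<open>Conjugating the series amounts to reindexing it by k -> -k, so the sum is its own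
  conjugate.\<close>

lemma of_real_fser:
  assumes "(\<lambda>k. norm (c k)) summable_on UNIV" "hermitian c"
  shows "of_real (fser c x) = (\<Sum>\<^sub>\<infinity>k. c k * ek k x)"
proof -
  have "cnj (\<Sum>\<^sub>\<infinity>k. c k * ek k x) = (\<Sum>\<^sub>\<infinity>k. cnj (c k * ek k x))" by (simp only: infsum_cnj)
  also have "\<dots> = (\<Sum>\<^sub>\<infinity>k. c (- k) * ek (- k) x)"
    using assms(2) by (simp add: hermitian_def cnj_ek)
  also have "\<dots> = (\<Sum>\<^sub>\<infinity>k. c k * ek k x)"
    by (rule infsum_reindex_bij_betw) (simp add: bij_uminus)
  finally show ?thesis by (simp add: fser_def complex_eq_iff)
qed

lemma measurable_fser: 
  assumes "(\<lambda>k. norm (c k)) summable_on UNIV"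
  shows "fser c \<in> borel_measurable torus"
proof -
  have "(\<lambda>x. \<Sum>\<^sub>\<infinity>k. c k * ek k x) \<in> borel_measurable torus"
    by (rule measurable_infsum[where w="\<lambda>_. 1" and b="\<lambda>k. norm (c k)"]) (use assms in \<open>auto simp: norm_mult\<close>)
  then show ?thesis unfolding fser_def by measurable
qed

lemma abs_fser_le:
  assumes "(\<lambda>k. norm (c k)) summable_on UNIV"
  shows "\<bar>fser c x\<bar> \<le> (\<Sum>\<^sub>\<infinity>k. norm (c k))"
proof -
  have "\<bar>fser c x\<bar> \<le> norm (\<Sum>\<^sub>\<infinity>k. c k * ek k x)"
    unfolding fser_def by (rule abs_Re_le_cmod)
  also have "\<dots> \<le> (\<Sum>\<^sub>\<infinity>k. norm (c k * ek k x))"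
    by (rule norm_infsum_bound) (use assms in \<open>simp add: norm_mult\<close>)
  finally show ?thesis by (simp add: norm_mult)
qed

lemma fser_L2_torus:
  assumes "(\<lambda>k. norm (c k)) summable_on UNIV"
  shows "fser c \<in> L2_torus"
proof (rule L2_torusI_bounded[OF _ measurable_fser[OF assms] abs_fser_le[OF assms]])
  have "ek k (x + axis i (2 * pi)) = ek k x" for k x i
    using periodic3_ek[of k] by (simp add: periodic3_def)
  then show "periodic3 (fser c)" by (simp add: periodic3_def fser_def)
qed

text \<open>The modulus of \<open>f\<close> times the summable coefficients dominates all partial
  sums, which justifies integrating term by term. The factor \<open>ek m\<close> makes every Fourier
  coefficient of the product available, not only its mean.\<close>

lemma integral_mult_series:
  assumes "integrable torus f" "(\<lambda>k. norm (c k)) summable_on UNIV"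
  shows "(LINT x|torus. of_real (f x) * (\<Sum>\<^sub>\<infinity>k. c k * ek k x) * ek m x) = vol * (\<Sum>\<^sub>\<infinity>k. c k * fourier f (- k - m))"
    and "(\<lambda>k. norm (c k * fourier f (- k - m))) summable_on UNIV"
    and "integrable torus (\<lambda>x. of_real (f x) * (\<Sum>\<^sub>\<infinity>k. c k * ek k x) * ek m x)"
proof -
  let ?g = "\<lambda>k x. c k * (of_real (f x) * ek (k + m) x)"
  have eq: "of_real (f x) * (\<Sum>\<^sub>\<infinity>k. c k * ek k x) * ek m x = (\<Sum>\<^sub>\<infinity>k. ?g k x)" for x
  proof -
    have "(\<Sum>\<^sub>\<infinity>k. ?g k x) = (\<Sum>\<^sub>\<infinity>k. c k * ek k x * (of_real (f x) * ek m x))"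
      by (rule infsum_cong) (simp add: ek_mult[symmetric] mult_ac)
    also have "\<dots> = (\<Sum>\<^sub>\<infinity>k. c k * ek k x) * (of_real (f x) * ek m x)"
      by (rule infsum_cmult_left) (use summable_mult_ek[OF assms(2)] in auto)
    finally show ?thesis by (simp add: mult_ac)
  qed
  have a: "?g k \<in> borel_measurable torus" for k
    using borel_measurable_integrable[OF integrable_mult_ek[OF assms(1), of "k + m"]] by measurable
  have b: "norm (?g k x) \<le> norm (c k) * \<bar>f x\<bar>" for k x by (simp add: norm_mult)
  have w: "integrable torus (\<lambda>x. \<bar>f x\<bar>)" using assms(1) by simp
  note * = integral_infsum[of ?g torus "\<lambda>k. norm (c k)" "\<lambda>x. \<bar>f x\<bar>", OF a b assms(2) _ w]
    summable_integral[of ?g torus "\<lambda>k. norm (c k)" "\<lambda>x. \<bar>f x\<bar>", OF a b assms(2) _ w]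
    integrable_infsum[of ?g torus "\<lambda>k. norm (c k)" "\<lambda>x. \<bar>f x\<bar>", OF a b assms(2) _ w]
  have v: "(LINT x|torus. ?g k x) = vol * (c k * fourier f (- k - m))" for k
    by (simp add: integral_mult_ek)
  have s: "(\<lambda>k. norm (vol * (c k * fourier f (- k - m)))) summable_on UNIV"
    using *(2) by (simp only: v norm_ge_zero abs_ge_zero)
  then have "(\<lambda>k. (2 * pi) ^ 3 * norm (c k * fourier f (- k - m))) summable_on UNIV"
    by (simp only: norm_mult norm_of_real abs_of_pos[of "(2 * pi) ^ 3"] zero_less_power zero_less_mult_iff pi_gt_zero) simp
  from summable_on_cmult_right[OF this, of "1 / (2 * pi) ^ 3"]
  show s': "(\<lambda>k. norm (c k * fourier f (- k - m))) summable_on UNIV" by simp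
  show "(LINT x|torus. of_real (f x) * (\<Sum>\<^sub>\<infinity>k. c k * ek k x) * ek m x) = vol * (\<Sum>\<^sub>\<infinity>k. c k * fourier f (- k - m))"
    unfolding eq using *(1) by (simp only: v norm_ge_zero abs_ge_zero) (rule infsum_cmult_right, use abs_summable_summable[OF s'] in auto)
  show "integrable torus (\<lambda>x. of_real (f x) * (\<Sum>\<^sub>\<infinity>k. c k * ek k x) * ek m x)"
    unfolding eq using *(3) by simp
qed

lemma fourier_1: "fourier (\<lambda>x. 1) k = (if k = 0 then 1 else 0)"
  using integral_ek[of "- k"] by (simp add: fourier_eq_ek)

lemma fourier_fser:
  assumes "(\<lambda>k. norm (c k)) summable_on UNIV" "hermitian c"
  shows "fourier (fser c) k = c k"
proof -
  have "vol * fourier (fser c) k = (LINT x|torus. of_real 1 * (\<Sum>\<^sub>\<infinity>l. c l * ek l x) * ek (- k) x)"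
    by (simp add: fourier_eq_ek of_real_fser[OF assms])
  also have "\<dots> = vol * (\<Sum>\<^sub>\<infinity>l. c l * fourier (\<lambda>x. 1) (- l + k))"
    using integral_mult_series(1)[of "\<lambda>_. 1" c "- k"] assms(1) by simp
  also have "(\<Sum>\<^sub>\<infinity>l. c l * fourier (\<lambda>x. 1) (- l + k)) = c k"
  proof -
    have "((\<lambda>l. c l * fourier (\<lambda>x. 1) (- l + k)) has_sum c k) UNIV"
      by (rule has_sum_finite_neutralI[of "{k}"]) (auto simp: fourier_1)
    then show ?thesis by (rule infsumI)
  qed
  finally show ?thesis by simp
qed

lemma AE_eq_fser:
  assumes "integrable torus f" "(\<lambda>k. norm (fourier f k)) summable_on UNIV"
  shows "AE x in torus. f x = fser (fourier f) x"
  by (rule fourier_eq_imp_AE_eq)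
     (use assms L2_torusD[OF fser_L2_torus] in \<open>auto simp: fourier_fser hermitian_fourier\<close>)

text \<open>The factor with summable coefficients is replaced, almost everywhere, by its absolutely
  convergent series; the other one is merely integrable. This asymmetry allows iteration, with a
  product as the integrable factor.\<close>

lemma integral_mult_fourier:
  assumes "integrable torus f" "integrable torus g" "(\<lambda>k. norm (fourier g k)) summable_on UNIV"
  shows "(LINT x|torus. of_real (f x * g x) * ek m x) = vol * (\<Sum>\<^sub>\<infinity>k. fourier g k * fourier f (- k - m))"
    and "(\<lambda>k. norm (fourier g k * fourier f (- k - m))) summable_on UNIV"
    and "integrable torus (\<lambda>x. f x * g x)"
proof -
  have g: "AE x in torus. complex_of_real (g x) = (\<Sum>\<^sub>\<infinity>k. fourier g k * ek k x)"
    using AE_eq_fser[OF assms(2,3)] of_real_fser[OF assms(3) hermitian_fourier] by auto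
  note S = integral_mult_series[OF assms(1,3)]
  have m: "(\<lambda>x. f x * g x) \<in> borel_measurable torus" using assms by auto
  have [measurable]: "(\<lambda>x. of_real (f x) * of_real (g x) * ek m x) \<in> borel_measurable torus"
    using borel_measurable_times[OF measurable_compose[OF m borel_measurable_of_real] measurable_ek[of m]] by simp
  have "(LINT x|torus. of_real (f x * g x) * ek m x)
      = (LINT x|torus. of_real (f x) * (\<Sum>\<^sub>\<infinity>k. fourier g k * ek k x) * ek m x)"
    by (rule integral_cong_AE) (use g m borel_measurable_integrable[OF S(3)[of m]] in \<open>auto elim!: eventually_mono\<close>)
  then show "(LINT x|torus. of_real (f x * g x) * ek m x) = vol * (\<Sum>\<^sub>\<infinity>k. fourier g k * fourier f (- k - m))"
    using S(1) by simp
  show "(\<lambda>k. norm (fourier g k * fourier f (- k - m))) summable_on UNIV" by (rule S(2))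
  have "integrable torus (\<lambda>x. of_real (f x) * (\<Sum>\<^sub>\<infinity>k. fourier g k * ek k x))"
    using S(3)[of 0] by simp
  then have "integrable torus (\<lambda>x. complex_of_real (f x * g x))"
    by (rule integrable_cong_AE_imp)
       (use g measurable_compose[OF m borel_measurable_of_real] in \<open>auto elim!: eventually_mono\<close>)
  from integrable_Re[OF this] show "integrable torus (\<lambda>x. f x * g x)" by simp
qed

lemma integral_mult_fourier_0:
  assumes "integrable torus f" "integrable torus g" "(\<lambda>k. norm (fourier g k)) summable_on UNIV"
  shows "complex_of_real (LINT x|torus. f x * g x) = vol * (\<Sum>\<^sub>\<infinity>k. fourier g k * fourier f (- k))"
  using integral_mult_fourier(1)[OF assms, of 0] by (simp only: integral_complex_of_real ek_0 mult_1_right diff_0_right)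

lemma fourier_mult:
  assumes "integrable torus f" "integrable torus g" "(\<lambda>k. norm (fourier g k)) summable_on UNIV"
  shows "fourier (\<lambda>x. f x * g x) m = (\<Sum>\<^sub>\<infinity>k. fourier g k * fourier f (m - k))"
  using integral_mult_fourier(1)[OF assms, of "- m"] by (simp add: fourier_eq_ek)

text \<open>The operator is a choice among representatives, so a witness is required before anything
  is known about it. The explicit series is one; evenness of the real multiplier keeps its
  coefficients hermitian.\<close>

lemma fourier_multiplier:
  assumes "(\<lambda>k. norm (of_real (m k) * fourier f k)) summable_on UNIV" "\<And>k. m (- k) = m k"
  shows "fourier_multiplier m f \<in> L2_torus"
    and "fourier (fourier_multiplier m f) k = of_real (m k) * fourier f k"
proof -
  let ?P = "\<lambda>g. g \<in> L2_torus \<and> (\<forall>k. fourier g k = of_real (m k) * fourier f k)"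
  have h: "hermitian (\<lambda>k. of_real (m k) * fourier f k)"
    by (simp add: hermitian_def assms(2) fourier_uminus_index)
  have "?P (fser (\<lambda>k. of_real (m k) * fourier f k))"
    using fser_L2_torus[OF assms(1)] fourier_fser[OF assms(1) h] by simp
  then have "?P (fourier_multiplier m f)"
    unfolding fourier_multiplier_def by (rule someI[of ?P])
  then show "fourier_multiplier m f \<in> L2_torus"
    "fourier (fourier_multiplier m f) k = of_real (m k) * fourier f k" by auto
qed

subsection \<open>Smooth test functions\<close>

lemma C_diff_continuous: "C_diff n f \<Longrightarrow> continuous_on UNIV f"
  by (cases n) (auto intro!: continuous_at_imp_continuous_on differentiable_imp_continuous_within)

lemma partial_deriv_eq:
  assumes "(f has_derivative f') (at x)"
  shows "partial_deriv i f x = f' (axis i 1)"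
  using frechet_derivative_at[OF assms] by (simp add: partial_deriv_def)

lemma partial_deriv_diff:
  assumes "f differentiable at x" "g differentiable at x"
  shows "partial_deriv i (\<lambda>x. f x - g x) x = partial_deriv i f x - partial_deriv i g x"
  using partial_deriv_eq[OF has_derivative_diff[OF assms[unfolded frechet_derivative_works]], of i]
  by (simp add: partial_deriv_def)

lemma C_diff_diff: "C_diff n f \<Longrightarrow> C_diff n g \<Longrightarrow> C_diff n (\<lambda>x. f x - g x)"
proof (induction n arbitrary: f g)
  case 0
  then show ?case by (simp add: continuous_on_diff)
next
  case (Suc n)
  have "partial_deriv i (\<lambda>x. f x - g x) = (\<lambda>x. partial_deriv i f x - partial_deriv i g x)" for i
    using Suc.prems by (intro ext partial_deriv_diff) auto
  then show ?case using Suc by (auto intro: differentiable_diff)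
qed

lemma periodic3_partial_deriv:
  assumes "periodic3 f" "\<And>x. f differentiable at x"
  shows "periodic3 (partial_deriv i f)"
  unfolding periodic3_def
proof (intro allI)
  fix x j
  let ?v = "axis j (2 * pi) :: real^3"
  have "(f has_derivative frechet_derivative f (at (x + ?v))) (at (x + ?v))"
    using assms(2) frechet_derivative_works by blast
  then have "((\<lambda>y. f (y + ?v)) has_derivative frechet_derivative f (at (x + ?v))) (at x)"
    using has_derivative_compose[of "\<lambda>y. y + ?v" "\<lambda>y. y" x UNIV f "frechet_derivative f (at (x + ?v))"]
    by (simp add: has_derivative_add_const[OF has_derivative_ident])
  moreover have "(\<lambda>y. f (y + ?v)) = f" using assms(1) by (simp add: periodic3_def)
  ultimately have "(f has_derivative frechet_derivative f (at (x + ?v))) (at x)" by simp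
  then show "partial_deriv i f (x + ?v) = partial_deriv i f x"
    using partial_deriv_eq by (simp add: partial_deriv_def)
qed

lemma smooth_torusD:
  assumes "\<phi> \<in> smooth_torus"
  shows "periodic3 \<phi>" "continuous_on UNIV \<phi>" "\<phi> differentiable at x"
    "partial_deriv i \<phi> \<in> smooth_torus" "integrable torus \<phi>"
proof -
  have c: "C_diff n \<phi>" for n using assms by (simp add: smooth_torus_def)
  show p: "periodic3 \<phi>" using assms by (simp add: smooth_torus_def)
  show co: "continuous_on UNIV \<phi>" by (rule C_diff_continuous[OF c])
  have d: "\<phi> differentiable at x" for x using c[of 1] by simp
  then show "\<phi> differentiable at x" by simp
  show "partial_deriv i \<phi> \<in> smooth_torus"
    using periodic3_partial_deriv[OF p d] c[of "Suc _"] by (auto simp: smooth_torus_def)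
  show "integrable torus \<phi>" by (rule continuous_imp_integrable_torus[OF co])
qed

lemma smooth_torus_diff: "f \<in> smooth_torus \<Longrightarrow> g \<in> smooth_torus \<Longrightarrow> (\<lambda>x. f x - g x) \<in> smooth_torus"
  by (simp add: smooth_torus_def periodic3_def C_diff_diff)

text \<open>Translation invariance gives \<open>\<integral> \<phi>(x + h e\<^sub>i) e\<^sub>-\<^sub>k = cis (k\<^sub>i h) \<integral> \<phi> e\<^sub>-\<^sub>k\<close>, and this is
  differentiated at \<open>h = 0\<close>.\<close>
lemma fourier_partial_deriv:
  assumes "\<phi> \<in> smooth_torus"
  shows "fourier (partial_deriv i \<phi>) k = \<i> * of_int (k $ i) * fourier \<phi> k"
proof -
  define D where "D = partial_deriv i \<phi>"
  define e :: "real^3" where "e = axis i 1"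
  have e: "axis i t = t *\<^sub>R e" for t by (simp add: e_def vec_eq_iff axis_def)
  note S = smooth_torusD[OF assms]
  have Dc: "continuous_on UNIV D" unfolding D_def by (rule smooth_torusD(2)[OF S(4)])
  have der: "((\<lambda>t. \<phi> (x + axis i t)) has_real_derivative D (x + axis i t)) (at t)" for x t
  proof -
    have "(\<phi> has_derivative frechet_derivative \<phi> (at (x + axis i t))) (at (x + axis i t))"
      using S(3) frechet_derivative_works by blast
    moreover have "((\<lambda>t. x + axis i t) has_derivative (\<lambda>s. axis i s)) (at t)"
    proof -
      show ?thesis unfolding e by (auto intro!: derivative_eq_intros)
    qed
    ultimately have "((\<lambda>t. \<phi> (x + axis i t)) has_derivative (\<lambda>s. frechet_derivative \<phi> (at (x + axis i t)) (axis i s))) (at t)"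
      by (rule has_derivative_compose[rotated])
    moreover have "frechet_derivative \<phi> (at (x + axis i t)) (axis i s) = D (x + axis i t) * s" for s
    proof -
      show ?thesis
        using linear_cmul[OF linear_frechet_derivative[OF S(3)[of "x + axis i t"]], of s "axis i 1"] e[of s]
        by (simp add: D_def partial_deriv_def e_def)
    qed
    ultimately show ?thesis by (simp add: has_field_derivative_def)
  qed
  \<comment> \<open>The box is enlarged by 1 because the mean value theorem evaluates the derivative
    at points that leave the cell by less than 1. The bound \<open>B\<close> dominates all
    difference quotients.\<close>
  obtain B where B: "\<And>y. y \<in> cbox 0 (\<chi> i. 2 * pi + 1) \<Longrightarrow> norm (D y) \<le> B"
    using continuous_on_compact_bound[of "cbox 0 (\<chi> i. 2 * pi + 1)" D] continuous_on_subset[OF Dc] by (metis compact_cbox subset_UNIV)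
  define h where "h n = 1 / (real (Suc n))" for n
  have h: "0 < h n" "h n \<le> 1" "h n \<noteq> 0" for n by (auto simp: h_def)
  have hlim: "h \<longlonglongrightarrow> 0" unfolding h_def using LIMSEQ_inverse_real_of_nat by (simp add: inverse_eq_divide)
  have hat: "filterlim h (at 0) sequentially"
    using hlim h(3) by (simp add: filterlim_at)
  define q where "q n x = (\<phi> (x + axis i (h n)) - \<phi> x) / h n" for n x
  have ax0: "axis i (0::real) = 0" by (simp add: vec_eq_iff axis_def)
  have qlim: "(\<lambda>n. q n x) \<longlonglongrightarrow> D x" for x
  proof -
    have "((\<lambda>s. (\<phi> (x + axis i (0 + s)) - \<phi> (x + axis i 0)) / s) \<longlongrightarrow> D (x + axis i 0)) (at 0)"
      using der[of x 0] by (simp only: DERIV_def)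
    from filterlim_compose[OF this hat] show ?thesis by (simp add: q_def ax0)
  qed
  have qb: "\<bar>q n x\<bar> \<le> B" if "x \<in> cell" for n x
  proof -
    obtain z where z: "z > 0" "z < h n" "\<phi> (x + axis i (h n)) - \<phi> (x + axis i 0) = (h n - 0) * D (x + axis i z)"
      using MVT2[OF h(1)[of n], of "\<lambda>t. \<phi> (x + axis i t)" "\<lambda>t. D (x + axis i t)"] der by blast
    have "0 \<le> (x + axis i z) $ j \<and> (x + axis i z) $ j \<le> 2 * pi + 1" for j
    proof -
      have "0 \<le> x $ j" "x $ j \<le> 2 * pi" using that by (auto simp: mem_box_cart)
      then show ?thesis using z h(2)[of n] by (auto simp: axis_def)
    qed
    then have "x + axis i z \<in> cbox 0 (\<chi> i. 2 * pi + 1)"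
      by (simp add: mem_box_cart)
    from B[OF this] show ?thesis using z(3) h(3)[of n] by (simp add: q_def ax0)
  qed
  have phc: "continuous_on UNIV (\<lambda>x. \<phi> (x + axis i t))" for t
    by (intro continuous_on_compose2[OF S(2)] continuous_intros) auto
  have qc: "continuous_on UNIV (q n)" for n
    unfolding q_def by (intro continuous_intros phc S(2)) (use h in auto)
  have val: "(LINT x|torus. of_real (q n x) * ek (- k) x) = (cis (of_int (k $ i) * h n) - 1) / of_real (h n) * (vol * fourier \<phi> k)" for n
  proof -
    have p: "periodic3 (\<lambda>x. of_real (\<phi> x) * ek (- k) x)"
      using S(1) periodic3_ek[of "- k"] by (simp add: periodic3_def)
    have c: "continuous_on UNIV (\<lambda>x. of_real (\<phi> x) * ek (- k) x)"
      by (intro continuous_intros S(2))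
    have "(LINT x|torus. of_real (\<phi> (x + axis i (h n))) * ek (- k) (x + axis i (h n))) = vol * fourier \<phi> k"
      using integral_torus_translate[OF c p, of "h n" i] h[of n] pi_gt3 by (simp add: fourier_eq_ek)
    moreover have "of_real (\<phi> (x + axis i (h n))) * ek (- k) x
       = cis (of_int (k $ i) * h n) * (of_real (\<phi> (x + axis i (h n))) * ek (- k) (x + axis i (h n)))" for x
      by (simp add: ek_add ek_axis cis_mult mult.left_commute flip: mult.assoc)
    ultimately have 1: "(LINT x|torus. of_real (\<phi> (x + axis i (h n))) * ek (- k) x) = cis (of_int (k $ i) * h n) * (vol * fourier \<phi> k)"
      using integral_mult_right_zero[of torus "cis (of_int (k $ i) * h n)" "\<lambda>x. of_real (\<phi> (x + axis i (h n))) * ek (- k) (x + axis i (h n))"]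
      by presburger
    have 2: "integrable torus (\<lambda>x. of_real (\<phi> (x + axis i (h n))) * ek (- k) x)" "integrable torus (\<lambda>x. of_real (\<phi> x) * ek (- k) x)"
      by (intro integrable_mult_ek continuous_imp_integrable_torus phc S(2))+
    have "(LINT x|torus. of_real (q n x) * ek (- k) x)
      = (LINT x|torus. (of_real (\<phi> (x + axis i (h n))) * ek (- k) x - of_real (\<phi> x) * ek (- k) x) / of_real (h n))"
      by (simp add: q_def left_diff_distrib)
    also have "\<dots> = (cis (of_int (k $ i) * h n) * (vol * fourier \<phi> k) - vol * fourier \<phi> k) / of_real (h n)"
      using 1 2 by (simp add: fourier_eq_ek)
    finally show ?thesis by (simp add: algebra_simps)
  qed
  have "(\<lambda>n. LINT x|torus. of_real (q n x) * ek (- k) x) \<longlonglongrightarrow> (LINT x|torus. of_real (D x) * ek (- k) x)"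
  proof (rule integral_dominated_convergence[where w="\<lambda>_. B"])
    show "AE x in torus. (\<lambda>n. of_real (q n x) * ek (- k) x) \<longlonglongrightarrow> of_real (D x) * ek (- k) x"
      by (intro AE_I2 tendsto_intros qlim)
    show "AE x in torus. norm (complex_of_real (q n x) * ek (- k) x) \<le> B" for n
      by (rule AE_I2) (use qb in \<open>simp add: norm_mult\<close>)
    show "(\<lambda>x. of_real (D x) * ek (- k) x) \<in> borel_measurable torus"
      "(\<lambda>x. of_real (q n x) * ek (- k) x) \<in> borel_measurable torus" for n
      by (intro continuous_imp_measurable_torus continuous_intros Dc qc)+
  qed auto
  moreover have "(\<lambda>n. LINT x|torus. of_real (q n x) * ek (- k) x) \<longlonglongrightarrow> \<i> * of_int (k $ i) * (vol * fourier \<phi> k)"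
    unfolding val
  proof (intro tendsto_mult tendsto_const)
    have "((\<lambda>z. exp (\<i> * of_int (k $ i) * z)) has_field_derivative \<i> * of_int (k $ i)) (at 0)"
      by (auto intro!: derivative_eq_intros)
    then have d: "((\<lambda>z. (exp (\<i> * of_int (k $ i) * z) - 1) / z) \<longlongrightarrow> \<i> * of_int (k $ i)) (at 0)"
      by (simp add: DERIV_def)
    have "filterlim (\<lambda>n. complex_of_real (h n)) (at 0) sequentially"
      using tendsto_of_real[OF hlim] h(3) by (simp add: filterlim_at)
    from filterlim_compose[OF d this]
    show "(\<lambda>n. (cis (of_int (k $ i) * h n) - 1) / of_real (h n)) \<longlonglongrightarrow> \<i> * of_int (k $ i)"
      by (simp add: cis_conv_exp mult.assoc)
  qed
  ultimately have "(LINT x|torus. of_real (D x) * ek (- k) x) = \<i> * of_int (k $ i) * (vol * fourier \<phi> k)"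
    by (rule LIMSEQ_unique)
  then show ?thesis unfolding D_def by (simp add: fourier_eq_ek)
qed

text \<open>The witness is the function minus its Laplacian, with the three second derivatives
  subtracted one at a time.\<close>

lemma bessel_potential_smooth:
  assumes "\<phi> \<in> smooth_torus"
  shows "\<exists>\<psi>\<in>smooth_torus. \<forall>k. fourier \<psi> k = of_real (wt 1 k) * fourier \<phi> k"
proof -
  define P where "P i = partial_deriv i (partial_deriv i \<phi>)" for i
  have P: "P i \<in> smooth_torus" for i unfolding P_def using assms smooth_torusD(4) by blast
  have ii: "\<i> * a * (\<i> * a * b) = - (a * a * b)" for a b :: complex
  proof -
    have "\<i> * a * (\<i> * a * b) = (\<i> * \<i>) * (a * a * b)" by (simp only: mult_ac)
    then show ?thesis by simp
  qed
  have fP: "fourier (P i) k = - of_real ((of_int (k $ i))\<^sup>2) * fourier \<phi> k" for i k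
    unfolding P_def using fourier_partial_deriv[OF assms] fourier_partial_deriv[OF smooth_torusD(4)[OF assms]]
    by (simp add: power2_eq_square ii)
  let ?a = "\<lambda>x. \<phi> x - P 1 x"
  let ?b = "\<lambda>x. ?a x - P 2 x"
  let ?c = "\<lambda>x. ?b x - P 3 x"
  have a: "?a \<in> smooth_torus" by (intro smooth_torus_diff assms P)
  have b: "?b \<in> smooth_torus" by (intro smooth_torus_diff a P)
  have c: "?c \<in> smooth_torus" by (intro smooth_torus_diff b P)
  have "fourier ?c k = of_real (wt 1 k) * fourier \<phi> k" for k
    using fourier_diff[OF smooth_torusD(5)[OF b] smooth_torusD(5)[OF P[of 3]], of k]
      fourier_diff[OF smooth_torusD(5)[OF a] smooth_torusD(5)[OF P[of 2]], of k]
      fourier_diff[OF smooth_torusD(5)[OF assms] smooth_torusD(5)[OF P[of 1]], of k]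
    by (simp add: fP wt_1 norm_freq_sq algebra_simps)
  then show ?thesis using c by blast
qed

text \<open>Applying 1 minus the Laplacian three times yields decay of order
  \<open>wt (- 3)\<close>. One power pays for the weight, and \<open>wt (- 2)\<close> is summable
  because 2 > 3/2.\<close>

lemma smooth_torus_decay:
  assumes "\<phi> \<in> smooth_torus"
  shows "(\<lambda>k. wt 1 k * norm (fourier \<phi> k)) summable_on UNIV"
proof -
  obtain \<psi>1 where 1: "\<psi>1 \<in> smooth_torus" "\<And>k. fourier \<psi>1 k = of_real (wt 1 k) * fourier \<phi> k"
    using bessel_potential_smooth[OF assms] by blast
  obtain \<psi>2 where 2: "\<psi>2 \<in> smooth_torus" "\<And>k. fourier \<psi>2 k = of_real (wt 1 k) * fourier \<psi>1 k"
    using bessel_potential_smooth[OF 1(1)] by blast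
  obtain \<psi>3 where 3: "\<psi>3 \<in> smooth_torus" "\<And>k. fourier \<psi>3 k = of_real (wt 1 k) * fourier \<psi>2 k"
    using bessel_potential_smooth[OF 2(1)] by blast
  define C where "C = (LINT x|torus. \<bar>\<psi>3 x\<bar>) / (2 * pi) ^ 3"
  have C: "wt 1 k * norm (fourier \<phi> k) \<le> wt (- 2) k * C" for k
  proof -
    have "wt 3 k * norm (fourier \<phi> k) \<le> C"
    proof -
      have "wt 3 k = wt 1 k * wt 1 k * wt 1 k" by (simp flip: wt_add)
      then have "fourier \<psi>3 k = of_real (wt 3 k) * fourier \<phi> k" by (simp add: 1 2 3)
      then show ?thesis using norm_fourier_le[OF smooth_torusD(5)[OF 3(1)], of k]
        by (simp add: C_def norm_mult)
    qed
    then have "wt (- 2) k * (wt 3 k * norm (fourier \<phi> k)) \<le> wt (- 2) k * C"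
      by (intro mult_left_mono) auto
    then show ?thesis by (simp flip: mult.assoc wt_add)
  qed
  show ?thesis
    by (rule summable_on_comparison_test[OF summable_on_cmult_left[OF summable_wt[of 2], of C]]) (use C in auto)
qed

text \<open>Partial derivatives of such a combination are again of this form with new
  \<open>a\<close> and \<open>b\<close>, so the order of differentiability is handled by induction
  with both coefficients general.\<close>

lemma smooth_torus_trig: "(\<lambda>x. a * cos (freq k \<bullet> x) + b * sin (freq k \<bullet> x)) \<in> smooth_torus"
proof -
  have der: "((\<lambda>x. a * cos (freq k \<bullet> x) + b * sin (freq k \<bullet> x)) has_derivative
     (\<lambda>v. a * (- sin (freq k \<bullet> x) * (freq k \<bullet> v)) + b * (cos (freq k \<bullet> x) * (freq k \<bullet> v)))) (at x)" for a b x
    by (auto intro!: derivative_eq_intros simp: fun_eq_iff)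
  have pd: "partial_deriv i (\<lambda>x. a * cos (freq k \<bullet> x) + b * sin (freq k \<bullet> x))
     = (\<lambda>x. (b * of_int (k $ i)) * cos (freq k \<bullet> x) + (- a * of_int (k $ i)) * sin (freq k \<bullet> x))" for i a b
    using partial_deriv_eq[OF der] by (auto simp: inner_axis algebra_simps)
  have "C_diff n (\<lambda>x. a * cos (freq k \<bullet> x) + b * sin (freq k \<bullet> x))" for n
  proof (induction n arbitrary: a b)
    case 0
    then show ?case by (auto intro!: continuous_intros)
  next
    case (Suc n)
    have "(\<lambda>x. a * cos (freq k \<bullet> x) + b * sin (freq k \<bullet> x)) differentiable at x" for x
      using der by (auto simp: differentiable_def)
    then show ?case using Suc by (simp only: C_diff.simps pd) simp
  qed
  moreover have "periodic3 (\<lambda>x. a * cos (freq k \<bullet> x) + b * sin (freq k \<bullet> x))"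
    unfolding periodic3_def
  proof (intro allI)
    fix x i
    have "cis (freq k \<bullet> (x + axis i (2 * pi))) = cis (freq k \<bullet> x)"
      using periodic3_ek[of k] by (simp add: periodic3_def ek_def)
    then have "cos (freq k \<bullet> (x + axis i (2 * pi))) = cos (freq k \<bullet> x)"
      "sin (freq k \<bullet> (x + axis i (2 * pi))) = sin (freq k \<bullet> x)"
      by (simp_all add: complex_eq_iff)
    then show "a * cos (freq k \<bullet> (x + axis i (2 * pi))) + b * sin (freq k \<bullet> (x + axis i (2 * pi)))
       = a * cos (freq k \<bullet> x) + b * sin (freq k \<bullet> x)" by simp
  qed
  ultimately show ?thesis by (simp add: smooth_torus_def)
qed

subsection \<open>Integral equations on an interval\<close>

lemma bounded_measurable_integrable_on:
  fixes f :: "real \<Rightarrow> 'b::euclidean_space"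
  assumes "f \<in> borel_measurable (lebesgue_on {0..T})" "\<And>t. t \<in> {0..T} \<Longrightarrow> norm (f t) \<le> B"
    and "0 \<le> a" "b \<le> T"
  shows "f integrable_on {a..b}"
proof (cases "a \<le> b")
  case True
  have "f integrable_on {0..T}"
    by (rule measurable_bounded_by_integrable_imp_integrable[of _ _ "\<lambda>_. B"]) (use assms in auto)
  then show ?thesis by (rule integrable_on_subinterval) (use assms in auto)
qed auto

lemma norm_integral_le_bound:
  fixes f :: "real \<Rightarrow> 'b::euclidean_space"
  assumes "f integrable_on {a..b}" "\<And>t. t \<in> {a..b} \<Longrightarrow> norm (f t) \<le> B" "a \<le> b"
  shows "norm (integral {a..b} f) \<le> B * (b - a)"
proof -
  have "norm (integral {a..b} f) \<le> integral {a..b} (\<lambda>_. B)"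
    by (rule integral_norm_bound_integral) (use assms in auto)
  then show ?thesis using assms(3) by (simp add: mult.commute)
qed

lemma integral_diff_interval:
  fixes f :: "real \<Rightarrow> 'b::euclidean_space"
  assumes "f integrable_on {0..t}" "0 \<le> r" "r \<le> t"
  shows "integral {0..t} f - integral {0..r} f = integral {r..t} f"
  using Henstock_Kurzweil_Integration.integral_combine[OF assms(2,3,1)] by (simp add: algebra_simps)

lemma continuous_imp_measurable_Icc:
  fixes f :: "real \<Rightarrow> 'b::euclidean_space"
  assumes "continuous_on {a..b} f"
  shows "f \<in> borel_measurable (lebesgue_on {a..b})"
  using assms by (intro continuous_imp_measurable_on_sets_lebesgue) auto

text \<open>Successive iterates differ by at most \<open>C 2\<^sup>-\<^sup>n exp (2 L t)\<close>.\<close>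
lemma picard:
  fixes G :: "real \<Rightarrow> ('k \<Rightarrow> complex) \<Rightarrow> 'k \<Rightarrow> complex"
  assumes T: "0 \<le> T" and L: "0 < L" and F: "finite F"
    and meas: "\<And>u k. k \<in> F \<Longrightarrow> (\<And>l. l \<in> F \<Longrightarrow> continuous_on {0..T} (\<lambda>t. u t l)) \<Longrightarrow>
        (\<lambda>t. G t (u t) k) \<in> borel_measurable (lebesgue_on {0..T})"
    and bound0: "\<And>t k. t \<in> {0..T} \<Longrightarrow> k \<in> F \<Longrightarrow> norm (G t u0 k) \<le> B"
    and lip: "\<And>t u v d k. t \<in> {0..T} \<Longrightarrow> k \<in> F \<Longrightarrow> (\<And>l. l \<in> F \<Longrightarrow> norm (u l - v l) \<le> d) \<Longrightarrow>
        norm (G t u k - G t v k) \<le> L * d"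
    and I0: "I u0"
    and step: "\<And>u t. t \<in> {0..T} \<Longrightarrow> (\<And>t. t \<in> {0..T} \<Longrightarrow> I (u t)) \<Longrightarrow>
        (\<And>k. k \<in> F \<Longrightarrow> (\<lambda>\<tau>. G \<tau> (u \<tau>) k) integrable_on {0..t}) \<Longrightarrow>
        I (\<lambda>k. if k \<in> F then u0 k + integral {0..t} (\<lambda>\<tau>. G \<tau> (u \<tau>) k) else u0 k)"
    and lim: "\<And>X y. (\<And>n::nat. I (X n)) \<Longrightarrow> (\<And>k. (\<lambda>n. X n k) \<longlonglongrightarrow> y k) \<Longrightarrow> I y"
  shows "\<exists>u. (\<forall>k\<in>F. continuous_on {0..T} (\<lambda>t. u t k)) \<and> (\<forall>t\<in>{0..T}. I (u t)) \<and>
     (\<forall>t\<in>{0..T}. \<forall>k\<in>F. u t k = u0 k + integral {0..t} (\<lambda>\<tau>. G \<tau> (u \<tau>) k))"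
proof -
  \<comment> \<open>Coordinates outside \<open>F\<close> keep their initial values, so that the
    invariant \<open>I\<close> can speak of the whole sequence; it will record reality and
    support.\<close>
  define \<Phi> where "\<Phi> u = (\<lambda>t k. if k \<in> F then u0 k + integral {0..t} (\<lambda>\<tau>. G \<tau> (u \<tau>) k) else u0 k)" for u
  define X where "X n = (\<Phi> ^^ n) (\<lambda>_. u0)" for n
  have X0: "X 0 = (\<lambda>_. u0)" by (simp add: X_def)
  have XS: "X (Suc n) = \<Phi> (X n)" for n by (simp add: X_def)
  have Gb: "\<exists>C. \<forall>t\<in>{0..T}. norm (G t (u t) k) \<le> C"
    if k: "k \<in> F" and c: "\<And>l. l \<in> F \<Longrightarrow> continuous_on {0..T} (\<lambda>t. u t l)" for u k
  proof -
    have "\<exists>D. \<forall>t\<in>{0..T}. norm (u t l - u0 l) \<le> D" if "l \<in> F" for l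
    proof -
      have "continuous_on {0..T} (\<lambda>t. u t l - u0 l)" by (intro continuous_intros c that)
      from continuous_on_compact_bound[OF _ this] show ?thesis by (metis compact_Icc)
    qed
    then obtain D where D: "\<And>l t. l \<in> F \<Longrightarrow> t \<in> {0..T} \<Longrightarrow> norm (u t l - u0 l) \<le> D l" by metis
    have "norm (G t (u t) k) \<le> L * (\<Sum>l\<in>F. \<bar>D l\<bar>) + B" if t: "t \<in> {0..T}" for t
    proof -
      have "norm (u t l - u0 l) \<le> (\<Sum>l\<in>F. \<bar>D l\<bar>)" if "l \<in> F" for l
      proof -
        have "norm (u t l - u0 l) \<le> \<bar>D l\<bar>" using D[OF that t] by linarith
        also have "\<dots> \<le> (\<Sum>l\<in>F. \<bar>D l\<bar>)" by (rule member_le_sum) (use that F in auto)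
        finally show ?thesis .
      qed
      from lip[OF t k this] have "norm (G t (u t) k - G t u0 k) \<le> L * (\<Sum>l\<in>F. \<bar>D l\<bar>)" .
      then show ?thesis using bound0[OF t k] norm_triangle_ineq[of "G t (u t) k - G t u0 k" "G t u0 k"] by simp
    qed
    then show ?thesis by blast
  qed
  have Gi: "(\<lambda>\<tau>. G \<tau> (u \<tau>) k) integrable_on {0..t}"
    if g: "k \<in> F" "\<And>l. l \<in> F \<Longrightarrow> continuous_on {0..T} (\<lambda>t. u t l)" "t \<in> {0..T}" for u k t
  proof -
    obtain C where C: "\<And>t. t \<in> {0..T} \<Longrightarrow> norm (G t (u t) k) \<le> C" using Gb[of k u, OF g(1,2)] by blast
    show ?thesis
      by (rule bounded_measurable_integrable_on[OF meas[of k u, OF g(1,2)] C]) (use g(3) in auto)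
  qed
  have cont: "continuous_on {0..T} (\<lambda>t. u0 k + integral {0..t} (\<lambda>\<tau>. G \<tau> (u \<tau>) k))"
    if "k \<in> F" "\<And>l. l \<in> F \<Longrightarrow> continuous_on {0..T} (\<lambda>t. u t l)" for u k
    using Gi[of k u T, OF that] T by (intro continuous_intros indefinite_integral_continuous_1) auto
  have Xc: "continuous_on {0..T} (\<lambda>t. X n t l)" if "l \<in> F" for n l
    using that
  proof (induction n arbitrary: l)
    case 0
    then show ?case by (simp add: X0)
  next
    case (Suc n)
    then show ?case using cont[of l "X n"] Suc by (simp add: XS \<Phi>_def)
  qed
  have GiX: "(\<lambda>\<tau>. G \<tau> (X n \<tau>) k) integrable_on {0..t}" if "k \<in> F" "t \<in> {0..T}" for n k t
    using Gi[of k "X n" t] Xc that by auto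
  have XI: "I (X n t)" if "t \<in> {0..T}" for n t
    using that
  proof (induction n arbitrary: t)
    case 0
    then show ?case using I0 by (simp add: X0)
  next
    case (Suc n)
    show ?case unfolding XS \<Phi>_def
      by (rule step[of t "X n"]) (use Suc GiX in auto)
  qed
  have XSk: "X (Suc n) t k = u0 k + integral {0..t} (\<lambda>\<tau>. G \<tau> (X n \<tau>) k)" if "k \<in> F" for n t k
    using that by (simp add: XS \<Phi>_def)
  define C where "C = \<bar>B\<bar> * T"
  have C0: "0 \<le> C" using T by (simp add: C_def)
  \<comment> \<open>The exponential weight produces a contraction on the whole interval: integrating
    L exp (2 L t) yields half of exp (2 L t), hence a factor 1/2 in each iteration.\<close>
  have diff: "norm (X (Suc n) t k - X n t k) \<le> C * (1/2) ^ n * exp (2 * L * t)"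
    if "t \<in> {0..T}" "k \<in> F" for n t k
    using that
  proof (induction n arbitrary: t k)
    case 0
    have "norm (integral {0..t} (\<lambda>\<tau>. G \<tau> (X 0 \<tau>) k)) \<le> \<bar>B\<bar> * (t - 0)"
    proof (rule norm_integral_le_bound)
      show "(\<lambda>\<tau>. G \<tau> (X 0 \<tau>) k) integrable_on {0..t}"
        by (rule GiX[OF 0(2,1)])
      show "norm (G \<tau> (X 0 \<tau>) k) \<le> \<bar>B\<bar>" if "\<tau> \<in> {0..t}" for \<tau>
        using bound0[of \<tau> k] that 0 by (auto simp: X0)
    qed (use 0 in auto)
    also have "\<dots> \<le> C" using 0 by (auto simp: C_def intro: mult_left_mono)
    also have "\<dots> \<le> C * exp (2 * L * t)"
      using mult_left_mono[OF _ C0, of 1 "exp (2 * L * t)"] 0 L by simp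
    finally show ?case using 0 by (simp add: XSk X0)
  next
    case (Suc n)
    have "norm (X (Suc (Suc n)) t k - X (Suc n) t k)
        = norm (integral {0..t} (\<lambda>\<tau>. G \<tau> (X (Suc n) \<tau>) k - G \<tau> (X n \<tau>) k))"
      using GiX[OF Suc(3,2), of "Suc n"] GiX[OF Suc(3,2), of n] Suc(3)
      by (simp add: XSk Henstock_Kurzweil_Integration.integral_diff del: XS)
    also have "\<dots> \<le> integral {0..t} (\<lambda>\<tau>. L * (C * (1/2) ^ n * exp (2 * L * \<tau>)))"
    proof (rule integral_norm_bound_integral)
      show "(\<lambda>\<tau>. G \<tau> (X (Suc n) \<tau>) k - G \<tau> (X n \<tau>) k) integrable_on {0..t}"
        using GiX[OF Suc(3,2), of "Suc n"] GiX[OF Suc(3,2), of n] by (rule integrable_diff)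
      show "(\<lambda>\<tau>. L * (C * (1/2) ^ n * exp (2 * L * \<tau>))) integrable_on {0..t}"
        by (intro integrable_continuous_real continuous_intros)
      show "norm (G \<tau> (X (Suc n) \<tau>) k - G \<tau> (X n \<tau>) k) \<le> L * (C * (1/2) ^ n * exp (2 * L * \<tau>))"
        if "\<tau> \<in> {0..t}" for \<tau>
        using that Suc by (intro lip) auto
    qed
    also have "\<dots> = C * (1/2) ^ Suc n * (exp (2 * L * t) - 1)"
    proof -
      have "((\<lambda>\<tau>. L * (C * (1/2) ^ n * exp (2 * L * \<tau>))) has_integral
          C * (1/2) ^ Suc n * exp (2 * L * t) - C * (1/2) ^ Suc n * exp (2 * L * 0)) {0..t}"
        using Suc(2) by (intro fundamental_theorem_of_calculus)
          (auto intro!: derivative_eq_intros simp: has_real_derivative_iff_has_vector_derivative[symmetric])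
      from integral_unique[OF this] show ?thesis by (simp only: right_diff_distrib mult_zero_right exp_zero mult_1_right)
    qed
    also have "\<dots> \<le> C * (1/2) ^ Suc n * exp (2 * L * t)"
      using C0 by (intro mult_left_mono) auto
    finally show ?case .
  qed
  define S where "S t k = u0 k + (\<Sum>n. X (Suc n) t k - X n t k)" for t k
  define u where "u t k = (if k \<in> F then S t k else u0 k)" for t k
  have ul: "uniform_limit {0..T} (\<lambda>n t. X n t k) (\<lambda>t. S t k) sequentially" if "k \<in> F" for k
  proof -
    have "uniform_limit {0..T} (\<lambda>n t. \<Sum>i<n. X (Suc i) t k - X i t k) (\<lambda>t. \<Sum>i. X (Suc i) t k - X i t k) sequentially"
    proof (rule Weierstrass_m_test)
      show "norm (X (Suc n) t k - X n t k) \<le> C * (1/2) ^ n * exp (2 * L * T)" if "t \<in> {0..T}" for n t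
      proof -
        have "C * (1/2) ^ n * exp (2 * L * t) \<le> C * (1/2) ^ n * exp (2 * L * T)"
          using that L C0 by (intro mult_left_mono) auto
        then show ?thesis using diff[OF that \<open>k \<in> F\<close>, of n] by linarith
      qed
      show "summable (\<lambda>n. C * (1/2) ^ n * exp (2 * L * T))"
        by (intro summable_mult summable_mult2 summable_geometric) auto
    qed
    then have "uniform_limit {0..T} (\<lambda>n t. u0 k + (\<Sum>i<n. X (Suc i) t k - X i t k)) (\<lambda>t. S t k) sequentially"
      unfolding S_def by (intro uniform_limit_intros)
    moreover have "u0 k + (\<Sum>i<n. X (Suc i) t k - X i t k) = X n t k" for n t
      using sum_lessThan_telescope[of "\<lambda>i. X i t k" n] by (simp add: X0)
    ultimately show ?thesis by simp
  qed
  have uc: "continuous_on {0..T} (\<lambda>t. u t k)" if "k \<in> F" for k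
    using uniform_limit_theorem[OF _ ul[OF that]] Xc[OF that] that by (auto simp: u_def)
  have Giu: "(\<lambda>\<tau>. G \<tau> (u \<tau>) k) integrable_on {0..t}" if "k \<in> F" "t \<in> {0..T}" for k t
    using Gi[of k u t] uc that by auto
  have Xu: "(\<lambda>n. X n t k) \<longlonglongrightarrow> u t k" if "t \<in> {0..T}" for t k
  proof (cases "k \<in> F")
    case True
    then show ?thesis using tendsto_uniform_limitI[OF ul[OF True] that] by (simp add: u_def)
  next
    case False
    then have "X n t k = u0 k" for n by (cases n) (auto simp: X0 XS \<Phi>_def)
    then show ?thesis using False by (simp add: u_def)
  qed
  have fixp: "u t k = u0 k + integral {0..t} (\<lambda>\<tau>. G \<tau> (u \<tau>) k)" if t: "t \<in> {0..T}" and k: "k \<in> F" for t k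
  proof -
    have "(\<lambda>n. integral {0..t} (\<lambda>\<tau>. G \<tau> (X n \<tau>) k)) \<longlonglongrightarrow> integral {0..t} (\<lambda>\<tau>. G \<tau> (u \<tau>) k)"
    proof (rule tendstoI)
      fix e :: real assume e: "0 < e"
      \<comment> \<open>The added 1 keeps the divisor in \<open>d\<close> positive when
        \<open>T\<close> is 0.\<close>
      define T1 where "T1 = T + 1"
      have T1: "0 < T1" "T \<le> T1" using T by (auto simp: T1_def)
      define d where "d = e / (2 * L * T1)"
      have d: "0 < d" using e L T1 by (simp add: d_def)
      have "\<forall>\<^sub>F n in sequentially. \<forall>l\<in>F. \<forall>\<tau>\<in>{0..T}. dist (X n \<tau> l) (S \<tau> l) < d"
        using ul d unfolding uniform_limit_iff by (intro eventually_ball_finite F) auto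
      then show "\<forall>\<^sub>F n in sequentially. dist (integral {0..t} (\<lambda>\<tau>. G \<tau> (X n \<tau>) k)) (integral {0..t} (\<lambda>\<tau>. G \<tau> (u \<tau>) k)) < e"
      proof eventually_elim
        case (elim n)
        have "norm (integral {0..t} (\<lambda>\<tau>. G \<tau> (X n \<tau>) k - G \<tau> (u \<tau>) k)) \<le> (L * d) * (t - 0)"
        proof (rule norm_integral_le_bound)
          show "(\<lambda>\<tau>. G \<tau> (X n \<tau>) k - G \<tau> (u \<tau>) k) integrable_on {0..t}"
            using GiX[OF k t, of n] Giu[OF k t] by (rule integrable_diff)
          show "norm (G \<tau> (X n \<tau>) k - G \<tau> (u \<tau>) k) \<le> L * d" if "\<tau> \<in> {0..t}" for \<tau>
            using elim that t k by (intro lip) (auto simp: u_def dist_norm less_imp_le)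
        qed (use t in auto)
        also have "\<dots> \<le> L * d * T1" using t L d T1 by (intro mult_left_mono) auto
        also have "L * d * T1 = e / 2" using L T1 by (simp add: d_def)
        also have "\<dots> < e" using e by simp
        finally show ?case
          using GiX[OF k t, of n] Giu[OF k t]
          by (simp add: dist_norm Henstock_Kurzweil_Integration.integral_diff)
      qed
    qed
    then have "(\<lambda>n. X (Suc n) t k) \<longlonglongrightarrow> u0 k + integral {0..t} (\<lambda>\<tau>. G \<tau> (u \<tau>) k)"
      unfolding XSk[OF k] by (intro tendsto_intros)
    then show ?thesis using LIMSEQ_Suc[OF Xu[OF t, of k]] LIMSEQ_unique by blast
  qed
  have "I (u t)" if "t \<in> {0..T}" for t
    by (rule lim[of "\<lambda>n. X n t"]) (use XI Xu that in auto)
  then show ?thesis using uc fixp by blast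
qed

text \<open>The difference of the two sides varies by at most a constant times \<open>\<bar>t - r\<bar>\<^sup>2\<close>.\<close>
lemma norm_sq_indefinite_integral:
  fixes g :: "real \<Rightarrow> complex"
  assumes m: "g \<in> borel_measurable (lebesgue_on {0..T})" and B: "\<And>t. t \<in> {0..T} \<Longrightarrow> norm (g t) \<le> B"
    and y: "\<And>t. t \<in> {0..T} \<Longrightarrow> y t = y 0 + integral {0..t} g"
    and t: "t \<in> {0..T}"
  shows "(norm (y t))\<^sup>2 = (norm (y 0))\<^sup>2 + integral {0..t} (\<lambda>\<tau>. 2 * Re (cnj (y \<tau>) * g \<tau>))"
    and "(\<lambda>\<tau>. 2 * Re (cnj (y \<tau>) * g \<tau>)) integrable_on {0..t}"
proof -
  have T: "0 \<le> T" using t by auto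
  have gi: "g integrable_on {a..b}" if "0 \<le> a" "b \<le> T" for a b
    by (rule bounded_measurable_integrable_on[OF m B that])
  have yc: "continuous_on {0..T} y"
  proof -
    have "continuous_on {0..T} (\<lambda>t. y 0 + integral {0..t} g)"
      by (intro continuous_intros indefinite_integral_continuous_1 gi) auto
    then show ?thesis by (rule continuous_on_eq) (rule y[symmetric])
  qed
  obtain Y where Y: "\<And>t. t \<in> {0..T} \<Longrightarrow> norm (y t) \<le> Y"
    using continuous_on_compact_bound[OF compact_Icc yc] by blast
  have Y0: "0 \<le> Y" using order_trans[OF norm_ge_zero Y[of 0]] T by simp
  have B0: "0 \<le> B" using order_trans[OF norm_ge_zero B[of 0]] T by simp
  define h where "h \<tau> = 2 * Re (cnj (y \<tau>) * g \<tau>)" for \<tau>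
  have ym: "y \<in> borel_measurable (lebesgue_on {0..T})" by (rule continuous_imp_measurable_Icc[OF yc])
  have hm: "h \<in> borel_measurable (lebesgue_on {0..T})"
  proof -
    note m [measurable] ym [measurable]
    have "h = (\<lambda>\<tau>. 2 * (Re (y \<tau>) * Re (g \<tau>) + Im (y \<tau>) * Im (g \<tau>)))"
      by (simp add: h_def[abs_def])
    then show ?thesis by simp
  qed
  have hb: "norm (h \<tau>) \<le> 2 * (Y * B)" if "\<tau> \<in> {0..T}" for \<tau>
  proof -
    have "\<bar>Re (cnj (y \<tau>) * g \<tau>)\<bar> \<le> norm (y \<tau>) * norm (g \<tau>)"
      using abs_Re_le_cmod[of "cnj (y \<tau>) * g \<tau>"] by (simp add: norm_mult)
    also have "\<dots> \<le> Y * B" using Y[OF that] B[OF that] Y0 by (intro mult_mono) auto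
    finally show ?thesis by (simp add: h_def abs_mult)
  qed
  have hi: "h integrable_on {a..b}" if "0 \<le> a" "b \<le> T" for a b
    by (rule bounded_measurable_integrable_on[OF hm hb that])
  have yd: "y b - y a = integral {a..b} g" if "0 \<le> a" "a \<le> b" "b \<le> T" for a b
    using y[of a] y[of b] integral_diff_interval[OF gi, of b a] that by simp
  have ydb: "norm (y b - y a) \<le> B * (b - a)" if "0 \<le> a" "a \<le> b" "b \<le> T" for a b
    unfolding yd[OF that] using that by (intro norm_integral_le_bound gi B) auto
  \<comment> \<open>Since \<open>g\<close> is only bounded and measurable, \<open>y\<close> need not
    be differentiable at each time. Instead of the product rule, increments of \<open>\<Psi>\<close>
    are shown to be quadratic in the length of the interval, so its derivative is zero
    everywhere.\<close>
  define \<Psi> where "\<Psi> t = (norm (y t))\<^sup>2 - integral {0..t} h" for t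
  have key: "norm (\<Psi> b - \<Psi> a) \<le> 2 * B\<^sup>2 * (b - a)\<^sup>2" if ab: "0 \<le> a" "a \<le> b" "b \<le> T" for a b
  proof -
    have "(norm (y b))\<^sup>2 - (norm (y a))\<^sup>2 = Re (cnj (y b + y a) * (y b - y a))"
      unfolding cmod_power2 by (simp add: power2_eq_square algebra_simps)
    also have "\<dots> = integral {a..b} (\<lambda>\<tau>. Re (cnj (y b + y a) * g \<tau>))"
    proof -
      have "((\<lambda>\<tau>. Re (cnj (y b + y a) * g \<tau>)) has_integral Re (cnj (y b + y a) * integral {a..b} g)) {a..b}"
        using has_integral_linear[OF integrable_integral[OF gi[OF ab(1,3)]] bounded_linear_compose[OF bounded_linear_Re bounded_linear_mult_right[of "cnj (y b + y a)"]]]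
        by (simp add: o_def)
      then show ?thesis using yd[OF ab] by (simp add: integral_unique)
    qed
    finally have e2: "(norm (y b))\<^sup>2 - (norm (y a))\<^sup>2 = integral {a..b} (\<lambda>\<tau>. Re (cnj (y b + y a) * g \<tau>))" .
    have e3: "integral {0..b} h - integral {0..a} h = integral {a..b} h"
      using integral_diff_interval[OF hi, of b a] ab by simp
    have i: "(\<lambda>\<tau>. Re (cnj (y b + y a) * g \<tau>)) integrable_on {a..b}"
      using integrable_linear[OF gi[OF ab(1,3)] bounded_linear_compose[OF bounded_linear_Re bounded_linear_mult_right[of "cnj (y b + y a)"]]]
      by (simp add: o_def)
    have "\<Psi> b - \<Psi> a = integral {a..b} (\<lambda>\<tau>. Re (cnj (y b + y a) * g \<tau>) - h \<tau>)"
      unfolding \<Psi>_def using e2 e3 Henstock_Kurzweil_Integration.integral_diff[OF i hi[OF ab(1,3)]] by simp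
    also have "norm \<dots> \<le> (2 * B\<^sup>2 * (b - a)) * (b - a)"
    proof (rule norm_integral_le_bound)
      show "(\<lambda>\<tau>. Re (cnj (y b + y a) * g \<tau>) - h \<tau>) integrable_on {a..b}"
        by (rule integrable_diff[OF i hi[OF ab(1,3)]])
      fix \<tau> assume \<tau>: "\<tau> \<in> {a..b}"
      \<comment> \<open>Replacing \<open>y b + y a\<close> by \<open>2 * y \<tau>\<close> leaves a
        difference of two increments of \<open>y\<close>, each of the order of the length of the
        interval; integration supplies the second factor of the length.\<close>
      have "Re (cnj (y b + y a) * g \<tau>) - h \<tau> = Re (cnj ((y b - y \<tau>) - (y \<tau> - y a)) * g \<tau>)"
        by (simp add: h_def algebra_simps)
      also have "norm \<dots> \<le> norm ((y b - y \<tau>) - (y \<tau> - y a)) * norm (g \<tau>)"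
        using abs_Re_le_cmod[of "cnj ((y b - y \<tau>) - (y \<tau> - y a)) * g \<tau>"] by (simp only: norm_mult complex_mod_cnj real_norm_def)
      also have "\<dots> \<le> (2 * B * (b - a)) * B"
      proof (rule mult_mono)
        have "norm ((y b - y \<tau>) - (y \<tau> - y a)) \<le> norm (y b - y \<tau>) + norm (y \<tau> - y a)" by (rule norm_triangle_ineq4)
        also have "\<dots> \<le> B * (b - \<tau>) + B * (\<tau> - a)" using \<tau> ab by (intro add_mono ydb) auto
        also have "\<dots> \<le> 2 * B * (b - a)" using B0 ab by (simp add: algebra_simps) (simp flip: distrib_left add: mult_left_mono)
        finally show "norm ((y b - y \<tau>) - (y \<tau> - y a)) \<le> 2 * B * (b - a)" .
      qed (use B[of \<tau>] B0 \<tau> ab in auto)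
      finally show "norm (Re (cnj (y b + y a) * g \<tau>) - h \<tau>) \<le> 2 * B\<^sup>2 * (b - a)"
        by (simp add: power2_eq_square mult_ac)
    qed (use ab in auto)
    finally show ?thesis by (simp add: power2_eq_square mult.assoc)
  qed
  have "\<exists>c. \<forall>x\<in>{0..T}. \<Psi> x = c"
  proof (rule has_derivative_zero_constant)
    show "convex {0..T}" by simp
    fix x assume x: "x \<in> {0..T}"
    have "(\<Psi> has_real_derivative 0) (at x within {0..T})"
      unfolding has_field_derivative_iff
    proof (rule Lim_null_comparison)
      show "\<forall>\<^sub>F y in at x within {0..T}. norm ((\<Psi> y - \<Psi> x) / (y - x)) \<le> 2 * B\<^sup>2 * \<bar>y - x\<bar>"
        unfolding eventually_at
      proof (intro exI[of _ 1] conjI ballI impI)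
        fix z assume z: "z \<in> {0..T}" "z \<noteq> x \<and> dist z x < 1"
        have "norm (\<Psi> z - \<Psi> x) \<le> 2 * B\<^sup>2 * \<bar>z - x\<bar>\<^sup>2"
          using key[of x z] key[of z x] x z by (cases "x \<le> z") (auto simp: abs_minus_commute power2_commute)
        then show "norm ((\<Psi> z - \<Psi> x) / (z - x)) \<le> 2 * B\<^sup>2 * \<bar>z - x\<bar>"
          using z by (simp add: norm_divide divide_simps power2_eq_square mult.assoc)
      qed auto
      show "((\<lambda>y. 2 * B\<^sup>2 * \<bar>y - x\<bar>) \<longlongrightarrow> 0) (at x within {0..T})"
        by (auto intro!: tendsto_eq_intros)
    qed
    then show "(\<Psi> has_derivative (\<lambda>h. 0)) (at x within {0..T})"
      by (simp add: has_field_derivative_def lambda_zero)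
  qed
  then have "\<Psi> t = \<Psi> 0" using t T by force
  then show "(norm (y t))\<^sup>2 = (norm (y 0))\<^sup>2 + integral {0..t} (\<lambda>\<tau>. 2 * Re (cnj (y \<tau>) * g \<tau>))"
    unfolding h_def[symmetric] by (simp add: \<Psi>_def)
  show "(\<lambda>\<tau>. 2 * Re (cnj (y \<tau>) * g \<tau>)) integrable_on {0..t}"
    unfolding h_def[symmetric] using hi[of 0 t] t by simp
qed

section \<open>Continuity method and a Gronwall argument\<close>

lemma bootstrap:
  fixes f :: "real \<Rightarrow> real"
  assumes c: "continuous_on {0..T} f"
    and b: "\<And>t. t \<in> {0..T} \<Longrightarrow> (\<And>\<tau>. 0 \<le> \<tau> \<Longrightarrow> \<tau> < t \<Longrightarrow> f \<tau> \<le> R) \<Longrightarrow> f t < R"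
    and t: "t \<in> {0..T}"
  shows "f t < R"
proof (rule ccontr)
  assume n: "\<not> f t < R"
  \<comment> \<open>At the first time at which \<open>f\<close> reaches \<open>R\<close>, the bound
    holds at all earlier times, so the hypothesis excludes that time.\<close>
  define S where "S = {0..T} \<inter> f -` {R..}"
  have "closed S" unfolding S_def by (rule continuous_closed_preimage[OF c]) auto
  moreover have "S \<noteq> {}" "bdd_below S" using n t by (auto simp: S_def intro: bdd_belowI)
  ultimately have I: "Inf S \<in> S" using closed_contains_Inf by blast
  have "f (Inf S) < R"
  proof (rule b)
    show "Inf S \<in> {0..T}" using I by (simp add: S_def)
    show "f \<tau> \<le> R" if "0 \<le> \<tau>" "\<tau> < Inf S" for \<tau>
    proof (rule ccontr)
      assume "\<not> f \<tau> \<le> R"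
      then have "\<tau> \<in> S" using that I by (auto simp: S_def)
      then have "Inf S \<le> \<tau>" using \<open>bdd_below S\<close> by (rule cInf_lower)
      then show False using that by simp
    qed
  qed
  then show False using I by (simp add: S_def)
qed

text \<open>If \<open>W\<close> vanishes on \<open>[0,r)\<close>, then on a short interval after \<open>r\<close> the supremum of \<open>W\<close> is at
  most half of itself.\<close>
lemma gronwall_zero:
  fixes W a :: "real \<Rightarrow> real"
  assumes W0: "\<And>t. t \<in> {0..T} \<Longrightarrow> 0 \<le> W t" and WB: "\<And>t. t \<in> {0..T} \<Longrightarrow> W t \<le> B"
    and a0: "\<And>t. t \<in> {0..T} \<Longrightarrow> 0 \<le> a t" and ai: "a integrable_on {0..T}"
    and aW: "(\<lambda>\<tau>. a \<tau> * W \<tau>) integrable_on {0..T}"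
    and le: "\<And>t. t \<in> {0..T} \<Longrightarrow> W t \<le> integral {0..t} (\<lambda>\<tau>. a \<tau> * W \<tau>)"
    and t: "t \<in> {0..T}"
  shows "W t = 0"
proof -
  have T: "0 \<le> T" using t by auto
  define A where "A t = integral {0..t} a" for t
  have Ac: "continuous_on {0..T} A"
    unfolding A_def by (rule indefinite_integral_continuous_1[OF ai])
  have ai': "a integrable_on {x..y}" if "0 \<le> x" "y \<le> T" for x y
    using ai that by (cases "x \<le> y") (auto intro: integrable_on_subinterval)
  have aW': "(\<lambda>\<tau>. a \<tau> * W \<tau>) integrable_on {x..y}" if "0 \<le> x" "y \<le> T" for x y
    using aW that by (cases "x \<le> y") (auto intro: integrable_on_subinterval)
  \<comment> \<open>Times up to which \<open>W\<close> vanishes identically; the supremum of this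
    set is shown to be \<open>T\<close>.\<close>
  define Z where "Z = {r \<in> {0..T}. \<forall>\<tau>\<in>{0..r}. W \<tau> = 0}"
  have z0: "0 \<in> Z"
    using le[of 0] W0[of 0] T by (auto simp: Z_def)
  have bdd: "bdd_above Z" by (auto simp: Z_def intro: bdd_aboveI)
  define r where "r = Sup Z"
  have r: "0 \<le> r" unfolding r_def by (rule cSup_upper[OF z0 bdd])
  have "r \<le> T" unfolding r_def by (rule cSup_least) (use z0 in \<open>auto simp: Z_def\<close>)
  note r = r this
  have lt: "W \<tau> = 0" if g: "0 \<le> \<tau>" "\<tau> < r" for \<tau>
  proof -
    obtain z where "z \<in> Z" "\<tau> < z" using g(2) less_cSup_iff[of Z \<tau>] z0 bdd by (auto simp: r_def)
    then show ?thesis using g(1) by (auto simp: Z_def)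
  qed
  have zero_int: "integral {0..r} (\<lambda>\<tau>. a \<tau> * W \<tau>) = 0"
  proof -
    have "integral {0..r} (\<lambda>\<tau>. a \<tau> * W \<tau>) = integral {0..r} (\<lambda>\<tau>. 0)"
      by (rule integral_spike[of "{r}"]) (use lt in auto)
    then show ?thesis by simp
  qed
  have "r = T"
  proof (rule ccontr)
    assume "r \<noteq> T"
    then have rT: "r < T" using r by simp
    have "continuous (at r within {0..T}) A" using Ac r by (simp add: continuous_on_eq_continuous_within)
    \<comment> \<open>The weight \<open>a\<close> is integrable but possibly unbounded. Smallness of
      its integral over short intervals comes from continuity of its primitive.\<close>
    then obtain d where d: "d > 0" "\<And>x. x \<in> {0..T} \<Longrightarrow> dist x r < d \<Longrightarrow> dist (A x) (A r) < 1/2"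
      unfolding continuous_within_eps_delta by (metis half_gt_zero zero_less_one)
    define r2 where "r2 = min T (r + d / 2)"
    have r2: "r < r2" "r2 \<le> T" "dist r2 r < d" using d rT by (auto simp: r2_def dist_real_def min_def)
    have half: "integral {r..x} a \<le> 1/2" if "r \<le> x" "x \<le> r2" for x
    proof -
      have "dist (A x) (A r) < 1/2" using d(2)[of x] that r r2 by (auto simp: dist_real_def)
      then show ?thesis using integral_diff_interval[OF ai'[of 0 x], of r] that r r2 by (auto simp: A_def dist_real_def)
    qed
    define Bs where "Bs = (SUP x\<in>{r..r2}. W x)"
    have bw: "bdd_above (W ` {r..r2})" using WB r r2 by (intro bdd_aboveI[of _ B]) auto
    have WBs: "W x \<le> Bs" if "x \<in> {r..r2}" for x unfolding Bs_def by (rule cSUP_upper[OF that bw])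
    have Bs0: "0 \<le> Bs" using WBs[of r] W0[of r] r r2 by auto
    have "W x \<le> Bs / 2" if x: "x \<in> {r..r2}" for x
    proof -
      have "W x \<le> integral {0..x} (\<lambda>\<tau>. a \<tau> * W \<tau>)" using x r r2 by (intro le) auto
      also have "\<dots> = integral {r..x} (\<lambda>\<tau>. a \<tau> * W \<tau>)"
        using integral_diff_interval[OF aW'[of 0 x], of r] zero_int x r r2 by auto
      also have "\<dots> \<le> integral {r..x} (\<lambda>\<tau>. a \<tau> * Bs)"
        using x r r2 a0 WBs by (intro integral_le aW' integrable_on_mult_left ai' mult_left_mono) auto
      also have "\<dots> = integral {r..x} a * Bs" by simp
      also have "\<dots> \<le> 1/2 * Bs" using half[of x] x Bs0 by (intro mult_right_mono) auto
      finally show ?thesis by simp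
    qed
    then have "Bs \<le> Bs / 2" unfolding Bs_def using r2 by (intro cSUP_least) auto
    then have "Bs = 0" using Bs0 by simp
    then have "W x = 0" if "x \<in> {r..r2}" for x
      using WBs[OF that] W0[of x] that r r2 by auto
    then have "r2 \<in> Z" using lt r r2 by (auto simp: Z_def) (metis linorder_not_le)
    then have "r2 \<le> r" unfolding r_def by (rule cSup_upper[OF _ bdd])
    then show False using r2 by simp
  qed
  show ?thesis
  proof (cases "t < r")
    case True
    then show ?thesis using lt t by auto
  next
    case False
    \<comment> \<open>So far \<open>W\<close> is known to vanish only before \<open>T\<close>. The
      endpoint does not affect the integral, so the inequality at \<open>T\<close> closes the
      remaining case.\<close>
    then have "t = r" using t \<open>r = T\<close> by auto
    then show ?thesis using le[OF t] zero_int W0[OF t] by simp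
  qed
qed

subsection \<open>The energy estimate\<close>

text \<open>The set \<open>F\<close> need not be invariant under l -> k - l. Both sums reduce to
  those \<open>l\<close> for which \<open>l\<close> and \<open>k - l\<close> lie in
  \<open>F\<close>, and this set is invariant.\<close>

lemma sum_convolution_swap:
  fixes f g :: "'a::ab_group_add \<Rightarrow> 'b::comm_semiring_0"
  assumes "finite F" "\<And>k. k \<notin> F \<Longrightarrow> f k = 0" "\<And>k. k \<notin> F \<Longrightarrow> g k = 0"
  shows "(\<Sum>l\<in>F. f (k - l) * g l) = (\<Sum>l\<in>F. f l * g (k - l))"
proof -
  let ?A = "{l \<in> F. k - l \<in> F}"
  have A: "finite ?A" using assms(1) by simp
  have "(\<Sum>l\<in>F. f (k - l) * g l) = (\<Sum>l\<in>?A. f (k - l) * g l)"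
    by (rule sum.mono_neutral_right) (use assms in auto)
  also have "\<dots> = (\<Sum>l\<in>?A. f l * g (k - l))"
    by (rule sum.reindex_bij_witness[of _ "\<lambda>l. k - l" "\<lambda>l. k - l"]) auto
  also have "\<dots> = (\<Sum>l\<in>F. f l * g (k - l))"
    by (rule sum.mono_neutral_left) (use assms in auto)
  finally show ?thesis .
qed

lemma sum_shift_sq_le:
  fixes v :: "'a::ab_group_add \<Rightarrow> real"
  assumes "finite F" "\<And>k. k \<notin> F \<Longrightarrow> v k = 0" "finite G"
  shows "(\<Sum>k\<in>G. (v (k - j))\<^sup>2) \<le> (\<Sum>k\<in>F. (v k)\<^sup>2)"
proof -
  have "(\<Sum>k\<in>G. (v (k - j))\<^sup>2) = (\<Sum>k\<in>(\<lambda>k. k - j) ` G. (v k)\<^sup>2)"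
    by (subst sum.reindex) (auto simp: inj_on_def)
  also have "\<dots> = (\<Sum>k\<in>(\<lambda>k. k - j) ` G \<inter> F. (v k)\<^sup>2)"
    by (rule sum.mono_neutral_right) (use assms in auto)
  also have "\<dots> \<le> (\<Sum>k\<in>F. (v k)\<^sup>2)"
    by (rule sum_mono2) (use assms in auto)
  finally show ?thesis .
qed

text \<open>A discrete Young inequality: for each fixed shift, the correlation of \<open>v\<close>
  with its translate is at most the squared l^2 norm, and the l^1 norm of \<open>b\<close> sums over
  the shifts.\<close>

lemma sum_trilinear_le:
  fixes v b :: "'a::ab_group_add \<Rightarrow> real"
  assumes F: "finite F" and v: "\<And>k. 0 \<le> v k" "\<And>k. k \<notin> F \<Longrightarrow> v k = 0" and b: "\<And>k. 0 \<le> b k"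
  shows "(\<Sum>k\<in>F. \<Sum>l\<in>F. v k * (b l * v (k - l))) \<le> (\<Sum>l\<in>F. b l) * (\<Sum>k\<in>F. (v k)\<^sup>2)"
proof -
  have le: "(\<Sum>k\<in>F. v k * v (k - l)) \<le> (\<Sum>k\<in>F. (v k)\<^sup>2)" for l
  proof -
    have "(\<Sum>k\<in>F. v k * v (k - l)) \<le> (\<Sum>k\<in>F. ((v k)\<^sup>2 + (v (k - l))\<^sup>2) / 2)"
    proof (rule sum_mono)
      fix k
      show "v k * v (k - l) \<le> ((v k)\<^sup>2 + (v (k - l))\<^sup>2) / 2"
        using sum_squares_bound[of "v k" "v (k - l)"] by simp
    qed
    also have "\<dots> = ((\<Sum>k\<in>F. (v k)\<^sup>2) + (\<Sum>k\<in>F. (v (k - l))\<^sup>2)) / 2"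
      by (simp add: sum_divide_distrib[symmetric] sum.distrib)
    also have "\<dots> \<le> (\<Sum>k\<in>F. (v k)\<^sup>2)"
      using sum_shift_sq_le[OF F v(2) F, where j=l] by simp
    finally show ?thesis .
  qed
  have "(\<Sum>k\<in>F. \<Sum>l\<in>F. v k * (b l * v (k - l))) = (\<Sum>l\<in>F. \<Sum>k\<in>F. v k * (b l * v (k - l)))"
    by (rule sum.swap)
  also have "\<dots> = (\<Sum>l\<in>F. b l * (\<Sum>k\<in>F. v k * v (k - l)))"
    by (simp add: sum_distrib_left mult_ac)
  also have "\<dots> \<le> (\<Sum>l\<in>F. b l * (\<Sum>k\<in>F. (v k)\<^sup>2))"
    by (intro sum_mono mult_left_mono le b)
  finally show ?thesis by (simp add: sum_distrib_right)
qed

section \<open>Inequalities for the weights\<close>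

lemma wt_half_triangle: "wt (1/2) k \<le> wt (1/2) l + norm (freq (k - l))"
proof -
  have sq: "wt (1/2) j = sqrt (1 + (norm (freq j))\<^sup>2)" for j
    unfolding wt_def using wt_base_pos[of j] by (simp add: powr_half_sqrt)
  have "norm (freq k) \<le> norm (freq l) + norm (freq (k - l))"
    using norm_triangle_ineq[of "freq l" "freq (k - l)"] by (simp add: freq_diff)
  \<comment> \<open>The weight is the Euclidean norm of the pair (1, k), so the claim is the
    triangle inequality in R x R^3.\<close>
  have "wt (1/2) k = norm (1::real, freq k)" by (simp add: sq norm_Pair)
  also have "\<dots> = norm ((1::real, freq l) + (0, freq (k - l)))" by (simp add: freq_diff)
  also have "\<dots> \<le> norm (1::real, freq l) + norm (0::real, freq (k - l))" by (rule norm_triangle_ineq)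
  also have "\<dots> = wt (1/2) l + norm (freq (k - l))" by (simp add: sq norm_Pair)
  finally show ?thesis .
qed

lemma wt_half_eq: "wt (r / 2) k = wt (1/2) k powr r"
  by (simp add: wt_def powr_powr)

lemma powr_diff_le:
  fixes x y :: real
  assumes "1 \<le> s" "0 < x" "0 < y"
  shows "\<bar>x powr s - y powr s\<bar> \<le> s * max x y powr (s - 1) * \<bar>x - y\<bar>"
proof -
  have *: "b powr s - a powr s \<le> s * b powr (s - 1) * (b - a)" if ab: "0 < a" "a < b" for a b :: real
  proof -
    obtain z where z: "a < z" "z < b" "b powr s - a powr s = (b - a) * (s * z powr (s - 1))"
      using MVT2[OF ab(2), of "\<lambda>x. x powr s" "\<lambda>x. s * x powr (s - 1)"] ab
      by (metis DERIV_powr has_real_derivative_powr less_le_trans)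
    have "z powr (s - 1) \<le> b powr (s - 1)" using z ab assms by (intro powr_mono2) auto
    then have "(b - a) * (s * z powr (s - 1)) \<le> (b - a) * (s * b powr (s - 1))"
      using ab assms by (intro mult_left_mono) auto
    then show ?thesis using z(3) by (simp add: mult_ac)
  qed
  show ?thesis
  proof (cases x y rule: linorder_cases)
    case less
    then have "x powr s \<le> y powr s" using assms by (intro powr_mono2) auto
    then show ?thesis using *[of x y] less assms by (simp add: max_def)
  next
    case greater
    then have "y powr s \<le> x powr s" using assms by (intro powr_mono2) auto
    then show ?thesis using *[of y x] greater assms by (simp add: max_def)
  qed auto
qed

text \<open>The mean value theorem bounds the difference of weights by the power s - 1 of the larger
  one times \<open>wt (1/2) (k - l)\<close>. The larger one is at most twice the maximum of the
  weights at \<open>l\<close> and \<open>k - l\<close>, whence the factor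
  \<open>2 powr (s - 1)\<close>. In each resulting product one frequency carries the full power s
  and the other only one derivative.\<close>

lemma wt_commutator:
  assumes s: "1 \<le> s"
  shows "\<bar>wt (s / 2) k - wt (s / 2) l\<bar> * norm (freq l)
    \<le> s * 2 powr (s - 1) * (wt (1/2) (k - l) * wt (s / 2) l + wt (s / 2) (k - l) * wt (1/2) l)"
proof -
  define x y z where "x = wt (1/2) k" "y = wt (1/2) l" "z = wt (1/2) (k - l)"
  have pos: "0 < x" "0 < y" "0 < z" by (auto simp: x_y_z_def)
  have xy: "x \<le> y + z" using wt_half_triangle[of k l] norm_freq_le_wt[of "k - l"] by (simp add: x_y_z_def)
  have yx: "\<bar>x - y\<bar> \<le> z"
    using wt_half_triangle[of k l] wt_half_triangle[of l k] norm_freq_le_wt[of "k - l"] norm_freq_le_wt[of "l - k"]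
      wt_uminus[of "1/2" "k - l"]
    by (simp add: x_y_z_def abs_le_iff)
  have m: "max x y powr (s - 1) \<le> 2 powr (s - 1) * (y powr (s - 1) + z powr (s - 1))"
  proof -
    have "max x y \<le> 2 * max y z" using xy pos by auto
    then have "max x y powr (s - 1) \<le> (2 * max y z) powr (s - 1)"
      using pos s by (intro powr_mono2) auto
    also have "\<dots> = 2 powr (s - 1) * max y z powr (s - 1)" using pos by (simp add: powr_mult)
    also have "\<dots> \<le> 2 powr (s - 1) * (y powr (s - 1) + z powr (s - 1))"
      by (intro mult_left_mono) (auto simp: max_def)
    finally show ?thesis .
  qed
  have "\<bar>wt (s / 2) k - wt (s / 2) l\<bar> = \<bar>x powr s - y powr s\<bar>"
    using wt_half_eq[of s] by (simp add: x_y_z_def)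
  also have "\<dots> \<le> s * max x y powr (s - 1) * \<bar>x - y\<bar>" by (rule powr_diff_le) (use s pos in auto)
  also have "\<dots> \<le> s * (2 powr (s - 1) * (y powr (s - 1) + z powr (s - 1))) * z"
    using m s yx pos by (intro mult_mono mult_left_mono) auto
  finally have "\<bar>wt (s / 2) k - wt (s / 2) l\<bar> * norm (freq l)
     \<le> s * (2 powr (s - 1) * (y powr (s - 1) + z powr (s - 1))) * z * y"
    using norm_freq_le_wt[of l] pos s by (intro mult_mono) (auto simp: x_y_z_def)
  also have "\<dots> = s * 2 powr (s - 1) * (z * (y powr (s - 1) * y) + (z powr (s - 1) * z) * y)"
    by (simp add: algebra_simps)
  also have "y powr (s - 1) * y = y powr s" using pos by (simp add: powr_diff)
  also have "z powr (s - 1) * z = z powr s" using pos by (simp add: powr_diff)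
  finally show ?thesis using wt_half_eq[of s] by (simp add: x_y_z_def)
qed

text \<open>Numbers in [0,1] do not exceed their r-th powers; this is applied to 1/(1+x) and
  x/(1+x), which add up to 1.\<close>

lemma powr_1_plus_le:
  fixes x r :: real
  assumes "0 \<le> x" "0 < r" "r \<le> 1"
  shows "(1 + x) powr r \<le> 1 + x powr r"
proof -
  have *: "t \<le> t powr r" if "0 \<le> t" "t \<le> 1" for t :: real
    using powr_mono'[of r 1 t] that assms by (cases "t = 0") auto
  have "1 = 1 / (1 + x) + x / (1 + x)" using assms by (simp add: add_divide_distrib[symmetric])
  also have "\<dots> \<le> (1 / (1 + x)) powr r + (x / (1 + x)) powr r"
    using assms by (intro add_mono *) auto
  also have "\<dots> = (1 + x powr r) / (1 + x) powr r"
    using assms by (simp add: powr_divide add_divide_distrib)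
  finally show ?thesis using assms by (simp add: field_simps)
qed

text \<open>Compares the inhomogeneous weight with the homogeneous one of the fractional Laplacian.
  The loss of 1 reappears as the linear term of \<open>Eb\<close>.\<close>

lemma wt_le_1_plus:
  assumes "0 \<le> r" "r \<le> 1"
  shows "wt r k \<le> 1 + norm (freq k) powr (2 * r)"
proof (cases "r = 0")
  case False
  have "(1 + (norm (freq k))\<^sup>2) powr r \<le> 1 + ((norm (freq k))\<^sup>2) powr r"
    by (rule powr_1_plus_le) (use assms False in auto)
  also have "((norm (freq k))\<^sup>2) powr r = norm (freq k) powr (2 * r)"
    by (cases "k = 0") (auto simp: powr_powr simp flip: powr_numeral)
  finally show ?thesis by (simp add: wt_def)
qed simp

text \<open>The properties of the symbol that the analysis uses, demanded on the whole lattice. They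
  will be met by the magneto-geostrophic symbol on the frequency plane, continued by zero.\<close>

locale active_scalar =
  fixes M :: "int^3 \<Rightarrow> real^3" and CM \<kappa> \<gamma> s :: real
  assumes M_uminus: "\<And>k. M (- k) = M k"
    and M_div: "\<And>k. freq k \<bullet> M k = 0"
    and M_bound: "\<And>k. norm (M k) \<le> CM"
    and \<kappa>: "0 < \<kappa>" and \<gamma>: "0 < \<gamma>" "\<gamma> < 1" and s: "5 / 2 - \<gamma> < s"
begin

lemma CM_nonneg: "0 \<le> CM"
  using order_trans[OF norm_ge_zero M_bound[of 0]] .

lemma s_gt: "3 / 2 < s" "1 \<le> s" "0 < s - \<gamma>"
  using s \<gamma> by auto

text \<open>Incompressibility in frequency form: the derivative may be placed on the product or on
  the transported factor.\<close>

lemma M_shift: "freq k \<bullet> M (k - l) = freq l \<bullet> M (k - l)"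
  using M_div[of "k - l"] by (simp add: freq_diff inner_diff_left)

lemma abs_M_le: "\<bar>freq k \<bullet> M l\<bar> \<le> CM * norm (freq k)"
proof -
  have "\<bar>freq k \<bullet> M l\<bar> \<le> norm (freq k) * norm (M l)" by (rule Cauchy_Schwarz_ineq2)
  also have "\<dots> \<le> norm (freq k) * CM" by (intro mult_left_mono M_bound) auto
  finally show ?thesis by (simp add: mult.commute)
qed

text \<open>The squared constant of the embedding of H^(s+\<gamma>) into sequences with one summable
  derivative. The sum converges because s + \<gamma> - 1 > 3/2, which is the regularity
  hypothesis.\<close>

definition K2 :: real where "K2 = (\<Sum>\<^sub>\<infinity>k. wt (- (s + \<gamma> - 1)) k)"

lemma summable_K2: "wt (- (s + \<gamma> - 1)) summable_on UNIV"
  by (rule summable_wt) (use s in auto)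

lemma K2_pos: "0 < K2"
proof -
  have "sum (wt (- (s + \<gamma> - 1))) {0} \<le> K2"
    unfolding K2_def by (rule finite_sum_le_infsum[OF summable_K2]) auto
  then show ?thesis using less_le_trans[OF wt_pos[of "- (s + \<gamma> - 1)" 0]] by simp
qed

text \<open>Cauchy-Schwarz after splitting the exponent 1/2 into -(s + \<gamma> - 1)/2 and (s +
  \<gamma>)/2.\<close>

lemma l1_sq_le:
  assumes "finite F"
  shows "(\<Sum>k\<in>F. wt (1/2) k * norm (u k))\<^sup>2 \<le> K2 * (\<Sum>k\<in>F. wt (s + \<gamma>) k * (norm (u k))\<^sup>2)"
proof -
  let ?a = "\<lambda>k. wt (- (s + \<gamma> - 1) / 2) k" and ?b = "\<lambda>k. wt ((s + \<gamma>) / 2) k * norm (u k)"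
  have "wt (1/2) k * norm (u k) = ?a k * ?b k" for k
  proof -
    have e: "- (s + \<gamma> - 1) / 2 + (s + \<gamma>) / 2 = 1/2" by (simp add: field_simps)
    have "?a k * wt ((s + \<gamma>) / 2) k = wt (1/2) k" unfolding wt_add[symmetric] e ..
    then show ?thesis by (simp only: mult.assoc[symmetric])
  qed
  then have "(\<Sum>k\<in>F. wt (1/2) k * norm (u k))\<^sup>2 = (\<Sum>k\<in>F. ?a k * ?b k)\<^sup>2" by (simp only:)
  also have "\<dots> \<le> (\<Sum>k\<in>F. (?a k)\<^sup>2) * (\<Sum>k\<in>F. (?b k)\<^sup>2)"
    by (rule Cauchy_Schwarz_ineq_sum)
  also have "\<dots> = (\<Sum>k\<in>F. wt (- (s + \<gamma> - 1)) k) * (\<Sum>k\<in>F. wt (s + \<gamma>) k * (norm (u k))\<^sup>2)"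
    by (simp add: power_mult_distrib)
  also have "\<dots> \<le> K2 * (\<Sum>k\<in>F. wt (s + \<gamma>) k * (norm (u k))\<^sup>2)"
    unfolding K2_def using assms
    by (intro mult_right_mono finite_sum_le_infsum summable_K2 sum_nonneg) auto
  finally show ?thesis .
qed

text \<open>Up to the factor \<open>\<i>\<close>, which is kept outside, the coefficient of the
  divergence of the flux. \<open>M l * u l\<close> is the velocity, and both factors are restricted
  to the modes in \<open>F\<close>.\<close>

definition nlF :: "(int^3) set \<Rightarrow> (int^3 \<Rightarrow> complex) \<Rightarrow> int^3 \<Rightarrow> complex" where
  "nlF F u k = (\<Sum>l\<in>F. of_real (freq k \<bullet> M l) * u l * (if k - l \<in> F then u (k - l) else 0))"

definition Cc :: real where "Cc = 2 * CM * (s * 2 powr (s - 1))"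

lemma Cc_nonneg: "0 \<le> Cc"
  using CM_nonneg s_gt by (simp add: Cc_def)

text \<open>By antisymmetry of the triad coefficients, \<open>wt s k\<close> may be replaced by
  \<open>wt (s/2) k * (wt (s/2) k - wt (s/2) l)\<close>; this commutator gains the lost derivative.\<close>
lemma nonlinear_energy:
  assumes F: "finite F" and u0: "\<And>k. k \<notin> F \<Longrightarrow> u k = 0" and h: "hermitian u"
  shows "\<bar>\<Sum>k\<in>F. wt s k * Re (cnj (u k) * (\<i> * nlF F u k))\<bar>
    \<le> Cc * (\<Sum>k\<in>F. wt (1/2) k * norm (u k)) * (\<Sum>k\<in>F. wt s k * (norm (u k))\<^sup>2)"
proof -
  define A where "A k l = freq l \<bullet> M (k - l)" for k l
  define Z where "Z k l = \<i> * of_real (A k l) * cnj (u k) * u (k - l) * u l" for k l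
  have Asym: "A l k = A k l" for k l
    using M_shift[of k l] M_uminus[of "k - l"] by (simp add: A_def)
  have usym: "u (l - k) = cnj (u (k - l))" for k l
    using h[unfolded hermitian_def, rule_format, of "k - l"] by simp
  \<comment> \<open>Exchanging \<open>k\<close> and \<open>l\<close> conjugates a triad up to sign:
    \<open>A\<close> is symmetric because \<open>M\<close> is even and divergence free, and reality
    of \<open>u\<close> turns u(l - k) into the conjugate of u(k - l).\<close>
  have anti: "Re (Z l k) = - Re (Z k l)" for k l
  proof -
    have "Z l k = - cnj (Z k l)" by (simp add: Z_def Asym[of l k] usym[of l k] mult_ac)
    then show ?thesis by simp
  qed
  have nl: "nlF F u k = (\<Sum>l\<in>F. of_real (A k l) * u (k - l) * u l)" for k
  proof -
    let ?f = "\<lambda>l. of_real (freq k \<bullet> M l) * u l"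
    have "nlF F u k = (\<Sum>l\<in>F. ?f l * u (k - l))"
      unfolding nlF_def by (intro sum.cong refl) (auto simp: u0)
    also have "\<dots> = (\<Sum>l\<in>F. ?f (k - l) * u l)"
      by (rule sum_convolution_swap[symmetric]) (use F u0 in auto)
    finally show ?thesis by (simp add: A_def M_shift)
  qed
  define w where "w k = wt (s / 2) k" for k
  have ww: "w k * w k = wt s k" for k by (simp add: w_def flip: wt_add)
  have 1: "(\<Sum>k\<in>F. wt s k * Re (cnj (u k) * (\<i> * nlF F u k))) = (\<Sum>k\<in>F. \<Sum>l\<in>F. w k * w k * Re (Z k l))"
  proof (rule sum.cong[OF refl])
    fix k
    have "cnj (u k) * (\<i> * nlF F u k) = (\<Sum>l\<in>F. Z k l)"
      by (simp add: nl Z_def sum_distrib_left mult_ac)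
    then show "wt s k * Re (cnj (u k) * (\<i> * nlF F u k)) = (\<Sum>l\<in>F. w k * w k * Re (Z k l))"
      by (simp add: ww sum_distrib_left)
  qed
  have 2: "(\<Sum>k\<in>F. \<Sum>l\<in>F. w k * w l * Re (Z k l)) = 0"
  proof -
    have "(\<Sum>k\<in>F. \<Sum>l\<in>F. w k * w l * Re (Z k l)) = (\<Sum>l\<in>F. \<Sum>k\<in>F. w k * w l * Re (Z k l))"
      by (rule sum.swap)
    also have "\<dots> = (\<Sum>l\<in>F. \<Sum>k\<in>F. - (w l * w k * Re (Z l k)))"
    proof (intro sum.cong refl)
      fix k l
      show "w k * w l * Re (Z k l) = - (w l * w k * Re (Z l k))"
        using anti[of l k] by simp
    qed
    also have "\<dots> = - (\<Sum>l\<in>F. \<Sum>k\<in>F. w l * w k * Re (Z l k))"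
      by (simp only: sum_negf)
    finally show ?thesis by simp
  qed
  define v where "v k = w k * norm (u k)" for k
  define b where "b k = wt (1/2) k * norm (u k)" for k
  define C1 where "C1 = s * 2 powr (s - 1)"
  have C1: "0 \<le> C1" using s_gt by (simp add: C1_def)
  have v0: "v k = 0" if "k \<notin> F" for k using u0[OF that] by (simp add: v_def)
  have b0: "b k = 0" if "k \<notin> F" for k using u0[OF that] by (simp add: b_def)
  have vn: "0 \<le> v k" and bn: "0 \<le> b k" for k by (simp_all add: v_def b_def w_def)
  \<comment> \<open>The frequency in \<open>A k l\<close> is the lost derivative. The commutator
    bound absorbs it so that each product contains two square-summable factors \<open>v\<close> and
    one factor \<open>b\<close> measured in l^1.\<close>
  have term_le: "\<bar>w k * (w k - w l) * Re (Z k l)\<bar> \<le> CM * C1 * (v k * (b (k - l) * v l) + v k * (v (k - l) * b l))" for k l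
  proof -
    have "\<bar>Re (Z k l)\<bar> \<le> norm (Z k l)" by (rule abs_Re_le_cmod)
    also have "\<dots> = \<bar>A k l\<bar> * (norm (u k) * norm (u (k - l)) * norm (u l))" by (simp add: Z_def norm_mult)
    also have "\<dots> \<le> (CM * norm (freq l)) * (norm (u k) * norm (u (k - l)) * norm (u l))"
      unfolding A_def by (intro mult_right_mono abs_M_le) auto
    finally have z: "\<bar>Re (Z k l)\<bar> \<le> (CM * norm (freq l)) * (norm (u k) * norm (u (k - l)) * norm (u l))" .
    have "\<bar>w k * (w k - w l) * Re (Z k l)\<bar> = w k * \<bar>w k - w l\<bar> * \<bar>Re (Z k l)\<bar>"
      by (simp add: abs_mult w_def)
    also have "\<dots> \<le> w k * \<bar>w k - w l\<bar> * ((CM * norm (freq l)) * (norm (u k) * norm (u (k - l)) * norm (u l)))"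
      by (intro mult_left_mono z) (auto simp: w_def)
    also have "\<dots> = (CM * w k * (norm (u k) * norm (u (k - l)) * norm (u l))) * (\<bar>w k - w l\<bar> * norm (freq l))"
      by (simp add: mult_ac)
    also have "\<dots> \<le> (CM * w k * (norm (u k) * norm (u (k - l)) * norm (u l)))
       * (C1 * (wt (1/2) (k - l) * w l + w (k - l) * wt (1/2) l))"
      unfolding C1_def w_def using wt_commutator[OF s_gt(2), of k l] CM_nonneg by (intro mult_left_mono) auto
    also have "\<dots> = CM * C1 * (v k * (b (k - l) * v l) + v k * (v (k - l) * b l))"
      by (simp add: v_def b_def algebra_simps)
    finally show ?thesis .
  qed
  have "\<bar>\<Sum>k\<in>F. wt s k * Re (cnj (u k) * (\<i> * nlF F u k))\<bar> = \<bar>\<Sum>k\<in>F. \<Sum>l\<in>F. w k * (w k - w l) * Re (Z k l)\<bar>"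
    using 1 2 by (simp add: algebra_simps sum_subtractf)
  also have "\<dots> \<le> (\<Sum>k\<in>F. \<Sum>l\<in>F. CM * C1 * (v k * (b (k - l) * v l) + v k * (v (k - l) * b l)))"
    by (intro order_trans[OF sum_abs] sum_mono order_trans[OF sum_abs] term_le)
  also have "\<dots> = CM * C1 * ((\<Sum>k\<in>F. v k * (\<Sum>l\<in>F. b (k - l) * v l)) + (\<Sum>k\<in>F. v k * (\<Sum>l\<in>F. v (k - l) * b l)))"
    by (simp add: sum_distrib_left sum.distrib distrib_left mult_ac)
  \<comment> \<open>A convolution swap identifies the two sums; this is the factor 2 in
    \<open>Cc\<close>.\<close>
  also have "\<dots> = CM * C1 * (2 * (\<Sum>k\<in>F. \<Sum>l\<in>F. v k * (b l * v (k - l))))"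
  proof -
    have "(\<Sum>l\<in>F. b (k - l) * v l) = (\<Sum>l\<in>F. b l * v (k - l))" for k
      by (rule sum_convolution_swap) (use F v0 b0 in auto)
    then show ?thesis by (simp add: sum_distrib_left mult_ac)
  qed
  also have "\<dots> \<le> CM * C1 * (2 * ((\<Sum>l\<in>F. b l) * (\<Sum>k\<in>F. (v k)\<^sup>2)))"
    using sum_trilinear_le[of F v b, OF F vn v0 bn] CM_nonneg C1 by (intro mult_left_mono) auto
  also have "\<dots> = Cc * (\<Sum>l\<in>F. b l) * (\<Sum>k\<in>F. (v k)\<^sup>2)"
    by (simp add: Cc_def C1_def)
  also have "(\<Sum>k\<in>F. (v k)\<^sup>2) = (\<Sum>k\<in>F. wt s k * (norm (u k))\<^sup>2)"
    by (simp add: v_def w_def power_mult_distrib)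
  finally show ?thesis by (simp add: b_def)
qed

text \<open>Bound for the growth rate of the squared H^s norm while that norm squared is at most
  \<open>R\<close>. The terms stem from the low-frequency loss in the dissipation, from the
  nonlinearity after Young's inequality, and from the source.\<close>

definition Eb :: "real \<Rightarrow> real \<Rightarrow> real" where
  "Eb \<sigma> R = 2 * \<kappa> * R + 2 * Cc\<^sup>2 * K2 / \<kappa> * R\<^sup>2 + 2 * \<sigma>\<^sup>2 / \<kappa>"

text \<open>Before the factor 2, the dissipation contributes -\<kappa> D, and the nonlinear and
  source terms each take back a quarter of \<kappa> D. Half of the dissipation survives and later
  yields the bound in H^(s+\<gamma>).\<close>

lemma energy_rate:
  assumes F: "finite F" and u0: "\<And>k. k \<notin> F \<Longrightarrow> u k = 0" and h: "hermitian u"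
    and S: "(\<Sum>k\<in>F. wt (s - \<gamma>) k * (norm (S k))\<^sup>2) \<le> \<sigma>\<^sup>2"
    and R: "(\<Sum>k\<in>F. wt s k * (norm (u k))\<^sup>2) \<le> R"
  shows "(\<Sum>k\<in>F. wt s k * (2 * Re (cnj (u k) * (- of_real (\<kappa> * norm (freq k) powr (2 * \<gamma>)) * u k - \<i> * nlF F u k + S k))))
     \<le> Eb \<sigma> R - \<kappa> * (\<Sum>k\<in>F. wt (s + \<gamma>) k * (norm (u k))\<^sup>2)"
proof -
  define E where "E = (\<Sum>k\<in>F. wt s k * (norm (u k))\<^sup>2)"
  define D where "D = (\<Sum>k\<in>F. wt (s + \<gamma>) k * (norm (u k))\<^sup>2)"
  define B where "B = (\<Sum>k\<in>F. wt (1/2) k * norm (u k))"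
  have E0: "0 \<le> E" by (auto simp: E_def intro!: sum_nonneg)
  have diss: "D - E \<le> (\<Sum>k\<in>F. wt s k * (norm (freq k) powr (2 * \<gamma>) * (norm (u k))\<^sup>2))"
    unfolding D_def E_def sum_subtractf[symmetric]
  proof (rule sum_mono)
    fix k
    have "wt \<gamma> k - 1 \<le> norm (freq k) powr (2 * \<gamma>)" using wt_le_1_plus[of \<gamma> k] \<gamma> by simp
    then have "wt s k * (norm (u k))\<^sup>2 * (wt \<gamma> k - 1) \<le> wt s k * (norm (u k))\<^sup>2 * norm (freq k) powr (2 * \<gamma>)"
      by (intro mult_left_mono) auto
    then show "wt (s + \<gamma>) k * (norm (u k))\<^sup>2 - wt s k * (norm (u k))\<^sup>2
        \<le> wt s k * (norm (freq k) powr (2 * \<gamma>) * (norm (u k))\<^sup>2)"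
      by (simp add: wt_add algebra_simps)
  qed
  have nl: "- (\<Sum>k\<in>F. wt s k * Re (cnj (u k) * (\<i> * nlF F u k))) \<le> \<kappa> / 4 * D + Cc\<^sup>2 * K2 / \<kappa> * R\<^sup>2"
  proof -
    have "- (\<Sum>k\<in>F. wt s k * Re (cnj (u k) * (\<i> * nlF F u k))) \<le> Cc * B * E"
      using nonlinear_energy[OF F u0 h] by (simp add: B_def E_def)
    also have "\<dots> = B * (Cc * E)" by simp
    \<comment> \<open>Young's inequality, weighted so that the constant \<open>K2\<close> from
      \<open>l1_sq_le\<close> cancels and exactly \<open>\<kappa> / 4 * D\<close> remains.\<close>
    also have "\<dots> \<le> \<kappa> / (4 * K2) * B\<^sup>2 + K2 / \<kappa> * (Cc * E)\<^sup>2"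
    proof -
      have "0 \<le> (\<kappa> * B - 2 * K2 * (Cc * E))\<^sup>2" by simp
      then have "4 * K2 * \<kappa> * (B * (Cc * E)) \<le> \<kappa>\<^sup>2 * B\<^sup>2 + 4 * K2\<^sup>2 * (Cc * E)\<^sup>2"
        by (simp add: power2_diff power_mult_distrib algebra_simps)
      also have "\<dots> = 4 * K2 * \<kappa> * (\<kappa> / (4 * K2) * B\<^sup>2 + K2 / \<kappa> * (Cc * E)\<^sup>2)"
        using K2_pos \<kappa> by (simp add: field_simps power2_eq_square)
      finally show ?thesis
        using mult_le_cancel_left_pos[of "4 * K2 * \<kappa>"] K2_pos \<kappa> by simp
    qed
    also have "\<dots> \<le> \<kappa> / (4 * K2) * (K2 * D) + K2 / \<kappa> * (Cc * R)\<^sup>2"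
    proof (intro add_mono mult_left_mono)
      show "B\<^sup>2 \<le> K2 * D" unfolding B_def D_def by (rule l1_sq_le[OF F])
      show "(Cc * E)\<^sup>2 \<le> (Cc * R)\<^sup>2"
        using R E0 Cc_nonneg by (intro power_mono mult_left_mono) (auto simp: E_def)
    qed (use K2_pos \<kappa> in auto)
    also have "\<dots> = \<kappa> / 4 * D + Cc\<^sup>2 * K2 / \<kappa> * R\<^sup>2"
      using K2_pos by (simp add: power_mult_distrib)
    finally show ?thesis .
  qed
  \<comment> \<open>The source is measured in H^(s-\<gamma>) and the solution in H^(s+\<gamma>); the
    weight \<open>wt s\<close> is the product of the square roots of the two weights.\<close>
  have src: "(\<Sum>k\<in>F. wt s k * Re (cnj (u k) * S k)) \<le> \<kappa> / 4 * D + \<sigma>\<^sup>2 / \<kappa>"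
  proof -
    have "(\<Sum>k\<in>F. wt s k * Re (cnj (u k) * S k))
       \<le> (\<Sum>k\<in>F. \<kappa> / 4 * (wt (s + \<gamma>) k * (norm (u k))\<^sup>2) + 1 / \<kappa> * (wt (s - \<gamma>) k * (norm (S k))\<^sup>2))"
    proof (rule sum_mono)
      fix k
      define p q where "p = wt ((s + \<gamma>) / 2) k * norm (u k)" and "q = wt ((s - \<gamma>) / 2) k * norm (S k)"
      have w: "wt ((s + \<gamma>) / 2) k * wt ((s - \<gamma>) / 2) k = wt s k"
      proof -
        have "(s + \<gamma>) / 2 + (s - \<gamma>) / 2 = s" by (simp add: field_simps)
        then show ?thesis by (simp flip: wt_add)
      qed
      have "Re (cnj (u k) * S k) \<le> norm (u k) * norm (S k)"
        using complex_Re_le_cmod[of "cnj (u k) * S k"] by (simp add: norm_mult)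
      then have "wt s k * Re (cnj (u k) * S k) \<le> wt s k * (norm (u k) * norm (S k))"
        by (intro mult_left_mono) auto
      also have "\<dots> = p * q" by (simp add: p_def q_def w[symmetric] mult_ac)
      also have "\<dots> \<le> \<kappa> / 4 * p\<^sup>2 + 1 / \<kappa> * q\<^sup>2"
      proof -
        have "0 \<le> (\<kappa> * p - 2 * q)\<^sup>2" by simp
        then have "4 * \<kappa> * (p * q) \<le> \<kappa>\<^sup>2 * p\<^sup>2 + 4 * q\<^sup>2"
          by (simp add: power2_diff power_mult_distrib algebra_simps)
        also have "\<dots> = 4 * \<kappa> * (\<kappa> / 4 * p\<^sup>2 + 1 / \<kappa> * q\<^sup>2)"
          using \<kappa> by (simp add: field_simps power2_eq_square)
        finally show ?thesis using mult_le_cancel_left_pos[of "4 * \<kappa>"] \<kappa> by simp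
      qed
      also have "\<dots> = \<kappa> / 4 * (wt (s + \<gamma>) k * (norm (u k))\<^sup>2) + 1 / \<kappa> * (wt (s - \<gamma>) k * (norm (S k))\<^sup>2)"
        by (simp add: p_def q_def power_mult_distrib)
      finally show "wt s k * Re (cnj (u k) * S k)
        \<le> \<kappa> / 4 * (wt (s + \<gamma>) k * (norm (u k))\<^sup>2) + 1 / \<kappa> * (wt (s - \<gamma>) k * (norm (S k))\<^sup>2)" .
    qed
    also have "\<dots> = \<kappa> / 4 * D + 1 / \<kappa> * (\<Sum>k\<in>F. wt (s - \<gamma>) k * (norm (S k))\<^sup>2)"
      by (simp add: D_def sum.distrib sum_distrib_left)
    also have "\<dots> \<le> \<kappa> / 4 * D + 1 / \<kappa> * \<sigma>\<^sup>2"
      using S \<kappa> by (intro add_mono mult_left_mono) auto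
    finally show ?thesis by simp
  qed
  have "(\<Sum>k\<in>F. wt s k * (2 * Re (cnj (u k) * (- of_real (\<kappa> * norm (freq k) powr (2 * \<gamma>)) * u k - \<i> * nlF F u k + S k))))
    = 2 * (- \<kappa> * (\<Sum>k\<in>F. wt s k * (norm (freq k) powr (2 * \<gamma>) * (norm (u k))\<^sup>2))
        - (\<Sum>k\<in>F. wt s k * Re (cnj (u k) * (\<i> * nlF F u k))) + (\<Sum>k\<in>F. wt s k * Re (cnj (u k) * S k)))"
  proof -
    have "wt s k * (2 * Re (cnj (u k) * (- of_real (\<kappa> * norm (freq k) powr (2 * \<gamma>)) * u k - \<i> * nlF F u k + S k)))
      = 2 * (- \<kappa> * (wt s k * (norm (freq k) powr (2 * \<gamma>) * (norm (u k))\<^sup>2))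
         - wt s k * Re (cnj (u k) * (\<i> * nlF F u k)) + wt s k * Re (cnj (u k) * S k))" for k
      unfolding cmod_power2 by (simp add: power2_eq_square algebra_simps)
    then show ?thesis by (simp only: sum_distrib_left sum.distrib sum_subtractf distrib_left right_diff_distrib)
  qed
  also have "\<dots> = 2 * (- \<kappa> * (\<Sum>k\<in>F. wt s k * (norm (freq k) powr (2 * \<gamma>) * (norm (u k))\<^sup>2))
        + - (\<Sum>k\<in>F. wt s k * Re (cnj (u k) * (\<i> * nlF F u k))) + (\<Sum>k\<in>F. wt s k * Re (cnj (u k) * S k)))"
    by simp
  also have "\<dots> \<le> 2 * (- \<kappa> * (D - E) + (\<kappa> / 4 * D + Cc\<^sup>2 * K2 / \<kappa> * R\<^sup>2) + (\<kappa> / 4 * D + \<sigma>\<^sup>2 / \<kappa>))"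
  proof (rule mult_left_mono, intro add_mono nl src)
    show "- \<kappa> * (\<Sum>k\<in>F. wt s k * (norm (freq k) powr (2 * \<gamma>) * (norm (u k))\<^sup>2)) \<le> - \<kappa> * (D - E)"
      using mult_left_mono[OF diss less_imp_le[OF \<kappa>]] by (simp only: mult_minus_left neg_le_iff_le)
  qed simp
  also have "\<dots> \<le> 2 * (- \<kappa> * (D - R) + (\<kappa> / 4 * D + Cc\<^sup>2 * K2 / \<kappa> * R\<^sup>2) + (\<kappa> / 4 * D + \<sigma>\<^sup>2 / \<kappa>))"
    using R \<kappa> by (simp add: E_def)
  also have "\<dots> = Eb \<sigma> R - \<kappa> * D" by (simp add: Eb_def algebra_simps)
  finally show ?thesis by (simp add: D_def)
qed

end

subsection \<open>Galerkin approximation\<close>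

lemma summable_shift_int3:
  fixes f :: "int^3 \<Rightarrow> real"
  assumes "f summable_on UNIV"
  shows "(\<lambda>l. f (k - l)) summable_on UNIV" "(\<Sum>\<^sub>\<infinity>l. f (k - l)) = infsum f UNIV"
proof -
  have b: "bij (\<lambda>l. k - l)" by (rule bij_betw_byWitness[where f'="\<lambda>l. k - l"]) auto
  show "(\<lambda>l. f (k - l)) summable_on UNIV"
    using assms by (subst summable_on_reindex_bij_betw[OF b])
  show "(\<Sum>\<^sub>\<infinity>l. f (k - l)) = infsum f UNIV"
    by (rule infsum_reindex_bij_betw[OF b])
qed

text \<open>Tannery's theorem: outside a large cube the majorant has a small sum, and inside only
  finitely many limits are involved.\<close>

lemma infsum_dominated_convergence:
  fixes f :: "nat \<Rightarrow> int^3 \<Rightarrow> complex"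
  assumes b: "b summable_on UNIV" and le: "\<And>n k. norm (f n k) \<le> b k" and lim: "\<And>k. (\<lambda>n. f n k) \<longlonglongrightarrow> g k"
  shows "(\<lambda>n. \<Sum>\<^sub>\<infinity>k. f n k) \<longlonglongrightarrow> (\<Sum>\<^sub>\<infinity>k. g k)"
proof (rule LIMSEQ_I)
  fix e :: real assume e: "0 < e"
  have gle: "norm (g k) \<le> b k" for k
    by (rule tendsto_upperbound[OF tendsto_norm[OF lim]]) (use le in auto)
  have "\<forall>\<^sub>F m in sequentially. dist (infsum b (- cube m)) 0 < e / 3"
    using infsum_tail_cube[OF b] e by (intro tendstoD) auto
  then obtain m where "\<forall>n\<ge>m. dist (infsum b (- cube n)) 0 < e / 3"
    unfolding eventually_sequentially by blast
  then have m: "infsum b (- cube m) < e / 3"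
    by (metis abs_less_iff diff_zero dist_real_def order_refl)
  have split: "infsum h UNIV = sum h (cube m) + infsum h (- cube m) \<and> norm (infsum h (- cube m)) < e / 3"
    if h: "\<And>k. norm (h k) \<le> b k" for h :: "int^3 \<Rightarrow> complex"
  proof -
    have a: "(\<lambda>k. norm (h k)) summable_on A" for A
      by (rule summable_on_comparison_test[OF summable_on_subset_banach[OF b subset_UNIV]]) (use h in auto)
    have "infsum h (cube m \<union> - cube m) = infsum h (cube m) + infsum h (- cube m)"
      by (rule infsum_Un_disjoint) (auto intro: abs_summable_summable a)
    moreover have "norm (infsum h (- cube m)) \<le> infsum b (- cube m)"
      using norm_infsum_bound[OF a[of "- cube m"]] infsum_mono[OF a[of "- cube m"] summable_on_subset_banach[OF b subset_UNIV] h]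
      by linarith
    ultimately show ?thesis using m by simp
  qed
  have "(\<lambda>n. \<Sum>k\<in>cube m. f n k) \<longlonglongrightarrow> (\<Sum>k\<in>cube m. g k)"
    by (intro tendsto_sum lim)
  then obtain N where N: "\<And>n. n \<ge> N \<Longrightarrow> norm ((\<Sum>k\<in>cube m. f n k) - (\<Sum>k\<in>cube m. g k)) < e / 3"
    using LIMSEQ_D e by (metis divide_pos_pos zero_less_numeral)
  show "\<exists>N. \<forall>n\<ge>N. norm ((\<Sum>\<^sub>\<infinity>k. f n k) - (\<Sum>\<^sub>\<infinity>k. g k)) < e"
  proof (intro exI[of _ N] allI impI)
    fix n assume n: "N \<le> n"
    have "(\<Sum>\<^sub>\<infinity>k. f n k) - (\<Sum>\<^sub>\<infinity>k. g k)
      = ((\<Sum>k\<in>cube m. f n k) - (\<Sum>k\<in>cube m. g k)) + (infsum (f n) (- cube m) - infsum g (- cube m))"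
      using split[of "f n", OF le] split[of g, OF gle] by simp
    also have "norm \<dots> \<le> norm ((\<Sum>k\<in>cube m. f n k) - (\<Sum>k\<in>cube m. g k)) + (norm (infsum (f n) (- cube m)) + norm (infsum g (- cube m)))"
      by (intro norm_triangle_mono order_refl norm_triangle_ineq4)
    also have "\<dots> < e" using N[OF n] split[of "f n", OF le] split[of g, OF gle] by linarith
    finally show "norm ((\<Sum>\<^sub>\<infinity>k. f n k) - (\<Sum>\<^sub>\<infinity>k. g k)) < e" .
  qed
qed

lemma norm_le_of_weighted_sum:
  assumes "0 \<le> r" "wt r k * (norm (u k :: complex))\<^sup>2 \<le> R"
  shows "norm (u k) \<le> sqrt R" "(norm (u k))\<^sup>2 \<le> R * wt (- r) k"
proof -
  have "(norm (u k))\<^sup>2 \<le> wt r k * (norm (u k))\<^sup>2"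
    using mult_right_mono[OF wt_ge_1[OF assms(1), of k], of "(norm (u k))\<^sup>2"] by simp
  then show "norm (u k) \<le> sqrt R" using assms(2) real_le_rsqrt by force
  show "(norm (u k))\<^sup>2 \<le> R * wt (- r) k"
    using assms(2) by (simp add: wt_minus field_simps)
qed

context active_scalar
begin

definition nl :: "(int^3 \<Rightarrow> complex) \<Rightarrow> int^3 \<Rightarrow> complex" where
  "nl u k = (\<Sum>\<^sub>\<infinity>l. of_real (freq k \<bullet> M l) * u l * u (k - l))"

definition lin :: "int^3 \<Rightarrow> real" where
  "lin k = \<kappa> * norm (freq k) powr (2 * \<gamma>)"

lemma lin_nonneg: "0 \<le> lin k"
  using \<kappa> by (simp add: lin_def)

lemma lin_uminus [simp]: "lin (- k) = lin k"
  by (simp add: lin_def)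

lemma nlF_eq_nl:
  assumes "finite F" "\<And>k. k \<notin> F \<Longrightarrow> u k = 0"
  shows "nlF F u k = nl u k"
proof -
  have "nl u k = infsum (\<lambda>l. of_real (freq k \<bullet> M l) * u l * u (k - l)) F"
    unfolding nl_def by (rule infsum_cong_neutral) (use assms in auto)
  also have "\<dots> = nlF F u k"
    unfolding nlF_def using assms by (simp add: infsum_finite) (intro sum.cong refl, auto)
  finally show ?thesis by simp
qed

text \<open>Each coefficient satisfies |u(l)|^2 <= R \<open>wt (- s) l\<close>, and an
  arithmetic-geometric mean bound separates the two factors. The majorant depends on
  \<open>u\<close> only through \<open>R\<close>, so it dominates whole sequences of
  approximations.\<close>

lemma norm_nl_term_le:
  fixes u :: "int^3 \<Rightarrow> complex"
  assumes "\<And>k. wt s k * (norm (u k))\<^sup>2 \<le> R"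
  shows "norm (of_real (freq k \<bullet> M l) * u l * u (k - l)) \<le> CM * norm (freq k) * R * (wt (- s) l + wt (- s) (k - l))"
proof -
  have s0: "0 \<le> s" using s_gt by simp
  have "norm (u l) * norm (u (k - l)) \<le> (norm (u l))\<^sup>2 + (norm (u (k - l)))\<^sup>2"
    using sum_squares_bound[of "norm (u l)" "norm (u (k - l))"] mult_nonneg_nonneg[OF norm_ge_zero[of "u l"] norm_ge_zero[of "u (k - l)"]]
    by linarith
  also have "\<dots> \<le> R * wt (- s) l + R * wt (- s) (k - l)"
    by (intro add_mono norm_le_of_weighted_sum[OF s0 assms])
  finally have 1: "norm (u l) * norm (u (k - l)) \<le> R * (wt (- s) l + wt (- s) (k - l))" by (simp add: distrib_left)
  have "norm (of_real (freq k \<bullet> M l) * u l * u (k - l)) = \<bar>freq k \<bullet> M l\<bar> * (norm (u l) * norm (u (k - l)))"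
    by (simp add: norm_mult)
  also have "\<dots> \<le> (CM * norm (freq k)) * (R * (wt (- s) l + wt (- s) (k - l)))"
    by (rule mult_mono[OF abs_M_le 1]) (use CM_nonneg in auto)
  finally show ?thesis by (simp add: mult.assoc)
qed

lemma summable_nl_bound: "(\<lambda>l. C * (wt (- s) l + wt (- s) (k - l))) summable_on UNIV"
  using s_gt summable_wt[of s] summable_shift_int3[of "wt (- s)" k]
  by (intro summable_on_cmult_right summable_on_add) auto

lemma norm_nl_le:
  assumes "\<And>k. wt s k * (norm (u k))\<^sup>2 \<le> R"
  shows "norm (nl u k) \<le> CM * norm (freq k) * R * (2 * infsum (wt (- s)) UNIV)"
    and "(\<lambda>l. norm (of_real (freq k \<bullet> M l) * u l * u (k - l))) summable_on UNIV"
proof -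
  let ?b = "\<lambda>l. CM * norm (freq k) * R * (wt (- s) l + wt (- s) (k - l))"
  have ws: "wt (- s) summable_on UNIV" by (rule summable_wt) (use s_gt in auto)
  show a: "(\<lambda>l. norm (of_real (freq k \<bullet> M l) * u l * u (k - l))) summable_on UNIV"
    by (rule summable_on_comparison_test[OF summable_nl_bound]) (use norm_nl_term_le[OF assms] in auto)
  have "norm (nl u k) \<le> infsum ?b UNIV"
    unfolding nl_def
    using norm_infsum_bound[OF a] infsum_mono[OF a summable_nl_bound norm_nl_term_le[OF assms]] by linarith
  also have "infsum ?b UNIV = CM * norm (freq k) * R * (\<Sum>\<^sub>\<infinity>l. wt (- s) l + wt (- s) (k - l))"
    by (rule infsum_cmult_right) (use ws summable_shift_int3[OF ws, of k] in \<open>auto intro: summable_on_add\<close>)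
  also have "(\<Sum>\<^sub>\<infinity>l. wt (- s) l + wt (- s) (k - l)) = 2 * infsum (wt (- s)) UNIV"
    using infsum_add[OF ws summable_shift_int3(1)[OF ws, of k]] summable_shift_int3(2)[OF ws, of k] by simp
  finally show "norm (nl u k) \<le> CM * norm (freq k) * R * (2 * infsum (wt (- s)) UNIV)" .
qed

lemma norm_nlF_diff_le:
  assumes F: "finite F" and p: "\<And>l. l \<in> F \<Longrightarrow> norm (p l) \<le> \<rho>" and q: "\<And>l. l \<in> F \<Longrightarrow> norm (q l) \<le> \<rho>"
    and e: "\<And>l. l \<in> F \<Longrightarrow> norm (p l - q l) \<le> e" and k: "k \<in> F"
  shows "norm (nlF F p k - nlF F q k) \<le> real (card F) * (CM * norm (freq k) * (2 * \<rho> * e))"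
proof -
  have \<rho>0: "0 \<le> \<rho>" and e0: "0 \<le> e"
    using order_trans[OF norm_ge_zero p[OF k]] order_trans[OF norm_ge_zero e[OF k]] by auto
  have "nlF F p k - nlF F q k = (\<Sum>l\<in>F. of_real (freq k \<bullet> M l) * (p l * (if k - l \<in> F then p (k - l) else 0) - q l * (if k - l \<in> F then q (k - l) else 0)))"
    by (simp add: nlF_def sum_subtractf algebra_simps)
  also have "norm \<dots> \<le> (\<Sum>l\<in>F. CM * norm (freq k) * (2 * \<rho> * e))"
  proof (rule sum_norm_le)
    fix l assume l: "l \<in> F"
    have "norm (p l * (if k - l \<in> F then p (k - l) else 0) - q l * (if k - l \<in> F then q (k - l) else 0)) \<le> 2 * \<rho> * e"
    proof (cases "k - l \<in> F")
      case True
      have "p l * p (k - l) - q l * q (k - l) = p l * (p (k - l) - q (k - l)) + (p l - q l) * q (k - l)"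
        by (simp add: algebra_simps)
      also have "norm \<dots> \<le> norm (p l) * norm (p (k - l) - q (k - l)) + norm (p l - q l) * norm (q (k - l))"
        by (metis norm_mult norm_triangle_ineq)
      also have "\<dots> \<le> \<rho> * e + e * \<rho>"
        using p q e l True \<rho>0 e0 by (intro add_mono mult_mono) auto
      finally show ?thesis using True by simp
    qed (use \<rho>0 e0 in auto)
    then show "norm (of_real (freq k \<bullet> M l) * (p l * (if k - l \<in> F then p (k - l) else 0) - q l * (if k - l \<in> F then q (k - l) else 0)))
        \<le> CM * norm (freq k) * (2 * \<rho> * e)"
      unfolding norm_mult using abs_M_le CM_nonneg by (intro mult_mono) auto
  qed
  finally show ?thesis by simp
qed

text \<open>The nonlinearity is made globally Lipschitz by a retraction onto a ball that the a priori
  bound keeps the solution inside.\<close>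
lemma galerkin_exists:
  assumes F: "finite F" and Fs: "\<And>k. k \<in> F \<Longrightarrow> - k \<in> F" and h0: "hermitian \<theta>0"
    and E0: "\<And>G. finite G \<Longrightarrow> (\<Sum>k\<in>G. wt s k * (norm (\<theta>0 k))\<^sup>2) \<le> E0"
    and Sh: "\<And>t. t \<in> {0..T} \<Longrightarrow> hermitian (Sc t)"
    and Sm: "\<And>k. (\<lambda>t. Sc t k) \<in> borel_measurable (lebesgue_on {0..T})"
    and Sb: "\<And>t G. t \<in> {0..T} \<Longrightarrow> finite G \<Longrightarrow> (\<Sum>k\<in>G. wt (s - \<gamma>) k * (norm (Sc t k))\<^sup>2) \<le> \<sigma>\<^sup>2"
    and T: "0 < T" "T * Eb \<sigma> (E0 + 1) < 1"
  shows "\<exists>u. (\<forall>t\<in>{0..T}. hermitian (u t) \<and> (\<forall>k. k \<notin> F \<longrightarrow> u t k = 0) \<and>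
        (\<Sum>k\<in>F. wt s k * (norm (u t k))\<^sup>2) \<le> E0 + 1) \<and>
      (\<forall>k. continuous_on {0..T} (\<lambda>t. u t k)) \<and>
      (\<forall>k\<in>F. \<forall>t\<in>{0..T}. u t k = \<theta>0 k + integral {0..t} (\<lambda>\<tau>. - of_real (lin k) * u \<tau> k - \<i> * nl (u \<tau>) k + Sc \<tau> k)) \<and>
      \<kappa> * integral {0..T} (\<lambda>t. \<Sum>k\<in>F. wt (s + \<gamma>) k * (norm (u t k))\<^sup>2) \<le> E0 + 1"
proof -
  define R where "R = E0 + 1"
  have E00: "0 \<le> E0" using E0[of "{}"] by simp
  \<comment> \<open>As all weights are at least 1, each coefficient in the energy ball is at most
    \<open>sqrt R\<close>, so the l^1 sum over \<open>F\<close> stays below \<open>\<rho>\<close>.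
    The added 1 keeps it positive for empty \<open>F\<close>.\<close>
  define \<rho> where "\<rho> = real (card F) * sqrt R + 1"
  have \<rho>: "0 < \<rho>" using E00 by (simp add: \<rho>_def R_def add_nonneg_pos)
  define mx where "mx u = max \<rho> (\<Sum>l\<in>F. norm (u l))" for u :: "int^3 \<Rightarrow> complex"
  have mx: "\<rho> \<le> mx u" "0 < mx u" for u using \<rho> by (auto simp: mx_def)
  \<comment> \<open>Radial retraction onto the l^1 ball of radius \<open>\<rho>\<close>. It
    multiplies by a positive real number, hence preserves reality.\<close>
  define cut where "cut u k = of_real (\<rho> / mx u) * u k" for u :: "int^3 \<Rightarrow> complex" and k
  have cut_b: "norm (cut u k) \<le> \<rho>" if "k \<in> F" for u k
  proof -
    have "norm (u k) \<le> (\<Sum>l\<in>F. norm (u l))" by (rule member_le_sum) (use that F in auto)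
    also have "\<dots> \<le> mx u" by (simp add: mx_def)
    finally have "\<rho> / mx u * norm (u k) \<le> \<rho> / mx u * mx u" using \<rho> mx(2)[of u] by (intro mult_left_mono) auto
    moreover have "norm (cut u k) = \<rho> / mx u * norm (u k)"
      unfolding cut_def norm_mult norm_of_real using \<rho> mx(2)[of u] by simp
    ultimately show ?thesis using mx(2)[of u] by simp
  qed
  have cut_d: "norm (cut u k - cut v k) \<le> (real (card F) + 1) * d"
    if d: "\<And>l. l \<in> F \<Longrightarrow> norm (u l - v l) \<le> d" and k: "k \<in> F" for u v d k
  proof -
    have d0: "0 \<le> d" using order_trans[OF norm_ge_zero d[OF k]] .
    have m: "\<bar>mx u - mx v\<bar> \<le> real (card F) * d"
    proof -
      have "\<bar>mx u - mx v\<bar> \<le> \<bar>(\<Sum>l\<in>F. norm (u l)) - (\<Sum>l\<in>F. norm (v l))\<bar>"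
        by (simp add: mx_def max_def)
      also have "\<dots> \<le> (\<Sum>l\<in>F. \<bar>norm (u l) - norm (v l)\<bar>)"
        unfolding sum_subtractf[symmetric] by (rule sum_abs)
      also have "\<dots> \<le> (\<Sum>l\<in>F. d)" by (intro sum_mono order_trans[OF norm_triangle_ineq3 d])
      finally show ?thesis by simp
    qed
    have "norm (u k) \<le> mx u"
    proof -
      have "norm (u k) \<le> (\<Sum>l\<in>F. norm (u l))" by (rule member_le_sum) (use k F in auto)
      then show ?thesis by (simp add: mx_def)
    qed
    have "cut u k - cut v k = of_real (\<rho> / mx u - \<rho> / mx v) * u k + of_real (\<rho> / mx v) * (u k - v k)"
      by (simp add: cut_def algebra_simps diff_divide_distrib)
    also have "norm \<dots> \<le> \<bar>\<rho> / mx u - \<rho> / mx v\<bar> * norm (u k) + \<rho> / mx v * norm (u k - v k)"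
      using norm_triangle_ineq[of "of_real (\<rho> / mx u - \<rho> / mx v) * u k" "of_real (\<rho> / mx v) * (u k - v k)"] \<rho> mx(2)[of v]
      by (simp only: norm_mult norm_of_real abs_of_nonneg[of "\<rho> / mx v"] divide_nonneg_nonneg less_imp_le)
    also have "\<dots> \<le> real (card F) * d + 1 * d"
    proof (rule add_mono)
      show "\<rho> / mx v * norm (u k - v k) \<le> 1 * d"
        using mx[of v] d[OF k] d0 by (intro mult_mono) auto
      have "\<bar>\<rho> / mx u - \<rho> / mx v\<bar> * norm (u k) \<le> \<bar>\<rho> / mx u - \<rho> / mx v\<bar> * mx u"
        by (intro mult_left_mono \<open>norm (u k) \<le> mx u\<close>) auto
      also have "\<dots> = \<rho> / mx v * \<bar>mx u - mx v\<bar>"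
      proof -
        have "(\<rho> / mx u - \<rho> / mx v) * mx u = \<rho> / mx v * (mx v - mx u)"
          using mx(2)[of u] mx(2)[of v] by (simp add: field_simps)
        then show ?thesis
          using mx(2)[of u] mx(2)[of v] \<rho>
          by (metis abs_minus_commute abs_mult abs_of_nonneg divide_nonneg_nonneg less_imp_le)
      qed
      also have "\<dots> \<le> 1 * (real (card F) * d)"
        using m \<rho> mx[of v] by (intro mult_mono) auto
      finally show "\<bar>\<rho> / mx u - \<rho> / mx v\<bar> * norm (u k) \<le> real (card F) * d" by simp
    qed
    finally show ?thesis by (simp add: algebra_simps)
  qed
  have cut_id: "cut u = u" if "(\<Sum>k\<in>F. wt s k * (norm (u k))\<^sup>2) \<le> R" for u
  proof -
    have "norm (u k) \<le> sqrt R" if k: "k \<in> F" for k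
    proof -
      have "wt s k * (norm (u k))\<^sup>2 \<le> (\<Sum>k\<in>F. wt s k * (norm (u k))\<^sup>2)"
        by (rule member_le_sum) (use k F in auto)
      then show ?thesis using norm_le_of_weighted_sum(1)[of s k u R] \<open>_ \<le> R\<close> s_gt by auto
    qed
    then have "(\<Sum>l\<in>F. norm (u l)) \<le> (\<Sum>l\<in>F. sqrt R)" by (rule sum_mono)
    then have "mx u = \<rho>" by (simp add: mx_def \<rho>_def)
    then show ?thesis using \<rho> by (simp add: cut_def fun_eq_iff)
  qed
  have Sn: "norm (Sc t k) \<le> \<bar>\<sigma>\<bar>" if "t \<in> {0..T}" for t k
    using norm_le_of_weighted_sum(1)[of "s - \<gamma>" k "Sc t" "\<sigma>\<^sup>2"] Sb[OF that, of "{k}"] s_gt by simp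
  define u0 where "u0 k = (if k \<in> F then \<theta>0 k else 0)" for k
  define G where "G t u k = - of_real (lin k) * u k - \<i> * nlF F (cut u) k + Sc t k" for t u k
  \<comment> \<open>Reality and support are exactly what the energy estimate asks of the solution,
    so they are propagated through the iteration.\<close>
  define I where "I u \<longleftrightarrow> hermitian u \<and> (\<forall>k. k \<notin> F \<longrightarrow> u k = 0)" for u
  define L where "L = (\<Sum>k\<in>F. lin k + real (card F) * (CM * norm (freq k) * (2 * \<rho> * (real (card F) + 1)))) + 1"
  have Lt: "0 \<le> lin k + real (card F) * (CM * norm (freq k) * (2 * \<rho> * (real (card F) + 1)))" for k
    using lin_nonneg CM_nonneg \<rho> by (intro add_nonneg_nonneg mult_nonneg_nonneg) auto
  have L: "0 < L" unfolding L_def using Lt by (intro add_nonneg_pos sum_nonneg) auto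
  have Fi: "- k \<in> F \<longleftrightarrow> k \<in> F" for k using Fs[of k] Fs[of "- k"] by auto
  have nlF_herm: "nlF F v (- k) = - cnj (nlF F v k)" if "hermitian v" for v k
  proof -
    have "nlF F v (- k) = (\<Sum>l\<in>F. of_real (freq (- k) \<bullet> M (- l)) * v (- l) * (if - k - - l \<in> F then v (- k - - l) else 0))"
      unfolding nlF_def by (rule sum.reindex_bij_witness[of _ uminus uminus]) (use Fi in auto)
    also have "\<dots> = (\<Sum>l\<in>F. - cnj (of_real (freq k \<bullet> M l) * v l * (if k - l \<in> F then v (k - l) else 0)))"
    proof (rule sum.cong[OF refl])
      fix l
      have "v (- k - - l) = cnj (v (k - l))" "- k - - l \<in> F \<longleftrightarrow> k - l \<in> F"
        using that[unfolded hermitian_def, rule_format, of "k - l"] Fi[of "k - l"] by simp_all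
      then show "of_real (freq (- k) \<bullet> M (- l)) * v (- l) * (if - k - - l \<in> F then v (- k - - l) else 0)
         = - cnj (of_real (freq k \<bullet> M l) * v l * (if k - l \<in> F then v (k - l) else 0))"
        using that by (simp add: M_uminus hermitian_def)
    qed
    finally show ?thesis by (simp add: nlF_def sum_negf)
  qed
  have mx_um: "hermitian (cut u)" if "hermitian u" for u
    using that by (simp add: hermitian_def cut_def)
  have G_herm: "G t u (- k) = cnj (G t u k)" if "hermitian u" "t \<in> {0..T}" for t u k
    using that Sh[OF that(2)] nlF_herm[OF mx_um[OF that(1)], of k] by (simp add: G_def hermitian_def)
  have "\<exists>u. (\<forall>k\<in>F. continuous_on {0..T} (\<lambda>t. u t k)) \<and> (\<forall>t\<in>{0..T}. I (u t)) \<and>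
     (\<forall>t\<in>{0..T}. \<forall>k\<in>F. u t k = u0 k + integral {0..t} (\<lambda>\<tau>. G \<tau> (u \<tau>) k))"
  proof (rule picard[where L=L and B="(\<Sum>k\<in>F. norm (of_real (lin k) * u0 k) + norm (nlF F (cut u0) k)) + \<bar>\<sigma>\<bar>"])
    show "0 \<le> T" "0 < L" "finite F" using T L F by auto
    show "(\<lambda>t. G t (u t) k) \<in> borel_measurable (lebesgue_on {0..T})"
      if k: "k \<in> F" and c: "\<And>l. l \<in> F \<Longrightarrow> continuous_on {0..T} (\<lambda>t. u t l)" for u k
    proof -
      have "continuous_on {0..T} (\<lambda>t. cut (u t) l)" if "l \<in> F" for l
        unfolding cut_def mx_def using \<rho> by (intro continuous_intros c that) (auto simp: max_def)
      moreover have "continuous_on {0..T} (\<lambda>t. if k - l \<in> F then cut (u t) (k - l) else 0)" for l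
        using calculation by (cases "k - l \<in> F") auto
      ultimately have "continuous_on {0..T} (\<lambda>t. - of_real (lin k) * u t k - \<i> * nlF F (cut (u t)) k)"
        unfolding nlF_def by (intro continuous_intros c k) auto
      then show ?thesis unfolding G_def
        by (intro borel_measurable_add continuous_imp_measurable_Icc Sm)
    qed
    show "norm (G t u0 k) \<le> (\<Sum>k\<in>F. norm (of_real (lin k) * u0 k) + norm (nlF F (cut u0) k)) + \<bar>\<sigma>\<bar>"
      if "t \<in> {0..T}" "k \<in> F" for t k
    proof -
      have "norm (G t u0 k) \<le> norm (of_real (lin k) * u0 k) + norm (nlF F (cut u0) k) + norm (Sc t k)"
        unfolding G_def using norm_triangle_ineq[of "- of_real (lin k) * u0 k - \<i> * nlF F (cut u0) k" "Sc t k"]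
          norm_triangle_ineq4[of "- of_real (lin k) * u0 k" "\<i> * nlF F (cut u0) k"] by (simp add: norm_mult)
      also have "norm (of_real (lin k) * u0 k) + norm (nlF F (cut u0) k) \<le> (\<Sum>k\<in>F. norm (of_real (lin k) * u0 k) + norm (nlF F (cut u0) k))"
        using member_le_sum[of k F "\<lambda>k. norm (of_real (lin k) * u0 k) + norm (nlF F (cut u0) k)"] that F by simp
      finally show ?thesis using Sn[OF that(1), of k] by simp
    qed
    show "norm (G t u k - G t v k) \<le> L * d"
      if "t \<in> {0..T}" and k: "k \<in> F" and d: "\<And>l. l \<in> F \<Longrightarrow> norm (u l - v l) \<le> d" for t u v d k
    proof -
      have d0: "0 \<le> d" using order_trans[OF norm_ge_zero d[OF k]] .
      have "G t u k - G t v k = - of_real (lin k) * (u k - v k) - \<i> * (nlF F (cut u) k - nlF F (cut v) k)"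
        by (simp add: G_def algebra_simps)
      also have "norm \<dots> \<le> lin k * norm (u k - v k) + norm (nlF F (cut u) k - nlF F (cut v) k)"
        using norm_triangle_ineq4[of "- of_real (lin k) * (u k - v k)" "\<i> * (nlF F (cut u) k - nlF F (cut v) k)"] lin_nonneg[of k]
        by (simp add: norm_mult)
      also have "\<dots> \<le> lin k * d + real (card F) * (CM * norm (freq k) * (2 * \<rho> * ((real (card F) + 1) * d)))"
        by (intro add_mono mult_left_mono d k lin_nonneg norm_nlF_diff_le F cut_b cut_d)
      also have "\<dots> = (lin k + real (card F) * (CM * norm (freq k) * (2 * \<rho> * (real (card F) + 1)))) * d"
        by (simp add: algebra_simps)
      also have "\<dots> \<le> L * d"
      proof (intro mult_right_mono d0)
        have "lin k + real (card F) * (CM * norm (freq k) * (2 * \<rho> * (real (card F) + 1))) \<le> L - 1"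
          unfolding L_def using Lt F k by (simp add: member_le_sum[of k F "\<lambda>k. lin k + real (card F) * (CM * norm (freq k) * (2 * \<rho> * (real (card F) + 1)))"])
        then show "lin k + real (card F) * (CM * norm (freq k) * (2 * \<rho> * (real (card F) + 1))) \<le> L" by simp
      qed
      finally show ?thesis .
    qed
    show "I u0" using h0 Fi by (auto simp: I_def u0_def hermitian_def)
    show "I (\<lambda>k. if k \<in> F then u0 k + integral {0..t} (\<lambda>\<tau>. G \<tau> (u \<tau>) k) else u0 k)"
      if t: "t \<in> {0..T}" and Iu: "\<And>t. t \<in> {0..T} \<Longrightarrow> I (u t)" for u t
      unfolding I_def
    proof
      have "integral {0..t} (\<lambda>\<tau>. G \<tau> (u \<tau>) (- k)) = cnj (integral {0..t} (\<lambda>\<tau>. G \<tau> (u \<tau>) k))" for k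
        unfolding Henstock_Kurzweil_Integration.integral_cnj
        by (rule Henstock_Kurzweil_Integration.integral_cong) (use G_herm Iu t in \<open>auto simp: I_def\<close>)
      then show "hermitian (\<lambda>k. if k \<in> F then u0 k + integral {0..t} (\<lambda>\<tau>. G \<tau> (u \<tau>) k) else u0 k)"
        using h0 Fi by (simp add: hermitian_def u0_def)
      show "\<forall>k. k \<notin> F \<longrightarrow> (if k \<in> F then u0 k + integral {0..t} (\<lambda>\<tau>. G \<tau> (u \<tau>) k) else u0 k) = 0"
        by (simp add: u0_def)
    qed
    show "I y" if X: "\<And>n::nat. I (X n)" and lim: "\<And>k. (\<lambda>n. X n k) \<longlonglongrightarrow> y k" for X y
      unfolding I_def hermitian_def
    proof (intro conjI allI impI)
      fix k
      have "(\<lambda>n. X n (- k)) \<longlonglongrightarrow> cnj (y k)"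
        using tendsto_cnj[OF lim[of k]] X by (simp add: I_def hermitian_def)
      then show "y (- k) = cnj (y k)" using lim LIMSEQ_unique by blast
    next
      fix k assume "k \<notin> F"
      then have "(\<lambda>n. X n k) \<longlonglongrightarrow> 0" using X by (simp add: I_def)
      then show "y k = 0" using lim LIMSEQ_unique by blast
    qed
  qed
  then obtain u where uc: "\<And>k. k \<in> F \<Longrightarrow> continuous_on {0..T} (\<lambda>t. u t k)"
    and uI: "\<And>t. t \<in> {0..T} \<Longrightarrow> I (u t)"
    and ueq: "\<And>t k. t \<in> {0..T} \<Longrightarrow> k \<in> F \<Longrightarrow> u t k = u0 k + integral {0..t} (\<lambda>\<tau>. G \<tau> (u \<tau>) k)"
    by blast
  have uh: "hermitian (u t)" and uz: "\<And>k. k \<notin> F \<Longrightarrow> u t k = 0" if "t \<in> {0..T}" for t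
    using uI[OF that] by (auto simp: I_def)
  have uc': "continuous_on {0..T} (\<lambda>t. u t k)" for k
  proof (cases "k \<in> F")
    case False
    then show ?thesis using uz by (subst continuous_on_cong[OF refl, of _ _ "\<lambda>_. 0"]) auto
  qed (rule uc)
  define E where "E t = (\<Sum>k\<in>F. wt s k * (norm (u t k))\<^sup>2)" for t
  define D where "D t = (\<Sum>k\<in>F. wt (s + \<gamma>) k * (norm (u t k))\<^sup>2)" for t
  have Ec: "continuous_on {0..T} E" and Dc: "continuous_on {0..T} D"
    unfolding E_def D_def by (intro continuous_intros uc')+
  have Gm: "(\<lambda>t. G t (u t) k) \<in> borel_measurable (lebesgue_on {0..T})"
    and Gb: "\<exists>B. \<forall>t\<in>{0..T}. norm (G t (u t) k) \<le> B" if k: "k \<in> F" for k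
  proof -
    have "continuous_on {0..T} (\<lambda>t. cut (u t) l)" for l
      unfolding cut_def mx_def using \<rho> by (intro continuous_intros uc') (auto simp: max_def)
    moreover have "continuous_on {0..T} (\<lambda>t. if k - l \<in> F then cut (u t) (k - l) else 0)" for l
      using calculation by (cases "k - l \<in> F") auto
    ultimately have c: "continuous_on {0..T} (\<lambda>t. - of_real (lin k) * u t k - \<i> * nlF F (cut (u t)) k)"
      unfolding nlF_def by (intro continuous_intros uc') auto
    then show "(\<lambda>t. G t (u t) k) \<in> borel_measurable (lebesgue_on {0..T})" unfolding G_def
      by (intro borel_measurable_add continuous_imp_measurable_Icc Sm)
    obtain B where B: "\<And>t. t \<in> {0..T} \<Longrightarrow> norm (- of_real (lin k) * u t k - \<i> * nlF F (cut (u t)) k) \<le> B"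
      using continuous_on_compact_bound[OF compact_Icc c] by blast
    have "norm (G t (u t) k) \<le> B + \<bar>\<sigma>\<bar>" if "t \<in> {0..T}" for t
      unfolding G_def using B[OF that] Sn[OF that, of k] norm_triangle_ineq[of "- of_real (lin k) * u t k - \<i> * nlF F (cut (u t)) k" "Sc t k"]
      by linarith
    then show "\<exists>B. \<forall>t\<in>{0..T}. norm (G t (u t) k) \<le> B" by blast
  qed
  define H where "H \<tau> = (\<Sum>k\<in>F. wt s k * (2 * Re (cnj (u \<tau> k) * G \<tau> (u \<tau>) k)))" for \<tau>
  have u00: "u 0 k = u0 k" if "k \<in> F" for k using ueq[of 0 k] that T by simp
  have Eeq: "E t = E 0 + integral {0..t} H" and Hi: "H integrable_on {0..t}" if t: "t \<in> {0..T}" for t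
  proof -
    have *: "(norm (u t k))\<^sup>2 = (norm (u 0 k))\<^sup>2 + integral {0..t} (\<lambda>\<tau>. 2 * Re (cnj (u \<tau> k) * G \<tau> (u \<tau>) k)) \<and>
       (\<lambda>\<tau>. 2 * Re (cnj (u \<tau> k) * G \<tau> (u \<tau>) k)) integrable_on {0..t}" if k: "k \<in> F" for k
    proof -
      obtain B where B: "\<And>t. t \<in> {0..T} \<Longrightarrow> norm (G t (u t) k) \<le> B" using Gb[OF k] by blast
      have e: "u t k = u 0 k + integral {0..t} (\<lambda>\<tau>. G \<tau> (u \<tau>) k)" if "t \<in> {0..T}" for t
        using ueq[OF that k] u00[OF k] by simp
      show ?thesis
        using norm_sq_indefinite_integral[OF Gm[OF k] B, of "\<lambda>t. u t k" t] e t by blast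
    qed
    show "H integrable_on {0..t}"
      unfolding H_def by (intro integrable_sum F integrable_on_cmult_left) (use * in auto)
    have "integral {0..t} H = (\<Sum>k\<in>F. wt s k * integral {0..t} (\<lambda>\<tau>. 2 * Re (cnj (u \<tau> k) * G \<tau> (u \<tau>) k)))"
      unfolding H_def using * F by (subst Henstock_Kurzweil_Integration.integral_sum) (auto intro!: integrable_on_cmult_left simp del: mult_minus_left)
    also have "\<dots> = (\<Sum>k\<in>F. wt s k * (norm (u t k))\<^sup>2 - wt s k * (norm (u 0 k))\<^sup>2)"
    proof (rule sum.cong[OF refl])
      fix k assume "k \<in> F"
      then have "integral {0..t} (\<lambda>\<tau>. 2 * Re (cnj (u \<tau> k) * G \<tau> (u \<tau>) k)) = (norm (u t k))\<^sup>2 - (norm (u 0 k))\<^sup>2"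
        using * by fastforce
      then show "wt s k * integral {0..t} (\<lambda>\<tau>. 2 * Re (cnj (u \<tau> k) * G \<tau> (u \<tau>) k)) = wt s k * (norm (u t k))\<^sup>2 - wt s k * (norm (u 0 k))\<^sup>2"
        by (simp only: right_diff_distrib)
    qed
    finally show "E t = E 0 + integral {0..t} H" by (simp add: E_def sum_subtractf)
  qed
  have E0': "E 0 \<le> E0"
  proof -
    have "E 0 = (\<Sum>k\<in>F. wt s k * (norm (\<theta>0 k))\<^sup>2)"
      unfolding E_def by (intro sum.cong refl) (simp add: u00, simp add: u0_def)
    then show ?thesis using E0[OF F] by simp
  qed
  have Hle: "H \<tau> \<le> Eb \<sigma> R - \<kappa> * D \<tau>" if "\<tau> \<in> {0..T}" "E \<tau> \<le> R" for \<tau>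
  proof -
    have c: "cut (u \<tau>) = u \<tau>" using cut_id that(2) by (simp add: E_def)
    show ?thesis
      unfolding H_def D_def G_def lin_def c
      by (rule energy_rate[OF F]) (use uz[OF that(1)] uh[OF that(1)] Sb[OF that(1) F] that(2) in \<open>auto simp: E_def\<close>)
  qed
  have Dn: "0 \<le> D \<tau>" for \<tau> unfolding D_def by (intro sum_nonneg) auto
  have Di: "D integrable_on {0..t}" if "t \<in> {0..T}" for t
    using that by (intro integrable_continuous_real continuous_on_subset[OF Dc]) auto
  have Eb0: "0 \<le> Eb \<sigma> R" unfolding Eb_def R_def using \<kappa> K2_pos E00 by (intro add_nonneg_nonneg) auto
  have TR: "t * Eb \<sigma> R < 1" if "t \<in> {0..T}" for t
    using mult_right_mono[of t T "Eb \<sigma> R"] that Eb0 T by (simp add: R_def)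
  have step: "E t + \<kappa> * integral {0..t} D \<le> E0 + t * Eb \<sigma> R" if t: "t \<in> {0..T}" and le: "\<And>\<tau>. 0 \<le> \<tau> \<Longrightarrow> \<tau> < t \<Longrightarrow> E \<tau> \<le> R" for t
  proof -
    \<comment> \<open>The energy bound is assumed only strictly before \<open>t\<close>. Changing
      the integrand at that one point leaves the integral unchanged and makes the inequality hold on
      the closed interval.\<close>
    define H' where "H' \<tau> = (if \<tau> = t then Eb \<sigma> R - \<kappa> * D \<tau> else H \<tau>)" for \<tau>
    have "integral {0..t} H = integral {0..t} H'"
      by (rule integral_spike[of "{t}"]) (auto simp: H'_def)
    also have "\<dots> \<le> integral {0..t} (\<lambda>\<tau>. Eb \<sigma> R - \<kappa> * D \<tau>)"
    proof (rule integral_le)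
      show "H' integrable_on {0..t}"
        by (rule integrable_spike[OF Hi[OF t], of "{t}"]) (auto simp: H'_def)
      show "(\<lambda>\<tau>. Eb \<sigma> R - \<kappa> * D \<tau>) integrable_on {0..t}"
        by (intro integrable_diff integrable_on_mult_right Di t) auto
      show "H' \<tau> \<le> Eb \<sigma> R - \<kappa> * D \<tau>" if "\<tau> \<in> {0..t}" for \<tau>
        using Hle[of \<tau>] le[of \<tau>] that t by (auto simp: H'_def)
    qed
    also have "\<dots> = t * Eb \<sigma> R - \<kappa> * integral {0..t} D"
      using t by (subst Henstock_Kurzweil_Integration.integral_diff) (auto intro!: integrable_on_mult_right Di)
    finally show ?thesis using Eeq[OF t] E0' by linarith
  qed
  \<comment> \<open>As long as the energy is at most \<open>R = E0 + 1\<close>, it is bounded by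
    \<open>E0 + t * Eb \<sigma> R\<close>, which is strictly smaller than \<open>R\<close> by the
    choice of \<open>T\<close>.\<close>
  have ER: "E t < R" if t: "t \<in> {0..T}" for t
  proof (rule bootstrap[OF Ec _ t])
    fix t assume t: "t \<in> {0..T}" and le: "\<And>\<tau>. 0 \<le> \<tau> \<Longrightarrow> \<tau> < t \<Longrightarrow> E \<tau> \<le> R"
    have "0 \<le> \<kappa> * integral {0..t} D"
      using \<kappa> Dn by (intro mult_nonneg_nonneg Henstock_Kurzweil_Integration.integral_nonneg Di t) auto
    then show "E t < R" using step[OF t le] TR[OF t] by (simp add: R_def)
  qed
  have En: "0 \<le> E t" for t unfolding E_def by (intro sum_nonneg) auto
  have "E T + \<kappa> * integral {0..T} D \<le> E0 + T * Eb \<sigma> R"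
    using ER T by (intro step) (auto intro: less_imp_le)
  then have DT: "\<kappa> * integral {0..T} D \<le> E0 + 1" using En[of T] TR[of T] T by simp
  \<comment> \<open>Along the solution the retraction is the identity, so the modified system is the
    truncated equation itself.\<close>
  have eq': "u t k = \<theta>0 k + integral {0..t} (\<lambda>\<tau>. - of_real (lin k) * u \<tau> k - \<i> * nl (u \<tau>) k + Sc \<tau> k)"
    if "k \<in> F" "t \<in> {0..T}" for k t
  proof -
    have "integral {0..t} (\<lambda>\<tau>. G \<tau> (u \<tau>) k) = integral {0..t} (\<lambda>\<tau>. - of_real (lin k) * u \<tau> k - \<i> * nl (u \<tau>) k + Sc \<tau> k)"
    proof (rule Henstock_Kurzweil_Integration.integral_cong)
      fix \<tau> assume "\<tau> \<in> {0..t}"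
      then have \<tau>: "\<tau> \<in> {0..T}" using that by auto
      have "cut (u \<tau>) = u \<tau>" using cut_id ER[OF \<tau>] by (simp add: E_def)
      then show "G \<tau> (u \<tau>) k = - of_real (lin k) * u \<tau> k - \<i> * nl (u \<tau>) k + Sc \<tau> k"
        using nlF_eq_nl[OF F uz[OF \<tau>]] by (simp add: G_def)
    qed
    then show ?thesis using ueq[OF that(2,1)] that(1) by (simp add: u0_def)
  qed
  show ?thesis
    using uh uz uc' eq' DT less_imp_le[OF ER] unfolding E_def D_def R_def by (intro exI[of _ u]) auto
qed

end

subsection \<open>Compactness in the Fourier coefficients\<close>

text \<open>The extension step of the Arzela-Ascoli argument. Positivity of \<open>T\<close>
  guarantees a rational time that is close to \<open>t\<close> and lies in the interval.\<close>

lemma equi_lipschitz_convergent: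
  fixes f :: "nat \<Rightarrow> real \<Rightarrow> complex"
  assumes T: "0 < T" and L: "\<And>n t r. t \<in> {0..T} \<Longrightarrow> r \<in> {0..T} \<Longrightarrow> norm (f n t - f n r) \<le> L * \<bar>t - r\<bar>"
    and c: "\<And>r. r \<in> {0..T} \<inter> \<rat> \<Longrightarrow> convergent (\<lambda>n. f n r)" and t: "t \<in> {0..T}"
  shows "convergent (\<lambda>n. f n t)"
proof (rule Cauchy_convergent, rule metric_CauchyI)
  fix e :: real assume e: "0 < e"
  define K where "K = \<bar>L\<bar> + 1"
  have K: "0 < K" "L \<le> K" by (auto simp: K_def)
  define d where "d = e / (3 * K)"
  have d: "0 < d" using e K by (simp add: d_def)
  have "max 0 (t - d) < min T (t + d)" using t d T by auto
  then obtain r where r: "r \<in> \<rat>" "max 0 (t - d) < r" "r < min T (t + d)"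
    using Rats_dense_in_real by blast
  have rT: "r \<in> {0..T}" and rd: "\<bar>t - r\<bar> \<le> d" using r by auto
  have close: "norm (f n t - f n r) \<le> e / 3" for n
  proof -
    have "norm (f n t - f n r) \<le> L * \<bar>t - r\<bar>" by (rule L[OF t rT])
    also have "\<dots> \<le> K * d" using rd K by (intro mult_mono) auto
    also have "\<dots> = e / 3" using K by (simp add: d_def)
    finally show ?thesis .
  qed
  have "Cauchy (\<lambda>n. f n r)" using c[of r] rT r(1) by (intro convergent_Cauchy) auto
  then obtain N where N: "\<And>m n. m \<ge> N \<Longrightarrow> n \<ge> N \<Longrightarrow> dist (f m r) (f n r) < e / 3"
    using e metric_CauchyD[of "\<lambda>n. f n r" "e / 3"] by auto
  show "\<exists>N. \<forall>m\<ge>N. \<forall>n\<ge>N. dist (f m t) (f n t) < e"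
  proof (intro exI[of _ N] allI impI)
    fix m n assume mn: "N \<le> m" "N \<le> n"
    have "dist (f m t) (f n t) \<le> dist (f m t) (f m r) + dist (f m r) (f n r) + dist (f n r) (f n t)"
      by (meson add_right_mono dist_triangle order_trans)
    also have "\<dots> < e / 3 + e / 3 + e / 3"
      using close[of m] close[of n] N[OF mn] by (simp add: dist_norm norm_minus_commute)
    finally show "dist (f m t) (f n t) < e" by simp
  qed
qed

context active_scalar
begin

definition rhs :: "(real \<Rightarrow> int^3 \<Rightarrow> complex) \<Rightarrow> (real \<Rightarrow> int^3 \<Rightarrow> complex) \<Rightarrow> int^3 \<Rightarrow> real \<Rightarrow> complex" where
  "rhs Sc \<theta> k \<tau> = - of_real (lin k) * \<theta> \<tau> k - \<i> * nl (\<theta> \<tau>) k + Sc \<tau> k"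

text \<open>A Lipschitz constant in time for the coefficient at \<open>k\<close>. It grows with
  \<open>k\<close> but is independent of the truncation, which suffices for compactness mode by
  mode.\<close>

definition rhs_bound :: "real \<Rightarrow> real \<Rightarrow> int^3 \<Rightarrow> real" where
  "rhs_bound R \<sigma> k = lin k * sqrt R + CM * norm (freq k) * R * (2 * infsum (wt (- s)) UNIV) + \<bar>\<sigma>\<bar>"

lemma nl_measurable:
  fixes \<theta> :: "real \<Rightarrow> int^3 \<Rightarrow> complex"
  assumes "\<And>k. (\<lambda>t. \<theta> t k) \<in> borel_measurable (lebesgue_on {0..T})" "\<And>t k. t \<in> {0..T} \<Longrightarrow> wt s k * (norm (\<theta> t k))\<^sup>2 \<le> R"
  shows "(\<lambda>t. nl (\<theta> t) k) \<in> borel_measurable (lebesgue_on {0..T})"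
proof (rule borel_measurable_LIMSEQ_metric)
  show "(\<lambda>t. \<Sum>l\<in>cube n. of_real (freq k \<bullet> M l) * \<theta> t l * \<theta> t (k - l)) \<in> borel_measurable (lebesgue_on {0..T})" for n
    using assms(1) by measurable
  show "(\<lambda>n. \<Sum>l\<in>cube n. of_real (freq k \<bullet> M l) * \<theta> t l * \<theta> t (k - l)) \<longlonglongrightarrow> nl (\<theta> t) k"
    if "t \<in> space (lebesgue_on {0..T})" for t
  proof -
    have "wt s l * (norm (\<theta> t l))\<^sup>2 \<le> R" for l using that assms(2) by simp
    from norm_nl_le(2)[OF this] show ?thesis
      unfolding nl_def by (rule infsum_cube[OF abs_summable_summable])
  qed
qed

lemma rhs_measurable:
  fixes \<theta> :: "real \<Rightarrow> int^3 \<Rightarrow> complex"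
  assumes "\<And>k. (\<lambda>t. \<theta> t k) \<in> borel_measurable (lebesgue_on {0..T})" "\<And>t k. t \<in> {0..T} \<Longrightarrow> wt s k * (norm (\<theta> t k))\<^sup>2 \<le> R"
    and "(\<lambda>t. Sc t k) \<in> borel_measurable (lebesgue_on {0..T})"
  shows "rhs Sc \<theta> k \<in> borel_measurable (lebesgue_on {0..T})"
proof -
  have "(\<lambda>t. - of_real (lin k) * \<theta> t k) \<in> borel_measurable (lebesgue_on {0..T})"
    using assms(1) by measurable
  moreover have "(\<lambda>t. \<i> * nl (\<theta> t) k) \<in> borel_measurable (lebesgue_on {0..T})"
    using nl_measurable[where \<theta>=\<theta> and R=R, OF assms(1,2)] by measurable
  ultimately show ?thesis
    unfolding rhs_def[abs_def] by (intro borel_measurable_add borel_measurable_diff assms(3))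
qed

lemma norm_rhs_le:
  assumes "\<And>k. wt s k * (norm (\<theta> t k))\<^sup>2 \<le> R" "norm (Sc t k) \<le> \<bar>\<sigma>\<bar>"
  shows "norm (rhs Sc \<theta> k t) \<le> rhs_bound R \<sigma> k"
proof -
  have "norm (rhs Sc \<theta> k t) \<le> norm (of_real (lin k) * \<theta> t k) + norm (nl (\<theta> t) k) + norm (Sc t k)"
    unfolding rhs_def using norm_triangle_ineq[of "- of_real (lin k) * \<theta> t k - \<i> * nl (\<theta> t) k" "Sc t k"]
      norm_triangle_ineq4[of "- of_real (lin k) * \<theta> t k" "\<i> * nl (\<theta> t) k"] by (simp add: norm_mult)
  also have "norm (of_real (lin k) * \<theta> t k) \<le> lin k * sqrt R"
    using norm_le_of_weighted_sum(1)[of s k "\<theta> t" R] assms(1) s_gt lin_nonneg[of k]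
    by (simp add: norm_mult mult_left_mono)
  also have "norm (nl (\<theta> t) k) \<le> CM * norm (freq k) * R * (2 * infsum (wt (- s)) UNIV)"
    by (rule norm_nl_le[OF assms(1)])
  finally show ?thesis using assms(2) by (simp add: rhs_bound_def)
qed

text \<open>The Cauchy problem as integral equations for the coefficients. The H^s bound is phrased
  by finite partial sums, since these pass to modewise limits.\<close>

definition coef_solution :: "(int^3) set \<Rightarrow> real \<Rightarrow> (int^3 \<Rightarrow> complex) \<Rightarrow> (real \<Rightarrow> int^3 \<Rightarrow> complex) \<Rightarrow> real \<Rightarrow> (real \<Rightarrow> int^3 \<Rightarrow> complex) \<Rightarrow> bool" where
  "coef_solution P T \<theta>0 Sc C \<theta> \<longleftrightarrow>
     (\<forall>t\<in>{0..T}. hermitian (\<theta> t) \<and> (\<forall>k. k \<notin> P \<longrightarrow> \<theta> t k = 0) \<and>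
        (\<forall>F. finite F \<longrightarrow> (\<Sum>k\<in>F. wt s k * (norm (\<theta> t k))\<^sup>2) \<le> C)) \<and>
     (\<forall>k. continuous_on {0..T} (\<lambda>t. \<theta> t k)) \<and>
     (\<forall>k. \<forall>t\<in>{0..T}. \<theta> t k = \<theta>0 k + integral {0..t} (rhs Sc \<theta> k))"

lemma coef_solution_exists:
  assumes P: "\<And>k. k \<in> P \<Longrightarrow> - k \<in> P" "\<And>k l. k \<in> P \<Longrightarrow> l \<in> P \<Longrightarrow> k + l \<in> P"
    and h0: "hermitian \<theta>0" and P0: "\<And>k. k \<notin> P \<Longrightarrow> \<theta>0 k = 0"
    and E0: "\<And>G. finite G \<Longrightarrow> (\<Sum>k\<in>G. wt s k * (norm (\<theta>0 k))\<^sup>2) \<le> E0"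
    and Sh: "\<And>t. t \<in> {0..T} \<Longrightarrow> hermitian (Sc t)"
    and Sm: "\<And>k. (\<lambda>t. Sc t k) \<in> borel_measurable (lebesgue_on {0..T})"
    and Sb: "\<And>t G. t \<in> {0..T} \<Longrightarrow> finite G \<Longrightarrow> (\<Sum>k\<in>G. wt (s - \<gamma>) k * (norm (Sc t k))\<^sup>2) \<le> \<sigma>\<^sup>2"
    and SP: "\<And>t k. t \<in> {0..T} \<Longrightarrow> k \<notin> P \<Longrightarrow> Sc t k = 0"
    and T: "0 < T" "T * Eb \<sigma> (E0 + 1) < 1"
  shows "\<exists>\<theta>. coef_solution P T \<theta>0 Sc (E0 + 1) \<theta> \<and>
     (\<forall>F. finite F \<longrightarrow> \<kappa> * integral {0..T} (\<lambda>t. \<Sum>k\<in>F. wt (s + \<gamma>) k * (norm (\<theta> t k))\<^sup>2) \<le> E0 + 1)"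
proof -
  define R where "R = E0 + 1"
  define F where "F n = cube n \<inter> P" for n
  have F: "finite (F n)" "\<And>k. k \<in> F n \<Longrightarrow> - k \<in> F n" for n using P(1) by (auto simp: F_def)
  have Sn: "norm (Sc t k) \<le> \<bar>\<sigma>\<bar>" if "t \<in> {0..T}" for t k
    using norm_le_of_weighted_sum(1)[of "s - \<gamma>" k "Sc t" "\<sigma>\<^sup>2"] Sb[OF that, of "{k}"] s_gt by simp
  define Q where "Q n u \<longleftrightarrow> (\<forall>t\<in>{0..T}. hermitian (u t) \<and> (\<forall>k. k \<notin> F n \<longrightarrow> u t k = 0) \<and>
        (\<Sum>k\<in>F n. wt s k * (norm (u t k))\<^sup>2) \<le> E0 + 1) \<and>
      (\<forall>k. continuous_on {0..T} (\<lambda>t. u t k)) \<and>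
      (\<forall>k\<in>F n. \<forall>t\<in>{0..T}. u t k = \<theta>0 k + integral {0..t} (\<lambda>\<tau>. - of_real (lin k) * u \<tau> k - \<i> * nl (u \<tau>) k + Sc \<tau> k)) \<and>
      \<kappa> * integral {0..T} (\<lambda>t. \<Sum>k\<in>F n. wt (s + \<gamma>) k * (norm (u t k))\<^sup>2) \<le> E0 + 1" for n u
  have "\<forall>n. \<exists>u. Q n u"
    unfolding Q_def by (intro allI galerkin_exists[where \<sigma>=\<sigma>] F h0 E0 Sh Sm Sb T)
  then obtain u where "\<forall>n. Q n (u n)" by metis
  then have u: "Q n (u n)" for n by blast
  have uh: "hermitian (u n t)" and uz: "\<And>k. k \<notin> F n \<Longrightarrow> u n t k = 0" and uR: "(\<Sum>k\<in>F n. wt s k * (norm (u n t k))\<^sup>2) \<le> R"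
    if "t \<in> {0..T}" for n t using u[of n] that by (auto simp: Q_def R_def)
  have uc: "continuous_on {0..T} (\<lambda>t. u n t k)" for n k using u[of n] by (auto simp: Q_def)
  have ueq: "u n t k = \<theta>0 k + integral {0..t} (rhs Sc (u n) k)" if "k \<in> F n" "t \<in> {0..T}" for n k t
    using u[of n] that unfolding rhs_def[abs_def] Q_def by blast
  have uD: "\<kappa> * integral {0..T} (\<lambda>t. \<Sum>k\<in>F n. wt (s + \<gamma>) k * (norm (u n t k))\<^sup>2) \<le> R" for n
    using u[of n] by (auto simp: Q_def R_def)
  have uG: "(\<Sum>k\<in>G. wt s k * (norm (u n t k))\<^sup>2) \<le> R" if "t \<in> {0..T}" "finite G" for n t G
  proof -
    have "(\<Sum>k\<in>G. wt s k * (norm (u n t k))\<^sup>2) = (\<Sum>k\<in>G \<inter> F n. wt s k * (norm (u n t k))\<^sup>2)"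
      by (rule sum.mono_neutral_right) (use that uz[OF that(1)] in auto)
    also have "\<dots> \<le> (\<Sum>k\<in>F n. wt s k * (norm (u n t k))\<^sup>2)"
      by (rule sum_mono2) (use F in auto)
    finally show ?thesis using uR[OF that(1), of n] by simp
  qed
  have uk: "wt s k * (norm (u n t k))\<^sup>2 \<le> R" if "t \<in> {0..T}" for n t k
    using uG[OF that, of "{k}"] by simp
  have R0: "0 \<le> R" using uG[of 0 "{}"] T by simp
  have un: "norm (u n t k) \<le> sqrt R" if "t \<in> {0..T}" for n t k
    using norm_le_of_weighted_sum(1)[of s k "u n t" R] uk[OF that] s_gt by simp
  have rm: "rhs Sc (u n) k \<in> borel_measurable (lebesgue_on {0..T})" for n k
    by (rule rhs_measurable[where \<theta>="u n" and R=R]) (use continuous_imp_measurable_Icc[OF uc] uk Sm in auto)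
  have rb: "norm (rhs Sc (u n) k t) \<le> rhs_bound R \<sigma> k" if "t \<in> {0..T}" for n k t
    by (rule norm_rhs_le[where \<theta>="u n"]) (use uk[OF that] Sn[OF that] in auto)
  have rb0: "0 \<le> rhs_bound R \<sigma> k" for k using order_trans[OF norm_ge_zero rb[of 0 0 k]] T by simp
  have ri: "rhs Sc (u n) k integrable_on {a..b}" if "0 \<le> a" "b \<le> T" for n k a b
    by (rule bounded_measurable_integrable_on[OF rm rb that])
  have lip1: "norm (u n b k - u n a k) \<le> rhs_bound R \<sigma> k * (b - a)" if ab: "0 \<le> a" "a \<le> b" "b \<le> T" for n a b k
  proof (cases "k \<in> F n")
    case True
    have "u n b k - u n a k = integral {a..b} (rhs Sc (u n) k)"
      using ueq[OF True, of a] ueq[OF True, of b] integral_diff_interval[OF ri, of b a] ab by simp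
    then show ?thesis using norm_integral_le_bound[OF ri[OF ab(1,3)] rb ab(2)] ab by auto
  next
    case False
    then show ?thesis using uz[of a k n] uz[of b k n] ab rb0[of k] by simp
  qed
  have lip: "norm (u n t k - u n r k) \<le> rhs_bound R \<sigma> k * \<bar>t - r\<bar>" if "t \<in> {0..T}" "r \<in> {0..T}" for n t r k
    using lip1[of r t n k] lip1[of t r n k] that by (cases "r \<le> t") (auto simp: norm_minus_commute)
  \<comment> \<open>Indexing by pairs of a rational time and a frequency lets one subsequence serve
    all frequencies.\<close>
  have "countable (({0..T} \<inter> \<rat>) \<times> (UNIV :: (int^3) set))"
    by (intro countable_SIGMA countable_Int2 countable_rat) auto
  moreover have "norm (u n (fst x) (snd x)) \<le> sqrt R" if "x \<in> ({0..T} \<inter> \<rat>) \<times> (UNIV :: (int^3) set)" for n x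
    using un that by auto
  ultimately obtain r where r: "strict_mono r"
    and rl: "\<And>x. x \<in> ({0..T} \<inter> \<rat>) \<times> (UNIV :: (int^3) set) \<Longrightarrow> \<exists>l. (\<lambda>n. u (r n) (fst x) (snd x)) \<longlonglongrightarrow> l"
    using function_convergent_subsequence[of "({0..T} \<inter> \<rat>) \<times> UNIV" "\<lambda>n x. u n (fst x) (snd x)" "sqrt R"] by metis
  have conv: "convergent (\<lambda>n. u (r n) t k)" if "t \<in> {0..T}" for t k
  proof (rule equi_lipschitz_convergent[OF T(1) _ _ that])
    show "norm (u (r n) t k - u (r n) q k) \<le> rhs_bound R \<sigma> k * \<bar>t - q\<bar>" if "t \<in> {0..T}" "q \<in> {0..T}" for n t q
      by (rule lip[OF that])
    show "convergent (\<lambda>n. u (r n) q k)" if "q \<in> {0..T} \<inter> \<rat>" for q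
      using rl[of "(q, k)"] that by (auto simp: convergent_def)
  qed
  define \<theta> where "\<theta> t k = lim (\<lambda>n. u (r n) t k)" for t k
  have lim: "(\<lambda>n. u (r n) t k) \<longlonglongrightarrow> \<theta> t k" if "t \<in> {0..T}" for t k
    using conv[OF that] by (simp add: \<theta>_def convergent_LIMSEQ_iff)
  have th: "hermitian (\<theta> t)" if "t \<in> {0..T}" for t
    unfolding hermitian_def
  proof
    fix k
    have "(\<lambda>n. u (r n) t (- k)) \<longlonglongrightarrow> cnj (\<theta> t k)"
      using tendsto_cnj[OF lim[OF that, of k]] uh[OF that] by (simp add: hermitian_def)
    then show "\<theta> t (- k) = cnj (\<theta> t k)" using lim[OF that] LIMSEQ_unique by blast
  qed
  have tz: "\<theta> t k = 0" if "t \<in> {0..T}" "k \<notin> P" for t k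
  proof -
    have "u (r n) t k = 0" for n using uz[OF that(1), of k "r n"] that(2) by (simp add: F_def)
    then show ?thesis using lim[OF that(1), of k] LIMSEQ_unique[OF tendsto_const] by force
  qed
  have tG: "(\<Sum>k\<in>G. wt s k * (norm (\<theta> t k))\<^sup>2) \<le> R" if "t \<in> {0..T}" "finite G" for t G
  proof (rule tendsto_upperbound)
    show "(\<lambda>n. \<Sum>k\<in>G. wt s k * (norm (u (r n) t k))\<^sup>2) \<longlonglongrightarrow> (\<Sum>k\<in>G. wt s k * (norm (\<theta> t k))\<^sup>2)"
      by (intro tendsto_intros lim that)
  qed (use uG[OF that] in auto)
  have tlip: "norm (\<theta> t k - \<theta> q k) \<le> rhs_bound R \<sigma> k * \<bar>t - q\<bar>" if "t \<in> {0..T}" "q \<in> {0..T}" for t q k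
  proof (rule tendsto_upperbound)
    show "(\<lambda>n. norm (u (r n) t k - u (r n) q k)) \<longlonglongrightarrow> norm (\<theta> t k - \<theta> q k)"
      by (intro tendsto_intros lim that)
  qed (use lip[OF that] in auto)
  have tc: "continuous_on {0..T} (\<lambda>t. \<theta> t k)" for k
  proof (rule lipschitz_on_continuous_on)
    show "(rhs_bound R \<sigma> k)-lipschitz_on {0..T} (\<lambda>t. \<theta> t k)"
      by (rule lipschitz_onI) (use tlip rb0 in \<open>auto simp: dist_norm\<close>)
  qed
  \<comment> \<open>Modewise convergence is enough for the quadratic term, because the majorant of
    its summands is the same for all approximations.\<close>
  have nlim: "(\<lambda>n. nl (u (r n) t) k) \<longlonglongrightarrow> nl (\<theta> t) k" if "t \<in> {0..T}" for t k
    unfolding nl_def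
    by (rule infsum_dominated_convergence[OF summable_nl_bound[of "CM * norm (freq k) * R"]])
       (use norm_nl_term_le[OF uk[OF that]] lim[OF that] in \<open>auto intro!: tendsto_intros\<close>)
  have rlim: "(\<lambda>n. rhs Sc (u (r n)) k t) \<longlonglongrightarrow> rhs Sc \<theta> k t" if "t \<in> {0..T}" for t k
    unfolding rhs_def by (intro tendsto_intros lim nlim that)
  have rF: "\<forall>\<^sub>F n in sequentially. k \<in> F (r n)" if "k \<in> P" for k
    using filterlim_subseq[OF r] eventually_cube[of k] that unfolding filterlim_iff F_def by auto
  have teq: "\<theta> t k = \<theta>0 k + integral {0..t} (rhs Sc \<theta> k)" if t: "t \<in> {0..T}" for t k
  proof (cases "k \<in> P")
    case True
    have "(\<lambda>n. integral {0..t} (rhs Sc (u (r n)) k)) \<longlonglongrightarrow> integral {0..t} (rhs Sc \<theta> k)"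
    proof (rule dominated_convergence(2)[where h="\<lambda>_. rhs_bound R \<sigma> k"])
      show "rhs Sc (u (r n)) k integrable_on {0..t}" for n using t by (intro ri) auto
      show "norm (rhs Sc (u (r n)) k x) \<le> rhs_bound R \<sigma> k" if "x \<in> {0..t}" for n x
        using that t by (intro rb) auto
      show "(\<lambda>n. rhs Sc (u (r n)) k x) \<longlonglongrightarrow> rhs Sc \<theta> k x" if "x \<in> {0..t}" for x
        using that t by (intro rlim) auto
    qed auto
    then have "(\<lambda>n. \<theta>0 k + integral {0..t} (rhs Sc (u (r n)) k)) \<longlonglongrightarrow> \<theta>0 k + integral {0..t} (rhs Sc \<theta> k)"
      by (intro tendsto_intros)
    moreover have "\<forall>\<^sub>F n in sequentially. \<theta>0 k + integral {0..t} (rhs Sc (u (r n)) k) = u (r n) t k"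
      using rF[OF True] by eventually_elim (simp add: ueq[OF _ t])
    ultimately have "(\<lambda>n. u (r n) t k) \<longlonglongrightarrow> \<theta>0 k + integral {0..t} (rhs Sc \<theta> k)"
      by (rule Lim_transform_eventually)
    then show ?thesis using lim[OF t] LIMSEQ_unique by blast
  next
    case False
    have "rhs Sc \<theta> k \<tau> = 0" if "\<tau> \<in> {0..T}" for \<tau>
    proof -
      \<comment> \<open>If \<open>l\<close> and \<open>k - l\<close> were both in \<open>P\<close>,
        so would be their sum \<open>k\<close>. Interactions therefore never excite a mode outside
        \<open>P\<close>.\<close>
      have "of_real (freq k \<bullet> M l) * \<theta> \<tau> l * \<theta> \<tau> (k - l) = 0" for l
        using tz[OF that, of l] tz[OF that, of "k - l"] P(2)[of l "k - l"] False by auto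
      then have "nl (\<theta> \<tau>) k = 0" unfolding nl_def by (simp only: infsum_0_simp)
      then show ?thesis using tz[OF that False] SP[OF that False] by (simp add: rhs_def)
    qed
    then have "integral {0..t} (rhs Sc \<theta> k) = integral {0..t} (\<lambda>_. 0)"
      using t by (intro Henstock_Kurzweil_Integration.integral_cong) auto
    then show ?thesis using tz[OF t False] P0[OF False] by simp
  qed
  \<comment> \<open>The dissipation bound is passed to the limit for a fixed finite set
    \<open>G\<close>, where the sum and the integral commute with the limit; modes of
    \<open>G\<close> outside the truncation contribute zero.\<close>
  have tD: "\<kappa> * integral {0..T} (\<lambda>t. \<Sum>k\<in>G. wt (s + \<gamma>) k * (norm (\<theta> t k))\<^sup>2) \<le> R" if G: "finite G" for G
  proof (rule tendsto_upperbound)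
    have sqb: "wt (s + \<gamma>) k * (norm (u n t k))\<^sup>2 \<le> wt (s + \<gamma>) k * R" if "t \<in> {0..T}" for n t k
      using power_mono[OF un[OF that, of n k], of 2] R0 by (intro mult_left_mono) auto
    have "(\<lambda>n. integral {0..T} (\<lambda>t. \<Sum>k\<in>G. wt (s + \<gamma>) k * (norm (u (r n) t k))\<^sup>2)) \<longlonglongrightarrow> integral {0..T} (\<lambda>t. \<Sum>k\<in>G. wt (s + \<gamma>) k * (norm (\<theta> t k))\<^sup>2)"
    proof (rule dominated_convergence(2)[where h="\<lambda>_. \<Sum>k\<in>G. wt (s + \<gamma>) k * R"])
      show "(\<lambda>t. \<Sum>k\<in>G. wt (s + \<gamma>) k * (norm (u (r n) t k))\<^sup>2) integrable_on {0..T}" for n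
        by (intro integrable_continuous_real continuous_intros uc)
      show "norm (\<Sum>k\<in>G. wt (s + \<gamma>) k * (norm (u (r n) t k))\<^sup>2) \<le> (\<Sum>k\<in>G. wt (s + \<gamma>) k * R)" if "t \<in> {0..T}" for n t
        using sqb[OF that] by (simp add: sum_nonneg abs_of_nonneg sum_mono)
      show "(\<lambda>n. \<Sum>k\<in>G. wt (s + \<gamma>) k * (norm (u (r n) t k))\<^sup>2) \<longlonglongrightarrow> (\<Sum>k\<in>G. wt (s + \<gamma>) k * (norm (\<theta> t k))\<^sup>2)" if "t \<in> {0..T}" for t
        by (intro tendsto_intros lim that)
    qed auto
    then show "(\<lambda>n. \<kappa> * integral {0..T} (\<lambda>t. \<Sum>k\<in>G. wt (s + \<gamma>) k * (norm (u (r n) t k))\<^sup>2)) \<longlonglongrightarrow> \<kappa> * integral {0..T} (\<lambda>t. \<Sum>k\<in>G. wt (s + \<gamma>) k * (norm (\<theta> t k))\<^sup>2)"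
      by (intro tendsto_intros)
    show "\<forall>\<^sub>F n in sequentially. \<kappa> * integral {0..T} (\<lambda>t. \<Sum>k\<in>G. wt (s + \<gamma>) k * (norm (u (r n) t k))\<^sup>2) \<le> R"
    proof (intro always_eventually allI order_trans[OF mult_left_mono uD])
      fix n
      show "integral {0..T} (\<lambda>t. \<Sum>k\<in>G. wt (s + \<gamma>) k * (norm (u (r n) t k))\<^sup>2) \<le> integral {0..T} (\<lambda>t. \<Sum>k\<in>F (r n). wt (s + \<gamma>) k * (norm (u (r n) t k))\<^sup>2)"
      proof (rule integral_le)
        fix t assume t: "t \<in> {0..T}"
        have "(\<Sum>k\<in>G. wt (s + \<gamma>) k * (norm (u (r n) t k))\<^sup>2) = (\<Sum>k\<in>G \<inter> F (r n). wt (s + \<gamma>) k * (norm (u (r n) t k))\<^sup>2)"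
          by (rule sum.mono_neutral_right) (use G uz[OF t] in auto)
        also have "\<dots> \<le> (\<Sum>k\<in>F (r n). wt (s + \<gamma>) k * (norm (u (r n) t k))\<^sup>2)"
          by (rule sum_mono2) (use F in auto)
        finally show "(\<Sum>k\<in>G. wt (s + \<gamma>) k * (norm (u (r n) t k))\<^sup>2) \<le> (\<Sum>k\<in>F (r n). wt (s + \<gamma>) k * (norm (u (r n) t k))\<^sup>2)" .
      qed (intro integrable_continuous_real continuous_intros uc)+
    qed (use \<kappa> in auto)
  qed simp
  show ?thesis
    using th tz tG tc teq tD unfolding coef_solution_def R_def by (intro exI[of _ \<theta>]) auto
qed

end

subsection \<open>Uniqueness\<close>

lemma summable_on_sum_swap:
  fixes f :: "'a \<Rightarrow> 'b \<Rightarrow> 'c::banach"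
  assumes "finite F" "\<And>k. k \<in> F \<Longrightarrow> f k summable_on A"
  shows "(\<lambda>l. \<Sum>k\<in>F. f k l) summable_on A" "infsum (\<lambda>l. \<Sum>k\<in>F. f k l) A = (\<Sum>k\<in>F. infsum (f k) A)"
proof -
  have "(\<lambda>l. \<Sum>k\<in>F. f k l) summable_on A \<and> infsum (\<lambda>l. \<Sum>k\<in>F. f k l) A = (\<Sum>k\<in>F. infsum (f k) A)"
    using assms by (induction) (auto intro: summable_on_add simp: infsum_add)
  then show "(\<lambda>l. \<Sum>k\<in>F. f k l) summable_on A" "infsum (\<lambda>l. \<Sum>k\<in>F. f k l) A = (\<Sum>k\<in>F. infsum (f k) A)"
    by auto
qed

lemma sum_mult_shift_le:
  fixes v w :: "int^3 \<Rightarrow> real"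
  assumes F: "finite F" and v: "\<And>G. finite G \<Longrightarrow> (\<Sum>k\<in>G. (v k)\<^sup>2) \<le> V" and w: "\<And>G. finite G \<Longrightarrow> (\<Sum>k\<in>G. (w k)\<^sup>2) \<le> W"
  shows "(\<Sum>k\<in>F. v k * w (k - l)) \<le> (V + W) / 2"
proof -
  have "(\<Sum>k\<in>F. v k * w (k - l)) \<le> (\<Sum>k\<in>F. ((v k)\<^sup>2 + (w (k - l))\<^sup>2) / 2)"
  proof (rule sum_mono)
    fix k
    show "v k * w (k - l) \<le> ((v k)\<^sup>2 + (w (k - l))\<^sup>2) / 2"
      using sum_squares_bound[of "v k" "w (k - l)"] by simp
  qed
  also have "\<dots> = ((\<Sum>k\<in>F. (v k)\<^sup>2) + (\<Sum>k\<in>(\<lambda>k. k - l) ` F. (w k)\<^sup>2)) / 2"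
    by (subst sum.reindex) (auto simp: inj_on_def sum_divide_distrib[symmetric] sum.distrib)
  also have "\<dots> \<le> (V + W) / 2"
    using v[OF F] w[of "(\<lambda>k. k - l) ` F"] F by simp
  finally show ?thesis .
qed

context active_scalar
begin

definition l1 :: "(int^3 \<Rightarrow> complex) \<Rightarrow> int^3 \<Rightarrow> real" where
  "l1 u k = wt (1/2) k * norm (u k)"

lemma l1_nonneg [simp]: "0 \<le> l1 u k"
  by (simp add: l1_def)

text \<open>The geometric mean of \<open>K2\<close> and \<open>D\<close> is replaced by the
  arithmetic mean. The bound is then affine in \<open>D\<close>, hence integrable in time whenever
  \<open>D\<close> is.\<close>

lemma l1_summable:
  assumes "\<And>F. finite F \<Longrightarrow> (\<Sum>k\<in>F. wt (s + \<gamma>) k * (norm (u k))\<^sup>2) \<le> D"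
  shows "l1 u summable_on UNIV" "infsum (l1 u) A \<le> (K2 + D) / 2"
proof -
  have D0: "0 \<le> D" using assms[of "{}"] by simp
  have le: "sum (l1 u) F \<le> (K2 + D) / 2" if "finite F" for F
  proof (rule power2_le_imp_le)
    have "(sum (l1 u) F)\<^sup>2 \<le> K2 * (\<Sum>k\<in>F. wt (s + \<gamma>) k * (norm (u k))\<^sup>2)"
      unfolding l1_def by (rule l1_sq_le[OF that])
    also have "\<dots> \<le> K2 * D" using assms[OF that] K2_pos by (intro mult_left_mono) auto
    also have "\<dots> \<le> ((K2 + D) / 2)\<^sup>2"
    proof -
      have "0 \<le> (K2 - D)\<^sup>2" by simp
      then show ?thesis by (simp add: power2_eq_square field_simps)
    qed
    finally show "(sum (l1 u) F)\<^sup>2 \<le> ((K2 + D) / 2)\<^sup>2" .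
    show "0 \<le> (K2 + D) / 2" using K2_pos D0 by simp
  qed
  show s: "l1 u summable_on UNIV"
    by (rule nonneg_bdd_above_summable_on) (auto intro!: bdd_aboveI le)
  show "infsum (l1 u) A \<le> (K2 + D) / 2"
    by (rule infsum_le_finite_sums[OF summable_on_subset_banach[OF s subset_UNIV]]) (use le in auto)
qed

text \<open>In the transport of \<open>w = u - v\<close> by the velocity of \<open>v\<close> the interactions inside \<open>F\<close> cancel by
  antisymmetry, which leaves the tail over \<open>- F\<close>.\<close>
lemma difference_energy:
  fixes u v :: "int^3 \<Rightarrow> complex"
  defines "w \<equiv> \<lambda>k. u k - v k"
  assumes F: "finite F" and hv: "hermitian v"
    and uD: "l1 u summable_on UNIV" and vD: "l1 v summable_on UNIV"
    and W: "\<And>G. finite G \<Longrightarrow> (\<Sum>k\<in>G. (norm (w k))\<^sup>2) \<le> W"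
    and V: "\<And>G. finite G \<Longrightarrow> (\<Sum>k\<in>G. (norm (v k))\<^sup>2) \<le> V"
    and su: "\<And>k. (\<lambda>l. norm (of_real (freq k \<bullet> M l) * u l * u (k - l))) summable_on UNIV"
    and sv: "\<And>k. (\<lambda>l. norm (of_real (freq k \<bullet> M l) * v l * v (k - l))) summable_on UNIV"
  shows "- (\<Sum>k\<in>F. Re (cnj (w k) * (\<i> * (nl u k - nl v k))))
     \<le> CM * infsum (l1 u) UNIV * W + CM * infsum (l1 w) (- F) * ((W + V) / 2)"
proof -
  define A where "A k l = freq l \<bullet> M (k - l)" for k l
  have A_le: "\<bar>A k l\<bar> \<le> CM * wt (1/2) l" for k l
    unfolding A_def using abs_M_le[of l "k - l"] mult_left_mono[OF norm_freq_le_wt CM_nonneg, of l] by linarith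
  have Asym: "A l k = A k l" for k l
    using M_shift[of k l] M_uminus[of "k - l"] by (simp add: A_def)
  have wW: "norm (w k) \<le> sqrt W" for k
    using W[of "{k}"] by (simp add: real_le_rsqrt)
  have vV: "norm (v k) \<le> sqrt V" for k
    using V[of "{k}"] by (simp add: real_le_rsqrt)
  have wD: "l1 w summable_on UNIV"
  proof (rule summable_on_comparison_test[OF summable_on_add[OF uD vD]])
    fix k
    have "norm (w k) \<le> norm (u k) + norm (v k)" unfolding w_def by (rule norm_triangle_ineq4)
    then show "l1 w k \<le> l1 u k + l1 v k"
      unfolding l1_def distrib_left[symmetric] by (intro mult_left_mono) auto
  qed auto
  have nl_eq: "nl x k = (\<Sum>\<^sub>\<infinity>l. of_real (A k l) * x (k - l) * x l)" for x k
  proof -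
    have b: "bij (\<lambda>l. k - l)" by (rule bij_betw_byWitness[where f'="\<lambda>l. k - l"]) auto
    show ?thesis
      unfolding nl_def A_def
      by (subst infsum_reindex_bij_betw[OF b, symmetric]) (simp add: M_shift)
  qed
  have nl_sum: "(\<lambda>l. of_real (A k l) * x (k - l) * x l) summable_on UNIV"
    if "(\<lambda>l. norm (of_real (freq k \<bullet> M l) * x l * x (k - l))) summable_on UNIV" for x :: "int^3 \<Rightarrow> complex" and k
  proof -
    have b: "bij (\<lambda>l. k - l)" by (rule bij_betw_byWitness[where f'="\<lambda>l. k - l"]) auto
    show ?thesis
      using abs_summable_summable[OF that] unfolding A_def
      by (subst (asm) summable_on_reindex_bij_betw[OF b, symmetric]) (simp add: M_shift)
  qed
  \<comment> \<open>In these products the factor at \<open>k - l\<close> provides the velocity and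
    the one at \<open>l\<close> is transported. \<open>P\<close> moves \<open>u\<close> with the
    velocity of \<open>w\<close> and puts the derivative on \<open>u\<close>; \<open>Q\<close> moves
    \<open>w\<close> with the velocity of \<open>v\<close> and cancels within
    \<open>F\<close>.\<close>
  define P where "P k l = of_real (A k l) * w (k - l) * u l" for k l
  define Q where "Q k l = of_real (A k l) * v (k - l) * w l" for k l
  have Ple: "norm (P k l) \<le> CM * norm (w (k - l)) * l1 u l" for k l
  proof -
    have "norm (P k l) \<le> (CM * wt (1/2) l) * (norm (w (k - l)) * norm (u l))"
      using mult_right_mono[OF A_le[of k l], of "norm (w (k - l)) * norm (u l)"] by (simp add: P_def norm_mult mult.assoc)
    then show ?thesis by (simp add: l1_def mult_ac)
  qed
  have Qle: "norm (Q k l) \<le> CM * norm (v (k - l)) * l1 w l" for k l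
  proof -
    have "norm (Q k l) \<le> (CM * wt (1/2) l) * (norm (v (k - l)) * norm (w l))"
      using mult_right_mono[OF A_le[of k l], of "norm (v (k - l)) * norm (w l)"] by (simp add: Q_def norm_mult mult.assoc)
    then show ?thesis by (simp add: l1_def mult_ac)
  qed
  have Pb: "(\<lambda>l. CM * norm (w (k - l)) * l1 u l) summable_on UNIV" for k
  proof (rule summable_on_comparison_test[OF summable_on_cmult_right[OF uD, of "CM * sqrt W"]])
    show "CM * norm (w (k - l)) * l1 u l \<le> CM * sqrt W * l1 u l" for l
      using wW CM_nonneg by (intro mult_right_mono mult_left_mono) auto
  qed (use CM_nonneg in auto)
  have Qb: "(\<lambda>l. CM * norm (v (k - l)) * l1 w l) summable_on UNIV" for k
  proof (rule summable_on_comparison_test[OF summable_on_cmult_right[OF wD, of "CM * sqrt V"]])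
    show "CM * norm (v (k - l)) * l1 w l \<le> CM * sqrt V * l1 w l" for l
      using vV CM_nonneg by (intro mult_right_mono mult_left_mono) auto
  qed (use CM_nonneg in auto)
  have Pn: "(\<lambda>l. norm (P k l)) summable_on B" for k B
    by (rule summable_on_comparison_test[OF summable_on_subset_banach[OF Pb[of k] subset_UNIV]]) (use Ple in auto)
  have Qn: "(\<lambda>l. norm (Q k l)) summable_on B" for k B
    by (rule summable_on_comparison_test[OF summable_on_subset_banach[OF Qb[of k] subset_UNIV]]) (use Qle in auto)
  note Ps = abs_summable_summable[OF Pn] and Qs = abs_summable_summable[OF Qn]
  have diff: "nl u k - nl v k = infsum (P k) UNIV + infsum (Q k) F + infsum (Q k) (- F)" for k
  proof -
    have "nl u k - nl v k = (\<Sum>\<^sub>\<infinity>l. of_real (A k l) * u (k - l) * u l - of_real (A k l) * v (k - l) * v l)"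
      unfolding nl_eq using infsum_add[OF nl_sum[OF su] summable_on_uminus[THEN iffD2, OF nl_sum[OF sv]], of k k]
      by (simp add: infsum_uminus)
    also have "\<dots> = (\<Sum>\<^sub>\<infinity>l. P k l + Q k l)"
      by (rule infsum_cong) (simp add: P_def Q_def w_def algebra_simps)
    also have "\<dots> = infsum (P k) UNIV + infsum (Q k) UNIV"
      by (rule infsum_add[OF Ps Qs])
    also have "infsum (Q k) UNIV = infsum (Q k) F + infsum (Q k) (- F)"
      using infsum_Un_disjoint[OF Qs[of k F] Qs[of k "- F"]] by simp
    finally show ?thesis by simp
  qed
  have sumF: "- (\<Sum>k\<in>F. Re (cnj (w k) * (\<i> * (nl u k - nl v k))))
    = - (\<Sum>k\<in>F. Re (cnj (w k) * (\<i> * infsum (P k) UNIV))) - (\<Sum>k\<in>F. \<Sum>l\<in>F. Re (cnj (w k) * (\<i> * Q k l)))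
      - (\<Sum>k\<in>F. Re (cnj (w k) * (\<i> * infsum (Q k) (- F))))"
  proof -
    have "Re (cnj (w k) * (\<i> * (nl u k - nl v k))) = Re (cnj (w k) * (\<i> * infsum (P k) UNIV))
       + (\<Sum>l\<in>F. Re (cnj (w k) * (\<i> * Q k l))) + Re (cnj (w k) * (\<i> * infsum (Q k) (- F)))" for k
    proof -
      have "cnj (w k) * (\<i> * (nl u k - nl v k)) = cnj (w k) * (\<i> * infsum (P k) UNIV)
       + cnj (w k) * (\<i> * infsum (Q k) F) + cnj (w k) * (\<i> * infsum (Q k) (- F))"
        unfolding diff by (simp only: distrib_left)
      moreover have "cnj (w k) * (\<i> * infsum (Q k) F) = (\<Sum>l\<in>F. cnj (w k) * (\<i> * Q k l))"
        using F by (simp add: sum_distrib_left)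
      ultimately show ?thesis by (simp only: plus_complex.sel Re_sum)
    qed
    then show ?thesis by (simp only: sum.distrib)
  qed
  have p0: "(\<Sum>k\<in>F. \<Sum>l\<in>F. Re (cnj (w k) * (\<i> * Q k l))) = 0"
  proof -
    have anti: "Re (cnj (w k) * (\<i> * Q k l)) = - Re (cnj (w l) * (\<i> * Q l k))" for k l
    proof -
      have "v (k - l) = cnj (v (l - k))"
        using hv[unfolded hermitian_def, rule_format, of "l - k"] by simp
      then have e: "cnj (w k) * (\<i> * Q k l) = - cnj (cnj (w l) * (\<i> * Q l k))"
        by (simp add: Q_def Asym[of k l] mult_ac)
      show ?thesis unfolding e by (simp only: uminus_complex.sel cnj.sel)
    qed
    have "(\<Sum>k\<in>F. \<Sum>l\<in>F. Re (cnj (w k) * (\<i> * Q k l))) = (\<Sum>k\<in>F. \<Sum>l\<in>F. - Re (cnj (w l) * (\<i> * Q l k)))"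
      by (intro sum.cong refl anti)
    also have "\<dots> = - (\<Sum>k\<in>F. \<Sum>l\<in>F. Re (cnj (w l) * (\<i> * Q l k)))"
      by (simp only: sum_negf)
    also have "(\<Sum>k\<in>F. \<Sum>l\<in>F. Re (cnj (w l) * (\<i> * Q l k))) = (\<Sum>k\<in>F. \<Sum>l\<in>F. Re (cnj (w k) * (\<i> * Q k l)))"
      by (rule sum.swap)
    finally show ?thesis by simp
  qed
  \<comment> \<open>Common estimate for both remainders: for fixed \<open>l\<close> the sum over
    \<open>k\<close> is a correlation bounded by \<open>Y\<close>, and the transported factor
    \<open>h\<close>, which carries the derivative, is then summed over \<open>l\<close>.\<close>
  have bound: "- (\<Sum>k\<in>F. Re (cnj (w k) * (\<i> * infsum (X k) B))) \<le> CM * infsum h B * Y"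
    if Xn: "\<And>k. (\<lambda>l. norm (X k l)) summable_on B" and Xle: "\<And>k l. norm (X k l) \<le> CM * norm (y (k - l)) * h l"
      and Xb: "\<And>k. (\<lambda>l. CM * norm (y (k - l)) * h l) summable_on B" and hs: "h summable_on B" and h0: "\<And>l. 0 \<le> h l"
      and Y: "\<And>l. (\<Sum>k\<in>F. norm (w k) * norm (y (k - l))) \<le> Y"
    for X :: "int^3 \<Rightarrow> int^3 \<Rightarrow> complex" and B h Y and y :: "int^3 \<Rightarrow> complex"
  proof -
    have "- (\<Sum>k\<in>F. Re (cnj (w k) * (\<i> * infsum (X k) B))) \<le> (\<Sum>k\<in>F. norm (w k) * infsum (\<lambda>l. CM * norm (y (k - l)) * h l) B)"
      unfolding sum_negf[symmetric]
    proof (rule sum_mono)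
      fix k
      have "- Re (cnj (w k) * (\<i> * infsum (X k) B)) \<le> norm (cnj (w k) * (\<i> * infsum (X k) B))"
        using abs_Re_le_cmod[of "cnj (w k) * (\<i> * infsum (X k) B)"] by linarith
      also have "\<dots> = norm (w k) * norm (infsum (X k) B)" by (simp add: norm_mult)
      also have "norm (infsum (X k) B) \<le> infsum (\<lambda>l. CM * norm (y (k - l)) * h l) B"
        using norm_infsum_bound[OF Xn[of k]] infsum_mono[OF Xn[of k] Xb[of k] Xle] by linarith
      finally show "- Re (cnj (w k) * (\<i> * infsum (X k) B)) \<le> norm (w k) * infsum (\<lambda>l. CM * norm (y (k - l)) * h l) B"
        by (simp add: mult_left_mono)
    qed
    also have "\<dots> = (\<Sum>k\<in>F. infsum (\<lambda>l. norm (w k) * (CM * norm (y (k - l)) * h l)) B)"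
      by (intro sum.cong refl infsum_cmult_right[symmetric] Xb)
    also have "\<dots> = infsum (\<lambda>l. \<Sum>k\<in>F. norm (w k) * (CM * norm (y (k - l)) * h l)) B"
      by (rule summable_on_sum_swap(2)[symmetric, OF F]) (intro summable_on_cmult_right Xb)
    also have "\<dots> \<le> infsum (\<lambda>l. CM * Y * h l) B"
    proof (rule infsum_mono)
      show "(\<lambda>l. \<Sum>k\<in>F. norm (w k) * (CM * norm (y (k - l)) * h l)) summable_on B"
        by (rule summable_on_sum_swap(1)[OF F]) (intro summable_on_cmult_right Xb)
      show "(\<lambda>l. CM * Y * h l) summable_on B" by (intro summable_on_cmult_right hs)
      fix l
      have "(\<Sum>k\<in>F. norm (w k) * (CM * norm (y (k - l)) * h l)) = CM * (\<Sum>k\<in>F. norm (w k) * norm (y (k - l))) * h l"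
        by (simp add: sum_distrib_left sum_distrib_right mult_ac)
      also have "\<dots> \<le> CM * Y * h l" using Y CM_nonneg h0 by (intro mult_right_mono mult_left_mono) auto
      finally show "(\<Sum>k\<in>F. norm (w k) * (CM * norm (y (k - l)) * h l)) \<le> CM * Y * h l" .
    qed
    also have "\<dots> = CM * Y * infsum h B" by (intro infsum_cmult_right hs)
    finally show ?thesis by (simp add: mult_ac)
  qed
  have 1: "- (\<Sum>k\<in>F. Re (cnj (w k) * (\<i> * infsum (P k) UNIV))) \<le> CM * infsum (l1 u) UNIV * W"
  proof (rule bound[OF Pn Ple Pb uD])
    show "(\<Sum>k\<in>F. norm (w k) * norm (w (k - l))) \<le> W" for l
      using sum_mult_shift_le[OF F W W, where l=l] by simp
  qed simp
  have 2: "- (\<Sum>k\<in>F. Re (cnj (w k) * (\<i> * infsum (Q k) (- F)))) \<le> CM * infsum (l1 w) (- F) * ((W + V) / 2)"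
  proof (rule bound[OF Qn Qle])
    show "(\<Sum>k\<in>F. norm (w k) * norm (v (k - l))) \<le> (W + V) / 2" for l
      using sum_mult_shift_le[OF F W V, where l=l] by simp
  qed (use summable_on_subset_banach[OF Qb subset_UNIV] summable_on_subset_banach[OF wD subset_UNIV] in auto)
  show ?thesis unfolding sumF p0 using 1 2 by linarith
qed

text \<open>The energy identity is available for finite sums over cubes, where the cancellation
  leaves a tail. This tail tends to zero at almost every time and is dominated by
  \<open>2 * \<alpha>\<close>, so it disappears after integration in time and a closed inequality
  for \<open>W\<close> remains.\<close>

lemma coef_solution_unique:
  assumes T: "0 \<le> T" and sol1: "coef_solution P T \<theta>0 Sc C1 \<theta>" and sol2: "coef_solution P T \<theta>0 Sc C2 \<theta>'"
    and Sm: "\<And>k. (\<lambda>t. Sc t k) \<in> borel_measurable (lebesgue_on {0..T})"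
    and Sn: "\<And>t k. t \<in> {0..T} \<Longrightarrow> norm (Sc t k) \<le> \<bar>\<sigma>\<bar>"
    and Di: "integrable (lebesgue_on {0..T}) D" and N: "negligible N"
    and D1: "\<And>t F. t \<in> {0..T} - N \<Longrightarrow> finite F \<Longrightarrow> (\<Sum>k\<in>F. wt (s + \<gamma>) k * (norm (\<theta> t k))\<^sup>2) \<le> D t"
    and D2: "\<And>t F. t \<in> {0..T} - N \<Longrightarrow> finite F \<Longrightarrow> (\<Sum>k\<in>F. wt (s + \<gamma>) k * (norm (\<theta>' t k))\<^sup>2) \<le> D t"
    and t: "t \<in> {0..T}"
  shows "\<theta> t k = \<theta>' t k"
proof -
  define C where "C = max C1 C2"
  define w where "w t k = \<theta> t k - \<theta>' t k" for t k
  have tC: "(\<Sum>k\<in>F. wt s k * (norm (\<theta> t k))\<^sup>2) \<le> C" "(\<Sum>k\<in>F. wt s k * (norm (\<theta>' t k))\<^sup>2) \<le> C"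
    if "t \<in> {0..T}" "finite F" for t F
    using sol1 sol2 that unfolding coef_solution_def C_def by (auto intro: max.coboundedI1 max.coboundedI2)
  have tk: "wt s k * (norm (\<theta> t k))\<^sup>2 \<le> C" "wt s k * (norm (\<theta>' t k))\<^sup>2 \<le> C" if "t \<in> {0..T}" for t k
    using tC[OF that, of "{k}"] by auto
  have tc: "continuous_on {0..T} (\<lambda>t. \<theta> t k)" "continuous_on {0..T} (\<lambda>t. \<theta>' t k)" for k
    using sol1 sol2 by (auto simp: coef_solution_def)
  have teq: "\<theta> t k = \<theta>0 k + integral {0..t} (rhs Sc \<theta> k)" "\<theta>' t k = \<theta>0 k + integral {0..t} (rhs Sc \<theta>' k)"
    if "t \<in> {0..T}" for t k using sol1 sol2 that by (auto simp: coef_solution_def)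
  have hv: "hermitian (\<theta>' t)" if "t \<in> {0..T}" for t using sol2 that by (auto simp: coef_solution_def)
  have C0: "0 \<le> C" using tC(1)[of 0 "{}"] T by simp
  have unw: "(\<Sum>k\<in>F. (norm (y k))\<^sup>2) \<le> C" if "(\<Sum>k\<in>F. wt s k * (norm (y k :: complex))\<^sup>2) \<le> C" for F y
  proof -
    have "(\<Sum>k\<in>F. (norm (y k))\<^sup>2) \<le> (\<Sum>k\<in>F. wt s k * (norm (y k))\<^sup>2)"
    proof (rule sum_mono)
      fix k show "(norm (y k))\<^sup>2 \<le> wt s k * (norm (y k))\<^sup>2"
        using mult_right_mono[OF wt_ge_1[of s k], of "(norm (y k))\<^sup>2"] s_gt by simp
    qed
    then show ?thesis using that by linarith
  qed
  have V: "(\<Sum>k\<in>F. (norm (\<theta>' t k))\<^sup>2) \<le> C" if "t \<in> {0..T}" "finite F" for t F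
    by (rule unw[OF tC(2)[OF that]])
  have Wb: "(\<Sum>k\<in>F. (norm (w t k))\<^sup>2) \<le> 4 * C" if "t \<in> {0..T}" "finite F" for t F
  proof -
    have "(\<Sum>k\<in>F. (norm (w t k))\<^sup>2) \<le> (\<Sum>k\<in>F. 2 * (norm (\<theta> t k))\<^sup>2 + 2 * (norm (\<theta>' t k))\<^sup>2)"
    proof (rule sum_mono)
      fix k
      have "(norm (w t k))\<^sup>2 \<le> (norm (\<theta> t k) + norm (\<theta>' t k))\<^sup>2"
        unfolding w_def by (intro power_mono norm_triangle_ineq4) auto
      also have "\<dots> \<le> 2 * (norm (\<theta> t k))\<^sup>2 + 2 * (norm (\<theta>' t k))\<^sup>2"
        using sum_squares_bound[of "norm (\<theta> t k)" "norm (\<theta>' t k)"] by (simp add: power2_sum)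
      finally show "(norm (w t k))\<^sup>2 \<le> 2 * (norm (\<theta> t k))\<^sup>2 + 2 * (norm (\<theta>' t k))\<^sup>2" .
    qed
    also have "\<dots> = 2 * (\<Sum>k\<in>F. (norm (\<theta> t k))\<^sup>2) + 2 * (\<Sum>k\<in>F. (norm (\<theta>' t k))\<^sup>2)"
      by (simp add: sum.distrib sum_distrib_left)
    also have "\<dots> \<le> 2 * C + 2 * C"
      by (intro add_mono mult_left_mono unw tC that) auto
    finally show ?thesis by simp
  qed
  define W where "W t = (\<Sum>\<^sub>\<infinity>k. (norm (w t k))\<^sup>2)" for t
  have ws: "(\<lambda>k. (norm (w t k))\<^sup>2) summable_on UNIV" if "t \<in> {0..T}" for t
    by (rule nonneg_bdd_above_summable_on) (auto intro!: bdd_aboveI Wb[OF that])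
  have WG: "(\<Sum>k\<in>G. (norm (w t k))\<^sup>2) \<le> W t" if "t \<in> {0..T}" "finite G" for t G
    unfolding W_def by (rule finite_sum_le_infsum[OF ws]) (use that in auto)
  have W0: "0 \<le> W t" for t unfolding W_def by (rule infsum_nonneg) auto
  have W4: "W t \<le> 4 * C" if "t \<in> {0..T}" for t
    unfolding W_def by (rule infsum_le_finite_sums[OF ws[OF that]]) (use Wb[OF that] in auto)
  have Wlim: "(\<lambda>n. \<Sum>k\<in>cube n. (norm (w t k))\<^sup>2) \<longlonglongrightarrow> W t" if "t \<in> {0..T}" for t
    unfolding W_def by (rule infsum_cube[OF ws[OF that]])
  have wc: "continuous_on {0..T} (\<lambda>t. w t k)" for k
    unfolding w_def by (intro continuous_intros tc)
  have Wm: "W \<in> borel_measurable (lebesgue_on {0..T})"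
  proof (rule borel_measurable_LIMSEQ_metric)
    show "(\<lambda>t. \<Sum>k\<in>cube n. (norm (w t k))\<^sup>2) \<in> borel_measurable (lebesgue_on {0..T})" for n
      by (intro continuous_imp_measurable_Icc continuous_intros wc)
    show "(\<lambda>n. \<Sum>k\<in>cube n. (norm (w t k))\<^sup>2) \<longlonglongrightarrow> W t" if "t \<in> space (lebesgue_on {0..T})" for t
      using Wlim that by simp
  qed
  \<comment> \<open>The modulus keeps \<open>\<alpha>\<close> nonnegative at every time, including
    those in \<open>N\<close>, where \<open>D\<close> is not tied to the solutions.\<close>
  define \<alpha> where "\<alpha> t = (K2 + \<bar>D t\<bar>) / 2" for t
  have \<alpha>0: "0 \<le> \<alpha> t" for t using K2_pos by (simp add: \<alpha>_def)
  have \<alpha>i: "integrable (lebesgue_on {0..T}) \<alpha>"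
    unfolding \<alpha>_def using Di by auto
  have l1: "l1 (\<theta> t) summable_on UNIV" "infsum (l1 (\<theta> t)) A \<le> \<alpha> t"
      "l1 (\<theta>' t) summable_on UNIV" "infsum (l1 (\<theta>' t)) A \<le> \<alpha> t" if "t \<in> {0..T} - N" for t A
  proof -
    have d: "D t \<le> \<bar>D t\<bar>" by simp
    show "l1 (\<theta> t) summable_on UNIV" "l1 (\<theta>' t) summable_on UNIV"
      by (rule l1_summable(1)[OF D1[OF that]] l1_summable(1)[OF D2[OF that]]; assumption)+
    show "infsum (l1 (\<theta> t)) A \<le> \<alpha> t"
      unfolding \<alpha>_def by (rule l1_summable(2)) (use D1[OF that] d in force)
    show "infsum (l1 (\<theta>' t)) A \<le> \<alpha> t"
      unfolding \<alpha>_def by (rule l1_summable(2)) (use D2[OF that] d in force)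
  qed
  have l1w: "l1 (w t) summable_on UNIV" "infsum (l1 (w t)) A \<le> 2 * \<alpha> t" if "t \<in> {0..T} - N" for t A
  proof -
    have le: "l1 (w t) k \<le> l1 (\<theta> t) k + l1 (\<theta>' t) k" for k
      unfolding l1_def distrib_left[symmetric] w_def by (intro mult_left_mono norm_triangle_ineq4) auto
    note s = summable_on_add[OF l1(1,3)[OF that]]
    show sw: "l1 (w t) summable_on UNIV"
      by (rule summable_on_comparison_test[OF s]) (use le in auto)
    have "infsum (l1 (w t)) A \<le> infsum (\<lambda>k. l1 (\<theta> t) k + l1 (\<theta>' t) k) A"
      by (intro infsum_mono le summable_on_subset_banach[OF sw] summable_on_subset_banach[OF s]) auto
    also have "\<dots> = infsum (l1 (\<theta> t)) A + infsum (l1 (\<theta>' t)) A"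
      by (intro infsum_add summable_on_subset_banach[OF l1(1)[OF that]] summable_on_subset_banach[OF l1(3)[OF that]]) auto
    finally show "infsum (l1 (w t)) A \<le> 2 * \<alpha> t" using l1(2,4)[OF that, of A] by linarith
  qed
  \<comment> \<open>On \<open>N\<close> the series may diverge. The value 0 there makes the bounds
    and the convergence valid at all times.\<close>
  define tail where "tail n t = (if t \<in> N then 0 else infsum (l1 (w t)) (- cube n))" for n t
  have tail0: "0 \<le> tail n t" for n t by (auto simp: tail_def intro!: infsum_nonneg)
  have tail_le: "tail n t \<le> 2 * \<alpha> t" if "t \<in> {0..T}" for n t
    using l1w(2)[of t "- cube n"] that \<alpha>0[of t] by (auto simp: tail_def)
  have tail_lim: "(\<lambda>n. tail n t) \<longlonglongrightarrow> 0" if "t \<in> {0..T}" for t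
    using infsum_tail_cube[OF l1w(1)[of t]] that by (cases "t \<in> N") (auto simp: tail_def)
  have Nm: "N \<in> sets lebesgue" using N by (simp add: negligible_imp_sets)
  have Nm': "{0..T} \<inter> N \<in> sets (lebesgue_on {0..T})" using Nm by (auto simp: sets_restrict_space)
  have tail_m: "tail n \<in> borel_measurable (lebesgue_on {0..T})" for n
  proof (rule borel_measurable_LIMSEQ_metric)
    fix m
    have c: "(\<lambda>t. \<Sum>k\<in>cube m - cube n. l1 (w t) k) \<in> borel_measurable (lebesgue_on {0..T})"
      unfolding l1_def by (intro continuous_imp_measurable_Icc continuous_intros wc)
    have "{t \<in> space (lebesgue_on {0..T}). t \<in> N} \<in> sets (lebesgue_on {0..T})"
      using Nm' by (simp add: Int_def)
    then show "(\<lambda>t. if t \<in> N then 0 else \<Sum>k\<in>cube m - cube n. l1 (w t) k) \<in> borel_measurable (lebesgue_on {0..T})"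
      by (rule measurable_If[OF measurable_const c, rotated]) simp
  next
    fix t assume "t \<in> space (lebesgue_on {0..T})"
    then have t: "t \<in> {0..T}" by simp
    show "(\<lambda>m. if t \<in> N then 0 else \<Sum>k\<in>cube m - cube n. l1 (w t) k) \<longlonglongrightarrow> tail n t"
    proof (cases "t \<in> N")
      case False
      have s: "l1 (w t) summable_on UNIV" using l1w(1) t False by auto
      have e: "infsum (l1 (w t)) (- cube n) = infsum (l1 (w t)) UNIV - sum (l1 (w t)) (cube n)"
      proof -
        have "infsum (l1 (w t)) (cube n \<union> - cube n) = infsum (l1 (w t)) (cube n) + infsum (l1 (w t)) (- cube n)"
          by (rule infsum_Un_disjoint) (auto intro: summable_on_subset_banach[OF s])
        then show ?thesis by simp
      qed
      have "(\<lambda>m. sum (l1 (w t)) (cube m) - sum (l1 (w t)) (cube n)) \<longlonglongrightarrow> infsum (l1 (w t)) (- cube n)"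
        unfolding e by (intro tendsto_intros infsum_cube s)
      moreover have "\<forall>\<^sub>F m in sequentially. sum (l1 (w t)) (cube m) - sum (l1 (w t)) (cube n) = (\<Sum>k\<in>cube m - cube n. l1 (w t) k)"
        unfolding eventually_sequentially using cube_mono by (intro exI[of _ n]) (simp add: sum_diff)
      ultimately show ?thesis using False by (simp add: tail_def Lim_transform_eventually)
    qed (simp add: tail_def)
  qed
  \<comment> \<open>Bound for \<open>(W \<tau> + C) / 2\<close>, since the squared difference is at
    most \<open>4 * C\<close> and the second solution at most \<open>C\<close>.\<close>
  define K where "K = (4 * C + C) / 2"
  define g where "g k \<tau> = rhs Sc \<theta> k \<tau> - rhs Sc \<theta>' k \<tau>" for k \<tau>
  have rm: "rhs Sc \<theta> k \<in> borel_measurable (lebesgue_on {0..T})" "rhs Sc \<theta>' k \<in> borel_measurable (lebesgue_on {0..T})" for k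
    by (rule rhs_measurable[where R=C]; use tc[THEN continuous_imp_measurable_Icc] tk Sm in auto)+
  have rb: "norm (rhs Sc \<theta> k t) \<le> rhs_bound C \<sigma> k" "norm (rhs Sc \<theta>' k t) \<le> rhs_bound C \<sigma> k" if "t \<in> {0..T}" for k t
    by (rule norm_rhs_le; use tk[OF that] Sn[OF that] in auto)+
  have gm: "g k \<in> borel_measurable (lebesgue_on {0..T})" for k
    unfolding g_def[abs_def] using rm by (intro borel_measurable_diff) auto
  have gb: "norm (g k t) \<le> 2 * rhs_bound C \<sigma> k" if "t \<in> {0..T}" for k t
    using rb[OF that, of k] norm_triangle_ineq4[of "rhs Sc \<theta> k t" "rhs Sc \<theta>' k t"] by (simp add: g_def)
  have weq: "w t k = w 0 k + integral {0..t} (g k)" and w00: "w 0 k = 0" if "t \<in> {0..T}" for t k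
  proof -
    have i: "rhs Sc \<theta> k integrable_on {0..t}" "rhs Sc \<theta>' k integrable_on {0..t}"
      using bounded_measurable_integrable_on[OF rm(1) rb(1), of 0 t k] bounded_measurable_integrable_on[OF rm(2) rb(2), of 0 t k] that by auto
    show "w 0 k = 0" using teq[of 0 k] T by (simp add: w_def)
    then show "w t k = w 0 k + integral {0..t} (g k)"
      using teq[OF that, of k] Henstock_Kurzweil_Integration.integral_diff[OF i] by (simp add: w_def g_def[abs_def])
  qed
  define H where "H n \<tau> = (\<Sum>k\<in>cube n. 2 * Re (cnj (w \<tau> k) * g k \<tau>))" for n \<tau>
  have Hint: "(\<Sum>k\<in>cube n. (norm (w t k))\<^sup>2) = integral {0..t} (H n)" and Hi: "H n integrable_on {0..t}" if t: "t \<in> {0..T}" for n t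
  proof -
    have *: "(norm (w t k))\<^sup>2 = integral {0..t} (\<lambda>\<tau>. 2 * Re (cnj (w \<tau> k) * g k \<tau>))
       \<and> (\<lambda>\<tau>. 2 * Re (cnj (w \<tau> k) * g k \<tau>)) integrable_on {0..t}" for k
    proof -
      have y: "w r k = w 0 k + integral {0..r} (g k)" if "r \<in> {0..T}" for r by (rule weq[OF that])
      have b: "norm (g k r) \<le> 2 * rhs_bound C \<sigma> k" if "r \<in> {0..T}" for r by (rule gb[OF that])
      show ?thesis
        using norm_sq_indefinite_integral[of "g k" T, OF gm b, of "\<lambda>t. w t k", OF _ y t] w00[OF t, of k] by simp
    qed
    show "H n integrable_on {0..t}"
      unfolding H_def[abs_def] by (intro integrable_sum) (use * in auto)
    show "(\<Sum>k\<in>cube n. (norm (w t k))\<^sup>2) = integral {0..t} (H n)"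
      unfolding H_def[abs_def] by (subst Henstock_Kurzweil_Integration.integral_sum) (use * in auto)
  qed
  define h where "h n \<tau> = 2 * CM * \<alpha> \<tau> * W \<tau> + 2 * CM * K * tail n \<tau>" for n \<tau>
  have Hle: "H n \<tau> \<le> h n \<tau>" if \<tau>: "\<tau> \<in> {0..T} - N" for n \<tau>
  proof -
    have \<tau>': "\<tau> \<in> {0..T}" using \<tau> by simp
    have "- (\<Sum>k\<in>cube n. Re (cnj (\<theta> \<tau> k - \<theta>' \<tau> k) * (\<i> * (nl (\<theta> \<tau>) k - nl (\<theta>' \<tau>) k))))
     \<le> CM * infsum (l1 (\<theta> \<tau>)) UNIV * W \<tau> + CM * infsum (l1 (\<lambda>k. \<theta> \<tau> k - \<theta>' \<tau> k)) (- cube n) * ((W \<tau> + C) / 2)"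
    proof (rule difference_energy)
      show "l1 (\<theta> \<tau>) summable_on UNIV" "l1 (\<theta>' \<tau>) summable_on UNIV" using l1(1,3)[OF \<tau>] by auto
      show "(\<Sum>k\<in>G. (norm (\<theta> \<tau> k - \<theta>' \<tau> k))\<^sup>2) \<le> W \<tau>" if "finite G" for G
        using WG[OF \<tau>' that] by (simp add: w_def)
      show "(\<lambda>l. norm (of_real (freq k \<bullet> M l) * \<theta> \<tau> l * \<theta> \<tau> (k - l))) summable_on UNIV" for k
        by (rule norm_nl_le(2)[OF tk(1)[OF \<tau>']])
      show "(\<lambda>l. norm (of_real (freq k \<bullet> M l) * \<theta>' \<tau> l * \<theta>' \<tau> (k - l))) summable_on UNIV" for k
        by (rule norm_nl_le(2)[OF tk(2)[OF \<tau>']])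
    qed (use hv[OF \<tau>'] V[OF \<tau>'] in auto)
    also have "\<dots> \<le> CM * \<alpha> \<tau> * W \<tau> + CM * tail n \<tau> * K"
    proof (intro add_mono mult_mono mult_left_mono mult_right_mono)
      show "infsum (l1 (\<theta> \<tau>)) UNIV \<le> \<alpha> \<tau>" by (rule l1(2)[OF \<tau>])
      show "infsum (l1 (\<lambda>k. \<theta> \<tau> k - \<theta>' \<tau> k)) (- cube n) \<le> tail n \<tau>"
        using \<tau> by (simp add: tail_def w_def[abs_def])
      show "(W \<tau> + C) / 2 \<le> K" using W4[OF \<tau>'] by (simp add: K_def)
    qed (use CM_nonneg W0 tail0 C0 \<alpha>0 in \<open>auto intro!: divide_nonneg_nonneg add_nonneg_nonneg infsum_nonneg\<close>)
    finally have nlb: "- (\<Sum>k\<in>cube n. Re (cnj (w \<tau> k) * (\<i> * (nl (\<theta> \<tau>) k - nl (\<theta>' \<tau>) k)))) \<le> CM * \<alpha> \<tau> * W \<tau> + CM * tail n \<tau> * K"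
      by (simp add: w_def)
    have "H n \<tau> \<le> (\<Sum>k\<in>cube n. - 2 * Re (cnj (w \<tau> k) * (\<i> * (nl (\<theta> \<tau>) k - nl (\<theta>' \<tau>) k))))"
      unfolding H_def
    proof (rule sum_mono)
      fix k
      \<comment> \<open>The source cancels in the difference, and the dissipative part has a
        favourable sign and is dropped.\<close>
      have geq: "g k \<tau> = - of_real (lin k) * w \<tau> k - \<i> * (nl (\<theta> \<tau>) k - nl (\<theta>' \<tau>) k)"
        by (simp add: g_def rhs_def w_def algebra_simps)
      have "2 * Re (cnj (w \<tau> k) * g k \<tau>) = - 2 * lin k * (norm (w \<tau> k))\<^sup>2 + - 2 * Re (cnj (w \<tau> k) * (\<i> * (nl (\<theta> \<tau>) k - nl (\<theta>' \<tau>) k)))"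
        unfolding geq cmod_power2 by (simp add: power2_eq_square algebra_simps)
      moreover have "0 \<le> lin k * (norm (w \<tau> k))\<^sup>2" using lin_nonneg by simp
      ultimately show "2 * Re (cnj (w \<tau> k) * g k \<tau>) \<le> - 2 * Re (cnj (w \<tau> k) * (\<i> * (nl (\<theta> \<tau>) k - nl (\<theta>' \<tau>) k)))"
        by linarith
    qed
    also have "\<dots> = 2 * - (\<Sum>k\<in>cube n. Re (cnj (w \<tau> k) * (\<i> * (nl (\<theta> \<tau>) k - nl (\<theta>' \<tau>) k))))"
      unfolding sum_distrib_left[symmetric] by simp
    also have "\<dots> \<le> h n \<tau>" using nlb by (simp add: h_def algebra_simps)
    finally show ?thesis .
  qed
  have aWi: "integrable (lebesgue_on {0..T}) (\<lambda>\<tau>. 2 * CM * \<alpha> \<tau> * W \<tau>)"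
  proof (rule Bochner_Integration.integrable_bound)
    show "integrable (lebesgue_on {0..T}) (\<lambda>\<tau>. 2 * CM * \<alpha> \<tau> * (4 * C))" using \<alpha>i by simp
    show "(\<lambda>\<tau>. 2 * CM * \<alpha> \<tau> * W \<tau>) \<in> borel_measurable (lebesgue_on {0..T})" using \<alpha>i Wm by measurable
    show "AE \<tau> in lebesgue_on {0..T}. norm (2 * CM * \<alpha> \<tau> * W \<tau>) \<le> norm (2 * CM * \<alpha> \<tau> * (4 * C))"
    proof (rule AE_I2)
      fix \<tau> assume "\<tau> \<in> space (lebesgue_on {0..T})"
      then have "W \<tau> \<le> 4 * C" by (intro W4) simp
      then show "norm (2 * CM * \<alpha> \<tau> * W \<tau>) \<le> norm (2 * CM * \<alpha> \<tau> * (4 * C))"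
        using mult_left_mono[of "W \<tau>" "4 * C" "2 * CM * \<alpha> \<tau>"] W0[of \<tau>] CM_nonneg \<alpha>0[of \<tau>] C0 by (simp add: abs_mult)
    qed
  qed
  have ti: "integrable (lebesgue_on {0..T}) (tail n)" for n
  proof (rule Bochner_Integration.integrable_bound)
    show "integrable (lebesgue_on {0..T}) (\<lambda>\<tau>. 2 * \<alpha> \<tau>)" using \<alpha>i by simp
    show "AE \<tau> in lebesgue_on {0..T}. norm (tail n \<tau>) \<le> norm (2 * \<alpha> \<tau>)"
      by (rule AE_I2) (use tail0 tail_le \<alpha>0 in auto)
  qed (rule tail_m)
  have hk: "f integrable_on {0..t}" if "integrable (lebesgue_on {0..T}) f" "t \<in> {0..T}" for f :: "real \<Rightarrow> real" and t
    using integrable_on_lebesgue_on[OF that(1)] that(2) by (auto intro: integrable_on_subinterval)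
  have main: "W t \<le> integral {0..t} (\<lambda>\<tau>. 2 * CM * \<alpha> \<tau> * W \<tau>)" if t: "t \<in> {0..T}" for t
  proof (rule tendsto_le[OF _ _ Wlim[OF t]])
    have tl: "(\<lambda>n. integral {0..t} (tail n)) \<longlonglongrightarrow> integral {0..t} (\<lambda>_. 0)"
      by (rule dominated_convergence(2)[where h="\<lambda>\<tau>. 2 * \<alpha> \<tau>"])
         (use t tail0 tail_le tail_lim in \<open>auto intro!: hk ti integrable_on_mult_right \<alpha>i\<close>)
    have "(\<lambda>n. integral {0..t} (\<lambda>\<tau>. 2 * CM * \<alpha> \<tau> * W \<tau>) + 2 * CM * K * integral {0..t} (tail n))
       \<longlonglongrightarrow> integral {0..t} (\<lambda>\<tau>. 2 * CM * \<alpha> \<tau> * W \<tau>) + 2 * CM * K * integral {0..t} (\<lambda>_. 0)"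
      by (intro tendsto_intros tl)
    then show "(\<lambda>n. integral {0..t} (\<lambda>\<tau>. 2 * CM * \<alpha> \<tau> * W \<tau>) + 2 * CM * K * integral {0..t} (tail n))
       \<longlonglongrightarrow> integral {0..t} (\<lambda>\<tau>. 2 * CM * \<alpha> \<tau> * W \<tau>)" by simp
    show "\<forall>\<^sub>F n in sequentially. (\<Sum>k\<in>cube n. (norm (w t k))\<^sup>2) \<le> integral {0..t} (\<lambda>\<tau>. 2 * CM * \<alpha> \<tau> * W \<tau>) + 2 * CM * K * integral {0..t} (tail n)"
    proof (intro always_eventually allI)
      fix n
      have i2: "(\<lambda>\<tau>. 2 * CM * K * tail n \<tau>) integrable_on {0..t}" by (intro integrable_on_mult_right hk ti t)
      have hi: "h n integrable_on {0..t}"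
        unfolding h_def[abs_def] by (intro integrable_add hk[OF aWi t] i2)
      define H' where "H' \<tau> = (if \<tau> \<in> N then h n \<tau> else H n \<tau>)" for \<tau>
      have "integral {0..t} (H n) = integral {0..t} H'"
        by (rule integral_spike[OF N]) (auto simp: H'_def)
      also have "\<dots> \<le> integral {0..t} (h n)"
      proof (rule integral_le)
        show "H' integrable_on {0..t}"
          by (rule integrable_spike[OF Hi[OF t, of n] N]) (auto simp: H'_def)
        show "H' \<tau> \<le> h n \<tau>" if "\<tau> \<in> {0..t}" for \<tau>
          using Hle[of \<tau> n] that t by (auto simp: H'_def)
      qed (rule hi)
      also have "\<dots> = integral {0..t} (\<lambda>\<tau>. 2 * CM * \<alpha> \<tau> * W \<tau>) + 2 * CM * K * integral {0..t} (tail n)"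
        unfolding h_def[abs_def] using Henstock_Kurzweil_Integration.integral_add[OF hk[OF aWi t] i2] by simp
      finally show "(\<Sum>k\<in>cube n. (norm (w t k))\<^sup>2) \<le> integral {0..t} (\<lambda>\<tau>. 2 * CM * \<alpha> \<tau> * W \<tau>) + 2 * CM * K * integral {0..t} (tail n)"
        using Hint[OF t, of n] by simp
    qed
  qed simp
  have "W t = 0"
  proof (rule gronwall_zero[where T=T and W=W and a="\<lambda>\<tau>. 2 * CM * \<alpha> \<tau>" and B="4 * C"])
    show "(\<lambda>\<tau>. 2 * CM * \<alpha> \<tau>) integrable_on {0..T}"
      using T by (intro integrable_on_mult_right hk \<alpha>i) auto
    show "(\<lambda>\<tau>. 2 * CM * \<alpha> \<tau> * W \<tau>) integrable_on {0..T}" using T by (intro hk[OF aWi]) auto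
  qed (use W0 W4 main t CM_nonneg \<alpha>0 in auto)
  then have "(norm (w t k))\<^sup>2 \<le> 0" using WG[OF t, of "{k}"] by simp
  then show ?thesis by (simp add: w_def)
qed

end

subsection \<open>Sobolev and Bochner spaces\<close>

lemma measurable_AE_lebesgue_on:
  fixes f g :: "'a::euclidean_space \<Rightarrow> 'b::euclidean_space"
  assumes S: "S \<in> sets lebesgue" and f: "f \<in> borel_measurable (lebesgue_on S)" and ae: "AE x in lebesgue_on S. f x = g x"
  shows "g \<in> borel_measurable (lebesgue_on S)"
proof -
  have "(\<lambda>x. if x \<in> S then f x else 0) \<in> borel_measurable lebesgue"
    using f borel_measurable_if[OF S, of f] by blast
  moreover have "AE x in lebesgue. (if x \<in> S then f x else 0) = (if x \<in> S then g x else 0)"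
  proof -
    have "AE x in lebesgue. x \<in> S \<longrightarrow> f x = g x"
      using ae S by (subst (asm) AE_restrict_space_iff) auto
    then show ?thesis by eventually_elim auto
  qed
  ultimately have "(\<lambda>x. if x \<in> S then g x else 0) \<in> borel_measurable lebesgue"
    by (rule borel_measurable_AE)
  then show ?thesis using borel_measurable_if[OF S, of g] by blast
qed

lemma AE_lebesgue_on_negligible:
  assumes "S \<in> sets lebesgue" "AE x in lebesgue_on S. P x"
  obtains N where "negligible N" "\<And>x. x \<in> S - N \<Longrightarrow> P x"
proof -
  have "AE x in lebesgue. x \<in> S \<longrightarrow> P x"
    using assms by (subst (asm) AE_restrict_space_iff) auto
  then obtain N where N: "N \<in> null_sets lebesgue" "{x. \<not> (x \<in> S \<longrightarrow> P x)} \<subseteq> N"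
    by (rule AE_E3) auto
  show ?thesis
    by (rule that[of N]) (use N in \<open>auto simp: negligible_iff_null_sets\<close>)
qed

lemma AE_lebesgue_onI:
  assumes "S \<in> sets lebesgue" "negligible N" "\<And>x. x \<in> S - N \<Longrightarrow> P x"
  shows "AE x in lebesgue_on S. P x"
proof -
  have "AE x in lebesgue. x \<notin> N" using assms(2) by (simp add: negligible_iff_null_sets AE_not_in)
  then have "AE x in lebesgue. x \<in> S \<longrightarrow> P x" by eventually_elim (use assms(3) in auto)
  then show ?thesis using assms(1) by (subst AE_restrict_space_iff) auto
qed

lemma sobolevD:
  assumes "f \<in> sobolev r"
  shows "f \<in> L2_torus" "(\<lambda>k. wt r k * (norm (fourier f k))\<^sup>2) summable_on UNIV"
    "finite F \<Longrightarrow> (\<Sum>k\<in>F. wt r k * (norm (fourier f k))\<^sup>2) \<le> (sobolev_norm r f)\<^sup>2"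
proof -
  show "f \<in> L2_torus" using assms by (simp add: sobolev_def)
  show s: "(\<lambda>k. wt r k * (norm (fourier f k))\<^sup>2) summable_on UNIV" using assms by (simp add: sobolev_def wt_def)
  have "(sobolev_norm r f)\<^sup>2 = (\<Sum>\<^sub>\<infinity>k. wt r k * (norm (fourier f k))\<^sup>2)"
    unfolding sobolev_norm_def wt_def by (rule real_sqrt_pow2) (auto intro: infsum_nonneg)
  then show "finite F \<Longrightarrow> (\<Sum>k\<in>F. wt r k * (norm (fourier f k))\<^sup>2) \<le> (sobolev_norm r f)\<^sup>2"
    using finite_sum_le_infsum[OF s, of F] by simp
qed

lemma sobolev_norm_sq: "(sobolev_norm r f)\<^sup>2 = (\<Sum>\<^sub>\<infinity>k. wt r k * (norm (fourier f k))\<^sup>2)"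
  unfolding sobolev_norm_def wt_def by (rule real_sqrt_pow2) (auto intro: infsum_nonneg)

lemma sobolev_norm_nonneg: "0 \<le> sobolev_norm r f"
  unfolding sobolev_norm_def by (auto intro: infsum_nonneg)

lemma sobolevI:
  assumes "f \<in> L2_torus" "(\<lambda>k. wt r k * (norm (fourier f k))\<^sup>2) summable_on UNIV"
  shows "f \<in> sobolev r"
  using assms by (simp add: sobolev_def wt_def)

lemma sobolev_diff:
  assumes "f \<in> sobolev r" "g \<in> sobolev r"
  shows "(\<lambda>x. f x - g x) \<in> sobolev r"
proof (rule sobolevI)
  note f = L2_torusD[OF sobolevD(1)[OF assms(1)]] and g = L2_torusD[OF sobolevD(1)[OF assms(2)]]
  have "integrable torus (\<lambda>x. (f x - g x)\<^sup>2)"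
  proof -
    have "integrable torus (\<lambda>x. (f x)\<^sup>2 + (g x)\<^sup>2 - 2 * (f x * g x))"
      using f g L2_torus_mult[OF sobolevD(1)[OF assms(1)] sobolevD(1)[OF assms(2)]] by auto
    then show ?thesis by (simp add: power2_diff mult.assoc)
  qed
  then show "(\<lambda>x. f x - g x) \<in> L2_torus"
    using f g by (simp add: L2_torus_def periodic3_def)
  show "(\<lambda>k. wt r k * (norm (fourier (\<lambda>x. f x - g x) k))\<^sup>2) summable_on UNIV"
  proof (rule summable_on_comparison_test)
    show "(\<lambda>k. 2 * (wt r k * (norm (fourier f k))\<^sup>2) + 2 * (wt r k * (norm (fourier g k))\<^sup>2)) summable_on UNIV"
      by (intro summable_on_add summable_on_cmult_right sobolevD(2) assms)
    show "wt r k * (norm (fourier (\<lambda>x. f x - g x) k))\<^sup>2 \<le> 2 * (wt r k * (norm (fourier f k))\<^sup>2) + 2 * (wt r k * (norm (fourier g k))\<^sup>2)" for k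
    proof -
      have "(norm (fourier (\<lambda>x. f x - g x) k))\<^sup>2 \<le> (norm (fourier f k) + norm (fourier g k))\<^sup>2"
        unfolding fourier_diff[OF f(3) g(3)] by (intro power_mono norm_triangle_ineq4) auto
      also have "\<dots> \<le> 2 * (norm (fourier f k))\<^sup>2 + 2 * (norm (fourier g k))\<^sup>2"
        using sum_squares_bound[of "norm (fourier f k)" "norm (fourier g k)"] by (simp add: power2_sum)
      finally have "wt r k * (norm (fourier (\<lambda>x. f x - g x) k))\<^sup>2 \<le> wt r k * (2 * (norm (fourier f k))\<^sup>2 + 2 * (norm (fourier g k))\<^sup>2)"
        by (intro mult_left_mono) auto
      then show ?thesis by (simp add: algebra_simps)
    qed
  qed auto
qed

lemma norm_fourier_diff_le:
  assumes "f \<in> sobolev r" "g \<in> sobolev r"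
  shows "norm (fourier f k - fourier g k) \<le> sobolev_norm r (\<lambda>x. f x - g x) * wt (- (r / 2)) k"
proof -
  note f = L2_torusD(3)[OF sobolevD(1)[OF assms(1)]] and g = L2_torusD(3)[OF sobolevD(1)[OF assms(2)]]
  have "wt r k * (norm (fourier f k - fourier g k))\<^sup>2 \<le> (sobolev_norm r (\<lambda>x. f x - g x))\<^sup>2"
    using sobolevD(3)[OF sobolev_diff[OF assms], of "{k}"] by (simp add: fourier_diff[OF f g])
  then have "(wt (r / 2) k * norm (fourier f k - fourier g k))\<^sup>2 \<le> (sobolev_norm r (\<lambda>x. f x - g x))\<^sup>2"
    by (simp add: power_mult_distrib)
  then have "wt (r / 2) k * norm (fourier f k - fourier g k) \<le> sobolev_norm r (\<lambda>x. f x - g x)"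
    by (rule power2_le_imp_le) (rule sobolev_norm_nonneg)
  then show ?thesis by (simp add: wt_minus field_simps)
qed

text \<open>Taking one coefficient is continuous on H^r, so along the approximating simple functions
  it is an almost everywhere limit of measurable functions.\<close>

lemma bochner_measurable_fourier:
  assumes "bochner_measurable r I u" "I \<in> sets lebesgue"
  shows "(\<lambda>t. fourier (u t) k) \<in> borel_measurable (lebesgue_on I)"
proof -
  obtain F :: "nat \<Rightarrow> real \<Rightarrow> real^3 \<Rightarrow> real"
    where F: "\<And>n. simple_function (lebesgue_on I) (F n)" "\<And>n. F n ` I \<subseteq> sobolev r"
      and lim: "AE t in lebesgue_on I. (\<lambda>n. sobolev_norm r (\<lambda>x. F n t x - u t x)) \<longlonglongrightarrow> 0"
    using assms(1) unfolding bochner_measurable_def by blast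
  have us: "AE t in lebesgue_on I. u t \<in> sobolev r" using assms(1) by (simp add: bochner_measurable_def)
  have m: "(\<lambda>t. fourier (F n t) k) \<in> borel_measurable (lebesgue_on I)" for n
    by (rule borel_measurable_simple_function, rule simple_function_compose1[OF F(1)])
  have "AE t in lebesgue_on I. lim (\<lambda>n. fourier (F n t) k) = fourier (u t) k"
    using lim us AE_space
  proof eventually_elim
    case (elim t)
    have Fs: "F n t \<in> sobolev r" for n using F(2)[of n] elim(3) by auto
    have "(\<lambda>n. fourier (F n t) k - fourier (u t) k) \<longlonglongrightarrow> 0"
    proof (rule Lim_null_comparison)
      show "\<forall>\<^sub>F n in sequentially. norm (fourier (F n t) k - fourier (u t) k) \<le> sobolev_norm r (\<lambda>x. F n t x - u t x) * wt (- (r / 2)) k"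
        using norm_fourier_diff_le[OF Fs elim(2)] by simp
      show "(\<lambda>n. sobolev_norm r (\<lambda>x. F n t x - u t x) * wt (- (r / 2)) k) \<longlonglongrightarrow> 0"
        using tendsto_mult_right[OF elim(1), of "wt (- (r / 2)) k"] by simp
    qed
    then show ?case by (intro limI) (simp add: LIM_zero_iff)
  qed
  then show ?thesis
    by (rule measurable_AE_lebesgue_on[OF assms(2) borel_measurable_lim_metric[OF m]])
qed

text \<open>The complement of a null set is dense in a nondegenerate interval: by continuity a
  violation would persist on a nonempty open interval contained in \<open>N\<close>.\<close>

lemma le_on_closure_negligible:
  fixes g :: "real \<Rightarrow> real"
  assumes T: "0 < T" and g: "continuous_on {0..T} g" and N: "negligible N" and le: "\<And>t. t \<in> {0..T} - N \<Longrightarrow> g t \<le> C"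
    and t: "t \<in> {0..T}"
  shows "g t \<le> C"
proof (rule ccontr)
  assume n: "\<not> g t \<le> C"
  then obtain d where d: "0 < d" "\<And>x. x \<in> {0..T} \<Longrightarrow> dist x t < d \<Longrightarrow> dist (g x) (g t) < g t - C"
    using g t unfolding continuous_on_iff by (metis diff_gt_0_iff_gt not_le)
  define U where "U = {max 0 (t - d)<..<min T (t + d)}"
  have "U \<subseteq> N"
  proof
    fix x assume x: "x \<in> U"
    then have xT: "x \<in> {0..T}" and "dist x t < d" by (auto simp: U_def dist_real_def)
    then have "dist (g x) (g t) < g t - C" using d(2) by blast
    then have "C < g x" by (simp add: dist_real_def)
    then show "x \<in> N" using le[of x] xT by force
  qed
  then have "negligible U" using N negligible_subset by blast
  moreover have "open U" "U \<noteq> {}" using d T t by (auto simp: U_def)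
  ultimately show False using open_not_negligible by blast
qed

text \<open>The Sobolev embedding into absolutely convergent Fourier series, by a product estimate
  in each mode; 3/2 is half the dimension.\<close>

lemma summable_fourier_sobolev:
  assumes "3 / 2 < r" "(\<lambda>k. wt r k * (norm (c k :: complex))\<^sup>2) summable_on UNIV"
  shows "(\<lambda>k. norm (c k)) summable_on UNIV"
proof (rule summable_on_comparison_test)
  show "(\<lambda>k. wt (- r) k + wt r k * (norm (c k))\<^sup>2) summable_on UNIV"
    by (intro summable_on_add summable_wt assms)
  show "norm (c k) \<le> wt (- r) k + wt r k * (norm (c k))\<^sup>2" for k
  proof -
    have *: "p * q \<le> p\<^sup>2 + q\<^sup>2" if "0 \<le> p" "0 \<le> q" for p q :: real
      using sum_squares_bound[of p q] mult_nonneg_nonneg[OF that] by linarith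
    have "wt (- (r / 2)) k * wt (r / 2) k = 1" by (simp flip: wt_add)
    then have "norm (c k) = wt (- (r / 2)) k * (wt (r / 2) k * norm (c k))" by (simp flip: mult.assoc)
    also have "\<dots> \<le> (wt (- (r / 2)) k)\<^sup>2 + (wt (r / 2) k * norm (c k))\<^sup>2"
      by (rule *) auto
    also have "\<dots> = wt (- r) k + wt r k * (norm (c k))\<^sup>2"
      by (simp add: power_mult_distrib wt_power2)
    finally show ?thesis .
  qed
qed auto

text \<open>A curve with continuous Fourier coefficients is approximated by truncating to \<open>cube n\<close> and
  freezing time on a fine grid.\<close>
lemma bochner_measurable_fser:
  assumes T: "0 < T" and h: "\<And>t. t \<in> {0..T} \<Longrightarrow> hermitian (\<theta> t)"
    and c: "\<And>k. continuous_on {0..T} (\<lambda>t. \<theta> t k)"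
    and l1: "\<And>t. t \<in> {0..T} \<Longrightarrow> (\<lambda>k. norm (\<theta> t k)) summable_on UNIV"
    and N: "negligible N" and s: "\<And>t. t \<in> {0..T} - N \<Longrightarrow> (\<lambda>k. wt r k * (norm (\<theta> t k))\<^sup>2) summable_on UNIV"
  shows "bochner_measurable r {0<..<T} (\<lambda>t. fser (\<theta> t))"
proof -
  define Z where "Z n = (\<Sum>k\<in>cube n. wt r k)" for n
  have Z: "0 \<le> Z n" for n by (simp add: Z_def sum_nonneg)
  \<comment> \<open>The accuracy is chosen so that the squared errors, summed over the cube with
    total weight \<open>Z n\<close>, stay below \<open>1 / Suc n\<close>. The added 1 avoids a zero
    denominator.\<close>
  have "\<exists>d>0. \<forall>k\<in>cube n. \<forall>t\<in>{0..T}. \<forall>q\<in>{0..T}. \<bar>q - t\<bar> < d \<longrightarrow> norm (\<theta> q k - \<theta> t k) \<le> sqrt (1 / ((Z n + 1) * Suc n))" for n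
  proof -
    have pos: "0 < sqrt (1 / ((Z n + 1) * Suc n))" using Z[of n] by simp
    have "\<exists>d>0. \<forall>t\<in>{0..T}. \<forall>q\<in>{0..T}. \<bar>q - t\<bar> < d \<longrightarrow> norm (\<theta> q k - \<theta> t k) \<le> sqrt (1 / ((Z n + 1) * Suc n))" for k
    proof -
      have "uniformly_continuous_on {0..T} (\<lambda>t. \<theta> t k)"
        by (rule compact_uniformly_continuous[OF c]) auto
      then obtain d where "d > 0" "\<And>t q. t \<in> {0..T} \<Longrightarrow> q \<in> {0..T} \<Longrightarrow> dist q t < d \<Longrightarrow> dist (\<theta> q k) (\<theta> t k) < sqrt (1 / ((Z n + 1) * Suc n))"
        using pos unfolding uniformly_continuous_on_def by blast
      then show ?thesis by (intro exI[of _ d]) (auto simp: dist_norm intro: less_imp_le)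
    qed
    then obtain d where d: "\<And>k. d k > 0" "\<And>k t q. t \<in> {0..T} \<Longrightarrow> q \<in> {0..T} \<Longrightarrow> \<bar>q - t\<bar> < d k \<Longrightarrow> norm (\<theta> q k - \<theta> t k) \<le> sqrt (1 / ((Z n + 1) * Suc n))"
      by metis
    have ne: "cube n \<noteq> {}" by (auto simp: cube_def intro!: exI[of _ 0])
    show ?thesis
    proof (intro exI[of _ "Min (d ` cube n)"] conjI ballI impI)
      show "0 < Min (d ` cube n)" using d(1) ne by (subst Min_gr_iff) auto
      fix k t q assume k: "k \<in> cube n" and t: "t \<in> {0..T}" "q \<in> {0..T}" "\<bar>q - t\<bar> < Min (d ` cube n)"
      have "Min (d ` cube n) \<le> d k" by (rule Min_le) (use k in auto)
      then have "\<bar>q - t\<bar> < d k" using t(3) by linarith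
      then show "norm (\<theta> q k - \<theta> t k) \<le> sqrt (1 / ((Z n + 1) * Suc n))" by (rule d(2)[OF t(1,2)])
    qed
  qed
  then obtain d where d: "\<And>n. 0 < d n" and dle: "\<And>n k t q. k \<in> cube n \<Longrightarrow> t \<in> {0..T} \<Longrightarrow> q \<in> {0..T} \<Longrightarrow> \<bar>q - t\<bar> < d n \<Longrightarrow>
      norm (\<theta> q k - \<theta> t k) \<le> sqrt (1 / ((Z n + 1) * Suc n))"
    by metis
  have "\<exists>m::nat. 0 < m \<and> 1 / real m < d n" for n
    using reals_Archimedean[OF d[of n]] by (metis inverse_eq_divide zero_less_Suc)
  then have "\<exists>m. \<forall>n. 0 < m n \<and> 1 / real (m n) < d n" by (intro choice allI)
  then obtain m :: "nat \<Rightarrow> nat" where m: "\<And>n. 0 < m n" "\<And>n. 1 / real (m n) < d n" by blast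
  \<comment> \<open>Rounding down to a grid point: it stays in the interval, moves time by less than
    \<open>d n\<close>, and takes finitely many values, as a simple function must.\<close>
  define grid where "grid n t = real_of_int \<lfloor>t * real (m n)\<rfloor> / real (m n)" for n t
  have grid: "grid n t \<in> {0..T}" "\<bar>grid n t - t\<bar> < d n" if "t \<in> {0<..<T}" for n t
  proof -
    have mp: "0 < real (m n)" using m(1)[of n] by simp
    have le: "grid n t \<le> t" using mp of_int_floor_le[of "t * real (m n)"] by (simp add: grid_def divide_simps)
    have "t * real (m n) < real_of_int \<lfloor>t * real (m n)\<rfloor> + 1" by linarith
    then have "t < grid n t + 1 / real (m n)" using mp by (simp add: grid_def field_simps)
    moreover have "0 \<le> grid n t" using that mp by (simp add: grid_def)
    ultimately show "grid n t \<in> {0..T}" "\<bar>grid n t - t\<bar> < d n" using le that m(2)[of n] by auto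
  qed
  define c' where "c' n t k = (if k \<in> cube n then \<theta> t k else 0)" for n t k
  have c'h: "hermitian (c' n t)" if "t \<in> {0..T}" for n t
    using h[OF that] by (simp add: hermitian_def c'_def)
  have fin: "g summable_on UNIV" if "\<And>k. k \<notin> cube n \<Longrightarrow> g k = 0" for g :: "int^3 \<Rightarrow> real" and n
    using summable_on_cong_neutral[of "cube n" UNIV g g] that by auto
  have c's: "(\<lambda>k. norm (c' n t k)) summable_on UNIV" for n t
    by (rule fin[of n]) (simp add: c'_def)
  define F where "F n t = fser (c' n (grid n t))" for n t
  have Fc: "fourier (F n t) k = c' n (grid n t) k" if "t \<in> {0<..<T}" for n t k
    unfolding F_def by (rule fourier_fser[OF c's c'h]) (rule grid(1)[OF that])
  have tc: "fourier (fser (\<theta> t)) k = \<theta> t k" if "t \<in> {0..T}" for t k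
    by (rule fourier_fser[OF l1[OF that] h[OF that]])
  have FL: "F n t \<in> L2_torus" for n t unfolding F_def by (rule fser_L2_torus[OF c's])
  have tL: "fser (\<theta> t) \<in> L2_torus" if "t \<in> {0..T}" for t by (rule fser_L2_torus[OF l1[OF that]])
  have Fs: "F n t \<in> sobolev r" if "t \<in> {0<..<T}" for n t
    by (rule sobolevI[OF FL]) (rule fin[of n], simp add: Fc[OF that] c'_def)
  have ts: "fser (\<theta> t) \<in> sobolev r" if "t \<in> {0<..<T} - N" for t
  proof -
    have t: "t \<in> {0..T}" using that by auto
    show ?thesis by (rule sobolevI[OF tL[OF t]]) (use tc[OF t] s[of t] that in auto)
  qed
  have sets: "{0<..<T} \<in> sets lebesgue" by auto
  show ?thesis unfolding bochner_measurable_def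
  proof (intro conjI exI[of _ F] allI)
    show "AE t in lebesgue_on {0<..<T}. fser (\<theta> t) \<in> sobolev r"
      by (rule AE_lebesgue_onI[OF sets N ts])
    show "F n ` {0<..<T} \<subseteq> sobolev r" for n using Fs by auto
    show "simple_function (lebesgue_on {0<..<T}) (F n)" for n
      unfolding F_def
    proof (rule simple_function_compose1, rule simple_function_borel_measurable)
      have "grid n \<in> borel_measurable borel" unfolding grid_def by measurable
      then have "grid n \<in> borel_measurable lebesgue" by (simp add: measurable_completion)
      then show "grid n \<in> borel_measurable (lebesgue_on {0<..<T})" by (rule measurable_restrict_space1)
      have "grid n ` {0<..<T} \<subseteq> (\<lambda>j. real_of_int j / real (m n)) ` {0..\<lfloor>T * real (m n)\<rfloor>}"
      proof
        fix y assume "y \<in> grid n ` {0<..<T}"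
        then obtain t where t: "t \<in> {0<..<T}" "y = grid n t" by auto
        have "\<lfloor>t * real (m n)\<rfloor> \<in> {0..\<lfloor>T * real (m n)\<rfloor>}"
          using t by (auto intro!: floor_mono mult_right_mono)
        then show "y \<in> (\<lambda>j. real_of_int j / real (m n)) ` {0..\<lfloor>T * real (m n)\<rfloor>}"
          using t by (auto simp: grid_def)
      qed
      then show "finite (grid n ` space (lebesgue_on {0<..<T}))"
        using finite_subset[OF _ finite_imageI[OF finite_atLeastAtMost_int]] by simp
    qed
    show "AE t in lebesgue_on {0<..<T}. (\<lambda>n. sobolev_norm r (\<lambda>x. F n t x - fser (\<theta> t) x)) \<longlonglongrightarrow> 0"
    proof (rule AE_lebesgue_onI[OF sets N])
      fix t assume t: "t \<in> {0<..<T} - N"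
      then have t0: "t \<in> {0<..<T}" and t': "t \<in> {0..T}" by auto
      have st: "(\<lambda>k. wt r k * (norm (\<theta> t k))\<^sup>2) summable_on UNIV" using s t by auto
      \<comment> \<open>Freezing time causes the error inside the cube; truncation causes the error
        outside.\<close>
      have le: "(sobolev_norm r (\<lambda>x. F n t x - fser (\<theta> t) x))\<^sup>2 \<le> 1 / Suc n + infsum (\<lambda>k. wt r k * (norm (\<theta> t k))\<^sup>2) (- cube n)" for n
      proof -
        have fd: "fourier (\<lambda>x. F n t x - fser (\<theta> t) x) k = c' n (grid n t) k - \<theta> t k" for k
          using fourier_diff[OF L2_torusD(3)[OF FL] L2_torusD(3)[OF tL[OF t']]] by (simp add: Fc[OF t0] tc[OF t'])
        have ds: "(\<lambda>k. wt r k * (norm (c' n (grid n t) k - \<theta> t k))\<^sup>2) summable_on UNIV"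
          using sobolevD(2)[OF sobolev_diff[OF Fs[OF t0] ts[OF t]], of n] by (simp add: fd)
        have "(sobolev_norm r (\<lambda>x. F n t x - fser (\<theta> t) x))\<^sup>2 = (\<Sum>\<^sub>\<infinity>k\<in>cube n \<union> - cube n. wt r k * (norm (c' n (grid n t) k - \<theta> t k))\<^sup>2)"
          by (simp add: sobolev_norm_sq fd)
        also have "\<dots> = (\<Sum>k\<in>cube n. wt r k * (norm (c' n (grid n t) k - \<theta> t k))\<^sup>2) + infsum (\<lambda>k. wt r k * (norm (c' n (grid n t) k - \<theta> t k))\<^sup>2) (- cube n)"
          by (subst infsum_Un_disjoint) (auto intro: summable_on_subset_banach[OF ds])
        also have "infsum (\<lambda>k. wt r k * (norm (c' n (grid n t) k - \<theta> t k))\<^sup>2) (- cube n) = infsum (\<lambda>k. wt r k * (norm (\<theta> t k))\<^sup>2) (- cube n)"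
          by (rule infsum_cong) (simp add: c'_def)
        also have "(\<Sum>k\<in>cube n. wt r k * (norm (c' n (grid n t) k - \<theta> t k))\<^sup>2) \<le> (\<Sum>k\<in>cube n. wt r k * (1 / ((Z n + 1) * Suc n)))"
        proof (intro sum_mono mult_left_mono)
          fix k assume k: "k \<in> cube n"
          have "norm (\<theta> (grid n t) k - \<theta> t k) \<le> sqrt (1 / ((Z n + 1) * Suc n))"
            by (rule dle[OF k t' grid[OF t0]])
          from power_mono[OF this, of 2]
          show "(norm (c' n (grid n t) k - \<theta> t k))\<^sup>2 \<le> 1 / ((Z n + 1) * Suc n)"
            using k Z[of n] by (simp add: c'_def)
        qed simp
        also have "\<dots> = Z n / (Z n + 1) * (1 / Suc n)" by (simp add: Z_def sum_distrib_right[symmetric] sum_divide_distrib[symmetric])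
        also have "\<dots> \<le> 1 * (1 / Suc n)" using Z[of n] by (intro mult_right_mono) auto
        finally show ?thesis by simp
      qed
      have lim: "(\<lambda>n. 1 / Suc n + infsum (\<lambda>k. wt r k * (norm (\<theta> t k))\<^sup>2) (- cube n)) \<longlonglongrightarrow> 0"
        using tendsto_add[OF LIMSEQ_inverse_real_of_nat infsum_tail_cube[OF st]] by (simp add: inverse_eq_divide)
      have "(\<lambda>n. (sobolev_norm r (\<lambda>x. F n t x - fser (\<theta> t) x))\<^sup>2) \<longlonglongrightarrow> 0"
        by (rule Lim_null_comparison[OF _ lim]) (use le in auto)
      from tendsto_real_sqrt[OF this]
      show "(\<lambda>n. sobolev_norm r (\<lambda>x. F n t x - fser (\<theta> t) x)) \<longlonglongrightarrow> 0"
        by (simp add: sobolev_norm_nonneg)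
    qed
  qed
qed

subsection \<open>The magneto-geostrophic symbol\<close>

lemma mg_symbol_uminus: "mg_symbol \<Omega> \<beta> \<eta> (- k) = mg_symbol \<Omega> \<beta> \<eta> k"
  by (simp add: mg_symbol_def Let_def)

lemma cube_mult_le_quartic:
  fixes x y :: real
  shows "\<bar>x\<bar> ^ 3 * \<bar>y\<bar> \<le> x ^ 4 + y ^ 4"
proof (cases "\<bar>y\<bar> \<le> \<bar>x\<bar>")
  case True
  have "\<bar>x\<bar> ^ 3 * \<bar>y\<bar> \<le> \<bar>x\<bar> ^ 3 * \<bar>x\<bar>" using True by (intro mult_left_mono) auto
  also have "\<dots> = x ^ 4" by (simp add: power3_eq_cube power4_eq_xxxx)
  finally show ?thesis by (rule order_trans) simp
next
  case False
  have "\<bar>x\<bar> ^ 3 * \<bar>y\<bar> \<le> \<bar>y\<bar> ^ 3 * \<bar>y\<bar>" using False by (intro mult_right_mono power_mono) auto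
  also have "\<dots> = y ^ 4" by (simp add: power3_eq_cube power4_eq_xxxx)
  finally show ?thesis by (rule order_trans) simp
qed

lemma freq_plane_real:
  assumes "k \<in> freq_plane q"
  shows "real_of_int (k $ 2) = real_of_rat q * real_of_int (k $ 1)"
proof -
  have "real_of_rat (of_int (k $ 2)) = real_of_rat (q * of_int (k $ 1))"
    using assms by (simp add: freq_plane_def)
  then show ?thesis by (simp add: of_rat_mult)
qed

text \<open>On the plane \<open>k\<^sub>2 = q k\<^sub>1\<close> with \<open>k\<^sub>3 \<noteq> 0\<close> a multiple of \<open>k\<^sub>1\<^sup>4 + k\<^sub>3\<^sup>4\<close> dominates the numerators of
  the symbol, and the denominator dominates another one.\<close>
lemma mg_symbol_bounded:
  assumes "0 < \<Omega>" "0 < \<beta>" "0 < \<eta>" "q \<noteq> 0"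
  shows "\<exists>C. \<forall>k\<in>freq_plane q. norm (mg_symbol \<Omega> \<beta> \<eta> k) \<le> C"
proof -
  define b where "b = \<beta>\<^sup>2 / \<eta>"
  define r where "r = real_of_rat q"
  have b: "0 < b" using assms by (simp add: b_def)
  have r: "r \<noteq> 0" using assms by (simp add: r_def)
  \<comment> \<open>A constant with D >= m (a^4 + c^4): the rotation term controls c^4 and the
    magnetic term controls a^4. Its positivity is where q must be nonzero.\<close>
  define m where "m = min (4 * \<Omega>\<^sup>2) (b\<^sup>2 * r ^ 4)"
  have m: "0 < m" using assms b r by (simp add: m_def zero_less_mult_iff)
  \<comment> \<open>The summands bound, in this order, the rotation terms and the magnetic terms of
    the horizontal components, and the vertical component. Their sum serves all three.\<close>
  define B where "B = 2 * \<Omega> * (\<bar>r\<bar> + 1) * (2 + r\<^sup>2) + b * (r\<^sup>2 + \<bar>r\<bar> ^ 3) + b * r\<^sup>2 * (1 + r\<^sup>2)"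
  have B0: "0 \<le> B" using assms b by (auto simp: B_def intro!: add_nonneg_nonneg mult_nonneg_nonneg)
  show ?thesis
  proof (intro exI[of _ "3 * (B / m)"] ballI)
    fix k assume k: "k \<in> freq_plane q"
    show "norm (mg_symbol \<Omega> \<beta> \<eta> k) \<le> 3 * (B / m)"
    proof (cases "k $ 3 = 0")
      case True
      then show ?thesis using B0 m by (simp add: mg_symbol_def)
    next
      case False
      define a c where "a = real_of_int (k $ 1)" and "c = real_of_int (k $ 3)"
      have c: "c \<noteq> 0" using False by (simp add: c_def)
      have k2: "real_of_int (k $ 2) = r * a" using freq_plane_real[OF k] by (simp add: r_def a_def)
      define K where "K = (1 + r\<^sup>2) * a\<^sup>2 + c\<^sup>2"
      have K: "(norm (freq k))\<^sup>2 = K"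
        unfolding norm_freq_sq k2 by (simp add: K_def a_def c_def power_mult_distrib algebra_simps)
      define D where "D = 4 * \<Omega>\<^sup>2 * c\<^sup>2 * K + b\<^sup>2 * (r * a) ^ 4"
      define Q where "Q = a ^ 4 + c ^ 4"
      have Q: "0 < Q" using c by (simp add: Q_def add_nonneg_pos)
      have DQ: "m * Q \<le> D"
      proof -
        have "c ^ 4 \<le> c\<^sup>2 * K"
        proof -
          have "c\<^sup>2 * c\<^sup>2 \<le> c\<^sup>2 * K" by (intro mult_left_mono) (auto simp: K_def)
          then show ?thesis by (simp add: power4_eq_xxxx power2_eq_square)
        qed
        then have "4 * \<Omega>\<^sup>2 * c ^ 4 \<le> 4 * \<Omega>\<^sup>2 * (c\<^sup>2 * K)" by (intro mult_left_mono) auto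
        moreover have "m * c ^ 4 \<le> 4 * \<Omega>\<^sup>2 * c ^ 4" "m * a ^ 4 \<le> b\<^sup>2 * r ^ 4 * a ^ 4"
          by (intro mult_right_mono; simp add: m_def)+
        ultimately show ?thesis by (simp add: D_def Q_def distrib_left power_mult_distrib mult_ac)
      qed
      have D: "0 < D" using DQ m Q by (meson less_le_trans mult_pos_pos)
      have acK: "\<bar>a\<bar> * \<bar>c\<bar> * K \<le> (2 + r\<^sup>2) * Q"
      proof -
        have "\<bar>a\<bar> * \<bar>c\<bar> * K = (1 + r\<^sup>2) * (\<bar>a\<bar> ^ 3 * \<bar>c\<bar>) + \<bar>c\<bar> ^ 3 * \<bar>a\<bar>"
          by (simp add: K_def power3_eq_cube power2_eq_square algebra_simps flip: abs_mult)
        also have "\<dots> \<le> (1 + r\<^sup>2) * Q + Q"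
          unfolding Q_def using cube_mult_le_quartic[of a c] cube_mult_le_quartic[of c a]
          by (intro add_mono mult_left_mono) auto
        finally show ?thesis by (simp add: algebra_simps)
      qed
      have a3c: "\<bar>a\<bar> ^ 3 * \<bar>c\<bar> \<le> Q" unfolding Q_def by (rule cube_mult_le_quartic)
      have sm: "mg_symbol \<Omega> \<beta> \<eta> k = vector [(2 * \<Omega> * (r * a) * c * K - b * a * (r * a)\<^sup>2 * c) / D,
          (- 2 * \<Omega> * a * c * K - b * (r * a) ^ 3 * c) / D, b * (r * a)\<^sup>2 * (a\<^sup>2 + (r * a)\<^sup>2) / D]"
        using False by (simp add: mg_symbol_def Let_def K k2 D_def b_def a_def c_def)
      have comp: "\<bar>X / D\<bar> \<le> B / m" if "\<bar>X\<bar> \<le> B * Q" for X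
      proof -
        have "\<bar>X / D\<bar> = \<bar>X\<bar> / D" using D by simp
        also have "\<dots> \<le> B * Q / (m * Q)" using that DQ D m Q B0 by (intro frac_le) auto
        finally show ?thesis using Q by simp
      qed
      define A1 A2 A3 where "A1 = 2 * \<Omega> * (\<bar>r\<bar> + 1) * (2 + r\<^sup>2)" and "A2 = b * (r\<^sup>2 + \<bar>r\<bar> ^ 3)" and "A3 = b * r\<^sup>2 * (1 + r\<^sup>2)"
      have A: "0 \<le> A1" "0 \<le> A2" "0 \<le> A3" "B = A1 + A2 + A3"
        using assms b by (auto simp: A1_def A2_def A3_def B_def intro!: mult_nonneg_nonneg add_nonneg_nonneg)
      have BQ: "B * Q = A1 * Q + A2 * Q + A3 * Q" by (simp add: A algebra_simps)
      have AQ: "0 \<le> A1 * Q" "0 \<le> A2 * Q" "0 \<le> A3 * Q" using A Q by auto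
      have X1: "\<bar>2 * \<Omega> * (r * a) * c * K - b * a * (r * a)\<^sup>2 * c\<bar> \<le> B * Q"
      proof -
        have K0: "0 \<le> K" by (simp add: K_def)
        have "\<bar>2 * \<Omega> * (r * a) * c * K\<bar> = 2 * \<Omega> * \<bar>r\<bar> * (\<bar>a\<bar> * \<bar>c\<bar> * K)"
          using assms K0 by (simp add: abs_mult)
        also have "\<dots> \<le> 2 * \<Omega> * (\<bar>r\<bar> + 1) * ((2 + r\<^sup>2) * Q)"
          using assms K0 by (intro mult_mono[OF _ acK]) auto
        finally have 1: "\<bar>2 * \<Omega> * (r * a) * c * K\<bar> \<le> A1 * Q" by (simp add: A1_def mult_ac)
        have e: "b * a * (r * a)\<^sup>2 * c = b * r\<^sup>2 * (a ^ 3 * c)" by (simp add: power2_eq_square power3_eq_cube)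
        have "\<bar>b * a * (r * a)\<^sup>2 * c\<bar> = b * r\<^sup>2 * (\<bar>a\<bar> ^ 3 * \<bar>c\<bar>)"
          unfolding e using b by (simp add: abs_mult power_abs)
        also have "\<dots> \<le> b * (r\<^sup>2 + \<bar>r\<bar> ^ 3) * Q"
          using b a3c Q by (intro mult_mono) auto
        finally have 2: "\<bar>b * a * (r * a)\<^sup>2 * c\<bar> \<le> A2 * Q" by (simp add: A2_def)
        show ?thesis using 1 2 AQ BQ abs_triangle_ineq4[of "2 * \<Omega> * (r * a) * c * K" "b * a * (r * a)\<^sup>2 * c"] by linarith
      qed
      have X2: "\<bar>- 2 * \<Omega> * a * c * K - b * (r * a) ^ 3 * c\<bar> \<le> B * Q"
      proof -
        have K0: "0 \<le> K" by (simp add: K_def)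
        have "\<bar>- 2 * \<Omega> * a * c * K\<bar> = 2 * \<Omega> * 1 * (\<bar>a\<bar> * \<bar>c\<bar> * K)"
          using assms K0 by (simp add: abs_mult)
        also have "\<dots> \<le> 2 * \<Omega> * (\<bar>r\<bar> + 1) * ((2 + r\<^sup>2) * Q)"
          using assms K0 by (intro mult_mono[OF _ acK]) auto
        finally have 1: "\<bar>- 2 * \<Omega> * a * c * K\<bar> \<le> A1 * Q" by (simp add: A1_def mult_ac)
        have "\<bar>b * (r * a) ^ 3 * c\<bar> = b * \<bar>r\<bar> ^ 3 * (\<bar>a\<bar> ^ 3 * \<bar>c\<bar>)"
          using b by (simp add: abs_mult power_mult_distrib power_abs)
        also have "\<dots> \<le> b * (r\<^sup>2 + \<bar>r\<bar> ^ 3) * Q"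
          using b a3c Q by (intro mult_mono) auto
        finally have 2: "\<bar>b * (r * a) ^ 3 * c\<bar> \<le> A2 * Q" by (simp add: A2_def)
        show ?thesis using 1 2 AQ BQ abs_triangle_ineq4[of "- 2 * \<Omega> * a * c * K" "b * (r * a) ^ 3 * c"] by linarith
      qed
      have X3: "\<bar>b * (r * a)\<^sup>2 * (a\<^sup>2 + (r * a)\<^sup>2)\<bar> \<le> B * Q"
      proof -
        have "\<bar>b * (r * a)\<^sup>2 * (a\<^sup>2 + (r * a)\<^sup>2)\<bar> = A3 * a ^ 4"
        proof -
          have "0 \<le> b * (r * a)\<^sup>2 * (a\<^sup>2 + (r * a)\<^sup>2)" using b by simp
          then show ?thesis by (subst abs_of_nonneg) (simp_all add: A3_def power4_eq_xxxx power2_eq_square algebra_simps)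
        qed
        also have "\<dots> \<le> A3 * Q" using A by (intro mult_left_mono) (auto simp: Q_def)
        finally show ?thesis using AQ BQ by linarith
      qed
      have "norm (mg_symbol \<Omega> \<beta> \<eta> k) \<le> (\<Sum>i\<in>UNIV. \<bar>mg_symbol \<Omega> \<beta> \<eta> k $ i\<bar>)"
        by (rule norm_le_l1_cart)
      also have "\<dots> \<le> B / m + B / m + B / m"
        unfolding sm sum_3 vector_3 by (intro add_mono comp X1 X2 X3)
      finally show ?thesis by simp
    qed
  qed
qed

subsection \<open>The weak formulation\<close>

text \<open>Exchanges the time integral with the frequency series. The integrands \<open>z k\<close>
  may grow like \<open>wt 1 k\<close>; the coefficients \<open>c\<close> of a smooth test function
  absorb this growth.\<close>

lemma time_pairing:
  fixes f :: "real \<Rightarrow> real" and z :: "int^3 \<Rightarrow> real \<Rightarrow> complex" and c :: "int^3 \<Rightarrow> complex"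
  assumes N: "negligible N" and B: "0 \<le> B"
    and eq: "\<And>\<tau>. \<tau> \<in> {0..t} - N \<Longrightarrow> of_real (f \<tau>) = vol * (\<Sum>\<^sub>\<infinity>k. c k * z k \<tau>)"
    and zm: "\<And>k. z k \<in> borel_measurable (lebesgue_on {0..t})"
    and zb: "\<And>k \<tau>. \<tau> \<in> {0..t} \<Longrightarrow> norm (z k \<tau>) \<le> B * wt 1 k"
    and c: "(\<lambda>k. wt 1 k * norm (c k)) summable_on UNIV"
  shows "integrable (lebesgue_on {0..t}) f"
    and "of_real (LINT \<tau>|lebesgue_on {0..t}. f \<tau>) = vol * (\<Sum>\<^sub>\<infinity>k. c k * integral {0..t} (z k))"
    and "(\<lambda>k. norm (c k * integral {0..t} (z k))) summable_on UNIV"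
proof -
  let ?M = "lebesgue_on {0..t}"
  have S: "{0..t} \<in> sets lebesgue" by auto
  have fin: "finite_measure ?M" by (rule finite_measure_lebesgue_on) auto
  interpret finite_measure ?M by (rule fin)
  have m: "(\<lambda>\<tau>. c k * z k \<tau>) \<in> borel_measurable ?M" for k using zm by measurable
  have b: "norm (c k * z k \<tau>) \<le> (B * (wt 1 k * norm (c k))) * 1" if "\<tau> \<in> space ?M" for k \<tau>
    using mult_left_mono[OF zb[of \<tau> k] norm_ge_zero[of "c k"]] that by (simp add: norm_mult mult_ac)
  have cs: "(\<lambda>k. B * (wt 1 k * norm (c k))) summable_on UNIV" by (rule summable_on_cmult_right[OF c])
  have c0: "0 \<le> B * (wt 1 k * norm (c k))" for k using B by simp
  have w: "integrable ?M (\<lambda>_. 1::real)" by simp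
  note I = integrable_infsum[OF m b cs c0 w] integral_infsum[OF m b cs c0 w] summable_integral[OF m b cs c0 w]
  have zi: "(LINT \<tau>|?M. c k * z k \<tau>) = c k * integral {0..t} (z k)" for k
  proof -
    have "integrable ?M (z k)"
      by (rule integrable_const_bound[where B="B * wt 1 k"]) (use zm zb in auto)
    then show ?thesis by (simp add: lebesgue_integral_eq_integral)
  qed
  have gi: "integrable ?M (\<lambda>\<tau>. vol * (\<Sum>\<^sub>\<infinity>k. c k * z k \<tau>))" using I(1) by simp
  have ae: "AE \<tau> in ?M. vol * (\<Sum>\<^sub>\<infinity>k. c k * z k \<tau>) = of_real (f \<tau>)"
    by (rule AE_lebesgue_onI[OF S N]) (use eq in auto)
  have fm: "(\<lambda>\<tau>. complex_of_real (f \<tau>)) \<in> borel_measurable ?M"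
    by (rule measurable_AE_lebesgue_on[OF S borel_measurable_integrable[OF gi] ae])
  have "integrable ?M (\<lambda>\<tau>. complex_of_real (f \<tau>))"
    by (rule integrable_cong_AE_imp[OF gi fm]) (use ae in \<open>auto elim!: eventually_mono\<close>)
  from integrable_Re[OF this] show "integrable ?M f" by simp
  have "(LINT \<tau>|?M. complex_of_real (f \<tau>)) = (LINT \<tau>|?M. vol * (\<Sum>\<^sub>\<infinity>k. c k * z k \<tau>))"
    by (rule integral_cong_AE) (use fm gi ae in \<open>auto elim!: eventually_mono\<close>)
  also have "\<dots> = vol * (\<Sum>\<^sub>\<infinity>k. c k * integral {0..t} (z k))"
    using I(2) unfolding zi by simp
  finally show "of_real (LINT \<tau>|?M. f \<tau>) = vol * (\<Sum>\<^sub>\<infinity>k. c k * integral {0..t} (z k))"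
    by (simp only: integral_complex_of_real)
  show "(\<lambda>k. norm (c k * integral {0..t} (z k))) summable_on UNIV"
    using I(3) unfolding zi by simp
qed

lemma summable_fourier_smooth:
  assumes "\<phi> \<in> smooth_torus" "\<And>k. norm (m k :: complex) \<le> B * wt 1 k"
  shows "(\<lambda>k. norm (m k * fourier \<phi> k)) summable_on UNIV"
proof (rule summable_on_comparison_test[OF summable_on_cmult_right[OF smooth_torus_decay[OF assms(1)], of B]])
  show "norm (m k * fourier \<phi> k) \<le> B * (wt 1 k * norm (fourier \<phi> k))" for k
    using mult_right_mono[OF assms(2)[of k] norm_ge_zero[of "fourier \<phi> k"]] by (simp add: norm_mult mult.assoc)
qed auto

lemma norm_freq_le_wt1: "norm (freq k) \<le> wt 1 k"
  using norm_freq_le_wt[of k] wt_mono[of "1/2" 1 k] by simp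

lemma norm_freq_powr_le_wt1:
  assumes "0 \<le> r" "r \<le> 1"
  shows "norm (freq k) powr (2 * r) \<le> wt 1 k"
proof -
  have "norm (freq k) powr (2 * r) = ((norm (freq k))\<^sup>2) powr r"
    by (cases "k = 0") (auto simp: powr_powr simp flip: powr_numeral)
  also have "\<dots> \<le> wt r k" unfolding wt_def using assms by (intro powr_mono2) auto
  also have "\<dots> \<le> wt 1 k" by (rule wt_mono[OF assms(2)])
  finally show ?thesis .
qed

text \<open>Euler's formula. The two cases are added rather than nested, so that the zero frequency,
  where both apply, is covered.\<close>

lemma fourier_trig:
  "fourier (\<lambda>x. a * cos (freq m \<bullet> x) + b * sin (freq m \<bullet> x)) k
    = (if k = m then (of_real a - \<i> * of_real b) / 2 else 0) + (if k = - m then (of_real a + \<i> * of_real b) / 2 else 0)"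
proof -
  let ?A = "(of_real a - \<i> * of_real b) / 2" and ?B = "(of_real a + \<i> * of_real b) / 2"
  have "of_real (a * cos (freq m \<bullet> x) + b * sin (freq m \<bullet> x)) * ek (- k) x = ?A * ek (m - k) x + ?B * ek (- m - k) x" for x
  proof -
    have "complex_of_real (a * cos (freq m \<bullet> x) + b * sin (freq m \<bullet> x)) = ?A * ek m x + ?B * ek (- m) x"
      by (simp add: ek_def complex_eq_iff field_simps)
    then show ?thesis using ek_mult[of m x "- k"] ek_mult[of "- m" x "- k"] by (simp add: distrib_right mult.assoc)
  qed
  moreover have "integrable torus (ek j)" for j by (intro continuous_imp_integrable_torus continuous_intros)
  ultimately have "(LINT x|torus. of_real (a * cos (freq m \<bullet> x) + b * sin (freq m \<bullet> x)) * ek (- k) x)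
     = ?A * (if m - k = 0 then vol else 0) + ?B * (if - m - k = 0 then vol else 0)"
    by (simp only: integral_ek Bochner_Integration.integral_add integrable_mult_right integral_mult_right_zero)
  moreover have "m - k = 0 \<longleftrightarrow> k = m" "- m - k = 0 \<longleftrightarrow> k = - m" by auto
  ultimately show ?thesis by (simp add: fourier_eq_ek add_divide_distrib del: of_real_add of_real_mult)
qed

context active_scalar
begin

text \<open>The gradient contributes the factor \<open>\<i>\<close> times the frequency to the test
  coefficient at \<open>k\<close>, which meets the flux coefficient at \<open>- k\<close>.
  Contracting the frequency with the velocity recovers \<open>nl\<close>, and the sign comes from
  writing \<open>k\<close> as the negative of \<open>- k\<close>.\<close>

lemma velocity_pairing:
  assumes f: "f \<in> L2_torus" and R: "\<And>k. wt s k * (norm (fourier f k))\<^sup>2 \<le> R"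
    and fs: "(\<lambda>k. wt s k * (norm (fourier f k))\<^sup>2) summable_on UNIV"
    and P: "fourier_supp f \<subseteq> P" and Mm: "\<And>k. k \<in> P \<Longrightarrow> mg_symbol \<Omega> \<beta> \<eta> k = M k" and \<phi>: "\<phi> \<in> smooth_torus"
  shows "of_real (LINT x|torus. f x * (mg_velocity \<Omega> \<beta> \<eta> f x \<bullet> grad \<phi> x))
     = vol * (\<Sum>\<^sub>\<infinity>k. fourier \<phi> k * (- \<i> * nl (fourier f) (- k)))"
proof -
  define y where "y = fourier f"
  note fi = L2_torusD(3)[OF f]
  have ys: "(\<lambda>k. norm (y k)) summable_on UNIV"
    unfolding y_def by (rule summable_fourier_sobolev[OF s_gt(1) fs])
  \<comment> \<open>The symbols agree on \<open>P\<close>, and off \<open>P\<close> the coefficient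
    of \<open>f\<close> vanishes.\<close>
  have my: "of_real (mg_symbol \<Omega> \<beta> \<eta> k $ j) * y k = of_real (M k $ j) * y k" for k j
    using Mm[of k] P by (cases "k \<in> P") (auto simp: y_def fourier_supp_def)
  have Mb: "\<bar>M k $ j\<bar> \<le> CM" for k j using component_le_norm_cart[of "M k" j] M_bound[of k] by linarith
  have us: "(\<lambda>k. norm (of_real (M k $ j) * y k)) summable_on UNIV" for j
    by (rule summable_on_comparison_test[OF summable_on_cmult_right[OF ys, of CM]])
       (use Mb in \<open>auto simp: norm_mult intro!: mult_right_mono\<close>)
  define U where "U j = fourier_multiplier (\<lambda>k. mg_symbol \<Omega> \<beta> \<eta> k $ j) f" for j
  have U: "U j \<in> L2_torus" "fourier (U j) k = of_real (M k $ j) * y k" for j k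
  proof -
    have "(\<lambda>k. norm (of_real (mg_symbol \<Omega> \<beta> \<eta> k $ j) * y k)) summable_on UNIV"
      unfolding my by (rule us)
    then have s: "(\<lambda>k. norm (of_real (mg_symbol \<Omega> \<beta> \<eta> k $ j) * fourier f k)) summable_on UNIV"
      by (simp only: y_def)
    show "U j \<in> L2_torus"
      unfolding U_def by (rule fourier_multiplier(1)[OF s]) (simp add: mg_symbol_uminus)
    have "fourier (U j) k = of_real (mg_symbol \<Omega> \<beta> \<eta> k $ j) * fourier f k"
      unfolding U_def by (rule fourier_multiplier(2)[OF s]) (simp add: mg_symbol_uminus)
    then show "fourier (U j) k = of_real (M k $ j) * y k" unfolding my[symmetric] by (simp only: y_def)
  qed
  have Us: "(\<lambda>k. norm (fourier (U j) k)) summable_on UNIV" for j using us by (simp add: U)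
  note Ui = L2_torusD(3)[OF U(1)]
  have fU: "integrable torus (\<lambda>x. f x * U j x)" for j
    by (rule integral_mult_fourier(3)[OF fi Ui Us])
  have fUk: "fourier (\<lambda>x. f x * U j x) m = (\<Sum>\<^sub>\<infinity>l. of_real (M l $ j) * y l * y (m - l))" for j m
    using fourier_mult[OF fi Ui Us] by (simp add: U y_def)
  have fUs: "(\<lambda>l. of_real (M l $ j) * y l * y (m - l)) summable_on UNIV" for j m
    using abs_summable_summable[OF integral_mult_fourier(2)[OF fi Ui[of j] Us, of "- m"]] by (simp add: U y_def)
  define d where "d j = partial_deriv j \<phi>" for j
  have dk: "fourier (d j) k = \<i> * of_int (k $ j) * fourier \<phi> k" for j k
    unfolding d_def by (rule fourier_partial_deriv[OF \<phi>])
  have di: "integrable torus (d j)" for j unfolding d_def by (rule smooth_torusD(5)[OF smooth_torusD(4)[OF \<phi>]])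
  have ds: "(\<lambda>k. norm (fourier (d j) k)) summable_on UNIV" for j
    unfolding dk
  proof (rule summable_fourier_smooth[OF \<phi>, of _ 1])
    show "norm (\<i> * of_int (k $ j)) \<le> 1 * wt 1 k" for k
      using component_le_norm_cart[of "freq k" j] norm_freq_le_wt1[of k] by (simp add: norm_mult)
  qed
  have I: "integrable torus (\<lambda>x. f x * U j x * d j x)" for j
    by (rule integral_mult_fourier(3)[OF fU di ds])
  have Ik: "of_real (LINT x|torus. f x * U j x * d j x) = vol * (\<Sum>\<^sub>\<infinity>k. fourier (d j) k * fourier (\<lambda>x. f x * U j x) (- k))" for j
    by (rule integral_mult_fourier_0[OF fU di ds])
  have Is: "(\<lambda>k. fourier (d j) k * fourier (\<lambda>x. f x * U j x) (- k)) summable_on UNIV" for j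
    using abs_summable_summable[OF integral_mult_fourier(2)[OF fU di ds, of j j 0]] by simp
  have "(LINT x|torus. f x * (mg_velocity \<Omega> \<beta> \<eta> f x \<bullet> grad \<phi> x)) = (LINT x|torus. (\<Sum>j\<in>UNIV. f x * U j x * d j x))"
    by (simp add: inner_vec_def mg_velocity_def grad_def U_def d_def sum_distrib_left mult.assoc)
  also have "\<dots> = (\<Sum>j\<in>UNIV. LINT x|torus. f x * U j x * d j x)"
    using I by (intro Bochner_Integration.integral_sum) auto
  finally have "of_real (LINT x|torus. f x * (mg_velocity \<Omega> \<beta> \<eta> f x \<bullet> grad \<phi> x))
     = (\<Sum>j\<in>UNIV. vol * (\<Sum>\<^sub>\<infinity>k. fourier (d j) k * fourier (\<lambda>x. f x * U j x) (- k)))"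
    by (simp only: of_real_sum Ik)
  also have "\<dots> = vol * (\<Sum>j\<in>UNIV. (\<Sum>\<^sub>\<infinity>k. fourier (d j) k * fourier (\<lambda>x. f x * U j x) (- k)))"
    by (simp only: sum_distrib_left)
  also have "(\<Sum>j\<in>UNIV. (\<Sum>\<^sub>\<infinity>k. fourier (d j) k * fourier (\<lambda>x. f x * U j x) (- k)))
     = (\<Sum>\<^sub>\<infinity>k. \<Sum>j\<in>UNIV. fourier (d j) k * fourier (\<lambda>x. f x * U j x) (- k))"
    by (rule summable_on_sum_swap(2)[symmetric]) (use Is in auto)
  also have "\<dots> = (\<Sum>\<^sub>\<infinity>k. fourier \<phi> k * (- \<i> * nl y (- k)))"
  proof (rule infsum_cong)
    fix k
    have "(\<Sum>j\<in>UNIV. of_int (k $ j) * fourier (\<lambda>x. f x * U j x) (- k))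
       = (\<Sum>j\<in>UNIV. \<Sum>\<^sub>\<infinity>l. of_int (k $ j) * (of_real (M l $ j) * y l * y (- k - l)))"
      unfolding fUk by (intro sum.cong refl infsum_cmult_right[symmetric] fUs)
    also have "\<dots> = (\<Sum>\<^sub>\<infinity>l. \<Sum>j\<in>UNIV. of_int (k $ j) * (of_real (M l $ j) * y l * y (- k - l)))"
      by (rule summable_on_sum_swap(2)[symmetric]) (auto intro: summable_on_cmult_right fUs)
    also have "\<dots> = (\<Sum>\<^sub>\<infinity>l. - (of_real (freq (- k) \<bullet> M l) * y l * y (- k - l)))"
    proof (rule infsum_cong)
      fix l
      have "complex_of_real (freq k \<bullet> M l) = (\<Sum>j\<in>UNIV. of_int (k $ j) * of_real (M l $ j))"
        by (simp add: inner_vec_def)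
      then show "(\<Sum>j\<in>UNIV. of_int (k $ j) * (of_real (M l $ j) * y l * y (- k - l))) = - (of_real (freq (- k) \<bullet> M l) * y l * y (- k - l))"
        by (simp add: sum_distrib_right mult.assoc)
    qed
    also have "\<dots> = - nl y (- k)" by (simp only: infsum_uminus nl_def)
    finally have 1: "(\<Sum>j\<in>UNIV. of_int (k $ j) * fourier (\<lambda>x. f x * U j x) (- k)) = - nl y (- k)" .
    have "(\<Sum>j\<in>UNIV. fourier (d j) k * fourier (\<lambda>x. f x * U j x) (- k))
      = \<i> * fourier \<phi> k * (\<Sum>j\<in>UNIV. of_int (k $ j) * fourier (\<lambda>x. f x * U j x) (- k))"
      unfolding dk sum_distrib_left by (intro sum.cong refl) (simp only: mult_ac)
    then show "(\<Sum>j\<in>UNIV. fourier (d j) k * fourier (\<lambda>x. f x * U j x) (- k)) = fourier \<phi> k * (- \<i> * nl y (- k))"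
      unfolding 1 by simp
  qed
  finally show ?thesis by (simp only: y_def)
qed

lemma frac_laplacian_pairing:
  assumes f: "f \<in> L2_torus" and \<phi>: "\<phi> \<in> smooth_torus"
  shows "of_real (LINT x|torus. f x * frac_laplacian \<gamma> \<phi> x)
     = vol * (\<Sum>\<^sub>\<infinity>k. fourier \<phi> k * (of_real (norm (freq k) powr (2 * \<gamma>)) * fourier f (- k)))"
proof -
  have s: "(\<lambda>k. norm (complex_of_real (norm (freq k) powr (2 * \<gamma>)) * fourier \<phi> k)) summable_on UNIV"
    by (rule summable_fourier_smooth[OF \<phi>, of _ 1]) (use norm_freq_powr_le_wt1[of \<gamma>] \<gamma> in auto)
  note F = fourier_multiplier[OF s, folded frac_laplacian_def]
  have F1: "frac_laplacian \<gamma> \<phi> \<in> L2_torus" "fourier (frac_laplacian \<gamma> \<phi>) k = of_real (norm (freq k) powr (2 * \<gamma>)) * fourier \<phi> k" for k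
    by (rule F; simp)+
  have "(\<lambda>k. norm (fourier (frac_laplacian \<gamma> \<phi>) k)) summable_on UNIV" using s by (simp only: F1)
  from integral_mult_fourier_0[OF L2_torusD(3)[OF f] L2_torusD(3)[OF F1(1)] this]
  show ?thesis by (simp only: F1) (simp only: mult_ac)
qed

text \<open>The defect of the weak formulation is one series whose terms contain the residuals of
  the integral equations. Read one way, vanishing residuals give a weak solution; read the other
  way, special test functions isolate each residual.\<close>

lemma weak_form_pairing:
  assumes t: "0 \<le> t" and N: "negligible N"
    and \<Theta>: "\<And>\<tau>. \<tau> \<in> {0..t} - N \<Longrightarrow> \<Theta> \<tau> \<in> L2_torus \<and> fourier (\<Theta> \<tau>) = y \<tau>"
    and ys: "\<And>\<tau>. \<tau> \<in> {0..t} \<Longrightarrow> (\<lambda>k. wt s k * (norm (y \<tau> k))\<^sup>2) summable_on UNIV"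
    and yR: "\<And>\<tau> k. \<tau> \<in> {0..t} \<Longrightarrow> wt s k * (norm (y \<tau> k))\<^sup>2 \<le> R"
    and yP: "\<And>\<tau> k. \<tau> \<in> {0..t} \<Longrightarrow> k \<notin> P \<Longrightarrow> y \<tau> k = 0"
    and ym: "\<And>k. (\<lambda>\<tau>. y \<tau> k) \<in> borel_measurable (lebesgue_on {0..t})"
    and Mm: "\<And>k. k \<in> P \<Longrightarrow> mg_symbol \<Omega> \<beta> \<eta> k = M k"
    and \<Theta>t: "\<Theta> t \<in> L2_torus" and \<Theta>0: "\<Theta>0 \<in> L2_torus"
    and S: "\<And>\<tau>. \<tau> \<in> {0..t} - N \<Longrightarrow> S \<tau> \<in> L2_torus \<and> fourier (S \<tau>) = Sc \<tau>"
    and Sm: "\<And>k. (\<lambda>\<tau>. Sc \<tau> k) \<in> borel_measurable (lebesgue_on {0..t})"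
    and Sn: "\<And>\<tau> k. \<tau> \<in> {0..t} \<Longrightarrow> norm (Sc \<tau> k) \<le> \<bar>\<sigma>\<bar>"
    and \<phi>: "\<phi> \<in> smooth_torus"
  shows "of_real ((LINT x|torus. (\<Theta> t x - \<Theta>0 x) * \<phi> x)
        + \<kappa> * (LINT \<tau>|lebesgue_on {0..t}. LINT x|torus. \<Theta> \<tau> x * frac_laplacian \<gamma> \<phi> x)
        - (LINT \<tau>|lebesgue_on {0..t}. LINT x|torus. \<Theta> \<tau> x * (mg_velocity \<Omega> \<beta> \<eta> (\<Theta> \<tau>) x \<bullet> grad \<phi> x))
        - (LINT \<tau>|lebesgue_on {0..t}. LINT x|torus. S \<tau> x * \<phi> x))
     = vol * (\<Sum>\<^sub>\<infinity>k. fourier \<phi> k * (fourier (\<Theta> t) (- k) - fourier \<Theta>0 (- k) - integral {0..t} (rhs Sc y (- k))))"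
proof -
  define c where "c = fourier \<phi>"
  have cs: "(\<lambda>k. wt 1 k * norm (c k)) summable_on UNIV" unfolding c_def by (rule smooth_torus_decay[OF \<phi>])
  have c1: "(\<lambda>k. norm (fourier \<phi> k)) summable_on UNIV"
    using summable_fourier_smooth[OF \<phi>, of "\<lambda>_. 1" 1] wt_ge_1[of 1] by simp
  note \<phi>i = smooth_torusD(5)[OF \<phi>]
  define f2 where "f2 \<tau> = (LINT x|torus. \<Theta> \<tau> x * frac_laplacian \<gamma> \<phi> x)" for \<tau>
  define f3 where "f3 \<tau> = (LINT x|torus. \<Theta> \<tau> x * (mg_velocity \<Omega> \<beta> \<eta> (\<Theta> \<tau>) x \<bullet> grad \<phi> x))" for \<tau>
  define f4 where "f4 \<tau> = (LINT x|torus. S \<tau> x * \<phi> x)" for \<tau>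
  define z2 where "z2 k \<tau> = of_real (norm (freq k) powr (2 * \<gamma>)) * y \<tau> (- k)" for k \<tau>
  define z3 where "z3 k \<tau> = - \<i> * nl (y \<tau>) (- k)" for k \<tau>
  define z4 where "z4 k \<tau> = Sc \<tau> (- k)" for k \<tau>
  have R0: "0 \<le> R" by (rule order_trans[OF _ yR[of 0 0]]) (use t in auto)
  define W where "W = infsum (wt (- s)) UNIV"
  have W0: "0 \<le> W" unfolding W_def by (rule infsum_nonneg) auto
  have e2: "of_real (f2 \<tau>) = vol * (\<Sum>\<^sub>\<infinity>k. c k * z2 k \<tau>)" if "\<tau> \<in> {0..t} - N" for \<tau>
    using frac_laplacian_pairing[of "\<Theta> \<tau>", OF _ \<phi>] \<Theta>[OF that] by (simp add: f2_def c_def z2_def)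
  have e3: "of_real (f3 \<tau>) = vol * (\<Sum>\<^sub>\<infinity>k. c k * z3 k \<tau>)" if "\<tau> \<in> {0..t} - N" for \<tau>
  proof -
    have \<tau>: "\<tau> \<in> {0..t}" using that by simp
    have f: "\<Theta> \<tau> \<in> L2_torus" "fourier (\<Theta> \<tau>) = y \<tau>" using \<Theta>[OF that] by auto
    have "of_real (f3 \<tau>) = vol * (\<Sum>\<^sub>\<infinity>k. fourier \<phi> k * (- \<i> * nl (fourier (\<Theta> \<tau>)) (- k)))"
      unfolding f3_def
      by (rule velocity_pairing[OF f(1), where R=R and P=P]) (use f ys[OF \<tau>] yR[OF \<tau>] yP[OF \<tau>] Mm \<phi> in \<open>auto simp: fourier_supp_def\<close>)
    then show ?thesis by (simp only: f c_def z3_def)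
  qed
  have e4: "of_real (f4 \<tau>) = vol * (\<Sum>\<^sub>\<infinity>k. c k * z4 k \<tau>)" if "\<tau> \<in> {0..t} - N" for \<tau>
    using integral_mult_fourier_0[of "S \<tau>" \<phi>, OF _ \<phi>i c1] S[OF that] L2_torusD(3)[of "S \<tau>"] by (simp add: f4_def c_def z4_def)
  have m2: "z2 k \<in> borel_measurable (lebesgue_on {0..t})" for k
    unfolding z2_def[abs_def] using ym by measurable
  have m3: "z3 k \<in> borel_measurable (lebesgue_on {0..t})" for k
  proof -
    have "(\<lambda>\<tau>. nl (y \<tau>) (- k)) \<in> borel_measurable (lebesgue_on {0..t})"
      by (rule nl_measurable[where R=R]) (use ym yR in auto)
    then show ?thesis unfolding z3_def[abs_def] by measurable
  qed
  have m4: "z4 k \<in> borel_measurable (lebesgue_on {0..t})" for k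
    unfolding z4_def[abs_def] by (rule Sm)
  have b2: "norm (z2 k \<tau>) \<le> sqrt R * wt 1 k" if "\<tau> \<in> {0..t}" for k \<tau>
  proof -
    have "norm (y \<tau> (- k)) \<le> sqrt R"
      using norm_le_of_weighted_sum(1)[of s "- k" "y \<tau>" R] yR[OF that, of "- k"] s_gt by simp
    then have "norm (freq k) powr (2 * \<gamma>) * norm (y \<tau> (- k)) \<le> wt 1 k * sqrt R"
      using norm_freq_powr_le_wt1[of \<gamma> k] \<gamma> by (intro mult_mono) auto
    then show ?thesis by (simp add: z2_def norm_mult mult.commute)
  qed
  have b3: "norm (z3 k \<tau>) \<le> (CM * R * (2 * W)) * wt 1 k" if "\<tau> \<in> {0..t}" for k \<tau>
  proof -
    have "norm (nl (y \<tau>) (- k)) \<le> CM * norm (freq (- k)) * R * (2 * W)"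
      unfolding W_def by (rule norm_nl_le(1)) (use yR[OF that] in auto)
    also have "\<dots> = (CM * R * (2 * W)) * norm (freq k)" by simp
    also have "\<dots> \<le> (CM * R * (2 * W)) * wt 1 k"
      using norm_freq_le_wt1[of k] CM_nonneg R0 W0 by (intro mult_left_mono) auto
    finally show ?thesis by (simp add: z3_def norm_mult)
  qed
  have b4: "norm (z4 k \<tau>) \<le> \<bar>\<sigma>\<bar> * wt 1 k" if "\<tau> \<in> {0..t}" for k \<tau>
    using Sn[OF that, of "- k"] mult_left_mono[OF wt_ge_1[of 1 k], of "\<bar>\<sigma>\<bar>"] by (simp add: z4_def)
  have B3: "0 \<le> CM * R * (2 * W)" using CM_nonneg R0 W0 by simp
  note i2 = time_pairing(1)[OF N _ e2 m2 b2 cs] and i3 = time_pairing(1)[OF N B3 e3 m3 b3 cs] and i4 = time_pairing(1)[OF N _ e4 m4 b4 cs]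
  have i: "integrable (lebesgue_on {0..t}) f2" "integrable (lebesgue_on {0..t}) f3" "integrable (lebesgue_on {0..t}) f4"
    using i2 i3 i4 R0 by auto
  \<comment> \<open>The three time integrands combine into the negative of the right-hand side, so
    one exchange of integral and series treats them together.\<close>
  define z where "z k \<tau> = - rhs Sc y (- k) \<tau>" for k \<tau>
  have z: "z k \<tau> = of_real \<kappa> * z2 k \<tau> - z3 k \<tau> - z4 k \<tau>" for k \<tau>
    by (simp add: z_def rhs_def z2_def z3_def z4_def lin_def)
  have sm: "(\<lambda>k. c k * g k) summable_on UNIV" if "\<And>k. norm (g k :: complex) \<le> B * wt 1 k" for g B
  proof (rule abs_summable_summable[OF summable_on_comparison_test[OF summable_on_cmult_right[OF cs, of B]]])
    show "norm (c k * g k) \<le> B * (wt 1 k * norm (c k))" for k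
      using mult_left_mono[OF that[of k] norm_ge_zero[of "c k"]] by (simp add: norm_mult mult_ac)
  qed auto
  have e: "of_real (\<kappa> * f2 \<tau> - f3 \<tau> - f4 \<tau>) = vol * (\<Sum>\<^sub>\<infinity>k. c k * z k \<tau>)" if "\<tau> \<in> {0..t} - N" for \<tau>
  proof -
    have \<tau>: "\<tau> \<in> {0..t}" using that by simp
    note s2 = summable_on_cmult_right[OF sm[OF b2[OF \<tau>]], of "of_real \<kappa>"] and s3' = summable_on_uminus[THEN iffD2, OF sm[OF b3[OF \<tau>]]] and s4' = summable_on_uminus[THEN iffD2, OF sm[OF b4[OF \<tau>]]]
    have "(\<Sum>\<^sub>\<infinity>k. c k * z k \<tau>) = (\<Sum>\<^sub>\<infinity>k. of_real \<kappa> * (c k * z2 k \<tau>) + (- (c k * z3 k \<tau>) + - (c k * z4 k \<tau>)))"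
      unfolding z by (rule infsum_cong) (simp add: algebra_simps)
    also have "\<dots> = (\<Sum>\<^sub>\<infinity>k. of_real \<kappa> * (c k * z2 k \<tau>)) + ((\<Sum>\<^sub>\<infinity>k. - (c k * z3 k \<tau>)) + (\<Sum>\<^sub>\<infinity>k. - (c k * z4 k \<tau>)))"
      by (simp only: infsum_add[OF s2 summable_on_add[OF s3' s4']] infsum_add[OF s3' s4'])
    also have "(\<Sum>\<^sub>\<infinity>k. of_real \<kappa> * (c k * z2 k \<tau>)) = of_real \<kappa> * (\<Sum>\<^sub>\<infinity>k. c k * z2 k \<tau>)"
      by (rule infsum_cmult_right) (rule sm[OF b2[OF \<tau>]])
    finally have A: "(\<Sum>\<^sub>\<infinity>k. c k * z k \<tau>) = of_real \<kappa> * (\<Sum>\<^sub>\<infinity>k. c k * z2 k \<tau>)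
        - (\<Sum>\<^sub>\<infinity>k. c k * z3 k \<tau>) - (\<Sum>\<^sub>\<infinity>k. c k * z4 k \<tau>)"
      by (simp only: infsum_uminus) simp
    show ?thesis
      unfolding A of_real_diff of_real_mult e2[OF that] e3[OF that] e4[OF that] by (simp add: right_diff_distrib)
  qed
  have zm: "z k \<in> borel_measurable (lebesgue_on {0..t})" for k
    unfolding z[abs_def] using m2 m3 m4 by measurable
  have zb: "norm (z k \<tau>) \<le> (\<kappa> * sqrt R + CM * R * (2 * W) + \<bar>\<sigma>\<bar>) * wt 1 k" if "\<tau> \<in> {0..t}" for k \<tau>
  proof -
    have "norm (z k \<tau>) \<le> norm (of_real \<kappa> * z2 k \<tau>) + norm (z3 k \<tau>) + norm (z4 k \<tau>)"
      unfolding z by (meson add_right_mono norm_triangle_ineq4 order_trans)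
    also have "norm (of_real \<kappa> * z2 k \<tau>) \<le> \<kappa> * (sqrt R * wt 1 k)"
      using mult_left_mono[OF b2[OF that], of \<kappa>] \<kappa> by (simp add: norm_mult)
    finally show ?thesis using b3[OF that, of k] b4[OF that, of k] by (simp add: algebra_simps)
  qed
  have Z0: "0 \<le> \<kappa> * sqrt R + CM * R * (2 * W) + \<bar>\<sigma>\<bar>" using \<kappa> R0 B3 by (intro add_nonneg_nonneg) auto
  have TP: "complex_of_real (LINT \<tau>|lebesgue_on {0..t}. \<kappa> * f2 \<tau> - f3 \<tau> - f4 \<tau>) = vol * (\<Sum>\<^sub>\<infinity>k. c k * integral {0..t} (z k))"
    "(\<lambda>k. norm (c k * integral {0..t} (z k))) summable_on UNIV"
    by (rule time_pairing(2,3)[OF N Z0 e zm zb cs]; assumption)+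
  have zi: "integral {0..t} (z k) = - integral {0..t} (rhs Sc y (- k))" for k
    unfolding z_def[abs_def] by simp
  have L1: "integrable torus (\<lambda>x. \<Theta> t x - \<Theta>0 x)" using L2_torusD(3)[OF \<Theta>t] L2_torusD(3)[OF \<Theta>0] by simp
  have p1: "of_real (LINT x|torus. (\<Theta> t x - \<Theta>0 x) * \<phi> x) = vol * (\<Sum>\<^sub>\<infinity>k. c k * (fourier (\<Theta> t) (- k) - fourier \<Theta>0 (- k)))"
    unfolding c_def using integral_mult_fourier_0[OF L1 \<phi>i c1] by (simp add: fourier_diff[OF L2_torusD(3)[OF \<Theta>t] L2_torusD(3)[OF \<Theta>0]])
  have s1: "(\<lambda>k. c k * (fourier (\<Theta> t) (- k) - fourier \<Theta>0 (- k))) summable_on UNIV"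
    unfolding c_def using abs_summable_summable[OF integral_mult_fourier(2)[OF L1 \<phi>i c1, of 0]]
    by (simp add: fourier_diff[OF L2_torusD(3)[OF \<Theta>t] L2_torusD(3)[OF \<Theta>0]])
  have "\<kappa> * (LINT \<tau>|lebesgue_on {0..t}. f2 \<tau>) - (LINT \<tau>|lebesgue_on {0..t}. f3 \<tau>) - (LINT \<tau>|lebesgue_on {0..t}. f4 \<tau>)
     = (LINT \<tau>|lebesgue_on {0..t}. \<kappa> * f2 \<tau> - f3 \<tau> - f4 \<tau>)"
    using i by simp
  then have "of_real ((LINT x|torus. (\<Theta> t x - \<Theta>0 x) * \<phi> x) + \<kappa> * (LINT \<tau>|lebesgue_on {0..t}. f2 \<tau>)
       - (LINT \<tau>|lebesgue_on {0..t}. f3 \<tau>) - (LINT \<tau>|lebesgue_on {0..t}. f4 \<tau>))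
     = of_real (LINT x|torus. (\<Theta> t x - \<Theta>0 x) * \<phi> x) + complex_of_real (LINT \<tau>|lebesgue_on {0..t}. \<kappa> * f2 \<tau> - f3 \<tau> - f4 \<tau>)"
    by (simp only: of_real_add[symmetric]) (simp add: algebra_simps)
  also have "\<dots> = vol * ((\<Sum>\<^sub>\<infinity>k. c k * (fourier (\<Theta> t) (- k) - fourier \<Theta>0 (- k))) + (\<Sum>\<^sub>\<infinity>k. c k * integral {0..t} (z k)))"
    unfolding p1 TP(1) by (simp only: distrib_left)
  also have "(\<Sum>\<^sub>\<infinity>k. c k * (fourier (\<Theta> t) (- k) - fourier \<Theta>0 (- k))) + (\<Sum>\<^sub>\<infinity>k. c k * integral {0..t} (z k))
     = (\<Sum>\<^sub>\<infinity>k. c k * (fourier (\<Theta> t) (- k) - fourier \<Theta>0 (- k)) + c k * integral {0..t} (z k))"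
    by (rule infsum_add[symmetric, OF s1 abs_summable_summable[OF TP(2)]])
  also have "\<dots> = (\<Sum>\<^sub>\<infinity>k. c k * (fourier (\<Theta> t) (- k) - fourier \<Theta>0 (- k) - integral {0..t} (rhs Sc y (- k))))"
    by (rule infsum_cong) (simp add: zi algebra_simps)
  finally show ?thesis by (simp only: f2_def f3_def f4_def c_def)
qed

end

subsection \<open>Well-posedness on a frequency plane\<close>

lemma integrable_lebesgue_on_iff:
  fixes f :: "'a::euclidean_space \<Rightarrow> real"
  assumes "A \<in> sets lebesgue"
  shows "integrable (lebesgue_on A) f \<longleftrightarrow> f absolutely_integrable_on A"
  using assms by (simp add: integrable_restrict_space set_integrable_def)

lemma measurable_extend_zero:
  fixes f :: "'a::euclidean_space \<Rightarrow> 'b::euclidean_space"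
  assumes "A \<in> sets lebesgue" "f \<in> borel_measurable (lebesgue_on A)" "\<And>x. x \<notin> A \<Longrightarrow> f x = 0"
  shows "f \<in> borel_measurable (lebesgue_on B)"
proof -
  have "(\<lambda>x. if x \<in> A then f x else 0) \<in> borel_measurable lebesgue"
    using assms borel_measurable_if[OF assms(1), of f] by blast
  moreover have "(\<lambda>x. if x \<in> A then f x else 0) = f" using assms(3) by auto
  ultimately show ?thesis by (simp add: measurable_restrict_space1)
qed

text \<open>Monotone convergence along the cubes: bounded integrals of the partial sums make their
  supremum integrable, hence finite outside a null set of times.\<close>

lemma summable_wt_AE:
  fixes \<theta> :: "real \<Rightarrow> int^3 \<Rightarrow> complex"
  assumes c: "\<And>k. continuous_on {0..T} (\<lambda>t. \<theta> t k)"
    and B: "\<And>F. finite F \<Longrightarrow> integral {0..T} (\<lambda>t. \<Sum>k\<in>F. wt r k * (norm (\<theta> t k))\<^sup>2) \<le> B"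
  obtains N where "negligible N" "\<And>t. t \<in> {0..T} - N \<Longrightarrow> (\<lambda>k. wt r k * (norm (\<theta> t k))\<^sup>2) summable_on UNIV"
    "integrable (lebesgue_on {0..T}) (\<lambda>t. \<Sum>\<^sub>\<infinity>k. wt r k * (norm (\<theta> t k))\<^sup>2)"
proof -
  let ?M = "lebesgue_on {0..T}"
  have S: "{0..T} \<in> sets lebesgue" by auto
  define e where "e n t = (\<Sum>k\<in>cube n. wt r k * (norm (\<theta> t k))\<^sup>2)" for n t
  have e0: "0 \<le> e n t" for n t by (auto simp: e_def intro!: sum_nonneg)
  have ec: "continuous_on {0..T} (e n)" for n unfolding e_def by (intro continuous_intros c)
  have ei: "integrable ?M (e n)" for n by (rule continuous_imp_integrable_real[OF ec])
  have em: "e n \<in> borel_measurable ?M" for n using ei by auto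
  have mono: "e m t \<le> e n t" if "m \<le> n" for m n t
    unfolding e_def by (rule sum_mono2) (use cube_mono[OF that] in auto)
  define E where "E t = (SUP n. ennreal (e n t))" for t
  have Em: "E \<in> borel_measurable ?M" unfolding E_def using em by measurable
  have "(\<integral>\<^sup>+ t. E t \<partial>?M) = (SUP n. \<integral>\<^sup>+ t. ennreal (e n t) \<partial>?M)"
    unfolding E_def
    by (rule nn_integral_monotone_convergence_SUP) (use em mono in \<open>auto simp: incseq_def le_fun_def intro!: ennreal_leI\<close>)
  also have "\<dots> \<le> ennreal B"
  proof (rule SUP_least)
    fix n
    have "(\<integral>\<^sup>+ t. ennreal (e n t) \<partial>?M) = ennreal (LINT t|?M. e n t)"
      by (rule nn_integral_eq_integral[OF ei]) (use e0 in auto)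
    also have "(LINT t|?M. e n t) = integral {0..T} (e n)" by (rule lebesgue_integral_eq_integral[OF ei S])
    finally show "(\<integral>\<^sup>+ t. ennreal (e n t) \<partial>?M) \<le> ennreal B"
      using B[of "cube n"] by (simp add: e_def[abs_def] ennreal_leI)
  qed
  finally have Ei: "(\<integral>\<^sup>+ t. E t \<partial>?M) \<le> ennreal B" .
  have "(\<integral>\<^sup>+ t. E t \<partial>?M) < \<infinity>" by (rule le_less_trans[OF Ei]) simp
  then have "(\<integral>\<^sup>+ t. E t \<partial>?M) \<noteq> \<infinity>" by simp
  then have ae: "AE t in ?M. E t \<noteq> \<infinity>" by (rule nn_integral_noteq_infinite[OF Em])
  have good: "(\<lambda>k. wt r k * (norm (\<theta> t k))\<^sup>2) summable_on UNIV \<and> ennreal (\<Sum>\<^sub>\<infinity>k. wt r k * (norm (\<theta> t k))\<^sup>2) \<le> E t"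
    if "E t \<noteq> \<infinity>" for t
  proof -
    obtain b where b: "0 \<le> b" "E t = ennreal b" using \<open>E t \<noteq> \<infinity>\<close> by (cases "E t") auto
    have eb: "e n t \<le> b" for n
    proof -
      have "ennreal (e n t) \<le> E t" unfolding E_def by (rule SUP_upper) simp
      then show ?thesis using b by simp
    qed
    have F: "(\<Sum>k\<in>F. wt r k * (norm (\<theta> t k))\<^sup>2) \<le> b" if "finite F" for F
    proof -
      obtain n where n: "F \<subseteq> cube n" using finite_subset_cube[OF \<open>finite F\<close>] by blast
      have "(\<Sum>k\<in>F. wt r k * (norm (\<theta> t k))\<^sup>2) \<le> e n t" unfolding e_def by (rule sum_mono2) (use n in auto)
      then show ?thesis using eb[of n] by linarith
    qed
    have s: "(\<lambda>k. wt r k * (norm (\<theta> t k))\<^sup>2) summable_on UNIV"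
      by (rule nonneg_bdd_above_summable_on) (auto intro!: bdd_aboveI F)
    moreover have "(\<Sum>\<^sub>\<infinity>k. wt r k * (norm (\<theta> t k))\<^sup>2) \<le> b"
      by (rule infsum_le_finite_sums[OF s F])
    ultimately show ?thesis using b by (simp add: ennreal_leI)
  qed
  obtain N where N: "negligible N" "\<And>t. t \<in> {0..T} - N \<Longrightarrow> E t \<noteq> \<infinity>"
    using AE_lebesgue_on_negligible[OF S ae] by blast
  show ?thesis
  proof (rule that[of N])
    show "negligible N" by (rule N(1))
    show "(\<lambda>k. wt r k * (norm (\<theta> t k))\<^sup>2) summable_on UNIV" if "t \<in> {0..T} - N" for t
      using good N(2)[OF that] by blast
    have "AE t in ?M. lim (\<lambda>n. e n t) = (\<Sum>\<^sub>\<infinity>k. wt r k * (norm (\<theta> t k))\<^sup>2)"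
      using ae
    proof eventually_elim
      case (elim t)
      then show ?case using infsum_cube[of "\<lambda>k. wt r k * (norm (\<theta> t k))\<^sup>2"] good[of t] by (intro limI) (simp add: e_def)
    qed
    then have m: "(\<lambda>t. \<Sum>\<^sub>\<infinity>k. wt r k * (norm (\<theta> t k))\<^sup>2) \<in> borel_measurable ?M"
      by (rule measurable_AE_lebesgue_on[OF S borel_measurable_lim_metric[OF em]])
    show "integrable ?M (\<lambda>t. \<Sum>\<^sub>\<infinity>k. wt r k * (norm (\<theta> t k))\<^sup>2)"
    proof (rule integrableI_bounded[OF m])
      have "(\<integral>\<^sup>+ t. ennreal (norm (\<Sum>\<^sub>\<infinity>k. wt r k * (norm (\<theta> t k))\<^sup>2)) \<partial>?M) \<le> (\<integral>\<^sup>+ t. E t \<partial>?M)"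
      proof (rule nn_integral_mono_AE)
        show "AE t in ?M. ennreal (norm (\<Sum>\<^sub>\<infinity>k. wt r k * (norm (\<theta> t k))\<^sup>2)) \<le> E t"
          using ae
        proof eventually_elim
          case (elim t)
          have "0 \<le> (\<Sum>\<^sub>\<infinity>k. wt r k * (norm (\<theta> t k))\<^sup>2)" by (rule infsum_nonneg) auto
          then show ?case using good[of t] elim by simp
        qed
      qed
      also have "\<dots> < \<infinity>" using Ei ennreal_less_top[of B] by (simp add: le_less_trans)
      finally show "(\<integral>\<^sup>+ t. ennreal (norm (\<Sum>\<^sub>\<infinity>k. wt r k * (norm (\<theta> t k))\<^sup>2)) \<partial>?M) < \<infinity>" .
    qed
  qed
qed

text \<open>Of the plane only closure under negation and addition is kept. \<open>Sc\<close> holds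
  the coefficients of the source outside the null set \<open>NS\<close>, with values there arranged
  so that its bounds hold at every time.\<close>

locale mg_problem = active_scalar M CM \<kappa> \<gamma> s
  for M :: "int^3 \<Rightarrow> real^3" and CM \<kappa> \<gamma> s :: real +
  fixes \<Omega> \<beta> \<eta> :: real and P NS and \<Theta>0 :: "real^3 \<Rightarrow> real" and S :: "real \<Rightarrow> real^3 \<Rightarrow> real"
    and Sc :: "real \<Rightarrow> int^3 \<Rightarrow> complex" and \<sigma> :: real
  assumes Mm: "\<And>k. k \<in> P \<Longrightarrow> mg_symbol \<Omega> \<beta> \<eta> k = M k"
    and P: "\<And>k. k \<in> P \<Longrightarrow> - k \<in> P" "\<And>k l. k \<in> P \<Longrightarrow> l \<in> P \<Longrightarrow> k + l \<in> P"
    and \<Theta>0: "\<Theta>0 \<in> sobolev s" "fourier_supp \<Theta>0 \<subseteq> P"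
    and NS: "negligible NS"
    and S: "\<And>\<tau>. 0 < \<tau> \<Longrightarrow> \<tau> \<notin> NS \<Longrightarrow> S \<tau> \<in> L2_torus \<and> fourier (S \<tau>) = Sc \<tau>"
    and Sm: "\<And>T k. (\<lambda>t. Sc t k) \<in> borel_measurable (lebesgue_on {0..T})"
    and Sb: "\<And>t G. finite G \<Longrightarrow> (\<Sum>k\<in>G. wt (s - \<gamma>) k * (norm (Sc t k))\<^sup>2) \<le> \<sigma>\<^sup>2"
    and Sh: "\<And>t. hermitian (Sc t)"
    and SP: "\<And>t k. k \<notin> P \<Longrightarrow> Sc t k = 0"
begin

lemma Sn: "norm (Sc t k) \<le> \<bar>\<sigma>\<bar>"
  using norm_le_of_weighted_sum(1)[of "s - \<gamma>" k "Sc t" "\<sigma>\<^sup>2"] Sb[of "{k}" t] s_gt by simp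

text \<open>Since s > 3/2 the coefficients sum absolutely at every time, so the function exists
  without exceptional times. Only the H^(s+\<gamma>) regularity holds outside a null set.\<close>

lemma mg_solution_fser:
  assumes T: "0 < T" and sol: "coef_solution P T (fourier \<Theta>0) Sc C \<theta>"
    and D: "\<And>F. finite F \<Longrightarrow> \<kappa> * integral {0..T} (\<lambda>t. \<Sum>k\<in>F. wt (s + \<gamma>) k * (norm (\<theta> t k))\<^sup>2) \<le> C"
  shows "mg_solution \<Omega> \<beta> \<eta> \<kappa> \<gamma> s S \<Theta>0 T (\<lambda>t. fser (\<theta> t))"
    and "\<And>t. t \<in> {0..T} \<Longrightarrow> fourier (fser (\<theta> t)) = \<theta> t"
    and "\<And>t. t \<in> {0..T} \<Longrightarrow> fser (\<theta> t) \<in> L2_torus"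
proof -
  have h: "hermitian (\<theta> t)" and z: "\<And>k. k \<notin> P \<Longrightarrow> \<theta> t k = 0"
    and F: "\<And>F. finite F \<Longrightarrow> (\<Sum>k\<in>F. wt s k * (norm (\<theta> t k))\<^sup>2) \<le> C"
    and eq: "\<And>k. \<theta> t k = fourier \<Theta>0 k + integral {0..t} (rhs Sc \<theta> k)"
    if "t \<in> {0..T}" for t
    using sol that by (auto simp: coef_solution_def)
  have c: "continuous_on {0..T} (\<lambda>t. \<theta> t k)" for k
    using sol by (auto simp: coef_solution_def)
  have s': "(\<lambda>k. wt s k * (norm (\<theta> t k))\<^sup>2) summable_on UNIV" if "t \<in> {0..T}" for t
    by (rule nonneg_bdd_above_summable_on) (auto intro!: bdd_aboveI F[OF that])
  have l1: "(\<lambda>k. norm (\<theta> t k)) summable_on UNIV" if "t \<in> {0..T}" for t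
    by (rule summable_fourier_sobolev[OF s_gt(1) s'[OF that]])
  have fc: "fourier (fser (\<theta> t)) = \<theta> t" if "t \<in> {0..T}" for t
    using fourier_fser[OF l1[OF that] h[OF that]] by auto
  show "\<And>t. t \<in> {0..T} \<Longrightarrow> fourier (fser (\<theta> t)) = \<theta> t" by (rule fc)
  have L2: "fser (\<theta> t) \<in> L2_torus" if "t \<in> {0..T}" for t by (rule fser_L2_torus[OF l1[OF that]])
  then show "\<And>t. t \<in> {0..T} \<Longrightarrow> fser (\<theta> t) \<in> L2_torus" .
  have tk: "wt s k * (norm (\<theta> t k))\<^sup>2 \<le> C" if "t \<in> {0..T}" for t k using F[OF that, of "{k}"] by simp
  have sets: "{0<..<T} \<in> sets lebesgue" by auto
  have Linf: "(\<lambda>t. fser (\<theta> t)) \<in> Linf_sobolev {0<..<T} s"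
  proof -
    have "sobolev_norm s (fser (\<theta> t)) \<le> sqrt C" if "t \<in> {0..T}" for t
    proof (rule real_le_rsqrt)
      show "(sobolev_norm s (fser (\<theta> t)))\<^sup>2 \<le> C"
        unfolding sobolev_norm_sq fc[OF that] by (rule infsum_le_finite_sums[OF s'[OF that] F[OF that]])
    qed
    then have "AE t in lebesgue_on {0<..<T}. sobolev_norm s (fser (\<theta> t)) \<le> sqrt C"
      by (intro AE_I2) auto
    moreover have "bochner_measurable s {0<..<T} (\<lambda>t. fser (\<theta> t))"
      by (rule bochner_measurable_fser[OF T h c l1, of "{}"]) (use s' in auto)
    ultimately show ?thesis by (auto simp: Linf_sobolev_def)
  qed
  have D': "integral {0..T} (\<lambda>t. \<Sum>k\<in>F. wt (s + \<gamma>) k * (norm (\<theta> t k))\<^sup>2) \<le> C / \<kappa>" if "finite F" for F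
    using D[OF that] \<kappa> by (simp add: field_simps)
  obtain N where N: "negligible N" and Ns: "\<And>t. t \<in> {0..T} - N \<Longrightarrow> (\<lambda>k. wt (s + \<gamma>) k * (norm (\<theta> t k))\<^sup>2) summable_on UNIV"
    and Ni: "integrable (lebesgue_on {0..T}) (\<lambda>t. \<Sum>\<^sub>\<infinity>k. wt (s + \<gamma>) k * (norm (\<theta> t k))\<^sup>2)"
    using summable_wt_AE[OF c D'] by blast
  have L2s: "(\<lambda>t. fser (\<theta> t)) \<in> L2_sobolev {0<..<T} (s + \<gamma>)"
  proof -
    have "bochner_measurable (s + \<gamma>) {0<..<T} (\<lambda>t. fser (\<theta> t))"
      by (rule bochner_measurable_fser[OF T h c l1 N Ns])
    moreover have "integrable (lebesgue_on {0<..<T}) (\<lambda>t. (sobolev_norm (s + \<gamma>) (fser (\<theta> t)))\<^sup>2)"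
    proof -
      have "(\<lambda>t. \<Sum>\<^sub>\<infinity>k. wt (s + \<gamma>) k * (norm (\<theta> t k))\<^sup>2) absolutely_integrable_on {0..T}"
        using Ni by (subst integrable_lebesgue_on_iff[symmetric]) auto
      then have "(\<lambda>t. \<Sum>\<^sub>\<infinity>k. wt (s + \<gamma>) k * (norm (\<theta> t k))\<^sup>2) absolutely_integrable_on {0<..<T}"
        by (rule set_integrable_subset) auto
      then have "integrable (lebesgue_on {0<..<T}) (\<lambda>t. \<Sum>\<^sub>\<infinity>k. wt (s + \<gamma>) k * (norm (\<theta> t k))\<^sup>2)"
        by (subst integrable_lebesgue_on_iff) auto
      then show ?thesis
        by (rule Bochner_Integration.integrable_cong[OF refl, THEN iffD1, rotated]) (simp add: sobolev_norm_sq fc)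
    qed
    ultimately show ?thesis by (simp add: L2_sobolev_def)
  qed
  have ini: "AE x in torus. fser (\<theta> 0) x = \<Theta>0 x"
    by (rule fourier_eq_imp_AE_eq)
       (use T L2_torusD(3)[OF L2[of 0]] L2_torusD(3)[OF sobolevD(1)[OF \<Theta>0(1)]] fc[of 0] eq[of 0] in auto)
  have weak: "(LINT x|torus. (fser (\<theta> t) x - \<Theta>0 x) * \<phi> x)
        + \<kappa> * (LINT \<tau>|lebesgue_on {0..t}. LINT x|torus. fser (\<theta> \<tau>) x * frac_laplacian \<gamma> \<phi> x)
        - (LINT \<tau>|lebesgue_on {0..t}. LINT x|torus. fser (\<theta> \<tau>) x * (mg_velocity \<Omega> \<beta> \<eta> (fser (\<theta> \<tau>)) x \<bullet> grad \<phi> x))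
        = (LINT \<tau>|lebesgue_on {0..t}. LINT x|torus. S \<tau> x * \<phi> x)"
    if \<phi>: "\<phi> \<in> smooth_torus" and t: "t \<in> {0<..<T}" for \<phi> t
  proof -
    have tT: "{0..t} \<subseteq> {0..T}" "t \<in> {0..T}" using t by auto
    have "complex_of_real ((LINT x|torus. (fser (\<theta> t) x - \<Theta>0 x) * \<phi> x)
        + \<kappa> * (LINT \<tau>|lebesgue_on {0..t}. LINT x|torus. fser (\<theta> \<tau>) x * frac_laplacian \<gamma> \<phi> x)
        - (LINT \<tau>|lebesgue_on {0..t}. LINT x|torus. fser (\<theta> \<tau>) x * (mg_velocity \<Omega> \<beta> \<eta> (fser (\<theta> \<tau>)) x \<bullet> grad \<phi> x))
        - (LINT \<tau>|lebesgue_on {0..t}. LINT x|torus. S \<tau> x * \<phi> x))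
      = vol * (\<Sum>\<^sub>\<infinity>k. fourier \<phi> k * (fourier (fser (\<theta> t)) (- k) - fourier \<Theta>0 (- k) - integral {0..t} (rhs Sc \<theta> (- k))))"
    proof (rule weak_form_pairing[where N="NS \<union> {0}" and P=P and R=C and \<sigma>=\<sigma>])
      show "0 \<le> t" using t by auto
      show "negligible (NS \<union> {0})" using NS by simp
      show "fser (\<theta> \<tau>) \<in> L2_torus \<and> fourier (fser (\<theta> \<tau>)) = \<theta> \<tau>" if "\<tau> \<in> {0..t} - (NS \<union> {0})" for \<tau>
        using that tT L2 fc by auto
      show "(\<lambda>k. wt s k * (norm (\<theta> \<tau> k))\<^sup>2) summable_on UNIV" if "\<tau> \<in> {0..t}" for \<tau> using that tT s' by auto
      show "wt s k * (norm (\<theta> \<tau> k))\<^sup>2 \<le> C" if "\<tau> \<in> {0..t}" for \<tau> k using that tT by (intro tk) auto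
      show "\<theta> \<tau> k = 0" if "\<tau> \<in> {0..t}" "k \<notin> P" for \<tau> k using that tT by (intro z) auto
      show "(\<lambda>\<tau>. \<theta> \<tau> k) \<in> borel_measurable (lebesgue_on {0..t})" for k
        by (rule continuous_imp_measurable_Icc[OF continuous_on_subset[OF c tT(1)]])
      show "S \<tau> \<in> L2_torus \<and> fourier (S \<tau>) = Sc \<tau>" if "\<tau> \<in> {0..t} - (NS \<union> {0})" for \<tau>
        using that by (intro S) auto
      show "fser (\<theta> t) \<in> L2_torus" by (rule L2[OF tT(2)])
      show "\<Theta>0 \<in> L2_torus" by (rule sobolevD(1)[OF \<Theta>0(1)])
    qed (use Mm Sm Sn \<phi> in auto)
    also have "\<dots> = 0"
      using eq[OF tT(2)] by (simp add: fc[OF tT(2)])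
    finally show ?thesis by (simp only: of_real_eq_0_iff right_minus_eq)
  qed
  show "mg_solution \<Omega> \<beta> \<eta> \<kappa> \<gamma> s S \<Theta>0 T (\<lambda>t. fser (\<theta> t))"
    unfolding mg_solution_def using Linf L2s L2 ini weak by auto
qed

text \<open>The weak formulation at every time ties the coefficients to an indefinite integral,
  hence makes them continuous. The result is stated on closed intervals ending before
  \<open>T\<close>, because a solution is prescribed on [0,T) only.\<close>

lemma mg_solution_coef:
  assumes T: "0 < T" and sol: "mg_solution \<Omega> \<beta> \<eta> \<kappa> \<gamma> s S \<Theta>0 T \<Theta>"
    and supp: "\<forall>t\<in>{0..<T}. fourier_supp (\<Theta> t) \<subseteq> P" and t: "t \<in> {0..<T}"
  obtains C where "coef_solution P t (fourier \<Theta>0) Sc C (\<lambda>t. fourier (\<Theta> t))"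
proof -
  have Li: "\<Theta> \<in> Linf_sobolev {0<..<T} s" and L2: "\<And>t. t \<in> {0..<T} \<Longrightarrow> \<Theta> t \<in> L2_torus"
    and ini: "AE x in torus. \<Theta> 0 x = \<Theta>0 x"
    and weak: "\<And>\<phi> t. \<phi> \<in> smooth_torus \<Longrightarrow> t \<in> {0<..<T} \<Longrightarrow>
        (LINT x|torus. (\<Theta> t x - \<Theta>0 x) * \<phi> x)
        + \<kappa> * (LINT \<tau>|lebesgue_on {0..t}. LINT x|torus. \<Theta> \<tau> x * frac_laplacian \<gamma> \<phi> x)
        - (LINT \<tau>|lebesgue_on {0..t}. LINT x|torus. \<Theta> \<tau> x * (mg_velocity \<Omega> \<beta> \<eta> (\<Theta> \<tau>) x \<bullet> grad \<phi> x))
        = (LINT \<tau>|lebesgue_on {0..t}. LINT x|torus. S \<tau> x * \<phi> x)"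
    using sol by (auto simp: mg_solution_def)
  have sets: "{0<..<T} \<in> sets lebesgue" by auto
  obtain C where bm: "bochner_measurable s {0<..<T} \<Theta>" and ae: "AE t in lebesgue_on {0<..<T}. sobolev_norm s (\<Theta> t) \<le> C"
    using Li by (auto simp: Linf_sobolev_def)
  define good where "good \<tau> \<longleftrightarrow> \<tau> \<in> {0<..<T} \<and> \<Theta> \<tau> \<in> sobolev s \<and> sobolev_norm s (\<Theta> \<tau>) \<le> C" for \<tau>
  have "AE t in lebesgue_on {0<..<T}. \<Theta> t \<in> sobolev s \<and> sobolev_norm s (\<Theta> t) \<le> C"
    using ae bm by (auto simp: bochner_measurable_def)
  then obtain N where N: "negligible N" and Ng: "\<And>\<tau>. \<tau> \<in> {0<..<T} - N \<Longrightarrow> good \<tau>"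
    using AE_lebesgue_on_negligible[OF sets] unfolding good_def by (metis (no_types, lifting) DiffD1)
  \<comment> \<open>At times without the H^s bound the coefficients are replaced by zero. The result
    is bounded everywhere and changes nothing under time integrals.\<close>
  define y where "y \<tau> k = (if good \<tau> then fourier (\<Theta> \<tau>) k else 0)" for \<tau> k
  have yb: "(\<Sum>k\<in>F. wt s k * (norm (y \<tau> k))\<^sup>2) \<le> C\<^sup>2" if "finite F" for F \<tau>
  proof (cases "good \<tau>")
    case True
    have "(sobolev_norm s (\<Theta> \<tau>))\<^sup>2 \<le> C\<^sup>2"
      using True sobolev_norm_nonneg by (intro power_mono) (auto simp: good_def)
    then show ?thesis using sobolevD(3)[of "\<Theta> \<tau>" s F] True that by (simp add: y_def good_def)
  qed (simp add: y_def)
  have yk: "wt s k * (norm (y \<tau> k))\<^sup>2 \<le> C\<^sup>2" for \<tau> k using yb[of "{k}" \<tau>] by simp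
  have ys: "(\<lambda>k. wt s k * (norm (y \<tau> k))\<^sup>2) summable_on UNIV" for \<tau>
    by (rule nonneg_bdd_above_summable_on) (auto intro!: bdd_aboveI yb)
  have ym: "(\<lambda>\<tau>. y \<tau> k) \<in> borel_measurable (lebesgue_on {0..r})" for k r
  proof (rule measurable_extend_zero[OF sets])
    show "(\<lambda>\<tau>. y \<tau> k) \<in> borel_measurable (lebesgue_on {0<..<T})"
      by (rule measurable_AE_lebesgue_on[OF sets bochner_measurable_fourier[OF bm sets, of k]])
         (rule AE_lebesgue_onI[OF sets N], use Ng in \<open>simp add: y_def\<close>)
    show "y \<tau> k = 0" if "\<tau> \<notin> {0<..<T}" for \<tau> using that by (auto simp: y_def good_def)
  qed
  have yz: "y \<tau> k = 0" if "k \<notin> P" for \<tau> k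
  proof (cases "good \<tau>")
    case True
    then have "\<tau> \<in> {0..<T}" by (auto simp: good_def)
    then show ?thesis using supp that by (auto simp: y_def fourier_supp_def)
  qed (simp add: y_def)
  define X where "X r m = fourier (\<Theta> r) m - fourier \<Theta>0 m - integral {0..r} (rhs Sc y m)" for r m
  have X0: "X r m = 0" if r: "r \<in> {0<..<T}" for r m
  proof -
    have pair: "(\<Sum>\<^sub>\<infinity>k. fourier \<phi> k * X r (- k)) = 0" if \<phi>: "\<phi> \<in> smooth_torus" for \<phi>
    proof -
      have "complex_of_real ((LINT x|torus. (\<Theta> r x - \<Theta>0 x) * \<phi> x)
        + \<kappa> * (LINT \<tau>|lebesgue_on {0..r}. LINT x|torus. \<Theta> \<tau> x * frac_laplacian \<gamma> \<phi> x)
        - (LINT \<tau>|lebesgue_on {0..r}. LINT x|torus. \<Theta> \<tau> x * (mg_velocity \<Omega> \<beta> \<eta> (\<Theta> \<tau>) x \<bullet> grad \<phi> x))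
        - (LINT \<tau>|lebesgue_on {0..r}. LINT x|torus. S \<tau> x * \<phi> x))
      = vol * (\<Sum>\<^sub>\<infinity>k. fourier \<phi> k * (fourier (\<Theta> r) (- k) - fourier \<Theta>0 (- k) - integral {0..r} (rhs Sc y (- k))))"
      proof (rule weak_form_pairing[where N="NS \<union> N \<union> {0}" and P=P and R="C\<^sup>2" and \<sigma>=\<sigma>])
        show "0 \<le> r" using r by auto
        show "negligible (NS \<union> N \<union> {0})" using NS N by simp
        show "\<Theta> \<tau> \<in> L2_torus \<and> fourier (\<Theta> \<tau>) = y \<tau>" if "\<tau> \<in> {0..r} - (NS \<union> N \<union> {0})" for \<tau>
        proof -
          have "\<tau> \<in> {0<..<T} - N" using that r by auto
          then show ?thesis using L2[of \<tau>] Ng[of \<tau>] by (auto simp: y_def[abs_def])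
        qed
        show "S \<tau> \<in> L2_torus \<and> fourier (S \<tau>) = Sc \<tau>" if "\<tau> \<in> {0..r} - (NS \<union> N \<union> {0})" for \<tau>
          using that by (intro S) auto
        show "\<Theta> r \<in> L2_torus" using r by (intro L2) auto
        show "\<Theta>0 \<in> L2_torus" by (rule sobolevD(1)[OF \<Theta>0(1)])
      qed (use ys yk yz ym Mm Sm Sn \<phi> in auto)
      then show ?thesis using weak[OF \<phi> r] by (simp add: X_def)
    qed
    have hs: "((\<lambda>k. (if k = j then a else 0) * X r (- k)) has_sum (a * X r (- j))) UNIV" for a j
      by (rule has_sum_finite_neutralI[of "{j}"]) auto
    \<comment> \<open>A cosine yields the sum and a sine the difference of the residuals at m and
      -m, so both residuals vanish.\<close>
    have two: "(of_real a - \<i> * of_real b) / 2 * X r (- m) + (of_real a + \<i> * of_real b) / 2 * X r m = 0" for a b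
    proof -
      have "((\<lambda>k. fourier (\<lambda>x. a * cos (freq m \<bullet> x) + b * sin (freq m \<bullet> x)) k * X r (- k)) has_sum
        ((of_real a - \<i> * of_real b) / 2 * X r (- m) + (of_real a + \<i> * of_real b) / 2 * X r (- (- m)))) UNIV"
        unfolding fourier_trig distrib_right by (intro has_sum_add hs)
      from infsumI[OF this] show ?thesis using pair[OF smooth_torus_trig[of a m b]] by simp
    qed
    have "X r (- m) + X r m = 0" using two[of 2 0] by simp
    moreover have "\<i> * (X r m - X r (- m)) = 0" using two[of 0 2] by (simp add: algebra_simps)
    ultimately show ?thesis by simp
  qed
  define y' where "y' r k = fourier \<Theta>0 k + integral {0..r} (rhs Sc y k)" for r k
  have fy: "fourier (\<Theta> r) k = y' r k" if "r \<in> {0..<T}" for r k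
  proof (cases "r = 0")
    case True
    have "fourier (\<Theta> 0) k = fourier \<Theta>0 k"
      by (rule fourier_cong_AE[OF _ _ ini])
         (use L2_torusD(1)[OF L2[of 0]] L2_torusD(1)[OF sobolevD(1)[OF \<Theta>0(1)]] T in auto)
    then show ?thesis using True by (simp add: y'_def)
  next
    case False
    then show ?thesis using X0[of r k] that by (simp add: X_def y'_def algebra_simps)
  qed
  have rm: "rhs Sc y k \<in> borel_measurable (lebesgue_on {0..T})" for k
    by (rule rhs_measurable[where R="C\<^sup>2"]) (use ym yk Sm in auto)
  have rb: "norm (rhs Sc y k \<tau>) \<le> rhs_bound (C\<^sup>2) \<sigma> k" for k \<tau>
    by (rule norm_rhs_le) (use yk Sn in auto)
  have ri: "rhs Sc y k integrable_on {0..T}" for k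
    by (rule bounded_measurable_integrable_on[OF rm rb]) auto
  have y'c: "continuous_on {0..T} (\<lambda>r. y' r k)" for k
    unfolding y'_def by (intro continuous_intros indefinite_integral_continuous_1 ri)
  \<comment> \<open>The bound holds at almost every time for \<open>y\<close>, which there equals
    the continuous \<open>y'\<close>; continuity extends it to all times.\<close>
  have y'b: "(\<Sum>k\<in>F. wt s k * (norm (y' r k))\<^sup>2) \<le> C\<^sup>2" if "finite F" "r \<in> {0..T}" for F r
  proof (rule le_on_closure_negligible[OF T _ _ _ that(2)])
    show "continuous_on {0..T} (\<lambda>r. \<Sum>k\<in>F. wt s k * (norm (y' r k))\<^sup>2)"
      by (intro continuous_intros y'c)
    show "negligible (N \<union> {0, T})" using N by simp
    fix \<tau> assume "\<tau> \<in> {0..T} - (N \<union> {0, T})"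
    then have \<tau>: "\<tau> \<in> {0<..<T} - N" by auto
    then have "y' \<tau> k = y \<tau> k" for k using Ng[OF \<tau>] fy[of \<tau> k] by (simp add: y_def)
    then show "(\<Sum>k\<in>F. wt s k * (norm (y' \<tau> k))\<^sup>2) \<le> C\<^sup>2" using yb[OF that(1), of \<tau>] by simp
  qed
  have "coef_solution P t (fourier \<Theta>0) Sc (C\<^sup>2) (\<lambda>t. fourier (\<Theta> t))"
    unfolding coef_solution_def
  proof (intro conjI ballI allI impI)
    fix r assume r: "r \<in> {0..t}"
    then have rT: "r \<in> {0..<T}" using t by auto
    show "hermitian (fourier (\<Theta> r))" by (rule hermitian_fourier)
    show "fourier (\<Theta> r) k = 0" if "k \<notin> P" for k using supp rT that by (auto simp: fourier_supp_def)
    show "(\<Sum>k\<in>F. wt s k * (norm (fourier (\<Theta> r) k))\<^sup>2) \<le> C\<^sup>2" if "finite F" for F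
      using y'b[OF that, of r] rT by (simp add: fy)
    fix k
    have "integral {0..r} (rhs Sc y k) = integral {0..r} (rhs Sc (\<lambda>t. fourier (\<Theta> t)) k)"
    proof (rule integral_spike)
      show "negligible (N \<union> {0})" using N by simp
      fix \<tau> assume "\<tau> \<in> {0..r} - (N \<union> {0})"
      then have "\<tau> \<in> {0<..<T} - N" using rT by auto
      then have "y \<tau> = fourier (\<Theta> \<tau>)" using Ng[of \<tau>] by (auto simp: y_def[abs_def])
      then show "rhs Sc (\<lambda>t. fourier (\<Theta> t)) k \<tau> = rhs Sc y k \<tau>" by (simp add: rhs_def)
    qed
    then show "fourier (\<Theta> r) k = fourier \<Theta>0 k + integral {0..r} (rhs Sc (\<lambda>t. fourier (\<Theta> t)) k)"
      using fy[OF rT, of k] by (simp add: y'_def)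
  next
    fix k
    have "continuous_on {0..t} (\<lambda>r. y' r k)" using t by (intro continuous_on_subset[OF y'c]) auto
    then show "continuous_on {0..t} (\<lambda>r. fourier (\<Theta> r) k)"
      by (rule continuous_on_eq) (use fy t in auto)
  qed
  then show thesis by (rule that)
qed

text \<open>Coefficient uniqueness is applied on [0,t] for each t < T. The integrable control is the
  sum of the squared H^(s+\<gamma>) norms of both solutions, and completeness turns equal
  coefficients into equality almost everywhere.\<close>

lemma mg_solution_unique:
  assumes T: "0 < T" and sol1: "mg_solution \<Omega> \<beta> \<eta> \<kappa> \<gamma> s S \<Theta>0 T \<Theta>1" and sol2: "mg_solution \<Omega> \<beta> \<eta> \<kappa> \<gamma> s S \<Theta>0 T \<Theta>2"
    and supp1: "\<forall>t\<in>{0..<T}. fourier_supp (\<Theta>1 t) \<subseteq> P" and supp2: "\<forall>t\<in>{0..<T}. fourier_supp (\<Theta>2 t) \<subseteq> P"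
    and t: "t \<in> {0..<T}"
  shows "AE x in torus. \<Theta>1 t x = \<Theta>2 t x"
proof -
  have sets: "{0<..<T} \<in> sets lebesgue" by auto
  have L2: "\<Theta>1 t \<in> L2_torus" "\<Theta>2 t \<in> L2_torus" using sol1 sol2 t by (auto simp: mg_solution_def)
  have reg: "\<exists>N. negligible N \<and> (\<forall>\<tau>\<in>{0<..<T} - N. \<Theta> \<tau> \<in> sobolev (s + \<gamma>)) \<and>
     integrable (lebesgue_on {0..t}) (\<lambda>\<tau>. (sobolev_norm (s + \<gamma>) (\<Theta> \<tau>))\<^sup>2)"
    if "mg_solution \<Omega> \<beta> \<eta> \<kappa> \<gamma> s S \<Theta>0 T \<Theta>" for \<Theta>
  proof -
    have "bochner_measurable (s + \<gamma>) {0<..<T} \<Theta>" and i: "integrable (lebesgue_on {0<..<T}) (\<lambda>\<tau>. (sobolev_norm (s + \<gamma>) (\<Theta> \<tau>))\<^sup>2)"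
      using that by (auto simp: mg_solution_def L2_sobolev_def)
    then have ae: "AE \<tau> in lebesgue_on {0<..<T}. \<Theta> \<tau> \<in> sobolev (s + \<gamma>)" by (simp add: bochner_measurable_def)
    obtain N where N: "negligible N" "\<And>\<tau>. \<tau> \<in> {0<..<T} - N \<Longrightarrow> \<Theta> \<tau> \<in> sobolev (s + \<gamma>)"
      using AE_lebesgue_on_negligible[OF sets ae] by blast
    have "(\<lambda>\<tau>. (sobolev_norm (s + \<gamma>) (\<Theta> \<tau>))\<^sup>2) absolutely_integrable_on {0<..<T}"
      using i by (subst integrable_lebesgue_on_iff[symmetric]) auto
    then have a: "(\<lambda>\<tau>. (sobolev_norm (s + \<gamma>) (\<Theta> \<tau>))\<^sup>2) absolutely_integrable_on {0<..t}"
      by (rule set_integrable_subset) (use t in auto)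
    \<comment> \<open>Passing from the half-open to the closed interval adds only the initial time,
      a null set.\<close>
    have n1: "negligible {x \<in> {0<..t} - {0..t}. (sobolev_norm (s + \<gamma>) (\<Theta> x))\<^sup>2 \<noteq> 0}"
      by (rule negligible_subset[of "{0}"]) auto
    have n2: "negligible {x \<in> {0..t} - {0<..t}. (sobolev_norm (s + \<gamma>) (\<Theta> x))\<^sup>2 \<noteq> 0}"
      by (rule negligible_subset[of "{0}"]) auto
    have "(\<lambda>\<tau>. (sobolev_norm (s + \<gamma>) (\<Theta> \<tau>))\<^sup>2) absolutely_integrable_on {0..t}"
      using absolutely_integrable_spike_set_eq[OF n1 n2] a by simp
    then have "integrable (lebesgue_on {0..t}) (\<lambda>\<tau>. (sobolev_norm (s + \<gamma>) (\<Theta> \<tau>))\<^sup>2)"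
      by (subst integrable_lebesgue_on_iff) auto
    then show ?thesis using N by blast
  qed
  obtain N1 where N1: "negligible N1" "\<And>\<tau>. \<tau> \<in> {0<..<T} - N1 \<Longrightarrow> \<Theta>1 \<tau> \<in> sobolev (s + \<gamma>)"
    "integrable (lebesgue_on {0..t}) (\<lambda>\<tau>. (sobolev_norm (s + \<gamma>) (\<Theta>1 \<tau>))\<^sup>2)" using reg[OF sol1] by blast
  obtain N2 where N2: "negligible N2" "\<And>\<tau>. \<tau> \<in> {0<..<T} - N2 \<Longrightarrow> \<Theta>2 \<tau> \<in> sobolev (s + \<gamma>)"
    "integrable (lebesgue_on {0..t}) (\<lambda>\<tau>. (sobolev_norm (s + \<gamma>) (\<Theta>2 \<tau>))\<^sup>2)" using reg[OF sol2] by blast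
  obtain C1 where C1: "coef_solution P t (fourier \<Theta>0) Sc C1 (\<lambda>t. fourier (\<Theta>1 t))" using mg_solution_coef[OF T sol1 supp1 t] .
  obtain C2 where C2: "coef_solution P t (fourier \<Theta>0) Sc C2 (\<lambda>t. fourier (\<Theta>2 t))" using mg_solution_coef[OF T sol2 supp2 t] .
  define D where "D \<tau> = (sobolev_norm (s + \<gamma>) (\<Theta>1 \<tau>))\<^sup>2 + (sobolev_norm (s + \<gamma>) (\<Theta>2 \<tau>))\<^sup>2" for \<tau>
  have eq: "fourier (\<Theta>1 t) k = fourier (\<Theta>2 t) k" for k
  proof (rule coef_solution_unique[OF _ C1 C2, where D=D and N="N1 \<union> N2 \<union> {0}" and \<sigma>=\<sigma>])
    show "0 \<le> t" "t \<in> {0..t}" using t by auto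
    show "integrable (lebesgue_on {0..t}) D" unfolding D_def using N1(3) N2(3) by auto
    show "negligible (N1 \<union> N2 \<union> {0})" using N1 N2 by simp
    show "(\<Sum>k\<in>F. wt (s + \<gamma>) k * (norm (fourier (\<Theta>1 \<tau>) k))\<^sup>2) \<le> D \<tau>" if "\<tau> \<in> {0..t} - (N1 \<union> N2 \<union> {0})" "finite F" for \<tau> F
    proof -
      have "\<tau> \<in> {0<..<T} - N1" using that t by auto
      from sobolevD(3)[OF N1(2)[OF this] that(2)] show ?thesis by (simp add: D_def add_increasing2)
    qed
    show "(\<Sum>k\<in>F. wt (s + \<gamma>) k * (norm (fourier (\<Theta>2 \<tau>) k))\<^sup>2) \<le> D \<tau>" if "\<tau> \<in> {0..t} - (N1 \<union> N2 \<union> {0})" "finite F" for \<tau> F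
    proof -
      have "\<tau> \<in> {0<..<T} - N2" using that t by auto
      from sobolevD(3)[OF N2(2)[OF this] that(2)] show ?thesis by (simp add: D_def add_increasing)
    qed
  qed (use Sm Sn in auto)
  show ?thesis by (rule fourier_eq_imp_AE_eq[OF L2_torusD(3)[OF L2(1)] L2_torusD(3)[OF L2(2)] eq])
qed

lemma mg_well_posed:
  "\<exists>T>0. \<exists>\<Theta>. mg_solution \<Omega> \<beta> \<eta> \<kappa> \<gamma> s S \<Theta>0 T \<Theta> \<and>
    (\<forall>t\<in>{0..<T}. fourier_supp (\<Theta> t) \<subseteq> P) \<and>
    (\<forall>\<Theta>'. mg_solution \<Omega> \<beta> \<eta> \<kappa> \<gamma> s S \<Theta>0 T \<Theta>' \<and> (\<forall>t\<in>{0..<T}. fourier_supp (\<Theta>' t) \<subseteq> P) \<longrightarrow>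
       (\<forall>t\<in>{0..<T}. AE x in torus. \<Theta>' t x = \<Theta> t x))"
proof -
  define E0 where "E0 = (sobolev_norm s \<Theta>0)\<^sup>2"
  \<comment> \<open>The modulus and the added 1 ensure both positivity and
    \<open>T * Eb \<sigma> (E0 + 1) < 1\<close>. Thus \<open>T\<close> depends on the data only
    through the two norms \<open>E0\<close> and \<open>\<sigma>\<close> and fixed constants.\<close>
  define T where "T = 1 / (\<bar>Eb \<sigma> (E0 + 1)\<bar> + 1)"
  have T: "0 < T" by (simp add: T_def add_nonneg_pos)
  have T1: "T * Eb \<sigma> (E0 + 1) < 1"
  proof -
    have "Eb \<sigma> (E0 + 1) < \<bar>Eb \<sigma> (E0 + 1)\<bar> + 1" by linarith
    then show ?thesis by (simp add: T_def divide_less_eq)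
  qed
  obtain \<theta> where sol: "coef_solution P T (fourier \<Theta>0) Sc (E0 + 1) \<theta>"
    and D: "\<And>F. finite F \<Longrightarrow> \<kappa> * integral {0..T} (\<lambda>t. \<Sum>k\<in>F. wt (s + \<gamma>) k * (norm (\<theta> t k))\<^sup>2) \<le> E0 + 1"
  proof -
    have "\<exists>\<theta>. coef_solution P T (fourier \<Theta>0) Sc (E0 + 1) \<theta> \<and>
     (\<forall>F. finite F \<longrightarrow> \<kappa> * integral {0..T} (\<lambda>t. \<Sum>k\<in>F. wt (s + \<gamma>) k * (norm (\<theta> t k))\<^sup>2) \<le> E0 + 1)"
      by (rule coef_solution_exists[where \<sigma>=\<sigma>])
         (use P hermitian_fourier \<Theta>0(2) sobolevD(3)[OF \<Theta>0(1)] Sh Sm Sb SP T T1 in \<open>auto simp: fourier_supp_def E0_def\<close>)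
    then show thesis using that by blast
  qed
  note F = mg_solution_fser[OF T sol D]
  have supp: "\<forall>t\<in>{0..<T}. fourier_supp (fser (\<theta> t)) \<subseteq> P"
  proof
    fix t assume "t \<in> {0..<T}"
    then have t: "t \<in> {0..T}" by auto
    have "\<theta> t k = 0" if "k \<notin> P" for k using sol t that unfolding coef_solution_def by blast
    moreover have "fourier (fser (\<theta> t)) = \<theta> t" by (rule F(2)[OF _ t])
    ultimately show "fourier_supp (fser (\<theta> t)) \<subseteq> P" by (auto simp: fourier_supp_def)
  qed
  show ?thesis
  proof (intro exI[of _ T] conjI exI[of _ "\<lambda>t. fser (\<theta> t)"] allI impI ballI)
    show "0 < T" by (rule T)
    show "mg_solution \<Omega> \<beta> \<eta> \<kappa> \<gamma> s S \<Theta>0 T (\<lambda>t. fser (\<theta> t))" by (rule F(1))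
    show "fourier_supp (fser (\<theta> t)) \<subseteq> P" if "t \<in> {0..<T}" for t using supp that by blast
    fix \<Theta>' t assume "mg_solution \<Omega> \<beta> \<eta> \<kappa> \<gamma> s S \<Theta>0 T \<Theta>' \<and> (\<forall>t\<in>{0..<T}. fourier_supp (\<Theta>' t) \<subseteq> P)" "t \<in> {0..<T}"
    then show "AE x in torus. \<Theta>' t x = fser (\<theta> t) x"
      using mg_solution_unique[OF T _ F(1) _ supp, of \<Theta>' t] by blast
  qed
qed

end

lemma freq_plane_uminus: "k \<in> freq_plane q \<Longrightarrow> - k \<in> freq_plane q"
  by (simp add: freq_plane_def)

lemma freq_plane_add: "k \<in> freq_plane q \<Longrightarrow> l \<in> freq_plane q \<Longrightarrow> k + l \<in> freq_plane q"
  by (simp add: freq_plane_def distrib_left)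

theorem theorem6p3:
  fixes \<Omega> \<beta> \<eta> \<kappa> \<gamma> s :: real
    and \<Theta>0 :: "real^3 \<Rightarrow> real"
    and S :: "real \<Rightarrow> real^3 \<Rightarrow> real"
    and q :: rat
  assumes "\<Omega> > 0" and "\<beta> > 0" and "\<eta> > 0" and "\<kappa> > 0"
    and "0 < \<gamma>" and "\<gamma> < 1"
    and "s > 5 / 2 - \<gamma>"
    and "\<Theta>0 \<in> sobolev s" and "zero_mean \<Theta>0"
    and "S \<in> Linf_sobolev {0<..} (s - \<gamma>)" and "\<forall>t\<ge>0. zero_mean (S t)"
    and "q \<noteq> 0"
    and "fourier_supp \<Theta>0 \<subseteq> freq_plane q"
    and "\<forall>t\<ge>0. fourier_supp (S t) \<subseteq> freq_plane q"
  shows "\<exists>T>0. \<exists>\<Theta>.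
    mg_solution \<Omega> \<beta> \<eta> \<kappa> \<gamma> s S \<Theta>0 T \<Theta> \<and>
    (\<forall>t\<in>{0..<T}. fourier_supp (\<Theta> t) \<subseteq> freq_plane q) \<and>
    (\<forall>\<Theta>'. mg_solution \<Omega> \<beta> \<eta> \<kappa> \<gamma> s S \<Theta>0 T \<Theta>' \<and>
          (\<forall>t\<in>{0..<T}. fourier_supp (\<Theta>' t) \<subseteq> freq_plane q) \<longrightarrow>
          (\<forall>t\<in>{0..<T}. AE x in torus. \<Theta>' t x = \<Theta> t x))"
proof -
  define P where "P = freq_plane q"
  \<comment> \<open>Continuation by zero makes the symbol bounded on the whole lattice and leaves
    velocities of functions supported in the plane unchanged.\<close>
  define M where "M k = (if k \<in> P then mg_symbol \<Omega> \<beta> \<eta> k else 0)" for k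
  obtain C where C: "\<And>k. k \<in> P \<Longrightarrow> norm (mg_symbol \<Omega> \<beta> \<eta> k) \<le> C"
    using mg_symbol_bounded[of \<Omega> \<beta> \<eta> q] assms unfolding P_def by blast
  have Pu: "- k \<in> P \<longleftrightarrow> k \<in> P" for k
    using freq_plane_uminus[of k q] freq_plane_uminus[of "- k" q] by (auto simp: P_def)
  have sets: "{0<..} \<in> sets (lebesgue :: real measure)" by auto
  obtain \<sigma> where bm: "bochner_measurable (s - \<gamma>) {0<..} S" and ae: "AE t in lebesgue_on {0<..}. sobolev_norm (s - \<gamma>) (S t) \<le> \<sigma>"
    using assms(10) by (auto simp: Linf_sobolev_def)
  define good where "good t \<longleftrightarrow> 0 < t \<and> S t \<in> sobolev (s - \<gamma>) \<and> sobolev_norm (s - \<gamma>) (S t) \<le> \<sigma>" for t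
  have "AE t in lebesgue_on {0<..}. S t \<in> sobolev (s - \<gamma>) \<and> sobolev_norm (s - \<gamma>) (S t) \<le> \<sigma>"
    using ae bm by (auto simp: bochner_measurable_def)
  then obtain N where N: "negligible N" and Ng: "\<And>t. t \<in> {0<..} - N \<Longrightarrow> good t"
    using AE_lebesgue_on_negligible[OF sets] unfolding good_def by (metis (no_types, lifting) DiffD1 greaterThan_iff)
  \<comment> \<open>At times where the source lacks its norm bound the coefficients are set to zero,
    so that all requirements on the source hold without exception.\<close>
  define Sc where "Sc t k = (if good t then fourier (S t) k else 0)" for t k
  \<comment> \<open>The maximum with 0 covers the frequencies off the plane, where the continued
    symbol is zero.\<close>
  interpret mg_problem M "max C 0" \<kappa> \<gamma> s \<Omega> \<beta> \<eta> P N \<Theta>0 S Sc \<sigma>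
  proof
    show "M (- k) = M k" for k by (simp add: M_def Pu mg_symbol_uminus)
    show "freq k \<bullet> M k = 0" for k by (simp add: M_def mg_symbol_divergence_free)
    show "norm (M k) \<le> max C 0" for k using C[of k] by (auto simp: M_def)
    show "mg_symbol \<Omega> \<beta> \<eta> k = M k" if "k \<in> P" for k using that by (simp add: M_def)
    show "- k \<in> P" if "k \<in> P" for k using that Pu by simp
    show "k + l \<in> P" if "k \<in> P" "l \<in> P" for k l using that freq_plane_add by (simp add: P_def)
    show "S \<tau> \<in> L2_torus \<and> fourier (S \<tau>) = Sc \<tau>" if "0 < \<tau>" "\<tau> \<notin> N" for \<tau>
      using Ng[of \<tau>] that sobolevD(1)[of "S \<tau>"] by (auto simp: Sc_def[abs_def] good_def)
    show "(\<lambda>t. Sc t k) \<in> borel_measurable (lebesgue_on {0..T})" for T k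
    proof (rule measurable_extend_zero[OF sets])
      show "(\<lambda>t. Sc t k) \<in> borel_measurable (lebesgue_on {0<..})"
        by (rule measurable_AE_lebesgue_on[OF sets bochner_measurable_fourier[OF bm sets, of k]])
           (rule AE_lebesgue_onI[OF sets N], use Ng in \<open>simp add: Sc_def\<close>)
      show "Sc t k = 0" if "t \<notin> {0<..}" for t using that by (simp add: Sc_def good_def)
    qed
    show "(\<Sum>k\<in>G. wt (s - \<gamma>) k * (norm (Sc t k))\<^sup>2) \<le> \<sigma>\<^sup>2" if "finite G" for t G
    proof (cases "good t")
      case True
      have "(sobolev_norm (s - \<gamma>) (S t))\<^sup>2 \<le> \<sigma>\<^sup>2"
        using True sobolev_norm_nonneg by (intro power_mono) (auto simp: good_def)
      then show ?thesis using sobolevD(3)[of "S t" "s - \<gamma>" G] True that by (simp add: Sc_def good_def)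
    qed (simp add: Sc_def)
    show "hermitian (Sc t)" for t
      using hermitian_fourier[of "S t"] by (simp add: hermitian_def Sc_def)
    show "Sc t k = 0" if "k \<notin> P" for t k
    proof (cases "good t")
      case True
      then have "fourier_supp (S t) \<subseteq> P" using assms(14) by (auto simp: good_def P_def)
      then show ?thesis using that by (auto simp: Sc_def fourier_supp_def)
    qed (simp add: Sc_def)
  qed (use assms N in \<open>auto simp: P_def\<close>)
  show ?thesis using mg_well_posed unfolding P_def .
qed

end
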